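(* Let $k$ be an arbitrary field, $n\ge 1$ an integer, and $\iota\colon S\hookrightarrow\mathbb{P}^1$ a closed subscheme of the projective line over $k$ which is finite over $k$ and satisfies $\dim_k H^0(S,\mathcal{O}_S)=n+1$. Put $L:=H^0(S,\mathcal{O}_S)$, a finite $k$-algebra with $\dim_kL=n+1$, and define the group \[G_S:=(k^{\times}\times L^{\times})/\{(\mathrm{N}_{L/k}(\alpha)^{-1},\alpha^2)\mid\alpha\in L^{\times}\}.\] Take a homogeneous polynomial $f(X_0,X_1)\in k[X_0,X_1]$ with $S=(f=0)$, write $f(X_0,X_1)=X_1^s\cdot g(X_0,X_1)$ with a polynomial $g(X_0,X_1)$ not divisible by $X_1$, and let $C_f\in k^{\times}$ be the coefficient of $X_0^{n+1-s}X_1^s$ in $f(X_0,X_1)$. Then the following hold. \begin{enumerate} \item There is a simply transitive action of $G_S$ on the set of $\mathrm{SL}_{n+1}(k)$-orbits in $(k^2\otimes\mathrm{Sym}_2k^{n+1})_{S,\mathrm{fr}}$. For $M\in(k^2\otimes\mathrm{Sym}_2k^{n+1})_{S,\mathrm{fr}}$ and $(u,\alpha)\in G_S$, denote this action by $\big([M],(u,\alpha)\big)\mapsto[M]\cdot(u,\alpha)$, where $[M]$ is the $\mathrm{SL}_{n+1}(k)$-orbit containing $M$. \item For any $M\in(k^2\otimes\mathrm{Sym}_2k^{n+1})_{S,\mathrm{fr}}$ and $(u,\alpha)\in G_S$, this action satisfies \[\mathrm{disc}\big([M]\cdot(u,\alpha)\big)=u^2\,\mathrm{N}_{L/k}(\alpha)\,\mathrm{disc}([M]).\]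 \item There is a bijection between the following sets: the set of $\mathrm{SL}_{n+1}(k)$-orbits in $(k^2\otimes\mathrm{Sym}_2k^{n+1})_{S,\mathrm{fr}}$ whose discriminant polynomials are equal to $f(X_0,X_1)$; and the quotient set \[\{(u,\alpha)\in k^{\times}\times L^{\times}\mid C_f=(-1)^{n(n+1)/2}u^2\,\mathrm{N}_{L/k}(\alpha)\}/\sim,\] where $(u,\alpha)\sim(u',\alpha')$ if and only if $(u,\alpha)=(\mathrm{N}_{L/k}(\beta)^{-1}u',\beta^2\alpha')$ for some $\beta\in L^{\times}$. \item There is a pair $M\in(k^2\otimes\mathrm{Sym}_2k^{n+1})_{S,\mathrm{fr}}$ with $\mathrm{disc}(M)=f(X_0,X_1)$ if and only if $C_f=(-1)^{n(n+1)/2}u^2\,\mathrm{N}_{L/k}(\alpha)$ for some $u\in k^{\times}$ and $\alpha\in L^{\times}$. \item Let $u\in k^{\times}$ and $\alpha\in L^{\times}$ satisfy $C_f=(-1)^{n(n+1)/2}u^2\,\mathrm{N}_{L/k}(\alpha)$, and let $M\in(k^2\otimes\mathrm{Sym}_2k^{n+1})_{S,\mathrm{fr}}$ be a pair in the $\mathrm{SL}_{n+1}(k)$-orbit corresponding to $(u,\alpha)$ under the bijection in (3). Then the stabilizer of $M$ in $\mathrm{SL}_{n+1}(k)$ is isomorphic to \[\mathrm{Res}_{L/k}(\mu_2)_{\mathrm{N}_{L/k}=1}:=\{\beta\in L^{\times}\mid\beta^2=1,\ \mathrm{N}_{L/k}(\beta)=1\}.\] \end{enumerate}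
   Context: $k^2\otimes\mathrm{Sym}_2 k^{n+1}$ denotes the set of pairs $M=(M_0,M_1)$ of symmetric matrices (${}^{t}M_i=M_i$) of size $n+1$ with entries in $k$. The discriminant polynomial is $\mathrm{disc}(M):=\det(X_0M_0+X_1M_1)\in k[X_0,X_1]$, where $X_0,X_1$ are the homogeneous coordinates on $\mathbb{P}^1$; if it is non-zero, it is homogeneous of degree $n+1$ and the discriminant subscheme is $D_M:=(\mathrm{disc}(M)=0)\subset\mathbb{P}^1$. The subset $(k^2\otimes\mathrm{Sym}_2 k^{n+1})_S$ consists of those $M$ with $\mathrm{disc}(M)\neq0$ and $D_M=S$ (equality of closed subschemes). $P\in\mathrm{SL}_{n+1}(k)$ acts on the right by $M\cdot P:=({}^{t}P M_0P,\,{}^{t}P M_1P)$; this preserves discriminant polynomials, so $\mathrm{disc}([M]):=\mathrm{disc}(M)$ is well defined on $\mathrm{SL}_{n+1}(k)$-orbits $[M]$. For $M\in(k^2\otimes\mathrm{Sym}_2 k^{n+1})_S$, the coherent $\mathcal{O}_S$-module associated with $M$ is the coherent $\mathcal{O}_S$-module $\mathcal{F}$ (unique up to isomorphism) such that $\iota_*\mathcal{F}$ is the cokernel of the morphism $\mathcal{O}_{\mathbb{P}^1}(-1)^{\oplus(n+1)}\to\mathcal{O}_{\mathbb{P}^1}^{\oplus(n+1)}$ given by multiplication of the matrix $X_0M_0+X_1M_1$ on column vectors. The subset $(k^2\otimes\mathrm{Sym}_2 k^{n+1})_{S,\mathrm{fr}}\subset(k^2\otimes\mathrm{Sym}_2 k^{n+1})_S$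 consists of those $M$ whose associated $\mathcal{O}_S$-module is free of rank one; it is stable under $\mathrm{SL}_{n+1}(k)$. $\mathrm{N}_{L/k}(\alpha)$ is the norm, i.e. the determinant of multiplication by $\alpha$ on the $k$-vector space $L$. If $(1,0)\notin S$ then $s=0$; if $(1,0)\in S$, then $s$ is the multiplicity of $(1,0)$ in $S$. *)

theory Defs
  imports
    "Jordan_Normal_Form.VS_Connect"
    "HOL-Computational_Algebra.Fraction_Field"
    "HOL-Algebra.QuotRing"
    "HOL-Algebra.Group_Action"
begin

section \<open>Binary forms and the projective line\<close>

text \<open>
  The ring \<open>k[X\<^sub>0, X\<^sub>1]\<close> is \<open>'a poly poly\<close>, that is \<open>k[X\<^sub>0][X\<^sub>1]\<close>: the coefficient of
  \<open>X\<^sub>0\<^sup>i X\<^sub>1\<^sup>j\<close> in \<open>p\<close> is \<open>coeff (coeff p j) i\<close>.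
\<close>

definition X0 :: "'a::field poly poly" where
  "X0 = [:[:0, 1:]:]"

definition X1 :: "'a::field poly poly" where
  "X1 = [:0, 1:]"

definition const :: "'a::field \<Rightarrow> 'a poly poly" where
  "const c = [:[:c:]:]"

definition homog :: "int \<Rightarrow> 'a::field poly poly \<Rightarrow> bool" where
  "homog e p \<longleftrightarrow> (\<forall>i j. coeff (coeff p j) i \<noteq> 0 \<longrightarrow> int i + int j = e)"

definition homogeneous :: "'a::field poly poly \<Rightarrow> bool" where
  "homogeneous p \<longleftrightarrow> (\<exists>e. homog e p)"

text \<open>
  \<open>\<P>\<^sup>1 = Proj k[X\<^sub>0, X\<^sub>1]\<close> has the standard basis of affine opens \<open>D\<^sub>+(g)\<close>, where \<open>g\<close> runs through the
  nonzero forms of positive degree, and \<open>D\<^sub>+(g) \<inter> D\<^sub>+(h) = D\<^sub>+(g h)\<close>.  All sheaves below are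
  quasi-coherent and are given by their sections on these opens together with the restriction maps
  from \<open>D\<^sub>+(g)\<close> to \<open>D\<^sub>+(g h)\<close>.
\<close>

definition forms :: "'a::field poly poly set" where
  "forms = {g. g \<noteq> 0 \<and> (\<exists>e>0. homog e g)}"

text \<open>
  Sections of \<open>\<O>(d)\<close> on \<open>D\<^sub>+(g)\<close>: the homogeneous elements of degree \<open>d\<close> in \<open>k[X\<^sub>0, X\<^sub>1]\<^sub>g\<close>,
  inside the field \<open>k(X\<^sub>0, X\<^sub>1)\<close>.  Restriction maps are inclusions.
\<close>

definition twist :: "int \<Rightarrow> 'a::field poly poly \<Rightarrow> 'a poly poly fract set" where
  "twist d g = {Fraction_Field.Fract a (g ^ m) | a m e. homog e g \<and> homog (d + int m * e) a}"

definition regular :: "'a::field poly poly \<Rightarrow> 'a poly poly fract ring" where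
  "regular g = class_ring \<lparr>carrier := twist 0 g\<rparr>"

section \<open>Closed subschemes of the projective line\<close>

text \<open>A closed subscheme is given by its quasi-coherent ideal sheaf.\<close>

type_synonym 'a subscheme = "'a poly poly \<Rightarrow> 'a poly poly fract set"

definition closed_subscheme :: "'a::field subscheme \<Rightarrow> bool" where
  "closed_subscheme S \<longleftrightarrow>
     (\<forall>g\<in>forms. ideal (S g) (regular g)) \<and>
     (\<forall>g\<in>forms. \<forall>h\<in>forms. S (g * h) = Idl\<^bsub>regular (g * h)\<^esub> (S g))"

definition same_subscheme :: "'a::field subscheme \<Rightarrow> 'a subscheme \<Rightarrow> bool" where
  "same_subscheme S T \<longleftrightarrow> (\<forall>g\<in>forms. S g = T g)"

text \<open>
  The subscheme \<open>(f = 0)\<close> for a form \<open>f\<close>: on \<open>D\<^sub>+(g)\<close> its ideal is the degree zero part of the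
  ideal generated by \<open>f\<close> in \<open>k[X\<^sub>0, X\<^sub>1]\<^sub>g\<close>.
\<close>

definition zero_scheme :: "'a::field poly poly \<Rightarrow> 'a subscheme" where
  "zero_scheme f g = {h \<in> twist 0 g. \<exists>b m. h = Fraction_Field.Fract (f * b) (g ^ m)}"

text \<open>\<open>\<O>\<^sub>S(D\<^sub>+(g))\<close> as a \<open>k\<close>-algebra, and its restriction maps.\<close>

definition struct_sheaf :: "'a::field subscheme \<Rightarrow> 'a poly poly \<Rightarrow> ('a, 'a poly poly fract set) module" where
  "struct_sheaf S g = ring.extend (regular g Quot S g)
     (module.fields (\<lambda>c A. (S g +>\<^bsub>regular g\<^esub> Fraction_Field.Fract (const c) 1) \<otimes>\<^bsub>regular g Quot S g\<^esub> A))"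

definition struct_res ::
  "'a::field subscheme \<Rightarrow> 'a poly poly \<Rightarrow> 'a poly poly \<Rightarrow> 'a poly poly fract set \<Rightarrow> 'a poly poly fract set" where
  "struct_res S g h A = S (g * h) <+>\<^bsub>regular (g * h)\<^esub> A"

text \<open>
  Finiteness over \<open>k\<close> is tested on the members of an affine cover: a closed subscheme \<open>S\<close> of \<open>\<P>\<^sup>1\<close>
  is proper over \<open>k\<close>, so it is finite over \<open>k\<close> if and only if every \<open>S \<inter> D\<^sub>+(g)\<close> is.
\<close>

definition finite_over_field :: "'a::field subscheme \<Rightarrow> bool" where
  "finite_over_field S \<longleftrightarrow> (\<forall>g\<in>forms. vectorspace.fin_dim class_ring (struct_sheaf S g))"

text \<open>The \<open>k\<close>-algebra \<open>H\<^sup>0(S, \<O>\<^sub>S)\<close>: compatible families of sections over all \<open>D\<^sub>+(g)\<close>.\<close>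

definition H0 ::
  "'a::field subscheme \<Rightarrow> ('a, 'a poly poly \<Rightarrow> 'a poly poly fract set) module" where
  "H0 S = \<lparr>
     carrier = {s \<in> (\<Pi>\<^sub>E g\<in>forms. carrier (struct_sheaf S g)).
                  \<forall>g\<in>forms. \<forall>h\<in>forms. s (g * h) = struct_res S g h (s g)},
     mult = (\<lambda>s t. \<lambda>g\<in>forms. s g \<otimes>\<^bsub>struct_sheaf S g\<^esub> t g),
     one = (\<lambda>g\<in>forms. \<one>\<^bsub>struct_sheaf S g\<^esub>),
     zero = (\<lambda>g\<in>forms. \<zero>\<^bsub>struct_sheaf S g\<^esub>),
     add = (\<lambda>s t. \<lambda>g\<in>forms. s g \<oplus>\<^bsub>struct_sheaf S g\<^esub> t g),
     smult = (\<lambda>c s. \<lambda>g\<in>forms. c \<odot>\<^bsub>struct_sheaf S g\<^esub> s g)\<rparr>"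

section \<open>Norm of a finite algebra\<close>

definition ordered_basis :: "('a::field, 'l) module \<Rightarrow> 'l list \<Rightarrow> bool" where
  "ordered_basis V bs \<longleftrightarrow> distinct bs \<and> vectorspace.basis class_ring V (set bs)"

text \<open>The determinant of an endomorphism is the determinant of its matrix in any ordered basis.\<close>

definition endo_det :: "('a::field, 'l) module \<Rightarrow> ('l \<Rightarrow> 'l) \<Rightarrow> 'a" where
  "endo_det V T = (THE c. \<exists>bs A. ordered_basis V bs \<and>
      A \<in> carrier_mat (length bs) (length bs) \<and>
      (\<forall>j<length bs. T (bs ! j) = (\<Oplus>\<^bsub>V\<^esub> i\<in>{..<length bs}. A $$ (i, j) \<odot>\<^bsub>V\<^esub> bs ! i)) \<and>
      c = det A)"

definition alg_norm :: "('a::field, 'l) module \<Rightarrow> 'l \<Rightarrow> 'a" where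
  "alg_norm L \<alpha> = endo_det L (\<lambda>x. \<alpha> \<otimes>\<^bsub>L\<^esub> x)"

section \<open>Pairs of symmetric matrices\<close>

definition sym_pairs :: "nat \<Rightarrow> ('a::field mat \<times> 'a mat) set" where
  "sym_pairs n = {(M0, M1). M0 \<in> carrier_mat (n + 1) (n + 1) \<and> M1 \<in> carrier_mat (n + 1) (n + 1) \<and>
                    transpose_mat M0 = M0 \<and> transpose_mat M1 = M1}"

definition pencil :: "'a::field mat \<times> 'a mat \<Rightarrow> 'a poly poly mat" where
  "pencil M = X0 \<cdot>\<^sub>m map_mat const (fst M) + X1 \<cdot>\<^sub>m map_mat const (snd M)"

definition disc :: "'a::field mat \<times> 'a mat \<Rightarrow> 'a poly poly" where
  "disc M = det (pencil M)"

definition sym_pairs_S :: "nat \<Rightarrow> 'a::field subscheme \<Rightarrow> ('a mat \<times> 'a mat) set" where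
  "sym_pairs_S n S = {M \<in> sym_pairs n. disc M \<noteq> 0 \<and> same_subscheme (zero_scheme (disc M)) S}"

subsection \<open>The associated sheaf\<close>

text \<open>\<open>free_sections m g\<close> is the \<open>\<O>(D\<^sub>+(g))\<close>-module of sections of \<open>\<O>\<^sup>m\<close> on \<open>D\<^sub>+(g)\<close>.\<close>

definition vec_over :: "nat \<Rightarrow> 'b set \<Rightarrow> 'b vec set" where
  "vec_over m A = {v \<in> carrier_vec m. \<forall>i<m. v $ i \<in> A}"

definition free_sections ::
  "nat \<Rightarrow> 'a::field poly poly \<Rightarrow> ('a poly poly fract, 'a poly poly fract vec) module" where
  "free_sections m g = (module_vec TYPE('a poly poly fract) m) \<lparr>carrier := vec_over m (twist 0 g)\<rparr>"

text \<open>The image of \<open>\<O>(-1)\<^sup>n\<^sup>+\<^sup>1 \<rightarrow> \<O>\<^sup>n\<^sup>+\<^sup>1\<close> on \<open>D\<^sub>+(g)\<close>.\<close>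

definition pencil_image ::
  "nat \<Rightarrow> 'a::field mat \<times> 'a mat \<Rightarrow> 'a poly poly \<Rightarrow> 'a poly poly fract vec set" where
  "pencil_image n M g =
     (\<lambda>w. map_mat (\<lambda>p. Fraction_Field.Fract p 1) (pencil M) *\<^sub>v w) ` vec_over (n + 1) (twist (- 1) g)"

text \<open>
  The cokernel on \<open>D\<^sub>+(g)\<close>, as a module over \<open>\<O>\<^sub>S(D\<^sub>+(g))\<close>: the class of \<open>a\<close> acts on the class of \<open>v\<close>
  by sending it to the class of \<open>a v\<close>.  This is well defined if \<open>M \<in> sym_pairs_S n S\<close>, because the
  cokernel is then annihilated by the ideal sheaf of \<open>S\<close>.  The fields \<open>mult\<close> and \<open>one\<close> of the
  record play no role for a module.
\<close>

definition assoc_sheaf ::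
  "nat \<Rightarrow> 'a::field mat \<times> 'a mat \<Rightarrow> 'a poly poly \<Rightarrow>
     ('a poly poly fract set, 'a poly poly fract vec set) module" where
  "assoc_sheaf n M g = \<lparr>
     carrier = a_rcosets\<^bsub>free_sections (n + 1) g\<^esub> (pencil_image n M g),
     mult = undefined,
     one = undefined,
     zero = pencil_image n M g,
     add = set_add (free_sections (n + 1) g),
     smult = (\<lambda>A B. \<Union>a\<in>A. \<Union>v\<in>B.
        pencil_image n M g +>\<^bsub>free_sections (n + 1) g\<^esub> (a \<odot>\<^bsub>free_sections (n + 1) g\<^esub> v))\<rparr>"

definition assoc_res ::
  "nat \<Rightarrow> 'a::field mat \<times> 'a mat \<Rightarrow> 'a poly poly \<Rightarrow> 'a poly poly \<Rightarrow>
     'a poly poly fract vec set \<Rightarrow> 'a poly poly fract vec set" where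
  "assoc_res n M g h B = pencil_image n M (g * h) <+>\<^bsub>free_sections (n + 1) (g * h)\<^esub> B"

text \<open>\<open>\<O>\<^sub>S(D\<^sub>+(g))\<close> as a module over itself.\<close>

definition self_module ::
  "'a::field subscheme \<Rightarrow> 'a poly poly \<Rightarrow> ('a poly poly fract set, 'a poly poly fract set) module" where
  "self_module S g = ring.extend (regular g Quot S g) (module.fields (mult (regular g Quot S g)))"

text \<open>
  The associated sheaf is free of rank one if it is isomorphic to \<open>\<O>\<^sub>S\<close> as a sheaf of
  \<open>\<O>\<^sub>S\<close>-modules.
\<close>

definition assoc_free_rank_one :: "nat \<Rightarrow> 'a::field subscheme \<Rightarrow> 'a mat \<times> 'a mat \<Rightarrow> bool" where
  "assoc_free_rank_one n S M \<longleftrightarrow> (\<exists>\<phi>.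
     (\<forall>g\<in>forms. \<phi> g \<in> LinearCombinations.module_hom (struct_sheaf S g) (self_module S g) (assoc_sheaf n M g) \<and>
        bij_betw (\<phi> g) (carrier (self_module S g)) (carrier (assoc_sheaf n M g))) \<and>
     (\<forall>g\<in>forms. \<forall>h\<in>forms. \<forall>A\<in>carrier (self_module S g).
        \<phi> (g * h) (struct_res S g h A) = assoc_res n M g h (\<phi> g A)))"

definition sym_pairs_fr :: "nat \<Rightarrow> 'a::field subscheme \<Rightarrow> ('a mat \<times> 'a mat) set" where
  "sym_pairs_fr n S = {M \<in> sym_pairs_S n S. assoc_free_rank_one n S M}"

subsection \<open>Orbits of the special linear group\<close>

definition SL :: "nat \<Rightarrow> 'a::field mat monoid" where
  "SL n = \<lparr>carrier = {P \<in> carrier_mat (n + 1) (n + 1). det P = 1}, mult = (*), one = 1\<^sub>m (n + 1)\<rparr>"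

text \<open>
  The right action \<open>M \<cdot> P\<close>.  The library's \<open>orbit\<close>, \<open>orbits\<close> and \<open>stabilizer\<close> do not depend on
  whether an action is from the left or from the right.
\<close>

definition SL_act :: "'a::field mat \<Rightarrow> 'a mat \<times> 'a mat \<Rightarrow> 'a mat \<times> 'a mat" where
  "SL_act P M = (transpose_mat P * fst M * P, transpose_mat P * snd M * P)"

definition SL_orbit :: "nat \<Rightarrow> 'a::field mat \<times> 'a mat \<Rightarrow> ('a mat \<times> 'a mat) set" where
  "SL_orbit n M = orbit (SL n) SL_act M"

definition fr_orbits :: "nat \<Rightarrow> 'a::field subscheme \<Rightarrow> ('a mat \<times> 'a mat) set set" where
  "fr_orbits n S = orbits (SL n) (sym_pairs_fr n S) SL_act"

definition SL_stabilizer :: "nat \<Rightarrow> 'a::field mat \<times> 'a mat \<Rightarrow> 'a mat monoid" where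
  "SL_stabilizer n M = (SL n) \<lparr>carrier := stabilizer (SL n) SL_act M\<rparr>"

text \<open>The common value of the discriminant polynomial on an orbit.\<close>

definition orbit_disc :: "('a::field mat \<times> 'a mat) set \<Rightarrow> 'a poly poly" where
  "orbit_disc Q = the_elem (disc ` Q)"

section \<open>The groups and quotient sets built from \<open>L = H\<^sup>0(S, \<O>\<^sub>S)\<close>\<close>

definition kL_units :: "'a::field subscheme \<Rightarrow> ('a \<times> ('a poly poly \<Rightarrow> 'a poly poly fract set)) monoid" where
  "kL_units S = units_of (class_ring :: 'a ring) \<times>\<times> units_of (H0 S)"

definition norm_square :: "'a::field subscheme \<Rightarrow> ('a \<times> ('a poly poly \<Rightarrow> 'a poly poly fract set)) set" where
  "norm_square S = {(inverse (alg_norm (H0 S) \<alpha>), \<alpha> \<otimes>\<^bsub>H0 S\<^esub> \<alpha>) | \<alpha>. \<alpha> \<in> Units (H0 S)}"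

definition G_grp :: "'a::field subscheme \<Rightarrow> ('a \<times> ('a poly poly \<Rightarrow> 'a poly poly fract set)) set monoid" where
  "G_grp S = kL_units S Mod norm_square S"

definition G_class ::
  "'a::field subscheme \<Rightarrow> 'a \<Rightarrow> ('a poly poly \<Rightarrow> 'a poly poly fract set) \<Rightarrow>
     ('a \<times> ('a poly poly \<Rightarrow> 'a poly poly fract set)) set" where
  "G_class S u \<alpha> = norm_square S #>\<^bsub>kL_units S\<^esub> (u, \<alpha>)"

text \<open>
  \<open>G_grp S\<close> is commutative, so right actions of it are the same as left actions, which is what
  the library's \<open>group_action\<close> describes.
\<close>

definition simply_transitive_action :: "('g, 'm) monoid_scheme \<Rightarrow> 'e set \<Rightarrow> ('g \<Rightarrow> 'e \<Rightarrow> 'e) \<Rightarrow> bool" where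
  "simply_transitive_action G E act \<longleftrightarrow>
     group_action G E act \<and> E \<noteq> {} \<and>
     (\<forall>x\<in>E. \<forall>y\<in>E. \<exists>!\<gamma>. \<gamma> \<in> carrier G \<and> act \<gamma> x = y)"

definition norm_solutions ::
  "nat \<Rightarrow> 'a::field subscheme \<Rightarrow> 'a \<Rightarrow> ('a \<times> ('a poly poly \<Rightarrow> 'a poly poly fract set)) set" where
  "norm_solutions n S c = {(u, \<alpha>). u \<noteq> 0 \<and> \<alpha> \<in> Units (H0 S) \<and>
      c = (- 1) ^ (n * (n + 1) div 2) * u\<^sup>2 * alg_norm (H0 S) \<alpha>}"

definition norm_solutions_rel ::
  "nat \<Rightarrow> 'a::field subscheme \<Rightarrow> 'a \<Rightarrow> ('a \<times> ('a poly poly \<Rightarrow> 'a poly poly fract set)) rel" where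
  "norm_solutions_rel n S c = {((u, \<alpha>), (u', \<alpha>')).
      (u, \<alpha>) \<in> norm_solutions n S c \<and> (u', \<alpha>') \<in> norm_solutions n S c \<and>
      (\<exists>\<beta>\<in>Units (H0 S). u = inverse (alg_norm (H0 S) \<beta>) * u' \<and>
          \<alpha> = (\<beta> \<otimes>\<^bsub>H0 S\<^esub> \<beta>) \<otimes>\<^bsub>H0 S\<^esub> \<alpha>')}"

definition mu2_norm_one :: "'a::field subscheme \<Rightarrow> ('a poly poly \<Rightarrow> 'a poly poly fract set) monoid" where
  "mu2_norm_one S = (units_of (H0 S))
     \<lparr>carrier := {\<beta> \<in> Units (H0 S). \<beta> \<otimes>\<^bsub>H0 S\<^esub> \<beta> = \<one>\<^bsub>H0 S\<^esub> \<and> alg_norm (H0 S) \<beta> = 1}\<rparr>"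

end

theory Submission
  imports Defs "Jordan_Normal_Form.Char_Poly" "Jordan_Normal_Form.DL_Rank"
begin

text \<open>
  Let \<open>f\<close> be a form of degree \<open>N = n + 1\<close> with \<open>S = (f = 0)\<close>.  The algebra \<open>L = H\<^sup>0(S, \<O>\<^sub>S)\<close> is made explicit as
  \<open>k[x]/F \<times> k[y]/(y\<^sup>s)\<close>, where \<open>F = f(x, 1)\<close> and \<open>s\<close> is the multiplicity of \<open>(1 : 0)\<close>, acting on itself by
  \<open>N \<times> N\<close> matrices.  After \<open>\<O>(1)\<close> is trivialized on \<open>S\<close>, the coordinates \<open>X\<^sub>0\<close> and \<open>X\<^sub>1\<close> become commuting
  matrices, and \<open>L\<close> is their commutant \<open>mult_algebra\<close> (\<open>global_section_bij\<close>).  Under this identification the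
  norm is the determinant.

  The key point is a normal form for free pairs.  Multiplication is self-adjoint for the pairing
  \<open>\<tau>(v w)\<close> on \<open>L\<close>, where \<open>\<tau>\<close> is the sum of top coefficients with suitable signs; let \<open>T\<close> be its Gram matrix.
  Hence for \<open>H\<close> in \<open>L\<close> the matrices \<open>T H X\<^sub>1\<close> and \<open>- T H X\<^sub>0\<close> are symmetric.  The pencil that they span is
  \<open>T H\<close> times the pencil \<open>X\<^sub>0 \<cdot> X\<^sub>1 - X\<^sub>1 \<cdot> X\<^sub>0\<close> (scalar variables on the left, multiplications on the
  right), whose cokernel is \<open>\<O>\<^sub>S\<close> by \<open>pencil_spanI\<close> and whose determinant is \<open>f\<close> up to a constant by
  \<open>det_mult_pencil\<close>.  So for invertible \<open>H\<close> and \<open>P\<close> the pair \<open>P\<^sup>T (T H X\<^sub>1, - T H X\<^sub>0) P\<close> has a free associated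
  sheaf.  Conversely (\<open>free_imp_SL_act_base_pair\<close>), a generator of a free associated sheaf turns the standard
  basis into a basis of \<open>L\<close> that kills the columns of the pencil; in terms of this basis the pair has the
  form above for some matrix \<open>H\<close>, and the symmetry of the two matrices becomes \<open>X\<^sub>0 H X\<^sub>1 = X\<^sub>1 H X\<^sub>0\<close>.
  Exchanging one linear factor at a time, this relation implies \<open>p H q = q H p\<close> for all forms of equal degree,
  and taking for \<open>p\<close> a form that restricts to \<open>1\<close> shows that \<open>H\<close> commutes with multiplication
  (\<open>mult_algebra_if_swap\<close>), that is, \<open>H\<close> belongs to \<open>L\<close>.

  The same argument shows that \<open>(P, H)\<close> and \<open>(Q, K)\<close> give the same pair if and only if \<open>P = g Q\<close> and \<open>K = H g\<^sup>2\<close>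
  for some \<open>g\<close> in \<open>L\<close> (\<open>SL_act_base_pair_eqD\<close>).  Passing to orbits of the special linear group leaves from
  \<open>P\<close> only \<open>det P\<close>, so orbits correspond to pairs \<open>(u, \<alpha>)\<close> of units modulo \<open>(N(\<beta>)\<^sup>-\<^sup>1, \<beta>\<^sup>2)\<close>; translation gives
  the simply transitive action.  The discriminant of the orbit of \<open>(u, \<alpha>)\<close> is
  \<open>(- 1)\<^sup>n\<^sup>(\<^sup>n\<^sup>+\<^sup>1\<^sup>)\<^sup>/\<^sup>2 u\<^sup>2 N(\<alpha>) f / C\<close>, where \<open>C\<close> is the leading coefficient of \<open>F\<close>.  This gives the effect of the
  action on discriminants, the orbits with discriminant \<open>f\<close>, and the criterion for their existence.
  Finally, the stabilizer of the pair of \<open>(P, H)\<close> is conjugate by \<open>P\<close> to the group of those \<open>g\<close> in \<open>L\<close> with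
  \<open>g\<^sup>2 = 1\<close> and \<open>det g = 1\<close>.
\<close>

section \<open>Matrices of linear maps\<close>

lemma mult_unit_vec_eq_col:
  assumes "A \<in> carrier_mat n m" "j < m"
  shows "A *\<^sub>v unit_vec m j = col (A :: 'a::comm_ring_1 mat) j"
  using assms by (intro eq_vecI) (auto simp: scalar_prod_def unit_vec_def sum.delta if_distrib cong: if_cong)

lemma mat_eq_if_action_eq:
  assumes "A \<in> carrier_mat n m" "B \<in> carrier_mat n m"
    and "\<And>v. v \<in> carrier_vec m \<Longrightarrow> A *\<^sub>v v = B *\<^sub>v v"
  shows "A = (B :: 'a::comm_ring_1 mat)"
proof (rule mat_col_eqI)
  fix j assume j: "j < dim_col B"
  show "col A j = col B j"
    using assms(3)[of "unit_vec m j"] j assms(1,2) by (simp add: mult_unit_vec_eq_col)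
qed (use assms in auto)

lemma mat_of_linear_map:
  fixes G :: "'a::comm_ring_1 vec \<Rightarrow> 'a vec"
  assumes add: "\<And>v w. v \<in> carrier_vec n \<Longrightarrow> w \<in> carrier_vec n \<Longrightarrow> G (v + w) = G v + G w"
    and sm: "\<And>c v. v \<in> carrier_vec n \<Longrightarrow> G (c \<cdot>\<^sub>v v) = c \<cdot>\<^sub>v G v"
    and car: "\<And>v. v \<in> carrier_vec n \<Longrightarrow> G v \<in> carrier_vec m"
    and v: "v \<in> carrier_vec n"
  shows "mat m n (\<lambda>(i, j). G (unit_vec n j) $ i) *\<^sub>v v = G v"
proof -
  let ?A = "mat m n (\<lambda>(i, j). G (unit_vec n j) $ i)"
  let ?v = "\<lambda>k. vec n (\<lambda>j. if j < k then v $ j else 0)"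
  have unit: "?A *\<^sub>v unit_vec n k = G (unit_vec n k)" if "k < n" for k
    using mult_unit_vec_eq_col[of ?A m n k] that car[of "unit_vec n k"]
    by (intro eq_vecI) (auto simp: col_def)
  have "?A *\<^sub>v ?v k = G (?v k)" if "k \<le> n" for k
    using that
  proof (induction k)
    case 0
    have "?v 0 = 0 \<cdot>\<^sub>v (0\<^sub>v n :: 'a vec)" by (intro eq_vecI) auto
    moreover have "?A *\<^sub>v (0 \<cdot>\<^sub>v (0\<^sub>v n)) = 0\<^sub>v m" by (intro eq_vecI) auto
    moreover have "G (0 \<cdot>\<^sub>v (0\<^sub>v n)) = 0\<^sub>v m"
      using sm[of "0\<^sub>v n" 0] car[of "0\<^sub>v n"] by (auto intro!: eq_vecI)
    ultimately show ?case by simp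
  next
    case (Suc k)
    have e: "?v (Suc k) = ?v k + v $ k \<cdot>\<^sub>v unit_vec n k"
      using Suc.prems by (intro eq_vecI) (auto simp: less_Suc_eq)
    have "?A *\<^sub>v ?v (Suc k) = ?A *\<^sub>v ?v k + v $ k \<cdot>\<^sub>v (?A *\<^sub>v unit_vec n k)"
      unfolding e by (subst mult_add_distrib_mat_vec[of _ m n]) (auto simp: mult_mat_vec[of _ m n])
    also have "\<dots> = G (?v k) + v $ k \<cdot>\<^sub>v G (unit_vec n k)"
      using Suc unit[of k] by simp
    also have "\<dots> = G (?v (Suc k))"
      unfolding e by (simp add: add sm)
    finally show ?case .
  qed
  from this[of n] have "?A *\<^sub>v ?v n = G (?v n)" by simp
  moreover have "?v n = v" using v by (intro eq_vecI) auto
  ultimately show ?thesis by simp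
qed

text \<open>
  A form is determined by its degree and by its restriction to either chart of the projective line:
  \<open>dehom_X1\<close> sets \<open>X\<^sub>1 = 1\<close> and uses the coordinate \<open>x = X\<^sub>0 / X\<^sub>1\<close>, and \<open>dehom_X0\<close> sets \<open>X\<^sub>0 = 1\<close> and
  uses \<open>y = X\<^sub>1 / X\<^sub>0\<close>.
\<close>

section \<open>Binary forms and dehomogenization\<close>

definition dehom_X1 :: "'a::field poly poly \<Rightarrow> 'a poly" where
  "dehom_X1 a = poly a 1"

definition dehom_X0 :: "'a::field poly poly \<Rightarrow> 'a poly" where
  "dehom_X0 a = map_poly (\<lambda>p. poly p 1) a"

definition homogenize :: "nat \<Rightarrow> 'a::field poly \<Rightarrow> 'a poly poly" where
  "homogenize l A = (\<Sum>j\<le>l. Polynomial.monom (Polynomial.monom (coeff A (l - j)) (l - j)) j)"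

lemma comm_ring_hom_poly_1: "comm_ring_hom (\<lambda>p. poly p (1::'a::field))"
  by unfold_locales auto

lemma dehom_X1_simps [simp]:
  "dehom_X1 (a + b) = dehom_X1 a + dehom_X1 b"
  "dehom_X1 (a - b) = dehom_X1 a - dehom_X1 b"
  "dehom_X1 (a * b) = dehom_X1 a * dehom_X1 b"
  "dehom_X1 0 = 0"
  "dehom_X1 1 = 1"
  "dehom_X1 X0 = [:0, 1:]"
  "dehom_X1 X1 = 1"
  "dehom_X1 (const c) = [:c:]"
  by (auto simp: dehom_X1_def X0_def X1_def const_def)

lemma dehom_X0_simps [simp]:
  "dehom_X0 (a + b) = dehom_X0 a + dehom_X0 b"
  "dehom_X0 (a - b) = dehom_X0 a - dehom_X0 b"
  "dehom_X0 (a * b) = dehom_X0 a * dehom_X0 b"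
  "dehom_X0 0 = 0"
  "dehom_X0 1 = 1"
  "dehom_X0 X0 = 1"
  "dehom_X0 X1 = [:0, 1:]"
  "dehom_X0 (const c) = [:c:]"
proof -
  interpret h: comm_ring_hom "\<lambda>p. poly p (1::'a)" by (rule comm_ring_hom_poly_1)
  interpret m: map_poly_comm_ring_hom "\<lambda>p. poly p (1::'a)" ..
  show "dehom_X0 (a + b) = dehom_X0 a + dehom_X0 b"
    "dehom_X0 (a - b) = dehom_X0 a - dehom_X0 b"
    "dehom_X0 (a * b) = dehom_X0 a * dehom_X0 b"
    by (auto simp: dehom_X0_def m.hom_add m.hom_mult m.hom_minus)
  show "dehom_X0 0 = 0" "dehom_X0 1 = 1" "dehom_X0 X0 = 1" "dehom_X0 X1 = [:0, 1:]"
    by (auto simp: dehom_X0_def X0_def X1_def map_poly_pCons one_pCons)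
  show "dehom_X0 (const c) = [:c:]"
    by (cases "c = 0") (auto simp: dehom_X0_def const_def map_poly_pCons)
qed

lemma homogD: "homog (int l) a \<Longrightarrow> i + j \<noteq> l \<Longrightarrow> coeff (coeff a j) i = 0"
  unfolding homog_def by force

lemma coeff_dehom_X1:
  assumes "homog (int l) a"
  shows "coeff (dehom_X1 a) i = (if i \<le> l then coeff (coeff a (l - i)) i else 0)"
proof -
  have "coeff (dehom_X1 a) i = (\<Sum>j\<le>degree a. coeff (coeff a j) i)"
    by (simp add: dehom_X1_def poly_altdef coeff_sum)
  also have "\<dots> = (\<Sum>j\<le>degree a. if j = l - i \<and> i \<le> l then coeff (coeff a j) i else 0)"
    by (intro sum.cong refl) (auto intro: homogD[OF assms])
  also have "\<dots> = (if i \<le> l then coeff (coeff a (l - i)) i else 0)"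
    by (auto simp: sum.delta coeff_eq_0)
  finally show ?thesis .
qed

lemma coeff_dehom_X0:
  assumes "homog (int l) a"
  shows "coeff (dehom_X0 a) j = (if j \<le> l then coeff (dehom_X1 a) (l - j) else 0)"
proof -
  have "coeff (dehom_X0 a) j = poly (coeff a j) 1"
    by (simp add: dehom_X0_def coeff_map_poly)
  also have "\<dots> = (\<Sum>i\<le>degree (coeff a j). coeff (coeff a j) i)"
    by (simp add: poly_altdef)
  also have "\<dots> = (\<Sum>i\<le>degree (coeff a j). if i = l - j \<and> j \<le> l then coeff (coeff a j) i else 0)"
    by (intro sum.cong refl) (auto intro: homogD[OF assms])
  also have "\<dots> = (if j \<le> l then coeff (coeff a j) (l - j) else 0)"
    by (auto simp: sum.delta coeff_eq_0)
  finally show ?thesis by (simp add: coeff_dehom_X1[OF assms])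
qed

lemma coeff_homogenize:
  "coeff (coeff (homogenize l A) j) i = (if i + j = l then coeff A i else 0)"
proof -
  have "coeff (homogenize l A) j = (if j \<le> l then Polynomial.monom (coeff A (l - j)) (l - j) else 0)"
    by (auto simp: homogenize_def coeff_sum sum.delta)
  then show ?thesis by auto
qed

lemma homog_homogenize: "homog (int l) (homogenize l A)"
  by (auto simp: homog_def coeff_homogenize split: if_splits)

lemma dehom_homogenize:
  assumes "\<And>i. i > l \<Longrightarrow> coeff A i = 0"
  shows "dehom_X1 (homogenize l A) = A"
  by (rule poly_eqI) (auto simp: coeff_dehom_X1[OF homog_homogenize] coeff_homogenize assms)

lemma homog_eqI:
  assumes "homog (int l) a" "homog (int l) b" "dehom_X1 a = dehom_X1 b"
  shows "a = b"
proof (intro poly_eqI)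
  fix i j
  show "coeff (coeff a j) i = coeff (coeff b j) i"
  proof (cases "i + j = l")
    case True
    then show ?thesis
      using coeff_dehom_X1[OF assms(1), of i] coeff_dehom_X1[OF assms(2), of i] assms(3) by auto
  qed (simp add: homogD[OF assms(1)] homogD[OF assms(2)])
qed

lemma homog_0 [simp]: "homog d 0"
  by (simp add: homog_def)

lemma homog_1 [simp]: "homog 0 1"
  by (auto simp: homog_def one_pCons coeff_pCons split: nat.splits)

lemma homog_X0 [simp]: "homog 1 X0" and homog_X1 [simp]: "homog 1 X1"
  by (auto simp: homog_def X0_def X1_def coeff_pCons split: nat.splits)

lemma homog_const [simp]: "homog 0 (const c)"
  by (auto simp: homog_def const_def coeff_pCons split: nat.splits)

lemma homog_add: "homog d a \<Longrightarrow> homog d b \<Longrightarrow> homog d (a + b)"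
  unfolding homog_def by (metis add_0 coeff_add)

lemma homog_uminus: "homog d a \<Longrightarrow> homog d (- a)"
  unfolding homog_def by simp

lemma homog_diff: "homog d a \<Longrightarrow> homog d b \<Longrightarrow> homog d (a - b)"
  using homog_add[of d a "- b"] homog_uminus[of d b] by simp

lemma homog_sum: "(\<And>x. x \<in> A \<Longrightarrow> homog d (h x)) \<Longrightarrow> homog d (sum h A)"
  by (induction A rule: infinite_finite_induct) (auto intro: homog_add)

lemma homog_mult:
  assumes "homog d a" "homog e b"
  shows "homog (d + e) (a * b)"
  unfolding homog_def
proof (intro allI impI)
  fix i j
  assume nz: "coeff (coeff (a * b) j) i \<noteq> 0"
  have "coeff (coeff (a * b) j) i
    = (\<Sum>k\<le>j. \<Sum>m\<le>i. coeff (coeff a k) m * coeff (coeff b (j - k)) (i - m))"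
    by (simp add: coeff_mult coeff_sum)
  with nz obtain k where k: "k \<le> j"
    and "(\<Sum>m\<le>i. coeff (coeff a k) m * coeff (coeff b (j - k)) (i - m)) \<noteq> 0"
    by (metis (no_types, lifting) atMost_iff sum.not_neutral_contains_not_neutral)
  then obtain m where m: "m \<le> i"
    and "coeff (coeff a k) m * coeff (coeff b (j - k)) (i - m) \<noteq> 0"
    by (metis (no_types, lifting) atMost_iff sum.not_neutral_contains_not_neutral)
  with assms have "int m + int k = d" "int (i - m) + int (j - k) = e"
    unfolding homog_def by force+
  with k m show "int i + int j = d + e" by auto
qed

lemma homog_power: "homog d a \<Longrightarrow> homog (int m * d) (a ^ m)"
  by (induction m) (auto simp: algebra_simps dest: homog_mult)

lemma homog_unique: "a \<noteq> 0 \<Longrightarrow> homog d a \<Longrightarrow> homog e a \<Longrightarrow> d = e"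
  unfolding homog_def by (metis leading_coeff_0_iff)

lemma homog_nonneg: "a \<noteq> 0 \<Longrightarrow> homog d a \<Longrightarrow> 0 \<le> d"
  unfolding homog_def by (metis leading_coeff_0_iff of_nat_0_le_iff add_nonneg_nonneg)

section \<open>The algebra of a binary form\<close>

lemma smult_mat_mult_vec:
  assumes "A \<in> carrier_mat n m" "v \<in> carrier_vec m"
  shows "(c \<cdot>\<^sub>m A) *\<^sub>v v = c \<cdot>\<^sub>v (A *\<^sub>v (v :: 'a::comm_ring_1 vec))"
  using assms by (intro eq_vecI) (auto simp: scalar_prod_def sum_distrib_left mult.assoc)

lemma zero_mat_mult_vec:
  "v \<in> carrier_vec m \<Longrightarrow> 0\<^sub>m n m *\<^sub>v v = 0\<^sub>v n"
  for v :: "'a::comm_ring_1 vec"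
  by (intro eq_vecI) (auto simp: scalar_prod_def)

text \<open>
  The subscheme \<open>(f = 0)\<close> is the disjoint union of its part in the chart \<open>X\<^sub>1 \<noteq> 0\<close>, given by
  \<open>F = f(x, 1)\<close>, and of the point \<open>(1 : 0)\<close> with its multiplicity \<open>s = N - deg F\<close>, given by \<open>Y = y\<^sup>s\<close>.
  The algebra of global functions is therefore \<open>k[x]/F \<times> k[y]/Y\<close>.  Its elements are written as vectors of
  length \<open>N\<close> in the basis \<open>1, x, \<dots>, x\<^sup>r\<^sup>-\<^sup>1\<close> of the first factor followed by \<open>1, y, \<dots>, y\<^sup>s\<^sup>-\<^sup>1\<close>.
\<close>

locale binary_form =
  fixes f :: "'a::field poly poly" and N :: nat
  assumes homog_f: "homog (int N) f" and f_nonzero: "f \<noteq> 0"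
begin

definition F :: "'a poly" where "F = dehom_X1 f"
definition r :: nat where "r = degree F"
definition s :: nat where "s = N - r"
definition Y :: "'a poly" where "Y = Polynomial.monom 1 s"

lemma F_nonzero: "F \<noteq> 0"
  using homog_eqI[OF homog_f, of 0] f_nonzero by (auto simp: F_def)

lemma r_le: "r \<le> N"
proof (rule ccontr)
  assume "\<not> r \<le> N"
  then have "coeff F r = 0" by (simp add: F_def coeff_dehom_X1[OF homog_f])
  then show False using F_nonzero by (simp add: r_def)
qed

lemma r_plus_s: "r + s = N"
  using r_le by (simp add: s_def)

lemma degree_Y: "degree Y = s" and Y_nonzero: "Y \<noteq> 0"
  by (auto simp: Y_def degree_monom_eq)

definition fst_part :: "'a vec \<Rightarrow> 'a poly" where
  "fst_part v = (\<Sum>i<r. Polynomial.monom (v $ i) i)"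

definition snd_part :: "'a vec \<Rightarrow> 'a poly" where
  "snd_part v = (\<Sum>i<s. Polynomial.monom (v $ (r + i)) i)"

definition coords :: "'a poly \<Rightarrow> 'a poly \<Rightarrow> 'a vec" where
  "coords p q = vec N (\<lambda>i. if i < r then coeff p i else coeff q (i - r))"

lemma coords_carrier [simp]: "coords p q \<in> carrier_vec N"
  by (simp add: coords_def)

lemma coeff_fst_part: "coeff (fst_part v) i = (if i < r then v $ i else 0)"
  by (auto simp: fst_part_def coeff_sum sum.delta)

lemma coeff_snd_part: "coeff (snd_part v) i = (if i < s then v $ (r + i) else 0)"
  by (auto simp: snd_part_def coeff_sum sum.delta)

lemma fst_part_linear:
  assumes "v \<in> carrier_vec N"
  shows "w \<in> carrier_vec N \<Longrightarrow> fst_part (v + w) = fst_part v + fst_part w"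
    and "fst_part (c \<cdot>\<^sub>v v) = Polynomial.smult c (fst_part v)"
  using assms r_plus_s by (auto intro!: poly_eqI simp: coeff_fst_part)

lemma snd_part_linear:
  assumes "v \<in> carrier_vec N"
  shows "w \<in> carrier_vec N \<Longrightarrow> snd_part (v + w) = snd_part v + snd_part w"
    and "snd_part (c \<cdot>\<^sub>v v) = Polynomial.smult c (snd_part v)"
  using assms r_plus_s by (auto intro!: poly_eqI simp: coeff_snd_part)

lemma coords_linear:
  "coords (p + p') (q + q') = coords p q + coords p' q'"
  "coords (Polynomial.smult c p) (Polynomial.smult c q) = c \<cdot>\<^sub>v coords p q"
  by (auto intro!: eq_vecI simp: coords_def)

lemma coords_parts: "v \<in> carrier_vec N \<Longrightarrow> coords (fst_part v) (snd_part v) = v"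
  using r_plus_s by (auto intro!: eq_vecI simp: coords_def coeff_fst_part coeff_snd_part)

lemma coeff_mod_F: "r \<le> i \<Longrightarrow> coeff (p mod F) i = 0"
  using degree_mod_less[of F p] F_nonzero by (auto simp: r_def coeff_eq_0)

lemma coeff_mod_Y: "s \<le> i \<Longrightarrow> coeff (p mod Y) i = 0"
  using degree_mod_less[of Y p] Y_nonzero by (auto simp: degree_Y coeff_eq_0)

lemma mod_F_idem: "(\<And>i. r \<le> i \<Longrightarrow> coeff p i = 0) \<Longrightarrow> p mod F = p"
  by (metis F_nonzero coeff_mod_F degree_mod_less leading_coeff_0_iff linorder_not_le mod_poly_less mod_0 r_def)

lemma mod_Y_idem: "(\<And>i. s \<le> i \<Longrightarrow> coeff p i = 0) \<Longrightarrow> p mod Y = p"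
  by (metis degree_Y leading_coeff_0_iff linorder_not_le mod_poly_less mod_0)

lemma parts_coords:
  "(\<And>i. r \<le> i \<Longrightarrow> coeff p i = 0) \<Longrightarrow> fst_part (coords p q) = p"
  "(\<And>i. s \<le> i \<Longrightarrow> coeff q i = 0) \<Longrightarrow> snd_part (coords p q) = q"
  using r_plus_s by (auto intro!: poly_eqI simp: coords_def coeff_fst_part coeff_snd_part)

lemma parts_coords_mod [simp]:
  "fst_part (coords (p mod F) q) = p mod F"
  "snd_part (coords p (q mod Y)) = q mod Y"
  by (auto intro!: parts_coords coeff_mod_F coeff_mod_Y)

lemma parts_mod [simp]: "fst_part v mod F = fst_part v" "snd_part v mod Y = snd_part v"
  by (auto intro!: mod_F_idem mod_Y_idem simp: coeff_fst_part coeff_snd_part)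

text \<open>
  A form is not a function on the subscheme, but it becomes one after trivializing \<open>\<O>(1)\<close> by \<open>X\<^sub>1\<close> on
  the first part and by \<open>X\<^sub>0\<close> at \<open>(1 : 0)\<close>.  In this way \<open>mul_mat\<close> is a ring homomorphism from
  \<open>k[X\<^sub>0, X\<^sub>1]\<close> to endomorphisms, defined on inhomogeneous polynomials as well.
\<close>

definition mul_vec :: "'a poly poly \<Rightarrow> 'a vec \<Rightarrow> 'a vec" where
  "mul_vec a v = coords (dehom_X1 a * fst_part v mod F) (dehom_X0 a * snd_part v mod Y)"

definition mul_mat :: "'a poly poly \<Rightarrow> 'a mat" where
  "mul_mat a = mat N N (\<lambda>(i, j). mul_vec a (unit_vec N j) $ i)"

definition one_vec :: "'a vec" where
  "one_vec = coords (1 mod F) (1 mod Y)"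

lemma mul_mat_carrier [simp]: "mul_mat a \<in> carrier_mat N N"
  by (simp add: mul_mat_def)

lemma one_vec_carrier [simp]: "one_vec \<in> carrier_vec N"
  by (simp add: one_vec_def)

lemma mul_vec_carrier [simp]: "mul_vec a v \<in> carrier_vec N"
  by (simp add: mul_vec_def)

lemma mul_mat_vec:
  assumes "v \<in> carrier_vec N"
  shows "mul_mat a *\<^sub>v v = mul_vec a v"
  unfolding mul_mat_def
  by (rule mat_of_linear_map[OF _ _ _ assms])
    (auto simp: mul_vec_def fst_part_linear snd_part_linear algebra_simps poly_mod_add_left
      mod_smult_left coords_linear)

lemma mul_mat_eqI:
  assumes "A \<in> carrier_mat N N" "\<And>v. v \<in> carrier_vec N \<Longrightarrow> A *\<^sub>v v = mul_vec a v"
  shows "A = mul_mat a"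
  using assms by (intro mat_eq_if_action_eq[of _ N N]) (auto simp: mul_mat_vec)

lemma mul_mat_add: "mul_mat (a + b) = mul_mat a + mul_mat b"
  by (rule mul_mat_eqI[symmetric])
    (auto simp: add_mult_distrib_mat_vec[of _ N N] mul_mat_vec mul_vec_def algebra_simps
      poly_mod_add_left coords_linear[symmetric])

lemma mul_mat_mult: "mul_mat (a * b) = mul_mat a * mul_mat b"
proof (rule mul_mat_eqI[symmetric])
  fix v :: "'a vec" assume v: "v \<in> carrier_vec N"
  have "mul_mat a * mul_mat b *\<^sub>v v = mul_vec a (mul_vec b v)"
    using v by (simp add: assoc_mult_mat_vec[of _ N N _ N] mul_mat_vec)
  also have "\<dots> = mul_vec (a * b) v"
    by (simp add: mul_vec_def mod_mult_right_eq mult.assoc)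
  finally show "mul_mat a * mul_mat b *\<^sub>v v = mul_vec (a * b) v" .
qed (auto intro!: mult_carrier_mat[of _ N N])

lemma mul_mat_const: "mul_mat (const c) = c \<cdot>\<^sub>m 1\<^sub>m N"
proof (rule mul_mat_eqI[symmetric])
  fix v :: "'a vec" assume v: "v \<in> carrier_vec N"
  have "(c \<cdot>\<^sub>m 1\<^sub>m N) *\<^sub>v v = c \<cdot>\<^sub>v v"
    using v by (simp add: smult_mat_mult_vec[of _ N N])
  also have "\<dots> = mul_vec (const c) v"
    using v by (simp add: mul_vec_def mod_smult_left coords_linear coords_parts)
  finally show "(c \<cdot>\<^sub>m 1\<^sub>m N) *\<^sub>v v = mul_vec (const c) v" .
qed auto

lemma mul_mat_one_vec: "mul_mat a *\<^sub>v one_vec = coords (dehom_X1 a mod F) (dehom_X0 a mod Y)"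
  by (simp add: mul_mat_vec mul_vec_def one_vec_def mod_mult_right_eq)

lemma dvd_Y_iff: "Y dvd q \<longleftrightarrow> (\<forall>j<s. coeff q j = 0)"
  by (simp add: Y_def monom_1_dvd_iff')

lemma mul_mat_eq_0_iff: "mul_mat a = 0\<^sub>m N N \<longleftrightarrow> F dvd dehom_X1 a \<and> Y dvd dehom_X0 a"
proof
  assume "mul_mat a = 0\<^sub>m N N"
  moreover have "0\<^sub>m N N *\<^sub>v one_vec = 0\<^sub>v N"
    by (simp add: zero_mat_mult_vec)
  ultimately have "coords (dehom_X1 a mod F) (dehom_X0 a mod Y) = 0\<^sub>v N"
    using mul_mat_one_vec[of a] by simp
  then have "fst_part (0\<^sub>v N) = dehom_X1 a mod F" "snd_part (0\<^sub>v N) = dehom_X0 a mod Y"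
    by (metis parts_coords_mod)+
  moreover have "fst_part (0\<^sub>v N) = 0" "snd_part (0\<^sub>v N) = 0"
    using r_plus_s by (auto intro!: poly_eqI simp: coeff_fst_part coeff_snd_part)
  ultimately show "F dvd dehom_X1 a \<and> Y dvd dehom_X0 a"
    by (simp add: dvd_eq_mod_eq_0)
next
  assume d: "F dvd dehom_X1 a \<and> Y dvd dehom_X0 a"
  show "mul_mat a = 0\<^sub>m N N"
  proof (rule mul_mat_eqI[symmetric])
    fix v :: "'a vec" assume v: "v \<in> carrier_vec N"
    have "dehom_X1 a * fst_part v mod F = 0" "dehom_X0 a * snd_part v mod Y = 0"
      using d by (auto intro!: dvd_imp_mod_0)
    then have "mul_vec a v = 0\<^sub>v N"
      by (auto simp: mul_vec_def coords_def)
    then show "0\<^sub>m N N *\<^sub>v v = mul_vec a v" using v by (simp add: zero_mat_mult_vec)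
  qed auto
qed

lemma mul_mat_f: "mul_mat f = 0\<^sub>m N N"
  unfolding mul_mat_eq_0_iff
proof
  show "Y dvd dehom_X0 f"
    unfolding dvd_Y_iff using r_plus_s
    by (auto simp: coeff_dehom_X0[OF homog_f] F_def[symmetric] intro!: coeff_eq_0 simp flip: r_def)
qed (simp add: F_def)

text \<open>
  The forms that vanish on the subscheme are the multiples of \<open>f\<close>.  Divisibility by \<open>F\<close> in the
  chart gives a quotient \<open>Q\<close>, and vanishing to order \<open>s\<close> at \<open>(1 : 0)\<close> bounds the degree of \<open>Q\<close> by
  \<open>l - N\<close>, so that \<open>Q\<close> comes from a form of the right degree.
\<close>

lemma mul_mat_homog_eq_0D:
  assumes a: "homog (int l) a" and "mul_mat a = 0\<^sub>m N N"
  obtains b where "homog (int l - int N) b" "a = f * b"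
proof (cases "a = 0")
  case True
  with that[of 0] show ?thesis by simp
next
  case False
  from assms(2) obtain Q where Q: "dehom_X1 a = F * Q" and van: "\<And>j. j < s \<Longrightarrow> coeff (dehom_X0 a) j = 0"
    by (auto simp: mul_mat_eq_0_iff dvd_Y_iff elim: dvdE)
  have Q0: "Q \<noteq> 0"
    using homog_eqI[OF a, of 0] Q False by auto
  define m where "m = degree (dehom_X1 a)"
  have m: "m = r + degree Q"
    using F_nonzero Q0 by (simp add: m_def Q degree_mult_eq r_def)
  have lead: "coeff (dehom_X1 a) m \<noteq> 0"
    using Q Q0 F_nonzero by (simp add: m_def)
  then have "m \<le> l"
    by (auto simp: coeff_dehom_X1[OF a] split: if_splits)
  moreover have "\<not> l - m < s"
  proof
    assume "l - m < s"
    from van[OF this] lead \<open>m \<le> l\<close> show False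
      by (simp add: coeff_dehom_X0[OF a] split: if_splits)
  qed
  ultimately have le: "N + degree Q \<le> l" using r_plus_s m by simp
  define b where "b = homogenize (l - N) Q"
  have b: "homog (int (l - N)) b" "dehom_X1 b = Q"
    unfolding b_def by (rule homog_homogenize, rule dehom_homogenize) (use le in \<open>auto intro: coeff_eq_0\<close>)
  have "homog (int l) (f * b)"
    using homog_mult[OF homog_f b(1)] le by simp
  then have "a = f * b"
    by (rule homog_eqI[OF a]) (simp add: Q b F_def)
  with that b(1) le show ?thesis by (simp add: of_nat_diff)
qed

lemma mul_mat_homog_eq_0_iff:
  assumes a: "homog (int l) a"
  shows "mul_mat a = 0\<^sub>m N N \<longleftrightarrow> f dvd a"
proof
  show "f dvd a \<Longrightarrow> mul_mat a = 0\<^sub>m N N"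
    by (auto elim!: dvdE simp: mul_mat_mult mul_mat_f left_mult_zero_mat[of _ N N])
  show "mul_mat a = 0\<^sub>m N N \<Longrightarrow> f dvd a"
    by (erule mul_mat_homog_eq_0D[OF a]) simp
qed

text \<open>
  Every function on the subscheme is the restriction of a form of degree \<open>l\<close>, as soon as
  \<open>l \<ge> N - 1\<close> (this bound is the vanishing of \<open>H\<^sup>1(\<P>\<^sup>1, \<O>(l - N))\<close>).  The coefficients of a form of
  degree \<open>l\<close> that matter at \<open>(1 : 0)\<close> are the top \<open>s\<close> ones in \<open>x\<close>; they are prescribed by \<open>B\<close>.
  Changing the coefficients below degree \<open>r\<close> leaves them alone because \<open>r + s \<le> l + 1\<close>, and suffices to
  obtain any residue modulo \<open>F\<close>.
\<close>

lemma homog_of_one_vec: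
  assumes l: "N \<le> l + 1" and w: "w \<in> carrier_vec N"
  shows "\<exists>a. homog (int l) a \<and> mul_mat a *\<^sub>v one_vec = w"
proof -
  define B where "B = (\<Sum>j<s. Polynomial.monom (coeff (snd_part w) j) (l - j))"
  define A where "A = B - B mod F + fst_part w"
  have sl: "s \<le> l + 1" "r + s \<le> l + 1" using l r_plus_s by auto
  have B: "coeff B i = (if i \<le> l \<and> l - i < s then coeff (snd_part w) (l - i) else 0)" for i
  proof -
    have "coeff B i = (\<Sum>j<s. if l - j = i then coeff (snd_part w) j else 0)"
      by (simp add: B_def coeff_sum)
    also have "\<dots> = (\<Sum>j<s. if j = l - i \<and> i \<le> l then coeff (snd_part w) j else 0)"
      using sl by (intro sum.cong refl) auto
    finally show ?thesis by (auto simp: sum.delta)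
  qed
  have A: "coeff A i = coeff B i" if "r \<le> i" for i
    using that by (simp add: A_def coeff_mod_F coeff_fst_part)
  define a where "a = homogenize l A"
  have a: "homog (int l) a" by (simp add: a_def homog_homogenize)
  have "dehom_X1 a = A"
    unfolding a_def using sl by (intro dehom_homogenize) (auto simp: A B coeff_snd_part)
  moreover have "A mod F = fst_part w"
    by (simp add: A_def poly_mod_add_left poly_mod_diff_left)
  moreover have "dehom_X0 a mod Y = snd_part w"
  proof -
    have "Y dvd dehom_X0 a - snd_part w"
      unfolding dvd_Y_iff using sl by (auto simp: coeff_dehom_X0[OF a] \<open>dehom_X1 a = A\<close> A B)
    then have "dehom_X0 a mod Y = snd_part w mod Y" by (simp only: mod_eq_dvd_iff)
    then show ?thesis by simp
  qed
  ultimately have "mul_mat a *\<^sub>v one_vec = w"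
    using w by (simp add: mul_mat_one_vec coords_parts)
  with a show ?thesis by blast
qed

end

section \<open>A trace form and the multiplication pencil\<close>

lemma triangular_number_add:
  "(r + s) * (r + s - 1) div 2 = r * (r - 1) div 2 + s * (s - 1) div 2 + r * (s::nat)"
proof (induction s)
  case (Suc s)
  have step: "Suc k * (Suc k - 1) div 2 = k * (k - 1) div 2 + k" for k :: nat
  proof -
    have "Suc k * k = k * (k - 1) + 2 * k" by (cases k) auto
    then show ?thesis by simp
  qed
  show ?case using Suc.IH step[of s] step[of "r + s"] by (simp add: algebra_simps)
qed simp

lemma det_anti_triangular:
  fixes A :: "'a::comm_ring_1 mat"
  assumes "A \<in> carrier_mat n n"
    and "\<And>i j. i + j + 1 < n \<Longrightarrow> A $$ (i, j) = 0"
    and "\<And>i j. i + j + 1 = n \<Longrightarrow> A $$ (i, j) = c"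
  shows "det A = (- 1) ^ (n * (n - 1) div 2) * c ^ n"
  using assms
proof (induction n arbitrary: A)
  case 0
  then show ?case by (simp add: det_dim_zero)
next
  case (Suc n)
  have "det A = (\<Sum>j<Suc n. A $$ (0, j) * cofactor A 0 j)"
    by (rule laplace_expansion_row) (use Suc.prems in auto)
  also have "\<dots> = A $$ (0, n) * cofactor A 0 n"
    using Suc.prems(2)[of 0] by (subst sum.remove[of _ n]) (auto intro!: sum.neutral)
  also have "A $$ (0, n) = c" using Suc.prems(3) by simp
  also have "cofactor A 0 n = (- 1) ^ n * det (mat_delete A 0 n)"
    by (simp add: cofactor_def)
  also have "det (mat_delete A 0 n) = (- 1) ^ (n * (n - 1) div 2) * c ^ n"
    using Suc.prems by (intro Suc.IH) (auto simp: mat_delete_def)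
  also have "c * ((- 1) ^ n * ((- 1) ^ (n * (n - 1) div 2) * c ^ n))
    = (- 1) ^ (n * (n - 1) div 2 + n) * c ^ Suc n"
    by (simp add: power_add)
  also have "n * (n - 1) div 2 + n = Suc n * (Suc n - 1) div 2"
    using triangular_number_add[of n 1] by simp
  finally show ?case .
qed

interpretation const_hom: comm_ring_hom "const :: 'a::field \<Rightarrow> 'a poly poly"
  by unfold_locales (auto simp: const_def one_pCons)

lemma const_eq_0_iff [simp]: "const c = 0 \<longleftrightarrow> c = 0"
  by (simp add: const_def)

lemma X1_nonzero [simp]: "X1 \<noteq> 0" and X0_nonzero [simp]: "X0 \<noteq> 0"
  by (auto simp: X1_def X0_def)

lemma homogenize_eq_sum:
  "homogenize l A = (\<Sum>i\<le>l. const (coeff A i) * X0 ^ i * X1 ^ (l - i))"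
proof (rule homog_eqI[OF homog_homogenize])
  have "homog (0 + int i * 1 + int (l - i) * 1) (const (coeff A i) * X0 ^ i * X1 ^ (l - i))" for i
    by (intro homog_mult homog_power homog_const homog_X0 homog_X1)
  then show "homog (int l) (\<Sum>i\<le>l. const (coeff A i) * X0 ^ i * X1 ^ (l - i))"
    by (intro homog_sum) (metis (no_types, lifting) add_0 atMost_iff le_add_diff_inverse mult.right_neutral of_nat_add)
  show "dehom_X1 (homogenize l A) = dehom_X1 (\<Sum>i\<le>l. const (coeff A i) * X0 ^ i * X1 ^ (l - i))"
    (is "_ = dehom_X1 ?s")
  proof (rule poly_eqI)
    fix k
    have "dehom_X1 ?s = (\<Sum>i\<le>l. Polynomial.monom (coeff A i) i)"
      by (simp add: dehom_X1_def poly_sum const_def X0_def X1_def monom_altdef)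
    then have "coeff (dehom_X1 ?s) k = (if k \<le> l then coeff A k else 0)"
      by (auto simp: coeff_sum sum.delta)
    then show "coeff (dehom_X1 (homogenize l A)) k = coeff (dehom_X1 ?s) k"
      by (auto simp: coeff_dehom_X1[OF homog_homogenize] coeff_homogenize)
  qed
qed

text \<open>
  The homogeneous characteristic polynomial of multiplication by \<open>x\<close> on \<open>k[x]/A\<close>.  The row vector
  \<open>(X\<^sub>0\<^sup>i X\<^sub>1\<^sup>n\<^sup>-\<^sup>1\<^sup>-\<^sup>i)\<^sub>i\<close> annihilates all columns of the matrix except the last, where it
  gives the homogenization of \<open>A / lead_coeff A\<close>.  Substituting this combination of rows for the first
  row multiplies the determinant by \<open>X\<^sub>1\<^sup>n\<^sup>-\<^sup>1\<close> (Cramer), and leaves a triangular minor with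
  \<open>- X\<^sub>1\<close> on its diagonal.
\<close>

lemma det_companion_pencil:
  fixes A :: "'a::field poly"
  defines "n \<equiv> degree A"
  assumes "A \<noteq> 0"
  shows "const (lead_coeff A) *
    det (mat n n (\<lambda>(i, j). (if i = j then X0 else 0)
      - X1 * const (coeff (Polynomial.monom 1 (Suc j) mod A) i))) = homogenize n A"
proof (cases "n = 0")
  case True
  then obtain c where "A = [:c:]" unfolding n_def by (metis degree_eq_zeroE)
  with True show ?thesis
    by (simp add: det_dim_zero homogenize_def const_def Polynomial.monom_0)
next
  case False
  define l where "l = lead_coeff A"
  have l0: "l \<noteq> 0" using assms by (simp add: l_def)
  let ?M = "mat n n (\<lambda>(i, j). (if i = j then X0 else 0)
      - X1 * const (coeff (Polynomial.monom 1 (Suc j) mod A) i))"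
  let ?w = "\<lambda>i. X0 ^ i * X1 ^ (n - 1 - i) :: 'a poly poly"
  have rem: "coeff (Polynomial.monom 1 (Suc j) mod A) i =
      (if Suc j = n then - coeff A i / l else if i = Suc j then 1 else 0)"
    if "i < n" "j < n" for i j
  proof (cases "Suc j = n")
    case True
    have "Polynomial.monom 1 n - Polynomial.smult (1 / l) A = Polynomial.monom 1 n mod A"
    proof -
      let ?R = "Polynomial.monom 1 n - Polynomial.smult (1 / l) A"
      have "coeff ?R k = 0" if "n \<le> k" for k
        using that l0 by (cases "k = n") (auto simp: l_def n_def coeff_eq_0)
      then have "?R mod A = ?R"
        by (metis mod_poly_less mod_0 leading_coeff_0_iff linorder_not_le n_def)
      moreover have "?R mod A = Polynomial.monom 1 n mod A"
        by (simp add: poly_mod_diff_left mod_smult_left)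
      ultimately show ?thesis by simp
    qed
    then have "coeff (Polynomial.monom 1 n mod A) i = coeff (Polynomial.monom 1 n - Polynomial.smult (1 / l) A) i"
      by simp
    with True that show ?thesis by simp
  next
    case False
    then have "Polynomial.monom 1 (Suc j) mod A = Polynomial.monom 1 (Suc j)"
      using that by (intro mod_poly_less) (auto simp: degree_monom_eq n_def)
    with False show ?thesis by auto
  qed
  define R where "R = replace_col ?M\<^sup>T (?M\<^sup>T *\<^sub>v vec n ?w) 0"
  have R: "R \<in> carrier_mat n n" by (simp add: R_def replace_col_def)
  have h: "(\<Sum>i<n. ?M $$ (i, j) * ?w i) = (if Suc j = n then const (1 / l) * homogenize n A else 0)"
    if j: "j < n" for j
  proof -
    have "(\<Sum>i<n. ?M $$ (i, j) * ?w i)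
      = X0 * ?w j - X1 * (\<Sum>i<n. const (coeff (Polynomial.monom 1 (Suc j) mod A) i) * ?w i)"
      using j by (simp add: left_diff_distrib sum_subtractf sum_distrib_left mult.assoc
        if_distribR if_distrib[of "\<lambda>x. x * _"] sum.delta cong: if_cong)
    also have "\<dots> = (if Suc j = n then const (1 / l) * homogenize n A else 0)"
    proof (cases "Suc j = n")
      case True
      have "homogenize n A = (\<Sum>i<n. const (coeff A i) * X0 ^ i * X1 ^ (n - i)) + const l * X0 ^ n"
        by (simp add: homogenize_eq_sum lessThan_Suc_atMost[symmetric] l_def n_def)
      also have "const (1 / l) * \<dots> = X0 ^ n + (\<Sum>i<n. const (coeff A i / l) * X0 ^ i * X1 ^ (n - i))"
      proof -
        have "const (1 / l) * const l = 1"
          using l0 by (simp flip: const_hom.hom_mult)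
        moreover have "const (1 / l) * (\<Sum>i<n. const (coeff A i) * X0 ^ i * X1 ^ (n - i))
          = (\<Sum>i<n. const (coeff A i / l) * X0 ^ i * X1 ^ (n - i))"
          by (simp add: sum_distrib_left mult.assoc[symmetric] flip: const_hom.hom_mult)
        ultimately show ?thesis
          by (simp add: distrib_left mult.assoc[symmetric] add.commute)
      qed
      finally have e: "const (1 / l) * homogenize n A
        = X0 ^ n + (\<Sum>i<n. const (coeff A i / l) * X0 ^ i * X1 ^ (n - i))" .
      have "X1 * (\<Sum>i<n. const (coeff (Polynomial.monom 1 (Suc j) mod A) i) * ?w i)
        = - (\<Sum>i<n. const (coeff A i / l) * X0 ^ i * X1 ^ (n - i))"
        unfolding sum_distrib_left sum_negf[symmetric]
      proof (intro sum.cong refl)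
        fix i assume "i \<in> {..<n}"
        then have i: "i < n" by simp
        then have "X1 ^ (n - i) = X1 * (X1 ^ (n - 1 - i) :: 'a poly poly)"
          by (metis Suc_diff_Suc diff_Suc_1 diff_diff_left plus_1_eq_Suc power_Suc add.commute Suc_eq_plus1)
        then show "X1 * (const (coeff (Polynomial.monom 1 (Suc j) mod A) i) * ?w i)
          = - (const (coeff A i / l) * X0 ^ i * X1 ^ (n - i))"
          using rem[OF i j] True by (simp add: const_hom.hom_uminus ac_simps)
      qed
      moreover have "X0 * ?w j = X0 ^ n" using True by (auto simp flip: power_Suc)
      ultimately show ?thesis using True e by simp
    next
      case False
      then have "(\<Sum>i<n. const (coeff (Polynomial.monom 1 (Suc j) mod A) i) * ?w i)
        = (\<Sum>i<n. if i = Suc j then ?w i else 0)"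
        using j by (intro sum.cong refl) (auto simp: rem)
      also have "\<dots> = ?w (Suc j)" using False j by (simp add: sum.delta)
      finally have "(\<Sum>i<n. const (coeff (Polynomial.monom 1 (Suc j) mod A) i) * ?w i) = ?w (Suc j)" .
      moreover have "(X1 :: 'a poly poly) ^ (n - 1 - j) = X1 * X1 ^ (n - 1 - Suc j)"
      proof -
        have "n - 1 - j = Suc (n - 1 - Suc j)" using False j by simp
        then show ?thesis by (simp only: power_Suc)
      qed
      ultimately show ?thesis using False by (simp only: power_Suc if_False) simp
    qed
    finally show ?thesis .
  qed
  have R0: "R $$ (j, 0) = (if Suc j = n then const (1 / l) * homogenize n A else 0)" if "j < n" for j
    using h[OF that] that False
    by (simp add: R_def replace_col_def scalar_prod_def atLeast0LessThan)
  have RS: "R $$ (i, j) = ?M $$ (j, i)" if "i < n" "j < n" "0 < j" for i j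
    using that by (simp add: R_def replace_col_def)
  have "det R = (\<Sum>i<n. R $$ (i, 0) * cofactor R i 0)"
    by (rule laplace_expansion_column[OF R]) (use False in simp)
  also have "\<dots> = R $$ (n - 1, 0) * cofactor R (n - 1) 0"
    using False R0 by (subst sum.remove[of _ "n - 1"]) (auto intro!: sum.neutral split: if_splits)
  also have "cofactor R (n - 1) 0 = (- 1) ^ (n - 1) * det (mat_delete R (n - 1) 0)"
    by (simp add: cofactor_def)
  also have "det (mat_delete R (n - 1) 0) = (- X1) ^ (n - 1)"
  proof -
    let ?D = "mat_delete R (n - 1) 0"
    have D: "?D \<in> carrier_mat (n - 1) (n - 1)" using R by (simp add: mat_delete_def)
    have ent: "?D $$ (i, j) = (if i = Suc j then X0 else 0) - (if i = j then X1 else 0)"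
      if "i < n - 1" "j < n - 1" for i j
      using that R RS[of i "Suc j"] by (auto simp: mat_delete_def rem)
    have "det ?D = prod_list (diag_mat ?D)"
      by (rule det_lower_triangular[OF _ D]) (use ent in auto)
    also have "diag_mat ?D = map (\<lambda>_. - X1) [0..<n - 1]"
      using D ent by (auto simp: diag_mat_def)
    finally show ?thesis by (simp add: map_replicate_const prod_list_replicate)
  qed
  also have "R $$ (n - 1, 0) * ((- 1) ^ (n - 1) * (- X1) ^ (n - 1))
    = X1 ^ (n - 1) * (const (1 / l) * homogenize n A)"
    using False R0[of "n - 1"] by (simp add: power_mult_distrib[symmetric])
  finally have "det R = X1 ^ (n - 1) * (const (1 / l) * homogenize n A)" .
  moreover have "det R = X1 ^ (n - 1) * det ?M"
    unfolding R_def using False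
    by (subst cramer_lemma_mat[of _ n]) (auto simp: det_transpose[of _ n])
  ultimately have "det ?M = const (1 / l) * homogenize n A" by simp
  then show ?thesis using l0
    by (simp add: l_def[symmetric] mult.assoc[symmetric] flip: const_hom.hom_mult)
qed

context binary_form
begin

text \<open>
  A linear form on the algebra whose associated bilinear form is perfect: the top coefficient on each
  factor.  The second summand is scaled by a sign so that the discriminant of the resulting pair
  carries the uniform sign \<open>(- 1)\<^sup>N\<^sup>(\<^sup>N\<^sup>-\<^sup>1\<^sup>)\<^sup>/\<^sup>2\<close>, whatever the multiplicity \<open>s\<close> is.
\<close>

definition gram_sign :: 'a where "gram_sign = - ((- 1) ^ r)"

definition trace_pairing :: "'a vec \<Rightarrow> 'a vec \<Rightarrow> 'a" where
  "trace_pairing v w = coeff (fst_part v * fst_part w mod F) (r - 1)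
     + gram_sign * coeff (snd_part v * snd_part w mod Y) (s - 1)"

definition gram :: "'a mat" where
  "gram = mat N N (\<lambda>(i, j). trace_pairing (unit_vec N i) (unit_vec N j))"

lemma gram_carrier [simp]: "gram \<in> carrier_mat N N"
  by (simp add: gram_def)

lemmas mat_dims [simp] = carrier_matD[OF gram_carrier] carrier_matD[OF mul_mat_carrier]

lemma trace_pairing_commute: "trace_pairing v w = trace_pairing w v"
  by (simp add: trace_pairing_def mult.commute)

lemma trace_pairing_mul_vec: "trace_pairing v (mul_vec a w) = trace_pairing w (mul_vec a v)"
  by (simp add: trace_pairing_def mul_vec_def mod_mult_right_eq ac_simps)

lemma gram_mult_vec:
  assumes "w \<in> carrier_vec N"
  shows "gram *\<^sub>v w = vec N (\<lambda>i. trace_pairing (unit_vec N i) w)"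
proof -
  let ?G = "\<lambda>w. vec N (\<lambda>i. trace_pairing (unit_vec N i) w)"
  have "gram = mat N N (\<lambda>(i, j). ?G (unit_vec N j) $ i)"
    by (auto simp: gram_def intro!: eq_matI)
  moreover have "\<dots> *\<^sub>v w = ?G w"
    by (rule mat_of_linear_map[OF _ _ _ assms])
      (auto intro!: eq_vecI simp: trace_pairing_def fst_part_linear snd_part_linear
        distrib_left poly_mod_add_left mod_smult_left algebra_simps)
  ultimately show ?thesis by simp
qed

lemma gram_symmetric: "gram\<^sup>T = gram"
  by (auto simp: gram_def trace_pairing_commute intro!: eq_matI)

text \<open>
  Multiplication is self-adjoint for the pairing \<open>(v, w) \<mapsto> \<tau>(v w)\<close>, since \<open>\<tau>(v a w)\<close> is symmetric
  in \<open>v\<close> and \<open>w\<close>.  This is the source of all symmetric matrices below.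
\<close>

lemma gram_mul_mat_symmetric: "(gram * mul_mat a)\<^sup>T = gram * mul_mat a"
proof -
  have ent: "(gram * mul_mat a) $$ (i, j) = trace_pairing (unit_vec N i) (mul_vec a (unit_vec N j))"
    if "i < N" "j < N" for i j
  proof -
    have "col (gram * mul_mat a) j = gram * mul_mat a *\<^sub>v unit_vec N j"
      using that by (subst mult_unit_vec_eq_col[of _ N N]) (auto intro!: mult_carrier_mat[of _ N N])
    also have "\<dots> = gram *\<^sub>v mul_vec a (unit_vec N j)"
      by (simp add: assoc_mult_mat_vec[of _ N N _ N] mul_mat_vec)
    also have "\<dots> = vec N (\<lambda>i. trace_pairing (unit_vec N i) (mul_vec a (unit_vec N j)))"
      by (simp add: gram_mult_vec)
    finally show ?thesis using that
      by (metis carrier_matD(1) carrier_matD(2) gram_carrier index_col index_mult_mat(2,3) index_vec mul_mat_carrier)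
  qed
  show ?thesis
    by (intro eq_matI) (auto simp: ent trace_pairing_mul_vec simp del: index_mult_mat(1))
qed

lemma fst_part_unit_vec:
  "j < N \<Longrightarrow> fst_part (unit_vec N j) = (if j < r then Polynomial.monom 1 j else 0)"
  using r_plus_s by (auto intro!: poly_eqI simp: coeff_fst_part)

lemma snd_part_unit_vec:
  "j < N \<Longrightarrow> snd_part (unit_vec N j) = (if j < r then 0 else Polynomial.monom 1 (j - r))"
  using r_plus_s by (auto intro!: poly_eqI simp: coeff_snd_part)

lemma coeff_monom_mod_Y: "k < s \<Longrightarrow> coeff (Polynomial.monom 1 i mod Y) k = (if i = k then 1 else 0)"
proof (cases "i < s")
  case True
  then show ?thesis by (subst mod_Y_idem) auto
next
  case False
  then have "Y dvd Polynomial.monom 1 i" by (auto simp: dvd_Y_iff)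
  with False show "k < s \<Longrightarrow> ?thesis" by (simp add: dvd_eq_mod_eq_0)
qed

lemma block_diagonal_eq:
  assumes "A \<in> carrier_mat N N"
    and "\<And>i j. i < r \<Longrightarrow> j < r \<Longrightarrow> A $$ (i, j) = B (i, j)"
    and "\<And>i j. i < s \<Longrightarrow> j < s \<Longrightarrow> A $$ (r + i, r + j) = D (i, j)"
    and "\<And>i j. i < r \<Longrightarrow> r \<le> j \<Longrightarrow> j < N \<Longrightarrow> A $$ (i, j) = 0"
    and "\<And>i j. r \<le> i \<Longrightarrow> i < N \<Longrightarrow> j < r \<Longrightarrow> A $$ (i, j) = 0"
  shows "A = four_block_mat (mat r r B) (0\<^sub>m r s) (0\<^sub>m s r) (mat s s D)"
proof (rule eq_matI)
  fix i j
  assume "i < dim_row (four_block_mat (mat r r B) (0\<^sub>m r s) (0\<^sub>m s r) (mat s s D))"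
    "j < dim_col (four_block_mat (mat r r B) (0\<^sub>m r s) (0\<^sub>m s r) (mat s s D))"
  then have ij: "i < N" "j < N" using r_plus_s by auto
  then show "A $$ (i, j) = four_block_mat (mat r r B) (0\<^sub>m r s) (0\<^sub>m s r) (mat s s D) $$ (i, j)"
    using assms(2)[of i j] assms(3)[of "i - r" "j - r"] assms(4,5)[of i j] r_plus_s by auto
qed (use assms(1) r_plus_s in auto)

text \<open>
  On either factor the Gram matrix in the power basis is zero above the antidiagonal and constant on it,
  because \<open>x\<^sup>i x\<^sup>j\<close> has no top coefficient before \<open>i + j\<close> reaches the top degree.
\<close>

lemma det_gram: "det gram = (- 1) ^ (r * (r - 1) div 2) * ((- 1) ^ (s * (s - 1) div 2) * gram_sign ^ s)"
proof -
  let ?B = "\<lambda>(i, j). coeff (Polynomial.monom 1 (i + j) mod F) (r - 1)"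
  let ?D = "\<lambda>(i, j). if i + j + 1 = s then gram_sign else 0"
  have "gram = four_block_mat (mat r r ?B) (0\<^sub>m r s) (0\<^sub>m s r) (mat s s ?D)"
    by (rule block_diagonal_eq[OF gram_carrier])
      (use r_plus_s in \<open>auto simp: gram_def trace_pairing_def fst_part_unit_vec snd_part_unit_vec
         mult_monom coeff_monom_mod_Y\<close>)
  then have "det gram = det (mat r r ?B) * det (mat s s ?D)"
    by (simp add: det_four_block_mat_lower_left_zero[of _ r _ s])
  also have "det (mat r r ?B) = (- 1) ^ (r * (r - 1) div 2) * 1 ^ r"
  proof (rule det_anti_triangular)
    fix i j
    have m: "Polynomial.monom 1 (i + j) mod F = Polynomial.monom 1 (i + j)" if "i + j < r"
      using that by (intro mod_F_idem) auto
    show "i + j + 1 < r \<Longrightarrow> mat r r ?B $$ (i, j) = 0" using m by auto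
    show "i + j + 1 = r \<Longrightarrow> mat r r ?B $$ (i, j) = 1" using m by auto
  qed auto
  also have "det (mat s s ?D) = (- 1) ^ (s * (s - 1) div 2) * gram_sign ^ s"
    by (rule det_anti_triangular) auto
  finally show ?thesis by simp
qed

lemma gram_sign_nonzero: "gram_sign \<noteq> 0"
  by (simp add: gram_sign_def)

lemma det_gram_nonzero: "det gram \<noteq> 0"
  by (simp add: det_gram gram_sign_nonzero)

lemma f_eq_homogenize: "f = homogenize r F * X1 ^ s"
proof (rule homog_eqI[OF homog_f])
  show "homog (int N) (homogenize r F * X1 ^ s)"
    using homog_mult[OF homog_homogenize[of r F] homog_power[OF homog_X1, of s]] r_plus_s
    by (metis mult.right_neutral of_nat_add)
  have "dehom_X1 (homogenize r F) = F"
    by (rule dehom_homogenize) (simp add: r_def coeff_eq_0)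
  moreover have "dehom_X1 (X1 ^ k) = (1 :: 'a poly)" for k
    by (induction k) auto
  ultimately show "dehom_X1 f = dehom_X1 (homogenize r F * X1 ^ s)"
    by (simp add: F_def)
qed

text \<open>
  The two products \<open>X\<^sub>0 \<cdot> (X\<^sub>1 v)\<close> and \<open>X\<^sub>1 \<cdot> (X\<^sub>0 v)\<close> agree on the subscheme.  This pencil is the universal
  relation of this kind: it is \<open>X\<^sub>0 - X\<^sub>1 x\<close> on the first factor and \<open>X\<^sub>0 y - X\<^sub>1\<close> on the second, and its
  cokernel is the structure sheaf of the subscheme.
\<close>

definition mult_pencil :: "'a poly poly mat" where
  "mult_pencil = X0 \<cdot>\<^sub>m map_mat const (mul_mat X1) - X1 \<cdot>\<^sub>m map_mat const (mul_mat X0)"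

lemma mult_pencil_carrier [simp]: "mult_pencil \<in> carrier_mat N N"
  unfolding mult_pencil_def by (intro minus_carrier_mat smult_carrier_mat map_carrier_mat) auto

lemma det_mult_pencil: "const (lead_coeff F) * det mult_pencil = (- 1) ^ s * f"
proof -
  let ?B = "\<lambda>(i, j). (if i = j then X0 else 0) - X1 * const (coeff (Polynomial.monom 1 (Suc j) mod F) i)"
  let ?D = "\<lambda>(i, j). (if i = Suc j then X0 else 0) - (if i = j then X1 else 0)"
  have "mult_pencil = four_block_mat (mat r r ?B) (0\<^sub>m r s) (0\<^sub>m s r) (mat s s ?D)"
    by (rule block_diagonal_eq[OF mult_pencil_carrier])
      (use r_plus_s in \<open>auto simp: mult_pencil_def mul_mat_def mul_vec_def coords_def
         fst_part_unit_vec snd_part_unit_vec coeff_fst_part coeff_snd_part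
         mod_F_idem mod_Y_idem coeff_monom_mod_Y
         monom_Suc[symmetric] coeff_mod_F\<close>)
  then have "det mult_pencil = det (mat r r ?B) * det (mat s s ?D)"
    by (simp add: det_four_block_mat_lower_left_zero[of _ r _ s])
  also have "det (mat s s ?D) = (- X1) ^ s"
  proof -
    have "det (mat s s ?D) = prod_list (diag_mat (mat s s ?D))"
      by (rule det_lower_triangular[of s]) auto
    also have "diag_mat (mat s s ?D) = map (\<lambda>_. - X1) [0..<s]"
      by (auto simp: diag_mat_def)
    finally show ?thesis by (simp add: map_replicate_const prod_list_replicate)
  qed
  finally have "const (lead_coeff F) * det mult_pencil
    = (const (lead_coeff F) * det (mat r r ?B)) * (- X1) ^ s" by (simp add: mult.assoc)
  also have "const (lead_coeff F) * det (mat r r ?B) = homogenize r F"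
    using det_companion_pencil[OF F_nonzero] by (simp add: r_def)
  also have "homogenize r F * (- X1) ^ s = (- 1) ^ s * (homogenize r F * X1 ^ s)"
    by (simp add: power_minus[of X1])
  also have "\<dots> = (- 1) ^ s * f"
    by (simp only: f_eq_homogenize[symmetric])
  finally show ?thesis .
qed

text \<open>
  The sign in \<open>gram_sign\<close> is chosen for this identity: with \<open>N = r + s\<close>, the triangular numbers of
  \<open>r\<close> and \<open>s\<close> together with \<open>r s\<close> add up to that of \<open>N\<close>.
\<close>

lemma det_gram_mult_pencil:
  "const (lead_coeff F) * (const (det gram) * det mult_pencil) = const ((- 1) ^ (N * (N - 1) div 2)) * f"
proof -
  have "const (lead_coeff F) * (const (det gram) * det mult_pencil)
    = const (det gram) * (const (lead_coeff F) * det mult_pencil)"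
    by (simp add: ac_simps)
  also have "\<dots> = const (det gram * (- 1) ^ s) * f"
    unfolding det_mult_pencil by (simp add: const_hom.hom_mult const_hom.hom_power const_hom.hom_uminus)
  also have "det gram * (- 1) ^ s = (- 1) ^ (N * (N - 1) div 2)"
  proof -
    have "gram_sign ^ s * (- 1) ^ s = (- 1) ^ (r * s)"
      by (simp add: gram_sign_def power_mult_distrib[symmetric] power_mult)
    then have "det gram * (- 1) ^ s = (- 1) ^ (r * (r - 1) div 2 + s * (s - 1) div 2 + r * s)"
      by (simp add: det_gram power_add mult.assoc)
    then show ?thesis using triangular_number_add[of r s] r_plus_s by simp
  qed
  finally show ?thesis .
qed

end

section \<open>Change of variables in a pair of matrices\<close>

lemma ex_inverse_mat:
  fixes A :: "'a::field mat"
  assumes A: "A \<in> carrier_mat n n" and "det A \<noteq> 0"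
  obtains B where "B \<in> carrier_mat n n" "A * B = 1\<^sub>m n" "B * A = 1\<^sub>m n" "det B = inverse (det A)"
proof -
  obtain B where B: "B \<in> carrier_mat n n" "A * B = 1\<^sub>m n" "B * A = 1\<^sub>m n"
    using det_non_zero_imp_unit[OF assms] unfolding Units_def ring_mat_simps by auto
  then have "det A * det B = 1" using A by (metis det_mult det_one)
  with B that \<open>det A \<noteq> 0\<close> show ?thesis by (metis inverse_unique)
qed

lemma homog_Suc_split:
  assumes "homog (int (Suc l)) a"
  obtains a0 a1 where "homog (int l) a0" "homog (int l) a1" "a = X0 * a0 + X1 * a1"
proof -
  obtain p b where a: "a = pCons p b" by (cases a)
  obtain c q where p: "p = pCons c q" by (cases p)
  have co: "coeff (coeff a j) i = 0" if "i + j \<noteq> Suc l" for i j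
    using homogD[OF assms that] .
  have "c = 0" using co[of 0 0] by (simp add: a p)
  then have "a = X0 * [:q:] + X1 * b"
    by (simp add: a p X0_def X1_def)
  moreover have "homog (int l) [:q:]"
    unfolding homog_def
  proof (intro allI impI)
    fix i j assume nz: "coeff (coeff [:q:] j) i \<noteq> 0"
    then have "j = 0" by (cases j) auto
    with nz co[of "Suc i" 0] show "int i + int j = int l" by (auto simp: a p)
  qed
  moreover have "homog (int l) b"
    unfolding homog_def
  proof (intro allI impI)
    fix i j assume nz: "coeff (coeff b j) i \<noteq> 0"
    with co[of i "Suc j"] have "i + j = l" by (auto simp: a)
    then show "int i + int j = int l" by simp
  qed
  ultimately show ?thesis using that by blast
qed

lemma homog_0_const:
  assumes "homog 0 a"
  obtains c where "a = const c"
proof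
  show "a = const (coeff (coeff a 0) 0)"
    using homogD[of 0 a] assms
    by (intro poly_eqI) (auto simp: const_def coeff_pCons split: nat.splits)
qed

lemma pencil_SL_act:
  assumes M: "fst M \<in> carrier_mat n n" "snd M \<in> carrier_mat n n" and P: "P \<in> carrier_mat n n"
  shows "pencil (SL_act P M) = (map_mat const P)\<^sup>T * pencil M * map_mat const P"
proof -
  let ?c = "map_mat const"
  have car: "?c A \<in> carrier_mat n n" if "A \<in> carrier_mat n n" for A using that by auto
  have m: "?c (P\<^sup>T * A * P) = (?c P)\<^sup>T * ?c A * ?c P" if "A \<in> carrier_mat n n" for A
    using that P by (simp add: const_hom.mat_hom_mult[of _ n n _ n] mult_carrier_mat[of _ n n] map_mat_transpose)
  have "(?c P)\<^sup>T * pencil M * ?c P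
    = X0 \<cdot>\<^sub>m ((?c P)\<^sup>T * ?c (fst M) * ?c P) + X1 \<cdot>\<^sub>m ((?c P)\<^sup>T * ?c (snd M) * ?c P)"
    using car[OF M(1)] car[OF M(2)] car[OF P]
    by (simp add: pencil_def mult_add_distrib_mat[of _ n n _ n] add_mult_distrib_mat[of _ n n _ _ n]
      mult_smult_distrib[of _ n n _ n] mult_smult_assoc_mat[of _ n n _ n] mult_carrier_mat[of _ n n])
  then show ?thesis by (simp add: pencil_def SL_act_def m M)
qed

lemma disc_SL_act:
  assumes M: "fst M \<in> carrier_mat n n" "snd M \<in> carrier_mat n n" and P: "P \<in> carrier_mat n n"
  shows "disc (SL_act P M) = const ((det P)\<^sup>2) * disc M"
proof -
  have c: "map_mat const P \<in> carrier_mat n n" "pencil M \<in> carrier_mat n n"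
    using assms by (auto simp: pencil_def)
  show ?thesis
    unfolding disc_def pencil_SL_act[OF assms] using c
    by (simp add: det_mult[of _ n] mult_carrier_mat[of _ n n] det_transpose[of _ n] const_hom.hom_det
      power2_eq_square const_hom.hom_mult ac_simps)
qed

lemma SL_act_SL_act:
  assumes M: "fst M \<in> carrier_mat n n" "snd M \<in> carrier_mat n n"
    and P: "P \<in> carrier_mat n n" "Q \<in> carrier_mat n n"
  shows "SL_act Q (SL_act P M) = SL_act (P * Q) M"
  using assms
  by (simp add: SL_act_def transpose_mult[of _ n n _ n] assoc_mult_mat[of _ n n _ n _ n] mult_carrier_mat[of _ n n])

lemma SL_act_one:
  assumes M: "fst M \<in> carrier_mat n n" "snd M \<in> carrier_mat n n"
  shows "SL_act (1\<^sub>m n) M = M"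
  using assms by (simp add: SL_act_def)

lemma SL_act_carrier:
  assumes M: "fst M \<in> carrier_mat n n" "snd M \<in> carrier_mat n n" and "P \<in> carrier_mat n n"
  shows "fst (SL_act P M) \<in> carrier_mat n n" "snd (SL_act P M) \<in> carrier_mat n n"
  using assms by (auto simp: SL_act_def mult_carrier_mat[of _ n n])

context binary_form
begin

text \<open>
  The matrices that commute with multiplication by \<open>X\<^sub>0\<close> and \<open>X\<^sub>1\<close> form a copy of the algebra
  \<open>k[x]/F \<times> k[y]/Y\<close>, acting on itself by multiplication.
\<close>

section \<open>The commutant of multiplication\<close>

definition mult_algebra :: "'a mat set" where
  "mult_algebra = {Z \<in> carrier_mat N N.
     Z * mul_mat X0 = mul_mat X0 * Z \<and> Z * mul_mat X1 = mul_mat X1 * Z}"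

lemma mult_algebra_carrier: "Z \<in> mult_algebra \<Longrightarrow> Z \<in> carrier_mat N N"
  by (simp add: mult_algebra_def)

lemmas mat_assoc = assoc_mult_mat[of _ N N _ N _ N]
lemmas mat_closed = mult_carrier_mat[of _ N N]
lemmas mat_distrib = mult_add_distrib_mat[of _ N N _ N] add_mult_distrib_mat[of _ N N _ _ N]

lemma mul_mat_commute: "mul_mat a * mul_mat b = mul_mat b * mul_mat a"
  by (metis mul_mat_mult mult.commute)

lemma mul_mat_in_algebra [simp]: "mul_mat a \<in> mult_algebra"
  by (simp add: mult_algebra_def mul_mat_commute)

lemma mult_algebra_commute_mul_mat:
  assumes Z: "Z \<in> mult_algebra"
  shows "Z * mul_mat b = mul_mat b * Z"
proof -
  have Zc: "Z \<in> carrier_mat N N" and Z0: "Z * mul_mat X0 = mul_mat X0 * Z"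
    and Z1: "Z * mul_mat X1 = mul_mat X1 * Z"
    using Z by (auto simp: mult_algebra_def)
  have step: "Z * mul_mat (c + x * b) = mul_mat (c + x * b) * Z"
    if "Z * mul_mat c = mul_mat c * Z" "Z * mul_mat x = mul_mat x * Z" "Z * mul_mat b = mul_mat b * Z"
    for c x b
  proof -
    have "Z * (mul_mat x * mul_mat b) = mul_mat x * mul_mat b * Z"
      using Zc that(2,3) by (metis mat_assoc mul_mat_carrier)
    then show ?thesis
      using Zc that(1) by (simp add: mul_mat_add mul_mat_mult mat_distrib mat_closed)
  qed
  have c: "Z * mul_mat (const c) = mul_mat (const c) * Z" for c
    using Zc by (simp add: mul_mat_const mult_smult_distrib[of _ N N _ N] mult_smult_assoc_mat[of _ N N _ N])
  have p: "Z * mul_mat [:p:] = mul_mat [:p:] * Z" for p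
  proof (induction p)
    case 0
    show ?case using c[of 0] by (simp add: const_def)
  next
    case (pCons a p)
    have "[:pCons a p:] = const a + X0 * [:p:]" by (simp add: const_def X0_def)
    then show ?case using step[OF c Z0 pCons.IH] by simp
  qed
  show ?thesis
  proof (induction b)
    case 0
    show ?case using c[of 0] by (simp add: const_def)
  next
    case (pCons q b)
    have "pCons q b = [:q:] + X1 * b" by (simp add: X1_def)
    then show ?case using step[OF p Z1 pCons.IH] by simp
  qed
qed

text \<open>
  An endomorphism that commutes with all multiplications is determined by its value at \<open>1\<close>, and this
  value is the restriction of a form of any degree \<open>l \<ge> N - 1\<close>.
\<close>

lemma mult_algebra_eq_mul_mat:
  assumes Z: "Z \<in> mult_algebra" and l: "N \<le> l + 1"
  obtains a where "homog (int l) a" "Z = mul_mat a"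
proof -
  have Zc: "Z \<in> carrier_mat N N" using Z by (rule mult_algebra_carrier)
  have "Z *\<^sub>v one_vec \<in> carrier_vec N" using Zc by (intro mult_mat_vec_carrier[of _ N N]) auto
  from homog_of_one_vec[OF l this]
  obtain a where a: "homog (int l) a" "mul_mat a *\<^sub>v one_vec = Z *\<^sub>v one_vec" by blast
  have "Z = mul_mat a"
  proof (rule mat_eq_if_action_eq[OF Zc mul_mat_carrier])
    fix w :: "'a vec" assume "w \<in> carrier_vec N"
    from homog_of_one_vec[OF l this] obtain b where b: "w = mul_mat b *\<^sub>v one_vec" by blast
    have "Z *\<^sub>v w = mul_mat b * Z *\<^sub>v one_vec"
      using Zc by (simp add: b assoc_mult_mat_vec[of _ N N _ N, symmetric] mult_algebra_commute_mul_mat[OF Z])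
    also have "\<dots> = mul_mat b * mul_mat a *\<^sub>v one_vec"
      using Zc a(2) by (simp add: assoc_mult_mat_vec[of _ N N _ N])
    also have "\<dots> = mul_mat a *\<^sub>v w"
      unfolding mul_mat_commute[of b] by (simp add: b assoc_mult_mat_vec[of _ N N _ N])
    finally show "Z *\<^sub>v w = mul_mat a *\<^sub>v w" .
  qed
  with a(1) that show ?thesis by blast
qed

lemma mult_algebra_commute: "Z \<in> mult_algebra \<Longrightarrow> W \<in> mult_algebra \<Longrightarrow> Z * W = W * Z"
  by (metis mult_algebra_commute_mul_mat mult_algebra_eq_mul_mat le_add1)

lemma mult_algebra_mult:
  assumes "Z \<in> mult_algebra" "W \<in> mult_algebra"
  shows "Z * W \<in> mult_algebra"
  using mult_algebra_eq_mul_mat[OF assms(1) le_add1] mult_algebra_eq_mul_mat[OF assms(2) le_add1]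
  by (metis mul_mat_mult mul_mat_in_algebra)

lemma mult_algebra_add:
  assumes "Z \<in> mult_algebra" "W \<in> mult_algebra"
  shows "Z + W \<in> mult_algebra"
  using mult_algebra_eq_mul_mat[OF assms(1) le_add1] mult_algebra_eq_mul_mat[OF assms(2) le_add1]
  by (metis mul_mat_add mul_mat_in_algebra)

lemma mult_algebra_one: "1\<^sub>m N \<in> mult_algebra"
  by (simp add: mult_algebra_def)

lemma mult_algebra_smult: "Z \<in> mult_algebra \<Longrightarrow> c \<cdot>\<^sub>m Z \<in> mult_algebra"
  by (auto simp: mult_algebra_def mult_smult_distrib[of _ N N _ N] mult_smult_assoc_mat[of _ N N _ N])

lemma mult_algebra_zero: "0\<^sub>m N N \<in> mult_algebra"
  by (simp add: mult_algebra_def)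

lemma mult_algebra_inverse:
  assumes Z: "Z \<in> mult_algebra" and W: "W \<in> carrier_mat N N" "Z * W = 1\<^sub>m N" "W * Z = 1\<^sub>m N"
  shows "W \<in> mult_algebra"
proof -
  have "W * mul_mat a = mul_mat a * W" for a
  proof -
    have "W * mul_mat a = W * mul_mat a * (Z * W)"
      using W by (simp add: mat_closed)
    also have "\<dots> = W * (mul_mat a * Z) * W"
      using W(1) mult_algebra_carrier[OF Z] by (simp add: mat_assoc mat_closed)
    also have "\<dots> = (W * Z) * (mul_mat a * W)"
      using W(1) mult_algebra_carrier[OF Z]
      by (simp add: mat_assoc mat_closed mult_algebra_commute_mul_mat[OF Z, symmetric])
    also have "\<dots> = mul_mat a * W" using W by (simp add: mat_closed)
    finally show ?thesis .
  qed
  with W show ?thesis by (simp add: mult_algebra_def)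
qed

lemma mult_algebra_eqI:
  assumes "Z \<in> mult_algebra" "W \<in> mult_algebra" "Z *\<^sub>v one_vec = W *\<^sub>v one_vec"
  shows "Z = W"
proof (rule mat_eq_if_action_eq)
  fix v :: "'a vec" assume "v \<in> carrier_vec N"
  then obtain b where b: "v = mul_mat b *\<^sub>v one_vec"
    using homog_of_one_vec[of N v] by auto
  have "Z *\<^sub>v v = mul_mat b *\<^sub>v (Z *\<^sub>v one_vec)" if "Z \<in> mult_algebra" for Z
    using that mult_algebra_carrier[OF that]
    by (simp add: b assoc_mult_mat_vec[of _ N N _ N, symmetric] mult_algebra_commute_mul_mat)
  then show "Z *\<^sub>v v = W *\<^sub>v v" using assms by metis
qed (use assms mult_algebra_carrier in auto)

lemma ex_mult_algebra_of_vec: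
  assumes "w \<in> carrier_vec N"
  obtains Z where "Z \<in> mult_algebra" "Z *\<^sub>v one_vec = w"
  using homog_of_one_vec[of N w] assms mul_mat_in_algebra by (metis le_add1)

text \<open>
  The coordinates \<open>X\<^sub>0\<close> and \<open>X\<^sub>1\<close> have no common zero: the function \<open>1\<close> is the restriction of a form of
  positive degree, and such a form lies in the ideal generated by \<open>X\<^sub>0\<close> and \<open>X\<^sub>1\<close>.
\<close>

lemma unimodular:
  obtains y0 y1 where "mul_mat y0 * mul_mat X0 + mul_mat y1 * mul_mat X1 = 1\<^sub>m N"
proof -
  obtain a where a: "homog (int (Suc N)) a" "1\<^sub>m N = mul_mat a"
    using mult_algebra_eq_mul_mat[OF mult_algebra_one, of "Suc N"] by auto
  obtain y0 y1 where "a = X0 * y0 + X1 * y1" using homog_Suc_split[OF a(1)] by blast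
  with a that show ?thesis by (metis mul_mat_add mul_mat_mult mult.commute)
qed

lemma cancel_X0_X1:
  assumes B: "B \<in> carrier_mat N N" "B' \<in> carrier_mat N N"
    and "B * mul_mat X0 = B' * mul_mat X0" "B * mul_mat X1 = B' * mul_mat X1"
  shows "B = B'"
proof -
  obtain y0 y1 where y: "mul_mat y0 * mul_mat X0 + mul_mat y1 * mul_mat X1 = 1\<^sub>m N"
    by (rule unimodular)
  have e: "B = B * mul_mat X0 * mul_mat y0 + B * mul_mat X1 * mul_mat y1"
    if "B \<in> carrier_mat N N" for B
  proof -
    have "B = B * (mul_mat y0 * mul_mat X0 + mul_mat y1 * mul_mat X1)" using that y by simp
    also have "\<dots> = B * mul_mat X0 * mul_mat y0 + B * mul_mat X1 * mul_mat y1"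
      using that by (simp add: mat_distrib mat_assoc mat_closed mul_mat_commute[of _ y0] mul_mat_commute[of _ y1])
    finally show ?thesis .
  qed
  show ?thesis using e[OF B(1)] e[OF B(2)] assms(3,4) by simp
qed

text \<open>
  Exchanging \<open>X\<^sub>0\<close> and \<open>X\<^sub>1\<close> across \<open>H\<close> one linear factor at a time exchanges any two forms of the same
  degree.
\<close>

lemma swap_forms:
  assumes H: "H \<in> carrier_mat N N" and sw: "mul_mat X0 * H * mul_mat X1 = mul_mat X1 * H * mul_mat X0"
  shows "homog (int l) p \<Longrightarrow> homog (int l) q \<Longrightarrow> mul_mat p * H * mul_mat q = mul_mat q * H * mul_mat p"
proof (induction l arbitrary: p q)
  case 0
  then obtain b c where "p = const b" "q = const c" by (metis homog_0_const of_nat_0)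
  with H show ?case
    by (simp add: mul_mat_const mult_smult_distrib[of _ N N _ N] mult_smult_assoc_mat[of _ N N _ N])
      (auto intro!: eq_matI)
next
  case (Suc l)
  obtain p0 p1 where p: "homog (int l) p0" "homog (int l) p1" "p = X0 * p0 + X1 * p1"
    using homog_Suc_split[OF Suc.prems(1)] by blast
  obtain q0 q1 where q: "homog (int l) q0" "homog (int l) q1" "q = X0 * q0 + X1 * q1"
    using homog_Suc_split[OF Suc.prems(2)] by blast
  have sw': "mul_mat a * H * mul_mat b = mul_mat b * H * mul_mat a"
    if "a \<in> {X0, X1}" "b \<in> {X0, X1}" for a b using that sw by auto
  have t: "mul_mat (a * p) * H * mul_mat (b * q) = mul_mat (b * q) * H * mul_mat (a * p)"
    if "homog (int l) p" "homog (int l) q" "a \<in> {X0, X1}" "b \<in> {X0, X1}" for a b p q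
  proof -
    have "mul_mat (a * p) * H * mul_mat (b * q) = mul_mat a * (mul_mat p * H * mul_mat q) * mul_mat b"
      using H by (simp add: mul_mat_mult mat_assoc mat_closed mul_mat_commute[of b])
    also have "\<dots> = mul_mat a * (mul_mat q * H * mul_mat p) * mul_mat b"
      using Suc.IH[OF that(1,2)] by simp
    also have "\<dots> = (mul_mat q * (mul_mat a * H * mul_mat b)) * mul_mat p"
      using H by (simp add: mat_assoc mat_closed mul_mat_commute[of p])
        (simp add: mat_assoc[symmetric] mat_closed mul_mat_commute[of q])
    also have "\<dots> = (mul_mat q * (mul_mat b * H * mul_mat a)) * mul_mat p"
      using sw'[OF that(3,4)] by simp
    also have "\<dots> = mul_mat (b * q) * H * mul_mat (a * p)"
      using H by (simp add: mul_mat_mult mat_assoc mat_closed mul_mat_commute[of b])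
    finally show ?thesis .
  qed
  have d: "mul_mat (p + p') * H * mul_mat (q + q') = mul_mat p * H * mul_mat q
    + mul_mat p * H * mul_mat q' + (mul_mat p' * H * mul_mat q + mul_mat p' * H * mul_mat q')" for p p' q q'
    using H by (simp add: mul_mat_add mat_distrib mat_closed)
      (rule eq_matI, auto simp del: index_mult_mat(1))
  show ?case
    using t[OF p(1) q(1), of X0 X0] t[OF p(1) q(2), of X0 X1] t[OF p(2) q(1), of X1 X0] t[OF p(2) q(2), of X1 X1] H
    unfolding p(3) q(3) d
    by (simp add: mat_closed) (rule eq_matI, auto simp: mat_closed algebra_simps simp del: index_mult_mat(1))
qed

text \<open>
  In degree \<open>N\<close> there is a form \<open>u\<close> that restricts to \<open>1\<close>.  Exchanging \<open>u\<close> with an arbitrary form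
  across \<open>H\<close> says that \<open>H\<close> commutes with multiplication.  This criterion recovers linearity over the
  algebra from the single symmetry relation that pairs of symmetric matrices provide.
\<close>

lemma mult_algebra_if_swap:
  assumes H: "H \<in> carrier_mat N N" and sw: "mul_mat X0 * H * mul_mat X1 = mul_mat X1 * H * mul_mat X0"
  shows "H \<in> mult_algebra"
proof -
  obtain u where u: "homog (int N) u" "1\<^sub>m N = mul_mat u"
    using mult_algebra_eq_mul_mat[OF mult_algebra_one le_add1] by auto
  have "H * mul_mat a = mul_mat a * H" for a
  proof -
    obtain b where b: "homog (int N) b" "mul_mat a = mul_mat b"
      using mult_algebra_eq_mul_mat[OF mul_mat_in_algebra le_add1] by metis
    from swap_forms[OF H sw u(1) b(1)] show ?thesis
      using H by (simp add: b u(2)[symmetric] mat_closed)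
  qed
  with H show ?thesis by (simp add: mult_algebra_def)
qed

lemma gram_mult_algebra_symmetric:
  assumes "Z \<in> mult_algebra"
  shows "Z\<^sup>T * gram = gram * Z"
proof -
  obtain a where a: "Z = mul_mat a" using mult_algebra_eq_mul_mat[OF assms le_add1] by blast
  show ?thesis using gram_mul_mat_symmetric[of a]
    by (simp add: a transpose_mult[of _ N N _ N] gram_symmetric)
qed

text \<open>
  The pencil \<open>gram H (X\<^sub>0 X\<^sub>1 - X\<^sub>1 X\<^sub>0)\<close>, where the outer variables are scalars and the inner ones are
  multiplications; it is symmetric when \<open>H\<close> belongs to the algebra.
\<close>

definition base_pair :: "'a mat \<Rightarrow> 'a mat \<times> 'a mat" where
  "base_pair H = (gram * (H * mul_mat X1), - (gram * (H * mul_mat X0)))"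

lemma base_pair_carrier:
  assumes "H \<in> carrier_mat N N"
  shows "fst (base_pair H) \<in> carrier_mat N N" "snd (base_pair H) \<in> carrier_mat N N"
  using assms by (auto simp: base_pair_def mat_closed)

end

section \<open>Pairs of symmetric matrices from the algebra\<close>

context binary_form
begin

lemma pencil_base_pair:
  assumes H: "H \<in> carrier_mat N N"
  shows "map_mat const (gram * H) * mult_pencil = pencil (gram * (H * mul_mat X1), - (gram * (H * mul_mat X0)))"
proof -
  let ?c = "map_mat const"
  have c: "?c (gram * (H * mul_mat a)) = ?c (gram * H) * ?c (mul_mat a)" for a
    using H by (simp add: const_hom.mat_hom_mult[of _ N N _ N, symmetric] mat_assoc mat_closed)
  have n: "?c (- A) = - ?c A" for A :: "'a mat"
    by (rule eq_matI) (auto simp: const_hom.hom_uminus)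
  have G: "?c (gram * H) \<in> carrier_mat N N" using H by (simp add: mat_closed)
  show ?thesis
    unfolding mult_pencil_def pencil_def fst_conv snd_conv n c
    using G by (simp add: mult_minus_distrib_mat[of _ N N _ N] mult_smult_distrib[of _ N N _ N] mat_closed)
      (rule eq_matI, auto simp del: index_mult_mat(1))
qed

lemma disc_base_pair:
  assumes H: "H \<in> carrier_mat N N"
  shows "const (lead_coeff F) * disc (base_pair H)
    = const ((- 1) ^ (N * (N - 1) div 2) * det H) * f"
proof -
  have "disc (base_pair H) = const (det H) * (const (det gram) * det mult_pencil)"
    unfolding disc_def base_pair_def pencil_base_pair[OF H, symmetric] using H
    by (simp add: det_mult[of _ N] mat_closed const_hom.hom_det const_hom.hom_mult ac_simps)
  then have "const (lead_coeff F) * disc (base_pair H)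
    = const (det H) * (const (lead_coeff F) * (const (det gram) * det mult_pencil))"
    by (simp add: ac_simps)
  also have "\<dots> = const (det H) * (const ((- 1) ^ (N * (N - 1) div 2)) * f)"
    by (simp only: det_gram_mult_pencil)
  finally show ?thesis
    by (simp add: const_hom.hom_mult ac_simps)
qed

text \<open>
  Read the columns of \<open>Z\<close> as elements \<open>z\<^sub>i\<close> of the algebra.  The relation says that the rows of
  the pencil become linearly dependent with coefficients \<open>z\<^sub>i\<close> on the subscheme.  Since \<open>X\<^sub>0\<close> and \<open>X\<^sub>1\<close> are
  coprime, it forces \<open>Z M\<^sub>0 = X\<^sub>1 \<Psi>\<close> and \<open>Z M\<^sub>1 = - X\<^sub>0 \<Psi>\<close> for one matrix \<open>\<Psi>\<close>.  In the basis in which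
  \<open>Z\<close> becomes the inverse of the Gram matrix, \<open>\<Psi>\<close> is a matrix \<open>H\<close>, and the symmetry of \<open>M\<^sub>0\<close> and \<open>M\<^sub>1\<close>
  combined with the self-adjointness of multiplication gives \<open>X\<^sub>0 H X\<^sub>1 = X\<^sub>1 H X\<^sub>0\<close>.
\<close>

lemma symmetric_pair_is_SL_act_base_pair:
  assumes M0: "M0 \<in> carrier_mat N N" "M0\<^sup>T = M0" and M1: "M1 \<in> carrier_mat N N" "M1\<^sup>T = M1"
    and Z: "Z \<in> carrier_mat N N" "det Z \<noteq> 0"
    and rel: "mul_mat X0 * (Z * M0) + mul_mat X1 * (Z * M1) = 0\<^sub>m N N"
  obtains P H where "P \<in> carrier_mat N N" "det P \<noteq> 0" "H \<in> mult_algebra"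
    "(M0, M1) = SL_act P (base_pair H)"
proof -
  obtain y0 y1 where y: "mul_mat y0 * mul_mat X0 + mul_mat y1 * mul_mat X1 = 1\<^sub>m N"
    by (rule unimodular)
  \<comment> \<open>the Bezout combination that divides \<open>Z M\<^sub>0\<close> by \<open>X\<^sub>1\<close> and \<open>Z M\<^sub>1\<close> by \<open>- X\<^sub>0\<close> at once\<close>
  define \<Psi> where "\<Psi> = mul_mat y1 * (Z * M0) - mul_mat y0 * (Z * M1)"
  have \<Psi>: "\<Psi> \<in> carrier_mat N N" unfolding \<Psi>_def by (intro minus_carrier_mat mat_closed) (use Z M0 M1 in auto)
  let ?A = "Z * M0" and ?B = "Z * M1"
  have AB: "?A \<in> carrier_mat N N" "?B \<in> carrier_mat N N" using Z M0 M1 by (auto simp: mat_closed)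
  have rel0: "mul_mat X0 * ?A = - (mul_mat X1 * ?B)"
  proof (rule eq_matI)
    fix i j assume "i < dim_row (- (mul_mat X1 * ?B))" "j < dim_col (- (mul_mat X1 * ?B))"
    then have ij: "i < N" "j < N" using Z(1) M0(1) M1(1) by auto
    have "(mul_mat X0 * ?A + mul_mat X1 * ?B) $$ (i, j) = 0" unfolding rel using ij by simp
    then show "(mul_mat X0 * ?A) $$ (i, j) = (- (mul_mat X1 * ?B)) $$ (i, j)"
      using ij Z(1) M0(1) M1(1) by (simp add: add_eq_0_iff2 del: index_mult_mat(1))
  qed (use Z(1) M0(1) M1(1) in auto)
  have rel1: "mul_mat X1 * ?B = - (mul_mat X0 * ?A)" by (simp add: rel0)
  have neg: "A * - B = - (A * B)" "- A * B = - (A * B)" if "A \<in> carrier_mat N N" "B \<in> carrier_mat N N" for A B :: "'a mat"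
    using that by (auto intro!: eq_matI)
  have sub: "A - - B = A + B" if "A \<in> carrier_mat N N" "B \<in> carrier_mat N N" for A B :: "'a mat"
    using that by (auto intro!: eq_matI)
  have mc: "mul_mat X1 * (mul_mat a * B) = mul_mat a * (mul_mat X1 * B)"
    "mul_mat X0 * (mul_mat a * B) = mul_mat a * (mul_mat X0 * B)" if "B \<in> carrier_mat N N" for a B
    using that by (metis mat_assoc mul_mat_carrier mul_mat_commute)+
  have A: "mul_mat X1 * \<Psi> = ?A"
  proof -
    have "mul_mat X1 * \<Psi> = mul_mat y1 * (mul_mat X1 * ?A) - mul_mat y0 * (mul_mat X1 * ?B)"
      using AB by (simp add: \<Psi>_def mult_minus_distrib_mat[of _ N N _ N] mat_closed mc)
    also have "\<dots> = (mul_mat y0 * mul_mat X0 + mul_mat y1 * mul_mat X1) * ?A"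
      unfolding rel1 using AB
      by (simp add: neg sub mat_closed mat_distrib mat_assoc comm_add_mat[of _ N N])
    also have "\<dots> = ?A" by (simp only: y left_mult_one_mat[OF AB(1)])
    finally show ?thesis .
  qed
  have B: "mul_mat X0 * \<Psi> = - ?B"
  proof -
    have "mul_mat X0 * \<Psi> = mul_mat y1 * (mul_mat X0 * ?A) - mul_mat y0 * (mul_mat X0 * ?B)"
      using AB by (simp add: \<Psi>_def mult_minus_distrib_mat[of _ N N _ N] mat_closed mc)
    also have "\<dots> = - ((mul_mat y0 * mul_mat X0 + mul_mat y1 * mul_mat X1) * ?B)"
      unfolding rel0 using AB
      by (simp add: neg mat_closed mat_distrib mat_assoc) (rule eq_matI, use Z(1) M0(1) M1(1) in \<open>auto simp del: index_mult_mat(1)\<close>)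
    also have "\<dots> = - ?B" by (simp only: y left_mult_one_mat[OF AB(2)])
    finally show ?thesis .
  qed
  obtain Zi where Zi: "Zi \<in> carrier_mat N N" "Z * Zi = 1\<^sub>m N" "Zi * Z = 1\<^sub>m N" "det Zi = inverse (det Z)"
    using ex_inverse_mat[OF Z] .
  obtain Gi where Gi: "Gi \<in> carrier_mat N N" "gram * Gi = 1\<^sub>m N" "Gi * gram = 1\<^sub>m N" "det Gi = inverse (det gram)"
    using ex_inverse_mat[OF gram_carrier det_gram_nonzero] .
  \<comment> \<open>chosen so that \<open>P\<^sup>T gram\<close> is the inverse of \<open>Z\<close>\<close>
  define P where "P = Gi * Zi\<^sup>T"
  have P: "P \<in> carrier_mat N N" using Gi Zi by (simp add: P_def mat_closed)
  have gP: "gram * P = Zi\<^sup>T"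
    using Gi Zi by (simp add: P_def mat_assoc[symmetric])
  have PT: "P\<^sup>T * gram = Zi"
  proof -
    have "P\<^sup>T * gram = (gram * P)\<^sup>T" using P by (simp add: transpose_mult[of _ N N _ N] gram_symmetric)
    then show ?thesis by (simp add: gP)
  qed
  have "det P \<noteq> 0"
    using Gi Zi Z det_gram_nonzero by (simp add: P_def det_mult[of _ N] det_transpose[of _ N])
  then obtain Pi where Pi: "Pi \<in> carrier_mat N N" "P * Pi = 1\<^sub>m N" "Pi * P = 1\<^sub>m N"
    using ex_inverse_mat[OF P] by blast
  define H where "H = \<Psi> * Pi"
  have H: "H \<in> carrier_mat N N" using \<Psi> Pi by (simp add: H_def mat_closed)
  have HP: "H * P = \<Psi>" using \<Psi> Pi P by (simp add: H_def mat_assoc)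
  have e: "P\<^sup>T * (gram * (mul_mat a * H)) * P = Zi * (mul_mat a * \<Psi>)" for a
    using P H Zi \<Psi> by (simp add: mat_assoc mat_closed HP) (simp add: mat_assoc[symmetric] mat_closed PT)
  have M0': "M0 = P\<^sup>T * (gram * (mul_mat X1 * H)) * P"
    unfolding e A using Zi Z M0 by (simp add: mat_assoc[symmetric])
  have M1': "M1 = - (P\<^sup>T * (gram * (mul_mat X0 * H)) * P)"
    unfolding e B using Zi Z M1 AB by (simp add: neg mat_assoc[symmetric])
  have sym: "(gram * (mul_mat a * H))\<^sup>T = gram * (mul_mat a * H)"
    if "(P\<^sup>T * (gram * (mul_mat a * H)) * P)\<^sup>T = P\<^sup>T * (gram * (mul_mat a * H)) * P" for a
  proof -
    let ?G = "gram * (mul_mat a * H)"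
    have G: "?G \<in> carrier_mat N N" using H by (simp add: mat_closed)
    have cancel: "Pi\<^sup>T * (P\<^sup>T * B * P) * Pi = B" if "B \<in> carrier_mat N N" for B
    proof -
      have "Pi\<^sup>T * P\<^sup>T = 1\<^sub>m N" using Pi P by (metis transpose_mult transpose_one)
      then have "Pi\<^sup>T * (P\<^sup>T * B) = B" using that Pi P
        by (metis left_mult_one_mat mat_assoc transpose_carrier_mat)
      then show ?thesis using that Pi P by (simp add: mat_assoc mat_closed)
    qed
    have "P\<^sup>T * ?G\<^sup>T * P = P\<^sup>T * ?G * P"
      using that P G by (simp add: transpose_mult[of _ N N _ N] mat_closed mat_assoc)
    then show ?thesis using cancel[OF G] cancel[of "?G\<^sup>T"] G by simp
  qed
  have "(P\<^sup>T * (gram * (mul_mat X0 * H)) * P)\<^sup>T = P\<^sup>T * (gram * (mul_mat X0 * H)) * P"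
    using M1(2) unfolding M1' by (simp add: transpose_uminus)
  then have s0: "(gram * (mul_mat X0 * H))\<^sup>T = gram * (mul_mat X0 * H)" by (rule sym)
  have "(P\<^sup>T * (gram * (mul_mat X1 * H)) * P)\<^sup>T = P\<^sup>T * (gram * (mul_mat X1 * H)) * P"
    using M0(2) unfolding M0' .
  then have s1: "(gram * (mul_mat X1 * H))\<^sup>T = gram * (mul_mat X1 * H)" by (rule sym)
  have t: "H\<^sup>T * gram * mul_mat a = gram * (mul_mat a * H)"
    if "(gram * (mul_mat a * H))\<^sup>T = gram * (mul_mat a * H)" for a
  proof -
    have "(gram * (mul_mat a * H))\<^sup>T = ((gram * mul_mat a) * H)\<^sup>T" using H by (simp add: mat_assoc)
    also have "\<dots> = H\<^sup>T * (gram * mul_mat a)"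
      using H by (simp add: transpose_mult[of "gram * mul_mat a" N N H N] mat_closed gram_mul_mat_symmetric)
    finally show ?thesis using that H by (simp add: mat_assoc)
  qed
  have "gram * (mul_mat X0 * H * mul_mat X1) = gram * (mul_mat X1 * H * mul_mat X0)"
  proof -
    have "gram * (mul_mat X0 * H * mul_mat X1) = H\<^sup>T * gram * (mul_mat X0 * mul_mat X1)"
      using H t[OF s0] by (metis mat_assoc mat_closed gram_carrier mul_mat_carrier transpose_carrier_mat)
    also have "\<dots> = H\<^sup>T * gram * (mul_mat X1 * mul_mat X0)" by (simp add: mul_mat_commute)
    also have "\<dots> = gram * (mul_mat X1 * H * mul_mat X0)"
      using H t[OF s1] by (metis mat_assoc mat_closed gram_carrier mul_mat_carrier transpose_carrier_mat)
    finally show ?thesis .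
  qed
  then have "Gi * gram * (mul_mat X0 * H * mul_mat X1) = Gi * gram * (mul_mat X1 * H * mul_mat X0)"
    using H Gi(1) by (simp add: mat_assoc mat_closed)
  then have "mul_mat X0 * H * mul_mat X1 = mul_mat X1 * H * mul_mat X0"
    using H Gi by (simp add: mat_closed)
  then have Halg: "H \<in> mult_algebra" by (rule mult_algebra_if_swap[OF H])
  have "(M0, M1) = SL_act P (base_pair H)"
    unfolding base_pair_def SL_act_def fst_conv snd_conv mult_algebra_commute_mul_mat[OF Halg]
    using M0' M1' P H by (simp add: neg mat_closed)
  with P \<open>det P \<noteq> 0\<close> Halg that show ?thesis by blast
qed

text \<open>
  With \<open>g = P Q\<^sup>-\<^sup>1\<close>, the equality of pairs reads \<open>g\<^sup>T gram H X g = gram K X\<close> for \<open>X = X\<^sub>0\<close> and \<open>X = X\<^sub>1\<close>.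
  Hence \<open>X g = V X\<close> for a common \<open>V\<close>, which gives the exchange relation for \<open>g\<close>.  So \<open>g\<close> belongs to the
  algebra, is self-adjoint, and moves past \<open>H\<close>.
\<close>

lemma SL_act_base_pair_eqD:
  assumes P: "P \<in> carrier_mat N N" "det P \<noteq> 0" and Q: "Q \<in> carrier_mat N N" "det Q \<noteq> 0"
    and H: "H \<in> mult_algebra" "det H \<noteq> 0" and K: "K \<in> mult_algebra"
    and eq: "SL_act P (base_pair H) = SL_act Q (base_pair K)"
  obtains g where "g \<in> mult_algebra" "P = g * Q" "K = H * (g * g)"
proof -
  have Hc: "H \<in> carrier_mat N N" and Kc: "K \<in> carrier_mat N N"
    using H K by (auto simp: mult_algebra_carrier)
  obtain Qi where Qi: "Qi \<in> carrier_mat N N" "Q * Qi = 1\<^sub>m N" "Qi * Q = 1\<^sub>m N" "det Qi = inverse (det Q)"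
    using ex_inverse_mat[OF Q] .
  obtain Gi where Gi: "Gi \<in> carrier_mat N N" "gram * Gi = 1\<^sub>m N" "Gi * gram = 1\<^sub>m N" "det Gi = inverse (det gram)"
    using ex_inverse_mat[OF gram_carrier det_gram_nonzero] .
  define g where "g = P * Qi"
  have g: "g \<in> carrier_mat N N" using P Qi by (simp add: g_def mat_closed)
  have gQ: "g * Q = P" using P Qi Q by (simp add: g_def mat_assoc)
  have detg: "det g \<noteq> 0" using P Q Qi by (simp add: g_def det_mult[of _ N])
  have "SL_act g (base_pair H) = SL_act Qi (SL_act P (base_pair H))"
    using base_pair_carrier[OF Hc] P Qi by (simp add: SL_act_SL_act[of _ N] g_def)
  also have "\<dots> = base_pair K"
    unfolding eq using base_pair_carrier[OF Kc] Q Qi by (simp add: SL_act_SL_act[of _ N] SL_act_one)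
  finally have gb: "SL_act g (base_pair H) = base_pair K" .
  have neg: "A * - B = - (A * B)" "- A * B = - (A * B)" if "A \<in> carrier_mat N N" "B \<in> carrier_mat N N" for A B :: "'a mat"
    using that by (auto intro!: eq_matI)
  have e1: "g\<^sup>T * (gram * (H * mul_mat X1)) * g = gram * (K * mul_mat X1)"
    using arg_cong[OF gb, of fst] by (simp add: SL_act_def base_pair_def)
  have e0: "g\<^sup>T * (gram * (H * mul_mat X0)) * g = gram * (K * mul_mat X0)"
    using arg_cong[OF gb, of snd] g Hc
    by (simp add: SL_act_def base_pair_def neg mat_closed)
  define U where "U = g\<^sup>T * (gram * H)"
  have U: "U \<in> carrier_mat N N" using g Hc by (simp add: U_def mat_closed)
  have "det U \<noteq> 0"
    using g Hc detg H(2) det_gram_nonzero by (simp add: U_def det_mult[of _ N] mat_closed det_transpose[of _ N])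
  then obtain Ui where Ui: "Ui \<in> carrier_mat N N" "U * Ui = 1\<^sub>m N" "Ui * U = 1\<^sub>m N"
    using ex_inverse_mat[OF U] by blast
  have c: "mul_mat a * g = Ui * gram * K * mul_mat a"
    if "g\<^sup>T * (gram * (H * mul_mat a)) * g = gram * (K * mul_mat a)" for a
  proof -
    have "mul_mat a * g = Ui * U * (mul_mat a * g)" using Ui g by (simp add: mat_closed)
    also have "\<dots> = Ui * (g\<^sup>T * (gram * (H * mul_mat a)) * g)"
      using Ui(1) g Hc by (simp add: U_def mat_assoc mat_closed)
    also have "\<dots> = Ui * gram * K * mul_mat a"
      unfolding that using Ui(1) Kc by (simp add: mat_assoc mat_closed)
    finally show ?thesis .
  qed
  let ?V = "Ui * gram * K"
  have V: "?V \<in> carrier_mat N N" using Ui Kc by (simp add: mat_closed)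
  have "mul_mat X0 * g * mul_mat X1 = mul_mat X1 * g * mul_mat X0"
    using c[OF e0] c[OF e1] V by (simp add: mat_assoc[OF V] mul_mat_commute)
  then have galg: "g \<in> mult_algebra" by (rule mult_algebra_if_swap[OF g])
  have gT: "g\<^sup>T * gram = gram * g" by (rule gram_mult_algebra_symmetric[OF galg])
  have fin: "H * (g * g) * mul_mat a = K * mul_mat a"
    if "g\<^sup>T * (gram * (H * mul_mat a)) * g = gram * (K * mul_mat a)" for a
  proof -
    have "gram * (K * mul_mat a) = g\<^sup>T * gram * (H * mul_mat a * g)"
      unfolding that[symmetric] using g Hc by (simp add: mat_assoc mat_closed)
    also have "\<dots> = gram * (g * H * (mul_mat a * g))"
      unfolding gT using g Hc by (simp add: mat_assoc mat_closed)
    also have "g * H * (mul_mat a * g) = H * (g * g) * mul_mat a"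
      using g Hc by (simp add: mult_algebra_commute[OF galg H(1)] mult_algebra_commute_mul_mat[OF galg, symmetric] mat_assoc mat_closed)
    finally have "Gi * gram * (K * mul_mat a) = Gi * gram * (H * (g * g) * mul_mat a)"
      using Gi(1) g Hc Kc by (simp add: mat_assoc mat_closed)
    then show ?thesis using Gi g Hc Kc by (simp add: mat_closed)
  qed
  have "H * (g * g) = K"
    by (rule cancel_X0_X1) (use fin[OF e0] fin[OF e1] g Hc Kc in \<open>auto simp: mat_closed\<close>)
  with galg gQ that show ?thesis by blast
qed

lemma SL_act_mult_algebra_base_pair:
  assumes g: "g \<in> mult_algebra" and H: "H \<in> mult_algebra"
  shows "SL_act g (base_pair H) = base_pair (H * (g * g))"
proof -
  have c: "g \<in> carrier_mat N N" "H \<in> carrier_mat N N" using g H by (auto simp: mult_algebra_carrier)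
  have neg: "A * - B = - (A * B)" "- A * B = - (A * B)" if "A \<in> carrier_mat N N" "B \<in> carrier_mat N N" for A B :: "'a mat"
    using that by (auto intro!: eq_matI)
  have "g\<^sup>T * (gram * (H * mul_mat a)) * g = gram * (H * (g * g) * mul_mat a)" for a
  proof -
    have "g\<^sup>T * (gram * (H * mul_mat a)) * g = g\<^sup>T * gram * (H * mul_mat a * g)"
      using c by (simp add: mat_assoc mat_closed)
    also have "\<dots> = gram * (g * H * (mul_mat a * g))"
      unfolding gram_mult_algebra_symmetric[OF g] using c by (simp add: mat_assoc mat_closed)
    also have "g * H * (mul_mat a * g) = H * (g * g) * mul_mat a"
      using c by (simp add: mult_algebra_commute[OF g H] mult_algebra_commute_mul_mat[OF g, symmetric] mat_assoc mat_closed)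
    finally show ?thesis .
  qed
  then show ?thesis using c by (simp add: SL_act_def base_pair_def neg mat_closed)
qed

end

section \<open>The structure sheaf of the subscheme\<close>

lemma forms_degree:
  assumes "g \<in> forms"
  obtains d where "0 < d" "homog (int d) g" "g \<noteq> 0"
  using assms that unfolding forms_def by (auto dest: zero_less_imp_eq_int)

lemma forms_mult: "g \<in> forms \<Longrightarrow> h \<in> forms \<Longrightarrow> g * h \<in> forms"
  unfolding forms_def by (auto intro!: add_pos_pos dest: homog_mult)

lemma Fract_cancel:
  assumes "(b :: 'b::idom) \<noteq> 0"
  shows "Fraction_Field.Fract (a * b) (c * b) = Fraction_Field.Fract a c"
  using mult_fract_cancel[OF assms, of a c] by (simp add: mult.commute)

text \<open>
  The denominator \<open>g\<close> has one degree only, so the existentially quantified degree in the definition of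
  \<open>twist\<close> can be replaced by a known one.
\<close>

lemma twist_iff:
  assumes "homog (int d) g" "g \<noteq> 0"
  shows "x \<in> twist e g \<longleftrightarrow>
    (\<exists>a m. homog (e + int (m * d)) a \<and> x = Fraction_Field.Fract a (g ^ m))"
proof
  assume "x \<in> twist e g"
  then obtain a m e' where "x = Fraction_Field.Fract a (g ^ m)" "homog e' g" "homog (e + int m * e') a"
    unfolding twist_def by blast
  moreover have "e' = int d" using homog_unique assms calculation(2) by blast
  ultimately show "\<exists>a m. homog (e + int (m * d)) a \<and> x = Fraction_Field.Fract a (g ^ m)"
    by (metis of_nat_mult)
next
  assume "\<exists>a m. homog (e + int (m * d)) a \<and> x = Fraction_Field.Fract a (g ^ m)"
  then show "x \<in> twist e g" unfolding twist_def using assms by fastforce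
qed

lemma twist_raise:
  assumes "homog (int d) g" "g \<noteq> 0" "homog (e + int (m * d)) a"
  shows "homog (e + int ((m + k) * d)) (a * g ^ k)"
    and "Fraction_Field.Fract (a * g ^ k) (g ^ (m + k)) = Fraction_Field.Fract a (g ^ m)"
  using homog_mult[OF assms(3) homog_power[OF assms(1), of k]] Fract_cancel[of "g ^ k" a "g ^ m"] assms(2)
  by (simp_all add: algebra_simps power_add)

lemma regular_simps:
  "carrier (regular g) = twist 0 g" "monoid.mult (regular g) = (*)" "add (regular g) = (+)"
  "one (regular g) = 1" "zero (regular g) = 0"
  by (simp_all add: regular_def)

lemma struct_sheaf_simps:
  "carrier (struct_sheaf S g) = a_rcosets\<^bsub>regular g\<^esub> (S g)"
  "monoid.mult (struct_sheaf S g) = rcoset_mult (regular g) (S g)"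
  "add (struct_sheaf S g) = set_add (regular g)"
  "one (struct_sheaf S g) = S g +>\<^bsub>regular g\<^esub> 1"
  "zero (struct_sheaf S g) = S g"
  "module.smult (struct_sheaf S g) =
    (\<lambda>c A. rcoset_mult (regular g) (S g) (S g +>\<^bsub>regular g\<^esub> Fraction_Field.Fract (const c) 1) A)"
  by (simp_all add: struct_sheaf_def ring.defs module.defs FactRing_def regular_simps)

lemma Fract_const_in_twist: "g \<in> forms \<Longrightarrow> Fraction_Field.Fract (const c) 1 \<in> twist 0 g"
proof -
  assume "g \<in> forms"
  then obtain d where "homog (int d) g" "g \<noteq> 0" by (rule forms_degree)
  then show ?thesis
    unfolding twist_iff[OF \<open>homog (int d) g\<close> \<open>g \<noteq> 0\<close>]
    by (intro exI[of _ "const c"] exI[of _ "0 :: nat"]) auto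
qed

locale binary_form_scheme = binary_form f N for f :: "'a::field poly poly" and N +
  fixes S :: "'a subscheme"
  assumes closed: "closed_subscheme S" and same: "same_subscheme (zero_scheme f) S"
begin

lemma S_ideal: "g \<in> forms \<Longrightarrow> ideal (S g) (regular g)"
  using closed by (simp add: closed_subscheme_def)

lemma S_eq: "g \<in> forms \<Longrightarrow> S g = zero_scheme f g"
  using same by (simp add: same_subscheme_def)

text \<open>
  The section \<open>x = c / g\<^sup>m\<close> of the structure sheaf of the projective line over \<open>D\<^sub>+(g)\<close> restricts on the
  subscheme to the function \<open>Z\<close>: the identity \<open>c = Z g\<^sup>m\<close> is checked in the algebra itself, after possibly
  enlarging \<open>m\<close>, which stands in for an equality in the localization of the algebra at \<open>g\<close>.
\<close>

definition represents :: "'a poly poly \<Rightarrow> 'a poly poly fract \<Rightarrow> 'a mat \<Rightarrow> bool" where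
  "represents g x Z \<longleftrightarrow> (\<exists>d c m. homog (int d) g \<and> homog (int (m * d)) c \<and>
     x = Fraction_Field.Fract c (g ^ m) \<and> mul_mat c = Z * mul_mat (g ^ m))"

lemma represents_iff:
  assumes "homog (int d) g" "g \<noteq> 0"
  shows "represents g x Z \<longleftrightarrow> (\<exists>c m. homog (int (m * d)) c \<and>
     x = Fraction_Field.Fract c (g ^ m) \<and> mul_mat c = Z * mul_mat (g ^ m))"
  unfolding represents_def using assms homog_unique[OF assms(2,1)] by (metis of_nat_eq_iff)

lemma mul_mat_power_add: "mul_mat (g ^ (m + k)) = mul_mat (g ^ m) * mul_mat (g ^ k)"
  by (simp add: power_add mul_mat_mult)

lemma represents_raise:
  assumes g: "homog (int d) g" "g \<noteq> 0" and r: "represents g x Z" and Z: "Z \<in> carrier_mat N N"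
  shows "\<exists>m0. \<forall>m\<ge>m0. \<exists>c. homog (int (m * d)) c \<and>
     x = Fraction_Field.Fract c (g ^ m) \<and> mul_mat c = Z * mul_mat (g ^ m)"
proof -
  obtain c m0 where c: "homog (int (m0 * d)) c" "x = Fraction_Field.Fract c (g ^ m0)"
    "mul_mat c = Z * mul_mat (g ^ m0)" using r unfolding represents_iff[OF g] by blast
  have "\<exists>c. homog (int (m * d)) c \<and> x = Fraction_Field.Fract c (g ^ m) \<and> mul_mat c = Z * mul_mat (g ^ m)"
    if "m0 \<le> m" for m
  proof -
    obtain k where k: "m = m0 + k" using le_Suc_ex[OF \<open>m0 \<le> m\<close>] by blast
    have "homog (0 + int (m0 * d)) c" using c(1) by simp
    note t = twist_raise[OF g this, of k]
    have "homog (int (m * d)) (c * g ^ k)" using t(1) by (simp only: k add_0)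
    moreover have "x = Fraction_Field.Fract (c * g ^ k) (g ^ m)" using t(2) by (simp only: k c(2))
    moreover have "mul_mat (c * g ^ k) = Z * mul_mat (g ^ m)"
    proof -
      have "mul_mat (c * g ^ k) = Z * mul_mat (g ^ m0) * mul_mat (g ^ k)"
        by (simp only: mul_mat_mult c(3))
      also have "\<dots> = Z * (mul_mat (g ^ m0) * mul_mat (g ^ k))"
        by (rule mat_assoc[OF Z mul_mat_carrier mul_mat_carrier])
      also have "\<dots> = Z * mul_mat (g ^ m)"
        by (simp only: k mul_mat_power_add)
      finally show ?thesis .
    qed
    ultimately show ?thesis by (intro exI[of _ "c * g ^ k"] conjI)
  qed
  then show ?thesis by (intro exI[of _ m0] allI impI)
qed

lemma represents_common:
  assumes g: "homog (int d) g" "g \<noteq> 0" and r: "represents g x Z" "represents g y W"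
    and Z: "Z \<in> carrier_mat N N" "W \<in> carrier_mat N N"
  obtains c c' m where "homog (int (m * d)) c" "homog (int (m * d)) c'"
     "x = Fraction_Field.Fract c (g ^ m)" "y = Fraction_Field.Fract c' (g ^ m)"
     "mul_mat c = Z * mul_mat (g ^ m)" "mul_mat c' = W * mul_mat (g ^ m)"
proof -
  obtain m0 where m0: "\<forall>m\<ge>m0. \<exists>c. homog (int (m * d)) c \<and>
     x = Fraction_Field.Fract c (g ^ m) \<and> mul_mat c = Z * mul_mat (g ^ m)"
    using represents_raise[OF g r(1) Z(1)] by blast
  obtain m1 where m1: "\<forall>m\<ge>m1. \<exists>c. homog (int (m * d)) c \<and>
     y = Fraction_Field.Fract c (g ^ m) \<and> mul_mat c = W * mul_mat (g ^ m)"
    using represents_raise[OF g r(2) Z(2)] by blast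
  obtain c where c: "homog (int ((m0 + m1) * d)) c" "x = Fraction_Field.Fract c (g ^ (m0 + m1))"
    "mul_mat c = Z * mul_mat (g ^ (m0 + m1))" using m0 le_add1 by blast
  obtain c' where c': "homog (int ((m0 + m1) * d)) c'" "y = Fraction_Field.Fract c' (g ^ (m0 + m1))"
    "mul_mat c' = W * mul_mat (g ^ (m0 + m1))" using m1 le_add2 by blast
  show ?thesis by (rule that[OF c(1) c'(1) c(2) c'(2) c(3) c'(3)])
qed

lemma represents_in_twist: "g \<in> forms \<Longrightarrow> represents g x Z \<Longrightarrow> x \<in> twist 0 g"
  by (elim forms_degree) (auto simp: represents_iff twist_iff)

lemma represents_add:
  assumes gf: "g \<in> forms" and r: "represents g x Z" "represents g y W"
    and Z: "Z \<in> carrier_mat N N" "W \<in> carrier_mat N N"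
  shows "represents g (x + y) (Z + W)"
proof -
  obtain d where g: "homog (int d) g" "g \<noteq> 0" using gf by (rule forms_degree)
  obtain c c' m where c: "homog (int (m * d)) c" "homog (int (m * d)) c'"
     "x = Fraction_Field.Fract c (g ^ m)" "y = Fraction_Field.Fract c' (g ^ m)"
     "mul_mat c = Z * mul_mat (g ^ m)" "mul_mat c' = W * mul_mat (g ^ m)"
    using represents_common[OF g r Z] .
  have "x + y = Fraction_Field.Fract (c + c') (g ^ m)"
    using g(2) Fract_cancel[of "g ^ m" "c + c'" "g ^ m"] by (simp add: c(3,4) distrib_right)
  moreover have "mul_mat (c + c') = (Z + W) * mul_mat (g ^ m)"
    using Z by (simp add: mul_mat_add c mat_distrib)
  ultimately show ?thesis
    unfolding represents_iff[OF g] using homog_add[OF c(1,2)] by blast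
qed

lemma represents_mult:
  assumes gf: "g \<in> forms" and r: "represents g x Z" "represents g y W"
    and Z: "Z \<in> mult_algebra" "W \<in> mult_algebra"
  shows "represents g (x * y) (Z * W)"
proof -
  obtain d where g: "homog (int d) g" "g \<noteq> 0" using gf by (rule forms_degree)
  have Zc: "Z \<in> carrier_mat N N" "W \<in> carrier_mat N N" using Z by (auto simp: mult_algebra_carrier)
  obtain c c' m where c: "homog (int (m * d)) c" "homog (int (m * d)) c'"
     "x = Fraction_Field.Fract c (g ^ m)" "y = Fraction_Field.Fract c' (g ^ m)"
     "mul_mat c = Z * mul_mat (g ^ m)" "mul_mat c' = W * mul_mat (g ^ m)"
    using represents_common[OF g r Zc] .
  have "x * y = Fraction_Field.Fract (c * c') (g ^ (m + m))"
    by (simp add: c(3,4) power_add)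
  moreover have "mul_mat (c * c') = Z * W * mul_mat (g ^ (m + m))"
  proof -
    have "Z * mul_mat (g ^ m) * (W * mul_mat (g ^ m)) = Z * (mul_mat (g ^ m) * W) * mul_mat (g ^ m)"
      using Zc by (simp add: mat_assoc mat_closed)
    then show ?thesis
      using Zc by (simp add: mul_mat_mult c mul_mat_power_add mult_algebra_commute_mul_mat[OF Z(2), symmetric] mat_assoc mat_closed)
  qed
  moreover have "homog (int ((m + m) * d)) (c * c')"
    using homog_mult[OF c(1,2)] by (simp add: algebra_simps)
  ultimately show ?thesis unfolding represents_iff[OF g] by blast
qed

lemma represents_const:
  assumes gf: "g \<in> forms"
  shows "represents g (Fraction_Field.Fract (const c) 1) (c \<cdot>\<^sub>m 1\<^sub>m N)"
proof -
  obtain d where g: "homog (int d) g" "g \<noteq> 0" using gf by (rule forms_degree)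
  have "mul_mat (const c) = c \<cdot>\<^sub>m 1\<^sub>m N * mul_mat (g ^ 0)"
    using mul_mat_const[of 1] by (simp add: mul_mat_const const_hom.hom_one)
      (auto intro!: eq_matI)
  then show ?thesis unfolding represents_iff[OF g]
    by (intro exI[of _ "const c"] exI[of _ 0]) auto
qed

text \<open>
  The ideal of the subscheme consists of the sections that restrict to zero: if \<open>c\<close> vanishes as a
  function then \<open>c\<close> is a multiple of \<open>f\<close>.
\<close>

lemma mem_S_iff_represents_zero:
  assumes gf: "g \<in> forms"
  shows "x \<in> S g \<longleftrightarrow> represents g x (0\<^sub>m N N)"
proof
  obtain d where g: "homog (int d) g" "g \<noteq> 0" using gf by (rule forms_degree)
  {
    assume "x \<in> S g"
    then have xt: "x \<in> twist 0 g" and "\<exists>b m. x = Fraction_Field.Fract (f * b) (g ^ m)"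
      using S_eq[OF gf] by (auto simp: zero_scheme_def)
    then obtain b k where b: "x = Fraction_Field.Fract (f * b) (g ^ k)" by blast
    obtain a m where a: "homog (int (m * d)) a" "x = Fraction_Field.Fract a (g ^ m)"
      using xt unfolding twist_iff[OF g] by auto
    from a b have "a * g ^ k = f * b * g ^ m"
      using g(2) by (simp add: eq_fract)
    then have "mul_mat (a * g ^ k) = 0\<^sub>m N N"
      by (simp add: mul_mat_mult mul_mat_f left_mult_zero_mat[of _ N N])
    then have "mul_mat (a * g ^ k) = 0\<^sub>m N N * mul_mat (g ^ (m + k))"
      by (simp add: left_mult_zero_mat[of _ N N])
    then show "represents g x (0\<^sub>m N N)"
      unfolding represents_iff[OF g] using twist_raise[OF g, of 0 m a k] a
      by (intro exI[of _ "a * g ^ k"] exI[of _ "m + k"]) auto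
  }
  {
    assume r: "represents g x (0\<^sub>m N N)"
    then obtain c m where c: "homog (int (m * d)) c" "x = Fraction_Field.Fract c (g ^ m)"
      "mul_mat c = 0\<^sub>m N N * mul_mat (g ^ m)" unfolding represents_iff[OF g] by blast
    then have "f dvd c" using mul_mat_homog_eq_0_iff[OF c(1)] by (simp add: left_mult_zero_mat[of _ N N])
    then show "x \<in> S g"
      using c represents_in_twist[OF gf r] unfolding S_eq[OF gf] zero_scheme_def by (auto elim!: dvdE)
  }
qed

lemma represents_diff:
  assumes gf: "g \<in> forms" and r: "represents g x Z" "represents g y W"
    and Z: "Z \<in> carrier_mat N N" "W \<in> carrier_mat N N"
  shows "represents g (x - y) (Z - W)"
proof -
  have "represents g (- y) (- W)"
  proof -
    obtain d where g: "homog (int d) g" "g \<noteq> 0" using gf by (rule forms_degree)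
    from r(2) obtain c m where c: "homog (int (m * d)) c" "y = Fraction_Field.Fract c (g ^ m)"
      "mul_mat c = W * mul_mat (g ^ m)" unfolding represents_iff[OF g] by blast
    have "mul_mat (- c) = mul_mat (const (- 1) * c)" by (simp add: const_hom.hom_uminus)
    also have "\<dots> = - W * mul_mat (g ^ m)"
    proof -
      let ?B = "W * mul_mat (g ^ m)"
      have B: "?B \<in> carrier_mat N N" using Z(2) by (simp add: mat_closed)
      have "mul_mat (const (- 1) * c) = (- 1) \<cdot>\<^sub>m 1\<^sub>m N * ?B"
        by (simp only: mul_mat_mult mul_mat_const c)
      also have "\<dots> = (- 1) \<cdot>\<^sub>m ?B"
        using B by (simp only: mult_smult_assoc_mat[of _ N N _ N] one_carrier_mat left_mult_one_mat)
      also have "\<dots> = - ?B" by (rule eq_matI) (simp_all del: index_mult_mat(1))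
      also have "\<dots> = - W * mul_mat (g ^ m)" using Z(2) by (simp add: uminus_mult_left_mat)
      finally show ?thesis .
    qed
    finally show ?thesis unfolding represents_iff[OF g] using c homog_uminus[OF c(1)]
      by (intro exI[of _ "- c"] exI[of _ m]) auto
  qed
  from represents_add[OF gf r(1) this] have "represents g (x + - y) (Z + - W)" using Z by simp
  moreover have "Z + - W = Z - W" using Z by (auto intro!: eq_matI)
  ultimately show ?thesis by simp
qed

text \<open>
  Multiplied by a high power of \<open>g\<close>, any function is the restriction of a form of the same degree.
\<close>

lemma ex_represents:
  assumes gf: "g \<in> forms" and Z: "Z \<in> mult_algebra"
  obtains x where "represents g x Z"
proof -
  obtain d where d: "0 < d" and g: "homog (int d) g" "g \<noteq> 0" using gf by (rule forms_degree)
  have "N \<le> N * d + 1" using d by (cases d) auto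
  with mult_algebra_eq_mul_mat[OF mult_algebra_mult[OF Z mul_mat_in_algebra, of "g ^ N"]]
  obtain c where "homog (int (N * d)) c" "Z * mul_mat (g ^ N) = mul_mat c" by metis
  then have "represents g (Fraction_Field.Fract c (g ^ N)) Z"
    unfolding represents_iff[OF g] by (intro exI[of _ c] exI[of _ N]) auto
  with that show ?thesis by blast
qed

lemma represents_restrict:
  assumes gf: "g \<in> forms" and hf: "h \<in> forms" and r: "represents g x Z" and Z: "Z \<in> carrier_mat N N"
  shows "represents (g * h) x Z"
proof -
  obtain d where g: "homog (int d) g" "g \<noteq> 0" using gf by (rule forms_degree)
  obtain e where h: "homog (int e) h" "h \<noteq> 0" using hf by (rule forms_degree)
  have gh: "homog (int (d + e)) (g * h)" "g * h \<noteq> 0" using homog_mult[OF g(1) h(1)] g h by auto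
  from r obtain c m where c: "homog (int (m * d)) c" "x = Fraction_Field.Fract c (g ^ m)"
    "mul_mat c = Z * mul_mat (g ^ m)" unfolding represents_iff[OF g] by blast
  have "homog (int (m * (d + e))) (c * h ^ m)"
    using homog_mult[OF c(1) homog_power[OF h(1), of m]] by (simp add: algebra_simps)
  moreover have "x = Fraction_Field.Fract (c * h ^ m) ((g * h) ^ m)"
    using Fract_cancel[of "h ^ m" c "g ^ m"] h by (simp add: c power_mult_distrib)
  moreover have "mul_mat (c * h ^ m) = Z * mul_mat ((g * h) ^ m)"
    using Z by (simp add: mul_mat_mult power_mult_distrib c mat_assoc)
  ultimately show ?thesis unfolding represents_iff[OF gh] by blast
qed

lemma S_mono: "g \<in> forms \<Longrightarrow> h \<in> forms \<Longrightarrow> S g \<subseteq> S (g * h)"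
  using represents_restrict[of g h _ "0\<^sub>m N N"] by (auto simp: mem_S_iff_represents_zero forms_mult)

lemma ex_unit_form:
  obtains u where "u \<in> forms" "mul_mat u = 1\<^sub>m N"
proof -
  obtain u where u: "homog (int (N + 1)) u" "1\<^sub>m N = mul_mat u"
    using mult_algebra_eq_mul_mat[OF mult_algebra_one, of "N + 1"] by auto
  show ?thesis
  proof (cases "u = 0")
    case False
    with u that show ?thesis by (force simp: forms_def)
  next
    case True
    have "N = 0"
    proof (rule ccontr)
      assume "N \<noteq> 0"
      then have "(1\<^sub>m N :: 'a mat) $$ (0, 0) = 1" by simp
      moreover have "mul_mat 0 = 0\<^sub>m N N" using mul_mat_homog_eq_0_iff[of 0 0] by simp
      ultimately show False using u True \<open>N \<noteq> 0\<close> by simp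
    qed
    have "mul_mat X0 = 1\<^sub>m N"
    proof (rule eq_matI)
      fix i j assume "i < dim_row (1\<^sub>m N)"
      with \<open>N = 0\<close> show "mul_mat X0 $$ (i, j) = 1\<^sub>m N $$ (i, j)" by simp
    qed simp_all
    moreover have "X0 \<in> (forms :: 'a poly poly set)" by (auto simp: forms_def intro!: exI[of _ 1])
    ultimately show ?thesis using that by blast
  qed
qed

text \<open>
  A form of positive degree without zeros on the subscheme, normalized to restrict to \<open>1\<close>.  The open set
  \<open>D\<^sub>+(unit_form)\<close> contains the whole subscheme, and sections over it determine global ones.
\<close>

definition unit_form :: "'a poly poly" where
  "unit_form = (SOME u. u \<in> forms \<and> mul_mat u = 1\<^sub>m N)"

lemma unit_form: "unit_form \<in> forms" "mul_mat unit_form = 1\<^sub>m N"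
  using someI_ex[of "\<lambda>u. u \<in> forms \<and> mul_mat u = 1\<^sub>m N"] ex_unit_form unfolding unit_form_def by metis+

lemma mul_mat_1: "mul_mat 1 = 1\<^sub>m N"
  using mul_mat_const[of 1] by (simp add: const_hom.hom_one) (auto intro!: eq_matI)

lemma mul_mat_unit_form_power: "mul_mat (unit_form ^ m) = 1\<^sub>m N"
  by (induction m) (auto simp: mul_mat_1 mul_mat_mult unit_form)

lemma ex_represented_by:
  assumes "x \<in> twist 0 unit_form"
  obtains Z where "Z \<in> mult_algebra" "represents unit_form x Z"
proof -
  obtain d where g: "homog (int d) unit_form" "unit_form \<noteq> 0" using unit_form(1) by (rule forms_degree)
  obtain a m where "homog (int (m * d)) a" "x = Fraction_Field.Fract a (unit_form ^ m)"
    using assms unfolding twist_iff[OF g] by auto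
  then have "represents unit_form x (mul_mat a)"
    unfolding represents_iff[OF g] by (intro exI[of _ a] exI[of _ m]) (auto simp: mul_mat_unit_form_power)
  then show ?thesis by (rule that[OF mul_mat_in_algebra])
qed

lemma represents_unit_form_unique:
  assumes r: "represents unit_form x Z" "represents unit_form x W" and Z: "Z \<in> carrier_mat N N" "W \<in> carrier_mat N N"
  shows "Z = W"
proof -
  obtain d where g: "homog (int d) unit_form" "unit_form \<noteq> 0" using unit_form(1) by (rule forms_degree)
  obtain c c' m where c: "x = Fraction_Field.Fract c (unit_form ^ m)" "x = Fraction_Field.Fract c' (unit_form ^ m)"
     "mul_mat c = Z * mul_mat (unit_form ^ m)" "mul_mat c' = W * mul_mat (unit_form ^ m)"
    using represents_common[OF g r Z] .
  from c(1,2) g(2) have "c = c'" by (simp add: eq_fract)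
  with c(3,4) Z show ?thesis by (simp add: mul_mat_unit_form_power)
qed

text \<open>
  The restriction to \<open>D\<^sub>+(g)\<close> of the function \<open>Z\<close> on the subscheme, as a coset of the ideal.
\<close>

definition residue :: "'a poly poly \<Rightarrow> 'a mat \<Rightarrow> 'a poly poly fract set" where
  "residue g Z = {x. represents g x Z}"

lemma S_coset_eq: "g \<in> forms \<Longrightarrow> S g +>\<^bsub>regular g\<^esub> x = {s + x | s. s \<in> S g}"
  by (auto simp: a_r_coset_def' regular_simps)

lemma residue_eq_coset:
  assumes gf: "g \<in> forms" and r: "represents g x Z" and Z: "Z \<in> carrier_mat N N"
  shows "residue g Z = S g +>\<^bsub>regular g\<^esub> x"
proof -
  have "y \<in> residue g Z \<longleftrightarrow> y - x \<in> S g" for y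
  proof
    assume "y \<in> residue g Z"
    then have "represents g (y - x) (Z - Z)"
      using represents_diff[OF gf _ r Z Z] by (simp add: residue_def)
    then show "y - x \<in> S g" using Z by (simp add: mem_S_iff_represents_zero[OF gf])
  next
    assume "y - x \<in> S g"
    then have "represents g (y - x) (0\<^sub>m N N)" by (simp add: mem_S_iff_represents_zero[OF gf])
    from represents_add[OF gf this r] Z show "y \<in> residue g Z" by (simp add: residue_def)
  qed
  then have "y \<in> residue g Z \<longleftrightarrow> (\<exists>s. s \<in> S g \<and> y = s + x)" for y
    by (metis add_diff_cancel_right' diff_add_cancel)
  then show ?thesis unfolding S_coset_eq[OF gf] by auto
qed

lemma residue_in_struct_sheaf:
  assumes "g \<in> forms" "Z \<in> mult_algebra"
  shows "residue g Z \<in> carrier (struct_sheaf S g)"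
proof -
  obtain x where "represents g x Z" using ex_represents assms by blast
  with assms show ?thesis
    unfolding struct_sheaf_simps A_RCOSETS_def' regular_simps
    using residue_eq_coset represents_in_twist mult_algebra_carrier by auto
qed

lemma S_coset_mult:
  assumes "g \<in> forms" "x \<in> twist 0 g" "y \<in> twist 0 g"
  shows "rcoset_mult (regular g) (S g) (S g +>\<^bsub>regular g\<^esub> x) (S g +>\<^bsub>regular g\<^esub> y) = S g +>\<^bsub>regular g\<^esub> (x * y)"
  using ideal.rcoset_mult_add[OF S_ideal] assms by (simp add: regular_simps)

lemma S_coset_add:
  assumes "g \<in> forms" "x \<in> twist 0 g" "y \<in> twist 0 g"
  shows "(S g +>\<^bsub>regular g\<^esub> x) <+>\<^bsub>regular g\<^esub> (S g +>\<^bsub>regular g\<^esub> y) = S g +>\<^bsub>regular g\<^esub> (x + y)"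
proof -
  interpret ideal "S g" "regular g" using assms S_ideal by blast
  show ?thesis using a_rcos_sum assms by (simp add: regular_simps)
qed

lemma residue_mult:
  assumes "g \<in> forms" "Z \<in> mult_algebra" "W \<in> mult_algebra"
  shows "residue g Z \<otimes>\<^bsub>struct_sheaf S g\<^esub> residue g W = residue g (Z * W)"
proof -
  have Zc: "Z \<in> carrier_mat N N" "W \<in> carrier_mat N N" using assms by (auto simp: mult_algebra_carrier)
  obtain x where x: "represents g x Z" using ex_represents[OF assms(1,2)] by blast
  obtain y where y: "represents g y W" using ex_represents[OF assms(1,3)] by blast
  note xy = represents_in_twist[OF assms(1) x] represents_in_twist[OF assms(1) y]
  show ?thesis
    unfolding residue_eq_coset[OF assms(1) x Zc(1)] residue_eq_coset[OF assms(1) y Zc(2)]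
      residue_eq_coset[OF assms(1) represents_mult[OF assms(1) x y assms(2,3)] mat_closed[OF Zc]]
    by (simp add: struct_sheaf_simps S_coset_mult[OF assms(1) xy])
qed

lemma residue_add:
  assumes "g \<in> forms" "Z \<in> mult_algebra" "W \<in> mult_algebra"
  shows "residue g Z \<oplus>\<^bsub>struct_sheaf S g\<^esub> residue g W = residue g (Z + W)"
proof -
  have Zc: "Z \<in> carrier_mat N N" "W \<in> carrier_mat N N" using assms by (auto simp: mult_algebra_carrier)
  obtain x where x: "represents g x Z" using ex_represents[OF assms(1,2)] by blast
  obtain y where y: "represents g y W" using ex_represents[OF assms(1,3)] by blast
  note xy = represents_in_twist[OF assms(1) x] represents_in_twist[OF assms(1) y]
  show ?thesis
    unfolding residue_eq_coset[OF assms(1) x Zc(1)] residue_eq_coset[OF assms(1) y Zc(2)]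
      residue_eq_coset[OF assms(1) represents_add[OF assms(1) x y Zc] add_carrier_mat[OF Zc(2)]]
    by (simp add: struct_sheaf_simps S_coset_add[OF assms(1) xy])
qed

lemma residue_smult:
  assumes "g \<in> forms" "Z \<in> mult_algebra"
  shows "c \<odot>\<^bsub>struct_sheaf S g\<^esub> residue g Z = residue g (c \<cdot>\<^sub>m Z)"
proof -
  have "c \<odot>\<^bsub>struct_sheaf S g\<^esub> residue g Z = residue g (c \<cdot>\<^sub>m 1\<^sub>m N) \<otimes>\<^bsub>struct_sheaf S g\<^esub> residue g Z"
    using residue_eq_coset[OF assms(1) represents_const[OF assms(1), of c]] by (simp add: struct_sheaf_simps)
  also have "\<dots> = residue g (c \<cdot>\<^sub>m Z)"
    using assms mult_algebra_carrier[OF assms(2)]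
    by (simp add: residue_mult mult_algebra_smult mult_algebra_one mult_smult_assoc_mat[of _ N N _ N])
  finally show ?thesis .
qed

lemma residue_one:
  assumes "g \<in> forms"
  shows "residue g (1\<^sub>m N) = \<one>\<^bsub>struct_sheaf S g\<^esub>"
proof -
  have "1 \<cdot>\<^sub>m 1\<^sub>m N = (1\<^sub>m N :: 'a mat)" by (rule eq_matI) auto
  then show ?thesis
    using residue_eq_coset[OF assms represents_const[OF assms, of 1]]
    by (simp add: struct_sheaf_simps const_hom.hom_one One_fract_def)
qed

lemma residue_zero: "g \<in> forms \<Longrightarrow> residue g (0\<^sub>m N N) = \<zero>\<^bsub>struct_sheaf S g\<^esub>"
  by (auto simp: struct_sheaf_simps residue_def mem_S_iff_represents_zero)

lemma residue_restrict:
  assumes gf: "g \<in> forms" and hf: "h \<in> forms" and Z: "Z \<in> mult_algebra"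
  shows "residue (g * h) Z = struct_res S g h (residue g Z)"
proof -
  have gh: "g * h \<in> forms" using gf hf by (rule forms_mult)
  have Zc: "Z \<in> carrier_mat N N" using Z by (rule mult_algebra_carrier)
  obtain x where x: "represents g x Z" using ex_represents gf Z by blast
  then have x': "represents (g * h) x Z" using represents_restrict gf hf Zc by blast
  have "struct_res S g h (residue g Z) = {s + y | s y. s \<in> S (g * h) \<and> y \<in> residue g Z}"
    by (auto simp: struct_res_def set_add_def' regular_simps)
  also have "\<dots> = {s + x | s. s \<in> S (g * h)}"
  proof (intro equalityI subsetI; clarsimp)
    fix s y assume s: "s \<in> S (g * h)" and y: "y \<in> residue g Z"
    have "y - x \<in> S g"
      using represents_diff[OF gf _ x Zc Zc, of y] y Zc by (simp add: residue_def mem_S_iff_represents_zero[OF gf])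
    then have "y - x \<in> S (g * h)" using S_mono[OF gf hf] by blast
    then have "s + (y - x) \<in> S (g * h)"
      using s represents_add[OF gh, of s "0\<^sub>m N N" "y - x" "0\<^sub>m N N"] by (simp add: mem_S_iff_represents_zero[OF gh])
    then show "\<exists>s'. s + y = s' + x \<and> s' \<in> S (g * h)"
      by (intro exI[of _ "s + (y - x)"]) simp
  next
    fix s assume "s \<in> S (g * h)"
    with x show "\<exists>s' y. s + x = s' + y \<and> s' \<in> S (g * h) \<and> y \<in> residue g Z"
      by (auto simp: residue_def)
  qed
  finally show ?thesis using residue_eq_coset[OF gh x' Zc] S_coset_eq[OF gh] by simp
qed

definition global_section :: "'a mat \<Rightarrow> 'a poly poly \<Rightarrow> 'a poly poly fract set" where
  "global_section Z = (\<lambda>g\<in>forms. residue g Z)"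

lemma H0_simps:
  "carrier (H0 S) = {s \<in> (\<Pi>\<^sub>E g\<in>forms. carrier (struct_sheaf S g)).
                  \<forall>g\<in>forms. \<forall>h\<in>forms. s (g * h) = struct_res S g h (s g)}"
  "monoid.mult (H0 S) = (\<lambda>s t. \<lambda>g\<in>forms. s g \<otimes>\<^bsub>struct_sheaf S g\<^esub> t g)"
  "one (H0 S) = (\<lambda>g\<in>forms. \<one>\<^bsub>struct_sheaf S g\<^esub>)"
  "zero (H0 S) = (\<lambda>g\<in>forms. \<zero>\<^bsub>struct_sheaf S g\<^esub>)"
  "add (H0 S) = (\<lambda>s t. \<lambda>g\<in>forms. s g \<oplus>\<^bsub>struct_sheaf S g\<^esub> t g)"
  "module.smult (H0 S) = (\<lambda>c s. \<lambda>g\<in>forms. c \<odot>\<^bsub>struct_sheaf S g\<^esub> s g)"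
  by (simp_all add: H0_def)

lemma global_section_hom:
  "Z \<in> mult_algebra \<Longrightarrow> W \<in> mult_algebra \<Longrightarrow>
     global_section Z \<otimes>\<^bsub>H0 S\<^esub> global_section W = global_section (Z * W)"
  "Z \<in> mult_algebra \<Longrightarrow> W \<in> mult_algebra \<Longrightarrow>
     global_section Z \<oplus>\<^bsub>H0 S\<^esub> global_section W = global_section (Z + W)"
  "Z \<in> mult_algebra \<Longrightarrow> c \<odot>\<^bsub>H0 S\<^esub> global_section Z = global_section (c \<cdot>\<^sub>m Z)"
  "\<one>\<^bsub>H0 S\<^esub> = global_section (1\<^sub>m N)"
  "\<zero>\<^bsub>H0 S\<^esub> = global_section (0\<^sub>m N N)"
  by (auto simp: H0_simps global_section_def residue_mult residue_add residue_smult residue_one residue_zero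
      intro!: restrict_ext)

text \<open>
  A compatible family of sections is determined by its member over \<open>D\<^sub>+(unit_form)\<close>, where sections
  are the same as elements of the algebra.  To compare with the member over \<open>D\<^sub>+(g)\<close>, both are restricted to
  \<open>D\<^sub>+(g \<cdot> unit_form)\<close>; the factor \<open>unit_form\<close> can then be dropped since it acts as the identity.
\<close>

lemma global_section_bij: "bij_betw global_section mult_algebra (carrier (H0 S))"
  unfolding bij_betw_def
proof (intro conjI equalityI subsetI inj_onI)
  fix Z W assume Z: "Z \<in> mult_algebra" "W \<in> mult_algebra" "global_section Z = global_section W"
  then have "residue unit_form Z = residue unit_form W"
    using unit_form by (metis global_section_def restrict_apply')
  moreover obtain x where "represents unit_form x Z" using ex_represents unit_form Z by blast
  ultimately show "Z = W"
    using represents_unit_form_unique Z mult_algebra_carrier unfolding residue_def by blast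
next
  fix s assume "s \<in> global_section ` mult_algebra"
  then obtain Z where "Z \<in> mult_algebra" "s = global_section Z" by blast
  then show "s \<in> carrier (H0 S)"
    by (auto simp: H0_simps global_section_def residue_in_struct_sheaf residue_restrict forms_mult)
next
  fix s assume "s \<in> carrier (H0 S)"
  then have s: "s \<in> (\<Pi>\<^sub>E g\<in>forms. carrier (struct_sheaf S g))"
    and comp: "\<And>g h. g \<in> forms \<Longrightarrow> h \<in> forms \<Longrightarrow> s (g * h) = struct_res S g h (s g)"
    by (auto simp: H0_simps)
  have coset: "\<exists>x\<in>twist 0 g. s g = S g +>\<^bsub>regular g\<^esub> x" if "g \<in> forms" for g
    using PiE_mem[OF s that] by (auto simp: struct_sheaf_simps A_RCOSETS_def' regular_simps)
  obtain x where x: "x \<in> twist 0 unit_form" "s unit_form = S unit_form +>\<^bsub>regular unit_form\<^esub> x"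
    using coset unit_form by blast
  obtain Z where Z: "Z \<in> mult_algebra" "represents unit_form x Z" using ex_represented_by x by blast
  have Zc: "Z \<in> carrier_mat N N" using Z by (simp add: mult_algebra_carrier)
  have su: "s unit_form = residue unit_form Z" using residue_eq_coset[OF unit_form(1) Z(2) Zc] x by simp
  have "s g = residue g Z" if gf: "g \<in> forms" for g
  proof -
    let ?u = unit_form
    obtain y where y: "y \<in> twist 0 g" "s g = S g +>\<^bsub>regular g\<^esub> y" using coset gf by blast
    have z: "0 \<in> S h" if "h \<in> forms" for h
    proof -
      have "additive_subgroup (S h) (regular h)" using S_ideal[OF that] by (rule ideal.axioms(1))
      from additive_subgroup.zero_closed[OF this] show ?thesis by (simp add: regular_simps)
    qed
    have "y \<in> s g" using y z[OF gf] by (force simp: S_coset_eq[OF gf])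
    then have "y \<in> s (g * ?u)"
      using comp[OF gf unit_form(1)] z[OF forms_mult[OF gf unit_form(1)]]
      by (force simp: struct_res_def set_add_def' regular_simps)
    also have "s (g * ?u) = residue (g * ?u) Z"
      using comp[OF unit_form(1) gf] su residue_restrict[OF unit_form(1) gf Z(1)] by (simp add: mult.commute)
    finally have ry: "represents (g * ?u) y Z" by (simp add: residue_def)
    obtain d where g: "homog (int d) g" "g \<noteq> 0" using gf by (rule forms_degree)
    obtain e where u: "homog (int e) ?u" "?u \<noteq> 0" using unit_form(1) by (rule forms_degree)
    have gu: "homog (int (d + e)) (g * ?u)" "g * ?u \<noteq> 0" using homog_mult[OF g(1) u(1)] g u by auto
    obtain c m where c: "homog (int (m * d)) c" "y = Fraction_Field.Fract c (g ^ m)"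
      using y(1) unfolding twist_iff[OF g] by auto
    obtain c' m' where c': "y = Fraction_Field.Fract c' ((g * ?u) ^ m')" "mul_mat c' = Z * mul_mat ((g * ?u) ^ m')"
      using ry unfolding represents_iff[OF gu] by blast
    have "c * (g * ?u) ^ m' = c' * g ^ m"
      using c(2) c'(1) g gu by (simp add: eq_fract)
    then have "mul_mat c * mul_mat ((g * ?u) ^ m') = Z * mul_mat ((g * ?u) ^ m') * mul_mat (g ^ m)"
      by (metis mul_mat_mult c'(2))
    then have "mul_mat (c * g ^ m') = Z * mul_mat (g ^ (m + m'))"
      using Zc by (simp add: power_mult_distrib mul_mat_mult mul_mat_unit_form_power mul_mat_power_add mat_assoc mul_mat_commute)
    then have "represents g y Z"
      unfolding represents_iff[OF g] using twist_raise[OF g, of 0 m c m'] c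
      by (intro exI[of _ "c * g ^ m'"] exI[of _ "m + m'"]) auto
    then show ?thesis using residue_eq_coset[OF gf _ Zc] y by simp
  qed
  then have "s = global_section Z"
    using s by (intro extensionalityI[of _ forms]) (auto simp: global_section_def PiE_def)
  with Z show "s \<in> global_section ` mult_algebra" by blast
qed

end

text \<open>
  Linear coordinates on an abstract vector space.  For \<open>H\<^sup>0(S, \<O>\<^sub>S)\<close> they give its dimension and turn
  the norm into a determinant.
\<close>

section \<open>The norm of the algebra of global sections\<close>

locale coordinate_iso =
  fixes V :: "('a::field, 'l) module" and \<psi> :: "'a vec \<Rightarrow> 'l" and N :: nat
  assumes bij: "bij_betw \<psi> (carrier_vec N) (carrier V)"
    and add: "\<And>v w. v \<in> carrier_vec N \<Longrightarrow> w \<in> carrier_vec N \<Longrightarrow> \<psi> (v + w) = \<psi> v \<oplus>\<^bsub>V\<^esub> \<psi> w"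
    and smult: "\<And>c v. v \<in> carrier_vec N \<Longrightarrow> \<psi> (c \<cdot>\<^sub>v v) = c \<odot>\<^bsub>V\<^esub> \<psi> v"
    and zero: "\<psi> (0\<^sub>v N) = \<zero>\<^bsub>V\<^esub>"
begin

lemma obtain_vec:
  assumes "x \<in> carrier V"
  obtains v where "v \<in> carrier_vec N" "x = \<psi> v"
  using bij assms unfolding bij_betw_def by auto

lemma image_closed: "v \<in> carrier_vec N \<Longrightarrow> \<psi> v \<in> carrier V"
  using bij unfolding bij_betw_def by auto

lemma \<psi>_eq_iff: "v \<in> carrier_vec N \<Longrightarrow> w \<in> carrier_vec N \<Longrightarrow> \<psi> v = \<psi> w \<longleftrightarrow> v = w"
  using bij unfolding bij_betw_def inj_on_def by auto

lemma abelian_group: "abelian_group V"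
proof (rule abelian_groupI)
  fix x y z assume "x \<in> carrier V" "y \<in> carrier V" "z \<in> carrier V"
  then obtain u v w where e: "u \<in> carrier_vec N" "x = \<psi> u" "v \<in> carrier_vec N" "y = \<psi> v"
    "w \<in> carrier_vec N" "z = \<psi> w" by (metis obtain_vec)
  show "x \<oplus>\<^bsub>V\<^esub> y \<in> carrier V" using e by (simp add: add[symmetric] image_closed)
  show "x \<oplus>\<^bsub>V\<^esub> y = y \<oplus>\<^bsub>V\<^esub> x" using e by (simp add: add[symmetric] comm_add_vec[of _ N])
  show "x \<oplus>\<^bsub>V\<^esub> y \<oplus>\<^bsub>V\<^esub> z = x \<oplus>\<^bsub>V\<^esub> (y \<oplus>\<^bsub>V\<^esub> z)"
    using e by (simp add: add[symmetric] assoc_add_vec[of _ N])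
  show "\<zero>\<^bsub>V\<^esub> \<oplus>\<^bsub>V\<^esub> x = x" using e by (simp add: add[symmetric] zero[symmetric])
  have "\<psi> (- u) \<in> carrier V \<and> \<psi> (- u) \<oplus>\<^bsub>V\<^esub> x = \<zero>\<^bsub>V\<^esub>"
    using e by (simp add: add[symmetric] zero[symmetric] image_closed)
  then show "\<exists>y\<in>carrier V. y \<oplus>\<^bsub>V\<^esub> x = \<zero>\<^bsub>V\<^esub>" by blast
qed (simp add: zero[symmetric] image_closed)

lemma module: "Module.module class_ring V"
proof (intro Module.module.intro abelian_group class_cring.cring_axioms)
  show "module_axioms class_ring V"
  proof
    fix a b and x y assume "x \<in> carrier V" "y \<in> carrier V"
    then obtain v w where e: "v \<in> carrier_vec N" "x = \<psi> v" "w \<in> carrier_vec N" "y = \<psi> w"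
      by (metis obtain_vec)
    show "a \<odot>\<^bsub>V\<^esub> x \<in> carrier V" using e by (simp add: smult[symmetric] image_closed)
    show "(a \<oplus>\<^bsub>class_ring\<^esub> b) \<odot>\<^bsub>V\<^esub> x = a \<odot>\<^bsub>V\<^esub> x \<oplus>\<^bsub>V\<^esub> b \<odot>\<^bsub>V\<^esub> x"
      using e by (simp add: smult[symmetric] add[symmetric] add_smult_distrib_vec)
    show "a \<odot>\<^bsub>V\<^esub> (x \<oplus>\<^bsub>V\<^esub> y) = a \<odot>\<^bsub>V\<^esub> x \<oplus>\<^bsub>V\<^esub> a \<odot>\<^bsub>V\<^esub> y"
      using e by (simp add: smult[symmetric] add[symmetric] smult_add_distrib_vec[of _ N])
    show "(a \<otimes>\<^bsub>class_ring\<^esub> b) \<odot>\<^bsub>V\<^esub> x = a \<odot>\<^bsub>V\<^esub> (b \<odot>\<^bsub>V\<^esub> x)"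
      using e by (simp add: smult[symmetric] smult_smult_assoc)
    show "\<one>\<^bsub>class_ring\<^esub> \<odot>\<^bsub>V\<^esub> x = x" using e by (simp add: smult[symmetric])
  qed
qed

lemma vectorspace: "vectorspace class_ring V"
  by (intro vectorspace.intro module class_field)

lemma linear_map: "linear_map class_ring (module_vec TYPE('a) N) V \<psi>"
  by (intro linear_map.intro mod_hom.intro mod_hom_axioms.intro vectorspace module vec_vs
      vectorspace.axioms(1)[OF vec_vs])
    (auto simp: LinearCombinations.module_hom_def module_vec_simps image_closed add smult)

lemma dim_eq: "vectorspace.dim class_ring V = N"
proof -
  interpret L: linear_map class_ring "module_vec TYPE('a) N" V \<psi> by (rule linear_map)
  interpret vec_space "TYPE('a)" N .
  show ?thesis using L.dim_eq fin_dim bij dim_is_n by (simp add: bij_betw_def module_vec_simps)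
qed

lemma finsum_eq:
  assumes "length ws = k" "set ws \<subseteq> carrier_vec N" "x \<in> carrier_vec k"
  shows "(\<Oplus>\<^bsub>V\<^esub>i\<in>{..<k}. x $ i \<odot>\<^bsub>V\<^esub> \<psi> (ws ! i)) = \<psi> (mat_of_cols N ws *\<^sub>v x)"
proof -
  interpret Module.module class_ring V by (rule module)
  have ws: "ws ! i \<in> carrier_vec N" if "i < k" for i using that assms by auto
  let ?p = "\<lambda>m. vec N (\<lambda>r. \<Sum>i<m. x $ i * (ws ! i $ r))"
  have "(\<Oplus>\<^bsub>V\<^esub>i\<in>{..<m}. x $ i \<odot>\<^bsub>V\<^esub> \<psi> (ws ! i)) = \<psi> (?p m)" if "m \<le> k" for m
    using that
  proof (induction m)
    case 0
    have "?p 0 = 0\<^sub>v N" by auto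
    then show ?case by (simp add: zero)
  next
    case (Suc m)
    have "(\<Oplus>\<^bsub>V\<^esub>i\<in>insert m {..<m}. x $ i \<odot>\<^bsub>V\<^esub> \<psi> (ws ! i))
      = x $ m \<odot>\<^bsub>V\<^esub> \<psi> (ws ! m) \<oplus>\<^bsub>V\<^esub> (\<Oplus>\<^bsub>V\<^esub>i\<in>{..<m}. x $ i \<odot>\<^bsub>V\<^esub> \<psi> (ws ! i))"
      using Suc.prems ws by (intro finsum_insert) (auto simp: smult[symmetric] image_closed)
    also have "\<dots> = \<psi> (x $ m \<cdot>\<^sub>v ws ! m + ?p m)"
      using Suc ws[of m] by (simp add: smult[symmetric] add)
    also have "x $ m \<cdot>\<^sub>v ws ! m + ?p m = ?p (Suc m)"
      using ws[of m] Suc.prems by (intro eq_vecI) auto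
    finally show ?case by (simp add: lessThan_Suc)
  qed
  then have "(\<Oplus>\<^bsub>V\<^esub>i\<in>{..<k}. x $ i \<odot>\<^bsub>V\<^esub> \<psi> (ws ! i)) = \<psi> (?p k)" by simp
  also have "?p k = mat_of_cols N ws *\<^sub>v x"
    using assms by (intro eq_vecI)
      (auto simp: mat_of_cols_def scalar_prod_def atLeast0LessThan mult.commute)
  finally show ?thesis .
qed

text \<open>
  Any other ordered basis is related to the one given by \<open>\<psi>\<close> by an invertible matrix \<open>W\<close> with
  \<open>A W = W B\<close>, so all matrices of \<open>T\<close> have the same determinant.
\<close>

lemma endo_det_eq:
  assumes A: "A \<in> carrier_mat N N"
    and T: "\<And>v. v \<in> carrier_vec N \<Longrightarrow> T (\<psi> v) = \<psi> (A *\<^sub>v v)"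
  shows "endo_det V T = det A"
  unfolding endo_det_def
proof (rule the_equality)
  interpret L: linear_map class_ring "module_vec TYPE('a) N" V \<psi> by (rule linear_map)
  interpret vs: vec_space "TYPE('a)" N .
  have inj: "inj_on \<psi> (carrier_vec N)" and im: "\<psi> ` carrier_vec N = carrier V"
    using bij by (auto simp: bij_betw_def)
  let ?bs = "map \<psi> (unit_vecs N)"
  have us: "set (unit_vecs N :: 'a vec list) \<subseteq> carrier_vec N" "length (unit_vecs N :: 'a vec list) = N"
    by (auto simp: unit_vecs_def)
  have dist: "distinct (unit_vecs N :: 'a vec list)" by (rule vs.unit_vecs_distinct)
  have "distinct ?bs"
    using inj us dist by (simp add: distinct_map inj_on_subset)
  moreover have "vectorspace.basis class_ring V (set ?bs)"
    using L.linear_inj_image_is_basis[OF _ _ vs.unit_vecs_basis vs.fin_dim] inj im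
    by (simp add: module_vec_simps)
  ultimately have ob: "ordered_basis V ?bs" by (simp add: ordered_basis_def)
  have "T (?bs ! j) = (\<Oplus>\<^bsub>V\<^esub>i\<in>{..<length ?bs}. A $$ (i, j) \<odot>\<^bsub>V\<^esub> ?bs ! i)" if "j < length ?bs" for j
  proof -
    have j: "j < N" using that us by simp
    have n: "unit_vecs N ! i = (unit_vec N i :: 'a vec)" if "i < N" for i using that by (simp add: unit_vecs_def)
    have "mat_of_cols N (unit_vecs N :: 'a vec list) = 1\<^sub>m N"
      by (rule eq_matI) (auto simp: mat_of_cols_def unit_vecs_def)
    then have e: "mat_of_cols N (unit_vecs N) *\<^sub>v col A j = col A j" using j A by simp
    have "T (?bs ! j) = \<psi> (col A j)" using j A us by (simp add: n T mult_unit_vec_eq_col[OF A])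
    also have "\<dots> = (\<Oplus>\<^bsub>V\<^esub>i\<in>{..<N}. col A j $ i \<odot>\<^bsub>V\<^esub> \<psi> (unit_vecs N ! i))"
      using finsum_eq[of "unit_vecs N" N "col A j"] us A j e by simp
    also have "\<dots> = (\<Oplus>\<^bsub>V\<^esub>i\<in>{..<N}. A $$ (i, j) \<odot>\<^bsub>V\<^esub> ?bs ! i)"
      using A j us
      by (intro abelian_monoid.finsum_cong'[OF abelian_group.axioms(1)[OF abelian_group]]) (auto simp: smult[symmetric] image_closed unit_vecs_def)
    finally show ?thesis using us by simp
  qed
  with ob A us show "\<exists>bs B. ordered_basis V bs \<and> B \<in> carrier_mat (length bs) (length bs) \<and>
      (\<forall>j<length bs. T (bs ! j) = (\<Oplus>\<^bsub>V\<^esub>i\<in>{..<length bs}. B $$ (i, j) \<odot>\<^bsub>V\<^esub> bs ! i)) \<and> det A = det B"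
    by (intro exI[of _ ?bs] exI[of _ A]) auto
next
  interpret L: linear_map class_ring "module_vec TYPE('a) N" V \<psi> by (rule linear_map)
  interpret vs: vec_space "TYPE('a)" N .
  fix c
  assume "\<exists>bs B. ordered_basis V bs \<and> B \<in> carrier_mat (length bs) (length bs) \<and>
      (\<forall>j<length bs. T (bs ! j) = (\<Oplus>\<^bsub>V\<^esub>i\<in>{..<length bs}. B $$ (i, j) \<odot>\<^bsub>V\<^esub> bs ! i)) \<and> c = det B"
  then obtain bs B where dist: "distinct bs" and basis: "vectorspace.basis class_ring V (set bs)"
    and B: "B \<in> carrier_mat (length bs) (length bs)"
    and TB: "\<And>j. j < length bs \<Longrightarrow> T (bs ! j) = (\<Oplus>\<^bsub>V\<^esub>i\<in>{..<length bs}. B $$ (i, j) \<odot>\<^bsub>V\<^esub> bs ! i)"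
    and c: "c = det B"
    unfolding ordered_basis_def by blast
  have len: "length bs = N"
    using vectorspace.dim_basis[OF vectorspace _ basis] dim_eq dist by (simp add: distinct_card)
  let ?\<phi> = "inv_into (carrier_vec N) \<psi>"
  have \<phi>: "?\<phi> x \<in> carrier_vec N" "\<psi> (?\<phi> x) = x" if "x \<in> carrier V" for x
    using that bij unfolding bij_betw_def by (metis inv_into_into, metis f_inv_into_f)
  have \<phi>': "?\<phi> (\<psi> v) = v" if "v \<in> carrier_vec N" for v
    using that bij by (simp add: bij_betw_def)
  have fd: "vectorspace.fin_dim class_ring V"
    using L.surj_fin_dim[OF vs.fin_dim] bij by (simp add: bij_betw_def module_vec_simps)
  have lin\<phi>: "linear_map class_ring V (module_vec TYPE('a) N) ?\<phi>"
  proof (intro linear_map.intro mod_hom.intro mod_hom_axioms.intro vectorspace module vec_vs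
      vectorspace.axioms(1)[OF vec_vs])
    have "?\<phi> (x \<oplus>\<^bsub>V\<^esub> y) = ?\<phi> x + ?\<phi> y" if "x \<in> carrier V" "y \<in> carrier V" for x y
      using \<phi>'[of "?\<phi> x + ?\<phi> y"] \<phi>[OF that(1)] \<phi>[OF that(2)] by (simp add: add)
    moreover have "?\<phi> (a \<odot>\<^bsub>V\<^esub> x) = a \<cdot>\<^sub>v ?\<phi> x" if "x \<in> carrier V" for a x
      using \<phi>'[of "a \<cdot>\<^sub>v ?\<phi> x"] \<phi>[OF that] by (simp add: smult)
    ultimately show "?\<phi> \<in> LinearCombinations.module_hom class_ring V (module_vec TYPE('a) N)"
      using \<phi> by (auto simp: LinearCombinations.module_hom_def module_vec_simps)
  qed
  interpret I: linear_map class_ring V "module_vec TYPE('a) N" ?\<phi> by (rule lin\<phi>)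
  have inj\<phi>: "inj_on ?\<phi> (carrier V)" using \<phi> by (metis inj_on_def)
  have im\<phi>: "?\<phi> ` carrier V = carrier_vec N"
  proof (intro equalityI subsetI)
    fix v :: "'a vec" assume "v \<in> carrier_vec N"
    then show "v \<in> ?\<phi> ` carrier V" using \<phi>' image_closed by (metis image_eqI)
  qed (use \<phi> in auto)
  define ws where "ws = map ?\<phi> bs"
  have bsV: "set bs \<subseteq> carrier V" using basis vectorspace.basis_def[OF vectorspace] by blast
  have ws: "set ws \<subseteq> carrier_vec N" "length ws = N" using bsV \<phi> len by (auto simp: ws_def)
  have wsn: "\<psi> (ws ! i) = bs ! i" "ws ! i \<in> carrier_vec N" if "i < N" for i
  proof -
    have "bs ! i \<in> carrier V" using that bsV len by (metis nth_mem subsetD)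
    then show "\<psi> (ws ! i) = bs ! i" "ws ! i \<in> carrier_vec N"
      using \<phi> that len by (simp_all add: ws_def)
  qed
  have cl: "a \<odot>\<^bsub>V\<^esub> bs ! i \<in> carrier V" if "i < N" for a i
    using smult[OF wsn(2)[OF that], of a] image_closed[of "a \<cdot>\<^sub>v ws ! i"] wsn[OF that] by simp
  let ?W = "mat_of_cols N ws"
  have W: "?W \<in> carrier_mat N N" using ws by auto
  have "vectorspace.basis class_ring (module_vec TYPE('a) N) (set ws)"
    using I.linear_inj_image_is_basis[OF inj\<phi> _ basis fd] im\<phi> by (simp add: module_vec_simps ws_def)
  then have "\<not> LinearCombinations.module.lin_dep class_ring (module_vec TYPE('a) N) (set (cols ?W))"
    using ws by (simp add: vectorspace.basis_def[OF vec_vs] cols_mat_of_cols)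
  moreover have "distinct (cols ?W)"
    using ws inj\<phi> bsV dist by (simp add: cols_mat_of_cols) (simp add: ws_def distinct_map inj_on_subset)
  ultimately have "vec_space.rank N ?W = N" using vs.lin_indpt_full_rank[OF W] by blast
  then have detW: "det ?W \<noteq> 0" using vs.det_rank_iff[OF W] by simp
  have "A * ?W = ?W * B"
  proof (rule mat_col_eqI)
    fix j assume "j < dim_col (?W * B)"
    then have j: "j < N" using B len by simp
    have "\<psi> (A *\<^sub>v ws ! j) = T (bs ! j)" using wsn[OF j] T by metis
    also have "\<dots> = (\<Oplus>\<^bsub>V\<^esub>i\<in>{..<N}. B $$ (i, j) \<odot>\<^bsub>V\<^esub> bs ! i)" using TB j len by simp
    also have "\<dots> = (\<Oplus>\<^bsub>V\<^esub>i\<in>{..<N}. col B j $ i \<odot>\<^bsub>V\<^esub> \<psi> (ws ! i))"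
      using B j len wsn
      by (intro abelian_monoid.finsum_cong'[OF abelian_group.axioms(1)[OF abelian_group]]) (auto simp: cl wsn)
    also have "\<dots> = \<psi> (?W *\<^sub>v col B j)"
      using ws B j len by (intro finsum_eq) auto
    finally have "A *\<^sub>v ws ! j = ?W *\<^sub>v col B j"
      using A W B j len wsn(2)[OF j] by (subst (asm) \<psi>_eq_iff) (auto intro!: mult_mat_vec_carrier[of _ N N])
    moreover have "col ?W j = ws ! j" using j ws by (simp add: col_mat_of_cols wsn)
    moreover have BN: "B \<in> carrier_mat N N" using B len by simp
    ultimately show "col (A * ?W) j = col (?W * B) j"
      by (simp only: col_mult2[OF A W j] col_mult2[OF W BN j])
  qed (use A W B len in auto)
  then have "det A * det ?W = det ?W * det B" using A W B len by (metis det_mult)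
  then show "c = det A" using detW c by simp
qed

end

context binary_form_scheme
begin

definition algebra_of_vec :: "'a vec \<Rightarrow> 'a mat" where
  "algebra_of_vec v = (SOME Z. Z \<in> mult_algebra \<and> Z *\<^sub>v one_vec = v)"

lemma algebra_of_vec:
  assumes "v \<in> carrier_vec N"
  shows "algebra_of_vec v \<in> mult_algebra" "algebra_of_vec v *\<^sub>v one_vec = v"
proof -
  have "\<exists>Z. Z \<in> mult_algebra \<and> Z *\<^sub>v one_vec = v" using ex_mult_algebra_of_vec[OF assms] by metis
  from someI_ex[OF this] show "algebra_of_vec v \<in> mult_algebra" "algebra_of_vec v *\<^sub>v one_vec = v"
    unfolding algebra_of_vec_def by auto
qed

lemma algebra_of_vec_eqI:
  assumes "Z \<in> mult_algebra" "Z *\<^sub>v one_vec = v" "v \<in> carrier_vec N"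
  shows "algebra_of_vec v = Z"
  using assms algebra_of_vec[OF assms(3)] mult_algebra_eqI by metis

lemma algebra_of_vec_bij: "bij_betw algebra_of_vec (carrier_vec N) mult_algebra"
  unfolding bij_betw_def
proof (intro conjI inj_onI equalityI subsetI)
  fix Z assume Z: "Z \<in> mult_algebra"
  then have "Z *\<^sub>v one_vec \<in> carrier_vec N" by (intro mult_mat_vec_carrier[OF mult_algebra_carrier]) auto
  with algebra_of_vec_eqI[OF Z refl this] show "Z \<in> algebra_of_vec ` carrier_vec N" by (metis image_eqI)
qed (metis algebra_of_vec(2), metis algebra_of_vec(1) imageE)

sublocale H0: coordinate_iso "H0 S" "\<lambda>v. global_section (algebra_of_vec v)" N
proof
  show "bij_betw (\<lambda>v. global_section (algebra_of_vec v)) (carrier_vec N) (carrier (H0 S))"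
    using bij_betw_trans[OF algebra_of_vec_bij global_section_bij] by (simp add: comp_def)
  show "global_section (algebra_of_vec (v + w))
    = global_section (algebra_of_vec v) \<oplus>\<^bsub>H0 S\<^esub> global_section (algebra_of_vec w)"
    if "v \<in> carrier_vec N" "w \<in> carrier_vec N" for v w
  proof -
    have "algebra_of_vec (v + w) = algebra_of_vec v + algebra_of_vec w"
      using algebra_of_vec[OF that(1)] algebra_of_vec[OF that(2)] that
      by (intro algebra_of_vec_eqI mult_algebra_add)
        (auto simp: add_mult_distrib_mat_vec[of _ N N] mult_algebra_carrier)
    then show ?thesis using algebra_of_vec that by (simp add: global_section_hom)
  qed
  show "global_section (algebra_of_vec (c \<cdot>\<^sub>v v)) = c \<odot>\<^bsub>H0 S\<^esub> global_section (algebra_of_vec v)"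
    if "v \<in> carrier_vec N" for c v
  proof -
    have "algebra_of_vec (c \<cdot>\<^sub>v v) = c \<cdot>\<^sub>m algebra_of_vec v"
      using algebra_of_vec[OF that] that
      by (intro algebra_of_vec_eqI mult_algebra_smult)
        (auto simp: smult_mat_mult_vec[of _ N N] mult_algebra_carrier)
    then show ?thesis using algebra_of_vec that by (simp add: global_section_hom)
  qed
  have "algebra_of_vec (0\<^sub>v N) = 0\<^sub>m N N"
    by (intro algebra_of_vec_eqI mult_algebra_zero) (auto simp: zero_mat_mult_vec)
  then show "global_section (algebra_of_vec (0\<^sub>v N)) = \<zero>\<^bsub>H0 S\<^esub>"
    by (simp add: global_section_hom)
qed

text \<open>
  The elements \<open>Z 1\<close> of the algebra are coordinates on it in which multiplication by \<open>Z\<close> is the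
  matrix \<open>Z\<close>.
\<close>

lemma alg_norm_global_section:
  assumes Z: "Z \<in> mult_algebra"
  shows "alg_norm (H0 S) (global_section Z) = det Z"
  unfolding alg_norm_def
proof (rule H0.endo_det_eq[OF mult_algebra_carrier[OF Z]])
  fix v :: "'a vec" assume v: "v \<in> carrier_vec N"
  have "algebra_of_vec (Z *\<^sub>v v) = Z * algebra_of_vec v"
    using algebra_of_vec[OF v] v mult_algebra_carrier[OF Z]
    by (intro algebra_of_vec_eqI mult_algebra_mult Z)
      (auto simp: assoc_mult_mat_vec[of _ N N _ N] mult_algebra_carrier intro!: mult_mat_vec_carrier[of _ N N])
  then show "global_section Z \<otimes>\<^bsub>H0 S\<^esub> global_section (algebra_of_vec v)
    = global_section (algebra_of_vec (Z *\<^sub>v v))"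
    using Z algebra_of_vec[OF v] by (simp add: global_section_hom)
qed

lemma comm_monoid_H0: "comm_monoid (H0 S)"
proof -
  have im: "\<exists>Z\<in>mult_algebra. x = global_section Z" if "x \<in> carrier (H0 S)" for x
    using that global_section_bij by (auto simp: bij_betw_def)
  have cl: "global_section Z \<in> carrier (H0 S)" if "Z \<in> mult_algebra" for Z
    using that global_section_bij by (auto simp: bij_betw_def)
  show ?thesis
  proof (rule comm_monoidI)
    fix x y z assume "x \<in> carrier (H0 S)" "y \<in> carrier (H0 S)" "z \<in> carrier (H0 S)"
    then obtain X Y Z where e: "X \<in> mult_algebra" "Y \<in> mult_algebra" "Z \<in> mult_algebra"
      "x = global_section X" "y = global_section Y" "z = global_section Z" using im by metis
    note c = e(1-3)[THEN mult_algebra_carrier]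
    show "x \<otimes>\<^bsub>H0 S\<^esub> y \<in> carrier (H0 S)" using e by (simp add: global_section_hom cl mult_algebra_mult)
    show "x \<otimes>\<^bsub>H0 S\<^esub> y \<otimes>\<^bsub>H0 S\<^esub> z = x \<otimes>\<^bsub>H0 S\<^esub> (y \<otimes>\<^bsub>H0 S\<^esub> z)"
      using e c by (simp add: global_section_hom mult_algebra_mult mat_assoc)
    show "\<one>\<^bsub>H0 S\<^esub> \<otimes>\<^bsub>H0 S\<^esub> x = x"
      using e c by (simp add: global_section_hom mult_algebra_one)
    show "x \<otimes>\<^bsub>H0 S\<^esub> y = y \<otimes>\<^bsub>H0 S\<^esub> x"
      using e mult_algebra_commute[of X Y] by (simp add: global_section_hom)
  qed (simp add: global_section_hom cl mult_algebra_one)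
qed

lemma Units_H0: "Units (H0 S) = global_section ` {Z \<in> mult_algebra. det Z \<noteq> 0}"
proof (intro equalityI subsetI)
  fix x assume "x \<in> Units (H0 S)"
  then obtain y where xy: "x \<in> carrier (H0 S)" "y \<in> carrier (H0 S)" "y \<otimes>\<^bsub>H0 S\<^esub> x = \<one>\<^bsub>H0 S\<^esub>"
    by (auto simp: Units_def)
  have im: "\<exists>Z\<in>mult_algebra. z = global_section Z" if "z \<in> carrier (H0 S)" for z
    using that global_section_bij by (auto simp: bij_betw_def)
  from im[OF xy(1)] im[OF xy(2)] obtain X Y
    where e: "X \<in> mult_algebra" "Y \<in> mult_algebra" "x = global_section X" "y = global_section Y"
    by blast
  with xy have "global_section (Y * X) = global_section (1\<^sub>m N)" by (simp add: global_section_hom)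
  then have "Y * X = 1\<^sub>m N"
    using global_section_bij e mult_algebra_mult mult_algebra_one by (auto simp: bij_betw_def inj_on_def)
  then have "det Y * det X = 1" using e by (metis det_mult det_one mult_algebra_carrier)
  then show "x \<in> global_section ` {Z \<in> mult_algebra. det Z \<noteq> 0}" using e by auto
next
  fix x assume "x \<in> global_section ` {Z \<in> mult_algebra. det Z \<noteq> 0}"
  then obtain X where X: "X \<in> mult_algebra" "det X \<noteq> 0" "x = global_section X" by blast
  obtain Y where Y: "Y \<in> carrier_mat N N" "X * Y = 1\<^sub>m N" "Y * X = 1\<^sub>m N"
    using ex_inverse_mat[OF mult_algebra_carrier[OF X(1)] X(2)] .
  then have "Y \<in> mult_algebra" using mult_algebra_inverse[OF X(1)] by blast
  then have "global_section Y \<in> carrier (H0 S)" "global_section X \<in> carrier (H0 S)"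
    "global_section Y \<otimes>\<^bsub>H0 S\<^esub> x = \<one>\<^bsub>H0 S\<^esub>" "x \<otimes>\<^bsub>H0 S\<^esub> global_section Y = \<one>\<^bsub>H0 S\<^esub>"
    using X Y global_section_bij by (auto simp: bij_betw_def global_section_hom)
  then show "x \<in> Units (H0 S)" using X unfolding Units_def by blast
qed

end

section \<open>Sections of the associated sheaf\<close>

lemma twist_add:
  assumes gf: "g \<in> forms" and "x \<in> twist e g" "y \<in> twist e g"
  shows "x + y \<in> twist e g"
proof -
  obtain d where g: "homog (int d) g" "g \<noteq> 0" using gf by (rule forms_degree)
  obtain a m b k where a: "homog (e + int (m * d)) a" "x = Fraction_Field.Fract a (g ^ m)"
    and b: "homog (e + int (k * d)) b" "y = Fraction_Field.Fract b (g ^ k)"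
    using assms(2,3) unfolding twist_iff[OF g] by blast
  note a' = twist_raise[OF g a(1), of k] and b' = twist_raise[OF g b(1), of m]
  have "x + y = Fraction_Field.Fract (a * g ^ k + b * g ^ m) (g ^ (m + k))"
    using g(2) by (simp add: a b power_add mult.commute)
  moreover have "homog (e + int ((m + k) * d)) (a * g ^ k + b * g ^ m)"
    using a'(1) b'(1) by (intro homog_add) (simp_all add: add.commute)
  ultimately show ?thesis unfolding twist_iff[OF g] by blast
qed

lemma twist_mult:
  assumes gf: "g \<in> forms" and "x \<in> twist e g" "y \<in> twist e' g"
  shows "x * y \<in> twist (e + e') g"
proof -
  obtain d where g: "homog (int d) g" "g \<noteq> 0" using gf by (rule forms_degree)
  obtain a m b k where a: "homog (e + int (m * d)) a" "x = Fraction_Field.Fract a (g ^ m)"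
    and b: "homog (e' + int (k * d)) b" "y = Fraction_Field.Fract b (g ^ k)"
    using assms(2,3) unfolding twist_iff[OF g] by blast
  have "x * y = Fraction_Field.Fract (a * b) (g ^ (m + k))"
    by (simp add: a b power_add)
  moreover have "homog (e + e' + int ((m + k) * d)) (a * b)"
    using homog_mult[OF a(1) b(1)] by (simp add: algebra_simps)
  ultimately show ?thesis unfolding twist_iff[OF g] by blast
qed

lemma twist_uminus:
  assumes gf: "g \<in> forms" and "x \<in> twist e g"
  shows "- x \<in> twist e g"
proof -
  obtain d where g: "homog (int d) g" "g \<noteq> 0" using gf by (rule forms_degree)
  obtain a m where a: "homog (e + int (m * d)) a" "x = Fraction_Field.Fract a (g ^ m)"
    using assms(2) unfolding twist_iff[OF g] by blast
  then have "- x = Fraction_Field.Fract (- a) (g ^ m)" by simp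
  with homog_uminus[OF a(1)] show ?thesis unfolding twist_iff[OF g] by blast
qed

lemma twist_zero: "g \<in> forms \<Longrightarrow> 0 \<in> twist e g"
proof -
  assume "g \<in> forms"
  then obtain d where g: "homog (int d) g" "g \<noteq> 0" by (rule forms_degree)
  show ?thesis unfolding twist_iff[OF g]
    by (intro exI[of _ "0 :: 'a poly poly"] exI[of _ "0 :: nat"]) (simp add: Zero_fract_def)
qed

lemma twist_one: "g \<in> forms \<Longrightarrow> 1 \<in> twist 0 g"
  using Fract_const_in_twist[of g 1] by (simp add: const_hom.hom_one One_fract_def)

lemma mult_mat_smult_vec:
  fixes A :: "'b::comm_ring_1 mat"
  assumes "A \<in> carrier_mat n m" "v \<in> carrier_vec m"
  shows "A *\<^sub>v (k \<cdot>\<^sub>v v) = k \<cdot>\<^sub>v (A *\<^sub>v v)"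
  using assms by (intro eq_vecI) (auto simp: scalar_prod_def sum_distrib_left ac_simps)

text \<open>
  Finitely many sections over \<open>D\<^sub>+(g)\<close> have a common denominator \<open>g\<^sup>m\<close>, so a vector of sections is a
  vector of forms divided by \<open>g\<^sup>m\<close>.
\<close>

definition frac_vec :: "'a::field poly poly \<Rightarrow> nat \<Rightarrow> 'a poly poly vec \<Rightarrow> 'a poly poly fract vec" where
  "frac_vec g m w = map_vec (\<lambda>p. Fraction_Field.Fract p (g ^ m)) w"

definition homog_vec :: "nat \<Rightarrow> int \<Rightarrow> 'a::field poly poly vec \<Rightarrow> bool" where
  "homog_vec n e w \<longleftrightarrow> w \<in> carrier_vec n \<and> (\<forall>i<n. homog e (w $ i))"

lemma Fract_sum:
  "(b :: 'b::idom) \<noteq> 0 \<Longrightarrow> (\<Sum>i\<in>A. Fraction_Field.Fract (h i) b) = Fraction_Field.Fract (sum h A) b"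
proof (induction A rule: infinite_finite_induct)
  case (insert x A)
  then show ?case
    using Fract_cancel[of b "h x + sum h A" b] by (simp add: distrib_right)
qed (simp_all add: Zero_fract_def eq_fract)

lemma mat_mult_frac_vec:
  fixes A :: "'a::field poly poly mat"
  assumes "A \<in> carrier_mat n n" "w \<in> carrier_vec n" "g \<noteq> 0"
  shows "map_mat (\<lambda>p. Fraction_Field.Fract p 1) A *\<^sub>v frac_vec g m w = frac_vec g m (A *\<^sub>v w)"
  using assms by (intro eq_vecI) (auto simp: frac_vec_def scalar_prod_def Fract_sum)

lemma frac_vec_raise:
  assumes "g \<noteq> 0"
  shows "frac_vec g (m + k) (g ^ k \<cdot>\<^sub>v w) = frac_vec g m w"
  using assms Fract_cancel[of "g ^ k" _ "g ^ m"]
  by (intro eq_vecI) (auto simp: frac_vec_def power_add mult.commute)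

lemma vec_over_twist_iff:
  assumes g: "homog (int d) g" "g \<noteq> 0"
  shows "v \<in> vec_over n (twist e g) \<longleftrightarrow> (\<exists>m w. homog_vec n (e + int (m * d)) w \<and> v = frac_vec g m w)"
proof
  assume "v \<in> vec_over n (twist e g)"
  then have v: "v \<in> carrier_vec n" and tw: "\<And>i. i < n \<Longrightarrow> v $ i \<in> twist e g"
    by (auto simp: vec_over_def)
  have "\<exists>m. \<forall>i<k. \<exists>a. homog (e + int (m * d)) a \<and> v $ i = Fraction_Field.Fract a (g ^ m)" if "k \<le> n" for k
    using that
  proof (induction k)
    case (Suc k)
    then obtain m where m: "\<And>i. i < k \<Longrightarrow> \<exists>a. homog (e + int (m * d)) a \<and> v $ i = Fraction_Field.Fract a (g ^ m)"
      by auto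
    obtain b l where b: "homog (e + int (l * d)) b" "v $ k = Fraction_Field.Fract b (g ^ l)"
      using tw[of k] Suc.prems unfolding twist_iff[OF g] by auto
    have "\<exists>a. homog (e + int ((m + l) * d)) a \<and> v $ i = Fraction_Field.Fract a (g ^ (m + l))" if "i < Suc k" for i
    proof (cases "i = k")
      case True
      with twist_raise[OF g b(1), of m] b(2) show ?thesis by (metis add.commute)
    next
      case False
      then obtain a where "homog (e + int (m * d)) a" "v $ i = Fraction_Field.Fract a (g ^ m)"
        using m[of i] \<open>i < Suc k\<close> by auto
      with twist_raise[OF g this(1), of l] show ?thesis by metis
    qed
    then show ?case by blast
  qed simp
  then obtain m where "\<forall>i<n. \<exists>a. homog (e + int (m * d)) a \<and> v $ i = Fraction_Field.Fract a (g ^ m)" by blast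
  then obtain a where a: "\<And>i. i < n \<Longrightarrow> homog (e + int (m * d)) (a i) \<and> v $ i = Fraction_Field.Fract (a i) (g ^ m)"
    by metis
  have "homog_vec n (e + int (m * d)) (vec n a)" "v = frac_vec g m (vec n a)"
    using a v by (auto simp: homog_vec_def frac_vec_def)
  then show "\<exists>m w. homog_vec n (e + int (m * d)) w \<and> v = frac_vec g m w" by blast
next
  assume "\<exists>m w. homog_vec n (e + int (m * d)) w \<and> v = frac_vec g m w"
  then show "v \<in> vec_over n (twist e g)"
  proof -
    obtain m w where w: "homog_vec n (e + int (m * d)) w" "v = frac_vec g m w"
      using \<open>\<exists>m w. homog_vec n (e + int (m * d)) w \<and> v = frac_vec g m w\<close> by blast
    have "v $ i \<in> twist e g" if "i < n" for i
      unfolding twist_iff[OF g] using w that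
      by (intro exI[of _ "w $ i"] exI[of _ m]) (auto simp: homog_vec_def frac_vec_def)
    then show "v \<in> vec_over n (twist e g)" using w by (auto simp: vec_over_def homog_vec_def frac_vec_def)
  qed
qed

lemma homog_vec_mult:
  assumes "\<And>i j. i < n \<Longrightarrow> j < n \<Longrightarrow> homog d (A $$ (i, j))" "A \<in> carrier_mat n n" "homog_vec n e w"
  shows "homog_vec n (d + e) (A *\<^sub>v w)"
  using assms by (auto simp: homog_vec_def scalar_prod_def intro!: homog_sum homog_mult)

lemma homog_vec_smult: "homog d a \<Longrightarrow> homog_vec n e w \<Longrightarrow> homog_vec n (d + e) (a \<cdot>\<^sub>v w)"
  by (auto simp: homog_vec_def intro!: homog_mult)

lemma homog_vec_add: "homog_vec n e v \<Longrightarrow> homog_vec n e w \<Longrightarrow> homog_vec n e (v + w)"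
  by (auto simp: homog_vec_def intro!: homog_add)

lemma homog_prod:
  "finite A \<Longrightarrow> (\<And>i. i \<in> A \<Longrightarrow> homog 1 (h i)) \<Longrightarrow> homog (int (card A)) (prod h A)"
proof (induction A rule: finite_induct)
  case (insert x A)
  then show ?case using homog_mult[of 1 "h x" "int (card A)" "prod h A"] by simp
qed simp

lemma homog_det:
  assumes A: "A \<in> carrier_mat n n" and h: "\<And>i j. i < n \<Longrightarrow> j < n \<Longrightarrow> homog 1 (A $$ (i, j))"
  shows "homog (int n) (det A)"
  unfolding det_def'[OF A]
proof (rule homog_sum)
  fix p assume "p \<in> {p. p permutes {0..<n}}"
  then have p: "p permutes {0..<n}" by simp
  have "homog (int (card {0..<n})) (\<Prod>i = 0..<n. A $$ (i, p i))"
    using permutes_in_image[OF p] by (intro homog_prod h) auto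
  moreover have "homog 0 (signof p :: 'a poly poly)"
    by (cases p rule: sign_cases) (auto intro: homog_uminus)
  ultimately show "homog (int n) (signof p * (\<Prod>i = 0..<n. A $$ (i, p i)))"
    using homog_mult[of 0 "signof p :: 'a poly poly" "int n"] by simp
qed

lemma homog_adj_mat:
  assumes A: "A \<in> carrier_mat n n" and h: "\<And>i j. i < n \<Longrightarrow> j < n \<Longrightarrow> homog 1 (A $$ (i, j))"
    and ij: "i < n" "j < n"
  shows "homog (int n - 1) (adj_mat A $$ (i, j))"
proof -
  have "homog (int (n - 1)) (det (mat_delete A j i))"
    using mat_delete_carrier[OF A] A ij by (intro homog_det) (auto simp: mat_delete_def intro!: h)
  moreover have "homog 0 ((- 1) ^ (j + i) :: 'a poly poly)"
    using homog_power[of 0 "- 1 :: 'a poly poly" "j + i"] homog_uminus[OF homog_1] by simp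
  ultimately have "homog (0 + int (n - 1)) ((- 1) ^ (j + i) * det (mat_delete A j i))"
    by (rule homog_mult[rotated])
  then show ?thesis using ij A by (simp add: adj_mat_def cofactor_def of_nat_diff)
qed

definition const_vec :: "'a::field vec \<Rightarrow> 'a poly poly vec" where
  "const_vec x = map_vec const x"

lemma const_vec_carrier [simp]: "const_vec x \<in> carrier_vec n \<longleftrightarrow> x \<in> carrier_vec n"
  by (simp add: const_vec_def)

lemma homog_const_vec: "x \<in> carrier_vec n \<Longrightarrow> homog_vec n 0 (const_vec x)"
  by (auto simp: homog_vec_def const_vec_def)

lemma const_mat_mult_vec:
  "A \<in> carrier_mat n m \<Longrightarrow> x \<in> carrier_vec m \<Longrightarrow> map_mat const A *\<^sub>v const_vec x = const_vec (A *\<^sub>v x)"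
  unfolding const_vec_def by (simp add: const_hom.mult_mat_vec_hom)

locale pencil_on_scheme = binary_form_scheme f N S
  for f :: "'a::field poly poly" and N and S :: "'a subscheme" +
  fixes n :: nat and M :: "'a mat \<times> 'a mat" and c0 :: 'a
  assumes N_eq: "N = n + 1" and M: "M \<in> sym_pairs n" and disc_M: "disc M = const c0 * f" and c0: "c0 \<noteq> 0"
begin

lemma M_carrier: "fst M \<in> carrier_mat N N" "snd M \<in> carrier_mat N N"
  using M N_eq by (auto simp: sym_pairs_def)

lemma pencil_carrier: "pencil M \<in> carrier_mat N N"
  using M_carrier by (auto simp: pencil_def)

lemma pencil_index:
  "i < N \<Longrightarrow> j < N \<Longrightarrow> pencil M $$ (i, j) = X0 * const (fst M $$ (i, j)) + X1 * const (snd M $$ (i, j))"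
  using M_carrier by (auto simp: pencil_def)

lemma homog_pencil: "i < N \<Longrightarrow> j < N \<Longrightarrow> homog 1 (pencil M $$ (i, j))"
  using homog_mult[OF homog_X0 homog_const, of "fst M $$ (i, j)"] homog_mult[OF homog_X1 homog_const, of "snd M $$ (i, j)"]
  by (simp add: pencil_index homog_add)

abbreviation "im \<equiv> pencil_image n M"

lemma mem_im_iff: "v \<in> im g \<longleftrightarrow>
  (\<exists>w\<in>vec_over N (twist (- 1) g). v = map_mat (\<lambda>p. Fraction_Field.Fract p 1) (pencil M) *\<^sub>v w)"
  by (auto simp: pencil_image_def N_eq)

lemma im_iff:
  assumes g: "homog (int d) g" "g \<noteq> 0" and y: "y \<in> carrier_vec N"
  shows "frac_vec g m y \<in> im g \<longleftrightarrow>
    (\<exists>k w. homog_vec N (int ((m + k) * d) - 1) w \<and> g ^ k \<cdot>\<^sub>v y = pencil M *\<^sub>v w)"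
proof
  assume "frac_vec g m y \<in> im g"
  then obtain v where v: "v \<in> vec_over N (twist (- 1) g)"
    and e: "frac_vec g m y = map_mat (\<lambda>p. Fraction_Field.Fract p 1) (pencil M) *\<^sub>v v"
    by (auto simp: mem_im_iff)
  obtain k w where w: "homog_vec N (- 1 + int (k * d)) w" "v = frac_vec g k w"
    using v unfolding vec_over_twist_iff[OF g] by blast
  have wc: "w \<in> carrier_vec N" using w by (simp add: homog_vec_def)
  have "frac_vec g m y = frac_vec g k (pencil M *\<^sub>v w)"
    using e mat_mult_frac_vec[OF pencil_carrier wc g(2)] w by simp
  then have "g ^ k * y $ i = g ^ m * (pencil M *\<^sub>v w) $ i" if "i < N" for i
    using that g(2) y pencil_carrier
    by (auto simp: frac_vec_def eq_fract mult.commute dest!: arg_cong[of _ _ "\<lambda>v. v $ i"])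
  then have "g ^ k \<cdot>\<^sub>v y = pencil M *\<^sub>v (g ^ m \<cdot>\<^sub>v w)"
    using y pencil_carrier wc by (intro eq_vecI) (auto simp: mult_mat_smult_vec[of _ N N])
  moreover have "homog_vec N (int ((m + k) * d) - 1) (g ^ m \<cdot>\<^sub>v w)"
    using homog_vec_smult[OF homog_power[OF g(1), of m] w(1)] by (simp add: algebra_simps)
  ultimately show "\<exists>k w. homog_vec N (int ((m + k) * d) - 1) w \<and> g ^ k \<cdot>\<^sub>v y = pencil M *\<^sub>v w" by blast
next
  assume "\<exists>k w. homog_vec N (int ((m + k) * d) - 1) w \<and> g ^ k \<cdot>\<^sub>v y = pencil M *\<^sub>v w"
  then obtain k w where w: "homog_vec N (int ((m + k) * d) - 1) w" "g ^ k \<cdot>\<^sub>v y = pencil M *\<^sub>v w" by blast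
  have wc: "w \<in> carrier_vec N" using w by (simp add: homog_vec_def)
  have "frac_vec g m y = map_mat (\<lambda>p. Fraction_Field.Fract p 1) (pencil M) *\<^sub>v frac_vec g (m + k) w"
    using frac_vec_raise[OF g(2), of m k y] mat_mult_frac_vec[OF pencil_carrier wc g(2)] w(2) by simp
  moreover have "frac_vec g (m + k) w \<in> vec_over N (twist (- 1) g)"
    unfolding vec_over_twist_iff[OF g] using w(1) by (intro exI[of _ "m + k"] exI[of _ w]) simp
  ultimately show "frac_vec g m y \<in> im g" by (auto simp: mem_im_iff)
qed

lemma vec_over_carrier: "v \<in> vec_over N A \<Longrightarrow> v \<in> carrier_vec N"
  by (simp add: vec_over_def)

lemma im_add:
  assumes "g \<in> forms" "v \<in> im g" "w \<in> im g"
  shows "v + w \<in> im g"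
proof -
  let ?p = "map_mat (\<lambda>p. Fraction_Field.Fract p 1) (pencil M)"
  obtain v' w' where v: "v' \<in> vec_over N (twist (- 1) g)" "v = ?p *\<^sub>v v'"
    and w: "w' \<in> vec_over N (twist (- 1) g)" "w = ?p *\<^sub>v w'"
    using assms by (auto simp: mem_im_iff)
  have "v + w = ?p *\<^sub>v (v' + w')"
    unfolding v(2) w(2) by (rule mult_add_distrib_mat_vec[symmetric, of _ N N])
      (use pencil_carrier vec_over_carrier v w in auto)
  moreover have "v' + w' \<in> vec_over N (twist (- 1) g)"
    using v w twist_add[OF assms(1)] by (auto simp: vec_over_def)
  ultimately show ?thesis by (auto simp: mem_im_iff)
qed

lemma im_smult:
  assumes "g \<in> forms" "x \<in> twist 0 g" "v \<in> im g"
  shows "x \<cdot>\<^sub>v v \<in> im g"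
proof -
  let ?p = "map_mat (\<lambda>p. Fraction_Field.Fract p 1) (pencil M)"
  obtain v' where v: "v' \<in> vec_over N (twist (- 1) g)" "v = ?p *\<^sub>v v'"
    using assms by (auto simp: mem_im_iff)
  have "x \<cdot>\<^sub>v v = ?p *\<^sub>v (x \<cdot>\<^sub>v v')"
    unfolding v(2) by (rule mult_mat_smult_vec[symmetric, of _ N N])
      (use pencil_carrier vec_over_carrier v in auto)
  moreover have "x \<cdot>\<^sub>v v' \<in> vec_over N (twist (- 1) g)"
    using v twist_mult[OF assms(1,2), of _ "- 1"] by (auto simp: vec_over_def)
  ultimately show ?thesis by (auto simp: mem_im_iff)
qed

lemma im_zero: "g \<in> forms \<Longrightarrow> 0\<^sub>v N \<in> im g"
proof -
  assume gf: "g \<in> forms"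
  let ?p = "map_mat (\<lambda>p. Fraction_Field.Fract p 1) (pencil M)"
  have "?p *\<^sub>v 0\<^sub>v N = 0\<^sub>v N"
    using pencil_carrier by (intro eq_vecI) (auto simp: scalar_prod_def)
  moreover have "0\<^sub>v N \<in> vec_over N (twist (- 1) g)"
    using twist_zero[OF gf] by (auto simp: vec_over_def)
  ultimately show ?thesis unfolding mem_im_iff by metis
qed

lemma im_carrier: "v \<in> im g \<Longrightarrow> v \<in> carrier_vec N"
  using pencil_carrier unfolding mem_im_iff by (auto intro!: mult_mat_vec_carrier[of _ N N] dest: vec_over_carrier)

lemma twist_minus_one: "g \<in> forms \<Longrightarrow> - 1 \<in> twist 0 g"
  by (intro twist_uminus twist_one)

lemma im_diff:
  assumes "g \<in> forms" "v \<in> im g" "w \<in> im g"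
  shows "v - w \<in> im g"
proof -
  have "v + (- 1) \<cdot>\<^sub>v w \<in> im g"
    using assms by (intro im_add im_smult twist_minus_one)
  moreover have "v + (- 1) \<cdot>\<^sub>v w = v - w"
    using im_carrier[OF assms(2)] im_carrier[OF assms(3)] by (intro eq_vecI) auto
  ultimately show ?thesis by simp
qed

lemma im_subset_vec_over: "g \<in> forms \<Longrightarrow> v \<in> im g \<Longrightarrow> v \<in> vec_over N (twist 0 g)"
proof -
  assume gf: "g \<in> forms" and "v \<in> im g"
  obtain d where g: "homog (int d) g" "g \<noteq> 0" using gf by (rule forms_degree)
  obtain v' where v': "v' \<in> vec_over N (twist (- 1) g)" "v = map_mat (\<lambda>p. Fraction_Field.Fract p 1) (pencil M) *\<^sub>v v'"
    using \<open>v \<in> im g\<close> by (auto simp: mem_im_iff)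
  obtain m w where w: "homog_vec N (- 1 + int (m * d)) w" "v' = frac_vec g m w"
    using v' unfolding vec_over_twist_iff[OF g] by blast
  have "v = frac_vec g m (pencil M *\<^sub>v w)"
    using w g by (simp add: v' mat_mult_frac_vec[OF pencil_carrier] homog_vec_def)
  moreover have "homog_vec N (0 + int (m * d)) (pencil M *\<^sub>v w)"
    using homog_vec_mult[OF homog_pencil pencil_carrier w(1)] by simp
  ultimately show ?thesis unfolding vec_over_twist_iff[OF g] by blast
qed

lemma im_restrict:
  assumes gf: "g \<in> forms" and hf: "h \<in> forms" and "v \<in> im g"
  shows "v \<in> im (g * h)"
proof -
  have "twist (- 1) g \<subseteq> twist (- 1) (g * h)"
  proof
    fix x assume x: "x \<in> twist (- 1) g"
    obtain d where g: "homog (int d) g" "g \<noteq> 0" using gf by (rule forms_degree)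
    obtain e where h: "homog (int e) h" "h \<noteq> 0" using hf by (rule forms_degree)
    have gh: "homog (int (d + e)) (g * h)" "g * h \<noteq> 0" using homog_mult[OF g(1) h(1)] g h by auto
    obtain a m where a: "homog (- 1 + int (m * d)) a" "x = Fraction_Field.Fract a (g ^ m)"
      using x unfolding twist_iff[OF g] by blast
    have "homog (- 1 + int (m * (d + e))) (a * h ^ m)"
      using homog_mult[OF a(1) homog_power[OF h(1), of m]] by (simp add: algebra_simps)
    moreover have "x = Fraction_Field.Fract (a * h ^ m) ((g * h) ^ m)"
      using Fract_cancel[of "h ^ m" a "g ^ m"] h by (simp add: a power_mult_distrib)
    ultimately show "x \<in> twist (- 1) (g * h)" unfolding twist_iff[OF gh] by blast
  qed
  then show ?thesis using assms(3) by (fastforce simp: mem_im_iff vec_over_def)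
qed

lemma adj_pencil: "adj_mat (pencil M) \<in> carrier_mat N N"
  "w \<in> carrier_vec N \<Longrightarrow> pencil M *\<^sub>v (adj_mat (pencil M) *\<^sub>v w) = (const c0 * f) \<cdot>\<^sub>v w"
  "w \<in> carrier_vec N \<Longrightarrow> adj_mat (pencil M) *\<^sub>v (pencil M *\<^sub>v w) = (const c0 * f) \<cdot>\<^sub>v w"
proof -
  note a = adj_mat[OF pencil_carrier]
  show c: "adj_mat (pencil M) \<in> carrier_mat N N" by (rule a)
  have d: "det (pencil M) = const c0 * f" using disc_M by (simp add: disc_def)
  show "pencil M *\<^sub>v (adj_mat (pencil M) *\<^sub>v w) = (const c0 * f) \<cdot>\<^sub>v w" if "w \<in> carrier_vec N"
    using that a(2) d by (simp add: assoc_mult_mat_vec[OF pencil_carrier c, symmetric] smult_mat_mult_vec[of _ N N])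
  show "adj_mat (pencil M) *\<^sub>v (pencil M *\<^sub>v w) = (const c0 * f) \<cdot>\<^sub>v w" if "w \<in> carrier_vec N"
    using that a(3) d by (simp add: assoc_mult_mat_vec[OF c pencil_carrier, symmetric] smult_mat_mult_vec[of _ N N])
qed

text \<open>
  Cramer's rule: the determinant of the pencil, and with it \<open>f\<close>, annihilates the cokernel.
\<close>

lemma S_annihilates:
  assumes gf: "g \<in> forms" and z: "z \<in> S g" and v: "v \<in> vec_over N (twist 0 g)"
  shows "z \<cdot>\<^sub>v v \<in> im g"
proof -
  obtain d where g: "homog (int d) g" "g \<noteq> 0" using gf by (rule forms_degree)
  obtain c m where c: "homog (int (m * d)) c" "z = Fraction_Field.Fract c (g ^ m)"
    "mul_mat c = 0\<^sub>m N N * mul_mat (g ^ m)"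
    using z unfolding mem_S_iff_represents_zero[OF gf] represents_iff[OF g] by blast
  then have "mul_mat c = 0\<^sub>m N N" by (simp add: left_mult_zero_mat[of _ N N])
  then obtain b where b: "homog (int (m * d) - int N) b" "c = f * b"
    by (rule mul_mat_homog_eq_0D[OF c(1)])
  obtain k w where w: "homog_vec N (0 + int (k * d)) w" "v = frac_vec g k w"
    using v unfolding vec_over_twist_iff[OF g] by blast
  have wc: "w \<in> carrier_vec N" using w by (simp add: homog_vec_def)
  have e: "z \<cdot>\<^sub>v v = frac_vec g (m + k) (c \<cdot>\<^sub>v w)"
    unfolding w(2) c(2) by (intro eq_vecI) (auto simp: frac_vec_def power_add)
  let ?b = "const (1 / c0) * b"
  have b': "homog (int (m * d) - int N) ?b" using homog_mult[OF homog_const b(1)] by simp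
  have "const c0 * const (1 / c0) = 1" using c0 by (simp flip: const_hom.hom_mult add: const_hom.hom_one)
  then have "const c0 * f * ?b = c" by (simp add: b(2) ac_simps)
  then have "c \<cdot>\<^sub>v w = (const c0 * f) \<cdot>\<^sub>v (?b \<cdot>\<^sub>v w)" by (simp add: smult_smult_assoc)
  also have "\<dots> = pencil M *\<^sub>v (adj_mat (pencil M) *\<^sub>v (?b \<cdot>\<^sub>v w))"
    using wc by (simp add: adj_pencil)
  finally have "c \<cdot>\<^sub>v w = pencil M *\<^sub>v (adj_mat (pencil M) *\<^sub>v (?b \<cdot>\<^sub>v w))" .
  moreover have "homog_vec N ((int N - 1) + ((int (m * d) - int N) + (0 + int (k * d)))) (adj_mat (pencil M) *\<^sub>v (?b \<cdot>\<^sub>v w))"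
    by (intro homog_vec_mult homog_adj_mat adj_pencil pencil_carrier homog_pencil homog_vec_smult b' w)
  then have "homog_vec N (int ((m + k + 0) * d) - 1) (adj_mat (pencil M) *\<^sub>v (?b \<cdot>\<^sub>v w))"
    by (simp add: algebra_simps)
  ultimately have "\<exists>j w'. homog_vec N (int ((m + k + j) * d) - 1) w' \<and> g ^ j \<cdot>\<^sub>v (c \<cdot>\<^sub>v w) = pencil M *\<^sub>v w'"
    by (intro exI[of _ 0] exI[of _ "adj_mat (pencil M) *\<^sub>v (?b \<cdot>\<^sub>v w)"]) simp
  then show ?thesis unfolding e using im_iff[OF g, of "c \<cdot>\<^sub>v w" "m + k"] wc by simp
qed

text \<open>
  The constant vectors inject into the global sections of the cokernel, because \<open>\<O>(- 1)\<close> has no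
  sections.  Concretely, the adjugate of the pencil applied to \<open>x\<close> consists of forms of degree \<open>n\<close> that
  vanish on the subscheme.  As \<open>f\<close> has degree \<open>n + 1\<close>, they are zero, and then so is \<open>f x\<close>.
\<close>

lemma const_vec_in_im:
  assumes x: "x \<in> carrier_vec N" and "frac_vec unit_form 0 (const_vec x) \<in> im unit_form"
  shows "x = 0\<^sub>v N"
proof -
  let ?u = unit_form
  obtain d where g: "homog (int d) ?u" "?u \<noteq> 0" using unit_form(1) by (rule forms_degree)
  obtain k w where w: "homog_vec N (int ((0 + k) * d) - 1) w" "?u ^ k \<cdot>\<^sub>v const_vec x = pencil M *\<^sub>v w"
    using assms im_iff[OF g, of "const_vec x" 0] by auto
  have wc: "w \<in> carrier_vec N" using w by (simp add: homog_vec_def)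
  let ?a = "adj_mat (pencil M) *\<^sub>v const_vec x"
  have ac: "?a \<in> carrier_vec N" using adj_pencil(1) x by (intro mult_mat_vec_carrier[of _ N N]) auto
  have "?u ^ k \<cdot>\<^sub>v ?a = adj_mat (pencil M) *\<^sub>v (pencil M *\<^sub>v w)"
    unfolding w(2)[symmetric] by (rule mult_mat_smult_vec[symmetric, of _ N N]) (use x adj_pencil(1) in auto)
  also have "\<dots> = (const c0 * f) \<cdot>\<^sub>v w" by (rule adj_pencil(3)[OF wc])
  finally have e: "?u ^ k \<cdot>\<^sub>v ?a = (const c0 * f) \<cdot>\<^sub>v w" .
  have ah: "homog_vec N (int N - 1 + 0) ?a"
    by (intro homog_vec_mult homog_adj_mat adj_pencil pencil_carrier homog_pencil homog_const_vec x)
  have "?a $ i = 0" if i: "i < N" for i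
  proof -
    have "?u ^ k * ?a $ i = (const c0 * f) * w $ i"
      using arg_cong[OF e, of "\<lambda>v. v $ i"] i adj_pencil(1) wc by simp
    then have "mul_mat (?u ^ k * ?a $ i) = mul_mat (const c0 * f) * mul_mat (w $ i)" by (simp add: mul_mat_mult)
    also have "\<dots> = 0\<^sub>m N N" by (simp add: mul_mat_mult mul_mat_f left_mult_zero_mat[of _ N N] right_mult_zero_mat[of _ N N])
    finally have "mul_mat (?a $ i) = 0\<^sub>m N N" by (simp add: mul_mat_mult mul_mat_unit_form_power left_mult_one_mat[of _ N N])
    moreover have "homog (int n) (?a $ i)" using ah i N_eq by (simp add: homog_vec_def)
    ultimately obtain b where "homog (int n - int N) b" "?a $ i = f * b" using mul_mat_homog_eq_0D by blast
    then show ?thesis using homog_nonneg[of b "int n - int N"] N_eq by (cases "b = 0") auto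
  qed
  then have "?a = 0\<^sub>v N" using adj_pencil(1) by (intro eq_vecI) auto
  then have z: "(const c0 * f) \<cdot>\<^sub>v const_vec x = pencil M *\<^sub>v 0\<^sub>v N"
    using adj_pencil(2)[of "const_vec x"] x by simp
  have "x $ i = 0" if i: "i < N" for i
    using arg_cong[OF z, of "\<lambda>v. v $ i"] i x pencil_carrier f_nonzero c0
    by (auto simp: const_vec_def scalar_prod_def)
  then show ?thesis using x by (intro eq_vecI) auto
qed

definition cok_class :: "'a poly poly \<Rightarrow> 'a poly poly fract vec \<Rightarrow> 'a poly poly fract vec set" where
  "cok_class g v = (\<lambda>i. i + v) ` im g"

lemma cok_class_eq_iff:
  assumes gf: "g \<in> forms" and v: "v \<in> carrier_vec N" "w \<in> carrier_vec N"
  shows "cok_class g v = cok_class g w \<longleftrightarrow> v - w \<in> im g"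
proof
  assume e: "cok_class g v = cok_class g w"
  have "v \<in> cok_class g v" using im_zero[OF gf] v by (force simp: cok_class_def)
  then obtain i where i: "i \<in> im g" "v = i + w" using e by (auto simp: cok_class_def)
  have "v - w = i" using i im_carrier[OF i(1)] v by (auto intro!: eq_vecI)
  with i show "v - w \<in> im g" by simp
next
  assume d: "v - w \<in> im g"
  have d': "w - v \<in> im g"
  proof -
    have "0\<^sub>v N - (v - w) \<in> im g" using im_diff[OF gf im_zero[OF gf] d] .
    moreover have "0\<^sub>v N - (v - w) = w - v" using v by (intro eq_vecI) auto
    ultimately show ?thesis by simp
  qed
  have sub: "cok_class g v \<subseteq> cok_class g w"
    if "v - w \<in> im g" "v \<in> carrier_vec N" "w \<in> carrier_vec N" for v w
  proof
    fix y assume "y \<in> cok_class g v"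
    then obtain i where i: "i \<in> im g" "y = i + v" by (auto simp: cok_class_def)
    have "y = (i + (v - w)) + w" using i im_carrier[OF i(1)] that by (auto intro!: eq_vecI)
    then show "y \<in> cok_class g w" using im_add[OF gf i(1) that(1)] by (auto simp: cok_class_def)
  qed
  show "cok_class g v = cok_class g w" using sub[OF d v] sub[OF d' v(2,1)] by blast
qed

lemma free_sections_simps:
  "carrier (free_sections (n + 1) g) = vec_over N (twist 0 g)"
  "add (free_sections (n + 1) g) = (+)"
  "module.smult (free_sections (n + 1) g) = (\<cdot>\<^sub>v)"
  by (simp_all add: free_sections_def module_vec_simps N_eq)

lemma cok_class_eq_coset: "pencil_image n M g +>\<^bsub>free_sections (n + 1) g\<^esub> v = cok_class g v"
  unfolding cok_class_def a_r_coset_def' free_sections_simps by auto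

lemma assoc_sheaf_carrier: "carrier (assoc_sheaf n M g) = cok_class g ` vec_over N (twist 0 g)"
  unfolding assoc_sheaf_def partial_object.simps A_RCOSETS_def' cok_class_eq_coset free_sections_simps by auto

lemma assoc_sheaf_add:
  assumes gf: "g \<in> forms" and v: "v \<in> carrier_vec N" "w \<in> carrier_vec N"
  shows "cok_class g v \<oplus>\<^bsub>assoc_sheaf n M g\<^esub> cok_class g w = cok_class g (v + w)"
proof -
  have "cok_class g v \<oplus>\<^bsub>assoc_sheaf n M g\<^esub> cok_class g w = {a + b | a b. a \<in> cok_class g v \<and> b \<in> cok_class g w}"
    unfolding assoc_sheaf_def ring.simps set_add_def' free_sections_simps by auto
  also have "\<dots> = cok_class g (v + w)"
  proof (intro equalityI subsetI)
    fix y assume "y \<in> {a + b | a b. a \<in> cok_class g v \<and> b \<in> cok_class g w}"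
    then obtain i j where ij: "i \<in> im g" "j \<in> im g" "y = (i + v) + (j + w)" by (auto simp: cok_class_def)
    then have "y = (i + j) + (v + w)"
      using im_carrier[OF ij(1)] im_carrier[OF ij(2)] v by (auto intro!: eq_vecI)
    then show "y \<in> cok_class g (v + w)" using im_add[OF gf ij(1,2)] by (auto simp: cok_class_def)
  next
    fix y assume "y \<in> cok_class g (v + w)"
    then obtain i where i: "i \<in> im g" "y = i + (v + w)" by (auto simp: cok_class_def)
    then have "y = (i + v) + (0\<^sub>v N + w)" using im_carrier[OF i(1)] v by (auto intro!: eq_vecI)
    then show "y \<in> {a + b | a b. a \<in> cok_class g v \<and> b \<in> cok_class g w}"
      using i(1) im_zero[OF gf] by (auto simp: cok_class_def)
  qed
  finally show ?thesis .
qed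

lemma assoc_sheaf_smult:
  assumes gf: "g \<in> forms" and x: "x \<in> twist 0 g" and v: "v \<in> vec_over N (twist 0 g)"
  shows "(S g +>\<^bsub>regular g\<^esub> x) \<odot>\<^bsub>assoc_sheaf n M g\<^esub> cok_class g v = cok_class g (x \<cdot>\<^sub>v v)"
proof -
  have vc: "v \<in> carrier_vec N" using v by (simp add: vec_over_def)
  have "(S g +>\<^bsub>regular g\<^esub> x) \<odot>\<^bsub>assoc_sheaf n M g\<^esub> cok_class g v =
    (\<Union>a\<in>{s + x | s. s \<in> S g}. \<Union>w\<in>cok_class g v. cok_class g (a \<cdot>\<^sub>v w))"
    unfolding assoc_sheaf_def module.simps S_coset_eq[OF gf] cok_class_eq_coset free_sections_simps by simp
  moreover have "cok_class g (a \<cdot>\<^sub>v w) = cok_class g (x \<cdot>\<^sub>v v)"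
    if a: "a \<in> {s + x | s. s \<in> S g}" and w: "w \<in> cok_class g v" for a w
  proof -
    obtain s where s: "s \<in> S g" "a = s + x" using a by auto
    obtain i where i: "i \<in> im g" "w = i + v" using w by (auto simp: cok_class_def)
    have ic: "i \<in> carrier_vec N" using im_carrier i by auto
    have st: "s \<in> twist 0 g" using s represents_in_twist[OF gf] by (simp add: mem_S_iff_represents_zero[OF gf])
    have "a \<cdot>\<^sub>v w - x \<cdot>\<^sub>v v = (s \<cdot>\<^sub>v i + x \<cdot>\<^sub>v i) + s \<cdot>\<^sub>v v"
      using ic vc by (auto intro!: eq_vecI simp: s i algebra_simps)
    also have "\<dots> \<in> im g"
      using i s x st v by (intro im_add im_smult S_annihilates gf)
    finally show ?thesis using ic vc i s by (subst cok_class_eq_iff[OF gf]) auto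
  qed
  moreover have "\<exists>a. a \<in> {s + x | s. s \<in> S g}" "\<exists>w. w \<in> cok_class g v"
    using im_zero[OF gf] additive_subgroup.zero_closed[OF ideal.axioms(1)[OF S_ideal[OF gf]]]
    by (auto simp: cok_class_def)
  ultimately show ?thesis by blast
qed

lemma self_module_simps:
  "carrier (self_module S g) = a_rcosets\<^bsub>regular g\<^esub> (S g)"
  "add (self_module S g) = set_add (regular g)"
  "module.smult (self_module S g) = rcoset_mult (regular g) (S g)"
  by (simp_all add: self_module_def ring.defs module.defs FactRing_def)

end

section \<open>Exactness of the multiplication pencil\<close>

context binary_form
begin

lemma mul_mat_0: "mul_mat 0 = 0\<^sub>m N N"
  using mul_mat_homog_eq_0_iff[of 0 0] by simp

lemma mul_mat_const_mult_vec:
  assumes "v \<in> carrier_vec N"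
  shows "mul_mat (const c * a) *\<^sub>v v = c \<cdot>\<^sub>v (mul_mat a *\<^sub>v v)"
proof -
  have "mul_mat (const c * a) = c \<cdot>\<^sub>m mul_mat a"
    by (simp add: mul_mat_mult mul_mat_const mult_smult_assoc_mat[of _ N N _ N] left_mult_one_mat[of _ N N])
  then show ?thesis using assms by (simp add: smult_mat_mult_vec[of _ N N])
qed

lemma mul_mat_add_mult_vec:
  "v \<in> carrier_vec N \<Longrightarrow> mul_mat (a + b) *\<^sub>v v = mul_mat a *\<^sub>v v + mul_mat b *\<^sub>v v"
  by (simp add: mul_mat_add add_mult_distrib_mat_vec[of _ N N])

lemma mul_mat_mult_mult_vec:
  "v \<in> carrier_vec N \<Longrightarrow> mul_mat (a * b) *\<^sub>v v = mul_mat a *\<^sub>v (mul_mat b *\<^sub>v v)"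
  by (simp add: mul_mat_mult assoc_mult_mat_vec[of _ N N _ N])

lemma mul_mat_mult_vec_carrier [simp]: "v \<in> carrier_vec N \<Longrightarrow> mul_mat a *\<^sub>v v \<in> carrier_vec N"
  by (intro mult_mat_vec_carrier[of _ N N]) auto

text \<open>
  The coordinates of the functions defined by the forms \<open>a\<^sub>0, \<dots>, a\<^sub>N\<^sub>-\<^sub>1\<close>, as columns.
\<close>

definition basis_mat :: "(nat \<Rightarrow> 'a poly poly) \<Rightarrow> 'a mat" where
  "basis_mat a = mat N N (\<lambda>(k, i). (mul_mat (a i) *\<^sub>v one_vec) $ k)"

lemma basis_mat_carrier [simp]: "basis_mat a \<in> carrier_mat N N"
  by (simp add: basis_mat_def)

lemma basis_mat_mult_vec:
  assumes c: "c \<in> carrier_vec N"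
  shows "basis_mat a *\<^sub>v c = mul_mat (\<Sum>i<N. const (c $ i) * a i) *\<^sub>v one_vec"
proof -
  have "(mul_mat (\<Sum>i<m. const (c $ i) * a i) *\<^sub>v one_vec) $ k
    = (\<Sum>i<m. c $ i * (mul_mat (a i) *\<^sub>v one_vec) $ k)" if k: "k < N" for m k
  proof (induction m)
    case 0
    show ?case using k by (simp add: mul_mat_0 zero_mat_mult_vec)
  next
    case (Suc m)
    have d: "dim_vec (mul_mat b *\<^sub>v one_vec) = N" for b by simp
    have "mul_mat (\<Sum>i<Suc m. const (c $ i) * a i) *\<^sub>v one_vec
      = mul_mat (\<Sum>i<m. const (c $ i) * a i) *\<^sub>v one_vec + c $ m \<cdot>\<^sub>v (mul_mat (a m) *\<^sub>v one_vec)"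
      by (simp add: mul_mat_add_mult_vec mul_mat_const_mult_vec)
    then show ?case using k Suc d by (simp del: index_mult_mat_vec)
  qed
  note sum_eq = this
  show ?thesis
  proof (rule eq_vecI)
    fix k assume "k < dim_vec (mul_mat (\<Sum>i<N. const (c $ i) * a i) *\<^sub>v one_vec)"
    then have k: "k < N" by simp
    have "(basis_mat a *\<^sub>v c) $ k = (\<Sum>i<N. basis_mat a $$ (k, i) * c $ i)"
      using k c carrier_matD[OF basis_mat_carrier[of a]] by (simp add: scalar_prod_def atLeast0LessThan)
    also have "\<dots> = (\<Sum>i<N. c $ i * (mul_mat (a i) *\<^sub>v one_vec) $ k)"
      using k by (intro sum.cong) (simp_all add: basis_mat_def mult.commute del: index_mult_mat_vec)
    finally show "(basis_mat a *\<^sub>v c) $ k = (mul_mat (\<Sum>i<N. const (c $ i) * a i) *\<^sub>v one_vec) $ k"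
      by (simp only: sum_eq[OF k])
  qed (simp add: carrier_matD[OF basis_mat_carrier])
qed

definition pencil_span :: "int \<Rightarrow> 'a poly poly vec set" where
  "pencil_span e = {mult_pencil *\<^sub>v w | w. homog_vec N (e - 1) w}"

lemma pencil_span_add: "v \<in> pencil_span e \<Longrightarrow> w \<in> pencil_span e \<Longrightarrow> v + w \<in> pencil_span e"
proof -
  assume "v \<in> pencil_span e" "w \<in> pencil_span e"
  then obtain v' w' where h: "homog_vec N (e - 1) v'" "homog_vec N (e - 1) w'"
    "v = mult_pencil *\<^sub>v v'" "w = mult_pencil *\<^sub>v w'" by (auto simp: pencil_span_def)
  then have "v + w = mult_pencil *\<^sub>v (v' + w')"
    by (simp add: homog_vec_def mult_add_distrib_mat_vec[of _ N N])
  with homog_vec_add[OF h(1,2)] show ?thesis unfolding pencil_span_def by blast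
qed

lemma pencil_span_smult: "homog d a \<Longrightarrow> v \<in> pencil_span e \<Longrightarrow> a \<cdot>\<^sub>v v \<in> pencil_span (d + e)"
proof -
  assume a: "homog d a" and "v \<in> pencil_span e"
  then obtain v' where h: "homog_vec N (e - 1) v'" "v = mult_pencil *\<^sub>v v'" by (auto simp: pencil_span_def)
  then have "a \<cdot>\<^sub>v v = mult_pencil *\<^sub>v (a \<cdot>\<^sub>v v')"
    by (simp add: homog_vec_def mult_mat_smult_vec[of _ N N])
  with homog_vec_smult[OF a h(1)] show ?thesis unfolding pencil_span_def by (auto simp: add_diff_eq)
qed

lemma pencil_span_zero: "0\<^sub>v N \<in> pencil_span e"
proof -
  have "mult_pencil *\<^sub>v 0\<^sub>v N = 0\<^sub>v N"
    by (intro eq_vecI) (auto simp: scalar_prod_def carrier_matD[OF mult_pencil_carrier])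
  moreover have "homog_vec N (e - 1) (0\<^sub>v N)" by (simp add: homog_vec_def)
  ultimately show ?thesis unfolding pencil_span_def mem_Collect_eq by metis
qed

lemma const_vec_simps:
  "x \<in> carrier_vec N \<Longrightarrow> y \<in> carrier_vec N \<Longrightarrow> const_vec (x + y) = const_vec x + const_vec y"
  "const_vec (c \<cdot>\<^sub>v x) = const c \<cdot>\<^sub>v const_vec x"
  "const_vec (0\<^sub>v N) = 0\<^sub>v N"
  by (auto intro!: eq_vecI simp: const_vec_def const_hom.hom_add const_hom.hom_mult)

lemma mult_pencil_const_vec:
  assumes x: "x \<in> carrier_vec N"
  shows "mult_pencil *\<^sub>v const_vec x
    = X0 \<cdot>\<^sub>v const_vec (mul_mat X1 *\<^sub>v x) - X1 \<cdot>\<^sub>v const_vec (mul_mat X0 *\<^sub>v x)"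
proof -
  have c: "map_mat const (mul_mat a) \<in> carrier_mat N N" for a by simp
  show ?thesis
    unfolding mult_pencil_def using x c
    by (simp add: minus_mult_distrib_mat_vec[of _ N N] smult_mat_mult_vec[of _ N N] const_mat_mult_vec[of _ N N])
qed

lemma swap_generators:
  assumes x: "x \<in> carrier_vec N" and ab: "a \<in> {X0, X1}" "b \<in> {X0, X1}"
  shows "a \<cdot>\<^sub>v const_vec (mul_mat b *\<^sub>v x) - b \<cdot>\<^sub>v const_vec (mul_mat a *\<^sub>v x) \<in> pencil_span 1"
proof -
  let ?d = "X0 \<cdot>\<^sub>v const_vec (mul_mat X1 *\<^sub>v x) - X1 \<cdot>\<^sub>v const_vec (mul_mat X0 *\<^sub>v x)"
  have d: "?d \<in> pencil_span 1"
    unfolding mult_pencil_const_vec[OF x, symmetric] pencil_span_def using homog_const_vec[OF x] by auto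
  then have d': "(- 1) \<cdot>\<^sub>v ?d \<in> pencil_span 1"
    using pencil_span_smult[of 0 "- 1"] homog_uminus[OF homog_1] by fastforce
  have n: "(- 1) \<cdot>\<^sub>v (v - w) = w - v" if "v \<in> carrier_vec N" "w \<in> carrier_vec N" for v w :: "'a poly poly vec"
    using that by (intro eq_vecI) auto
  have c: "const_vec (mul_mat a *\<^sub>v x) \<in> carrier_vec N" for a using x by simp
  have "v - v = 0\<^sub>v N" if "v \<in> carrier_vec N" for v :: "'a poly poly vec" using that by simp
  then have same: "a \<cdot>\<^sub>v const_vec (mul_mat a *\<^sub>v x) - a \<cdot>\<^sub>v const_vec (mul_mat a *\<^sub>v x) = 0\<^sub>v N" for a
    using c[of a] by simp
  have "(- 1) \<cdot>\<^sub>v ?d = X1 \<cdot>\<^sub>v const_vec (mul_mat X0 *\<^sub>v x) - X0 \<cdot>\<^sub>v const_vec (mul_mat X1 *\<^sub>v x)"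
    using c by (intro n) simp_all
  with d' have d'': "X1 \<cdot>\<^sub>v const_vec (mul_mat X0 *\<^sub>v x) - X0 \<cdot>\<^sub>v const_vec (mul_mat X1 *\<^sub>v x) \<in> pencil_span 1"
    by simp
  consider "a = b" | "a = X0" "b = X1" | "a = X1" "b = X0" using ab by auto
  then show ?thesis
    by cases (use d d'' same pencil_span_zero in simp_all)
qed

text \<open>
  Modulo the image of the multiplication pencil, the scalars \<open>X\<^sub>0\<close>, \<open>X\<^sub>1\<close> and the operators of
  multiplication by \<open>X\<^sub>0\<close>, \<open>X\<^sub>1\<close> can be exchanged; one linear factor at a time, this exchanges forms of any
  common degree.
\<close>

lemma swap_forms_vec:
  "homog (int l) p \<Longrightarrow> homog (int l) q \<Longrightarrow> x \<in> carrier_vec N \<Longrightarrow>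
    p \<cdot>\<^sub>v const_vec (mul_mat q *\<^sub>v x) - q \<cdot>\<^sub>v const_vec (mul_mat p *\<^sub>v x) \<in> pencil_span (int l)"
proof (induction l arbitrary: p q x)
  case 0
  then obtain b c where "p = const b" "q = const c" by (metis homog_0_const of_nat_0)
  moreover have "const b \<cdot>\<^sub>v const_vec (mul_mat (const c) *\<^sub>v x) - const c \<cdot>\<^sub>v const_vec (mul_mat (const b) *\<^sub>v x) = 0\<^sub>v N"
    using mul_mat_const_mult_vec[OF 0(3), of c 1] mul_mat_const_mult_vec[OF 0(3), of b 1] 0(3)
    by (intro eq_vecI) (auto simp: const_vec_simps const_vec_def const_hom.hom_mult ac_simps simp del: index_mult_mat_vec)
  ultimately show ?case using pencil_span_zero by simp
next
  case (Suc l)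
  have t: "(a * p) \<cdot>\<^sub>v const_vec (mul_mat (b * q) *\<^sub>v x) - (b * q) \<cdot>\<^sub>v const_vec (mul_mat (a * p) *\<^sub>v x)
      \<in> pencil_span (int (Suc l))"
    if "homog (int l) p" "homog (int l) q" and ab: "a \<in> {X0, X1}" "b \<in> {X0, X1}" for a b p q
  proof -
    have ha: "homog 1 a" using ab by auto
    let ?y = "mul_mat b *\<^sub>v x" and ?z = "mul_mat p *\<^sub>v x"
    have yz: "?y \<in> carrier_vec N" "?z \<in> carrier_vec N" using Suc.prems(3) by auto
    have 1: "a \<cdot>\<^sub>v (p \<cdot>\<^sub>v const_vec (mul_mat q *\<^sub>v ?y) - q \<cdot>\<^sub>v const_vec (mul_mat p *\<^sub>v ?y)) \<in> pencil_span (1 + int l)"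
      by (rule pencil_span_smult[OF ha Suc.IH[OF that(1,2) yz(1)]])
    have 2: "q \<cdot>\<^sub>v (a \<cdot>\<^sub>v const_vec (mul_mat b *\<^sub>v ?z) - b \<cdot>\<^sub>v const_vec (mul_mat a *\<^sub>v ?z)) \<in> pencil_span (int l + 1)"
      by (rule pencil_span_smult[OF that(2) swap_generators[OF yz(2) ab]])
    have e1: "mul_mat (b * q) *\<^sub>v x = mul_mat q *\<^sub>v ?y" "mul_mat (a * p) *\<^sub>v x = mul_mat a *\<^sub>v ?z"
      and e2: "mul_mat p *\<^sub>v ?y = mul_mat b *\<^sub>v ?z"
      using Suc.prems(3) by (simp_all add: mul_mat_mult_mult_vec[symmetric] mult.commute)
    let ?A = "const_vec (mul_mat q *\<^sub>v ?y)" and ?B = "const_vec (mul_mat b *\<^sub>v ?z)" and ?C = "const_vec (mul_mat a *\<^sub>v ?z)"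
    have ABC: "?A \<in> carrier_vec N" "?B \<in> carrier_vec N" "?C \<in> carrier_vec N" using yz by auto
    have "(a * p) \<cdot>\<^sub>v ?A - (b * q) \<cdot>\<^sub>v ?C = a \<cdot>\<^sub>v (p \<cdot>\<^sub>v ?A - q \<cdot>\<^sub>v ?B) + q \<cdot>\<^sub>v (a \<cdot>\<^sub>v ?B - b \<cdot>\<^sub>v ?C)"
      using ABC by (intro eq_vecI) (auto simp: algebra_simps)
    also have "\<dots> \<in> pencil_span (1 + int l)"
      using pencil_span_add[OF 1[unfolded e2]] 2 by (simp add: add.commute)
    finally show ?thesis unfolding e1 by (simp add: add.commute)
  qed
  obtain p0 p1 where p: "homog (int l) p0" "homog (int l) p1" "p = X0 * p0 + X1 * p1"
    using homog_Suc_split[OF Suc.prems(1)] by blast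
  obtain q0 q1 where q: "homog (int l) q0" "homog (int l) q1" "q = X0 * q0 + X1 * q1"
    using homog_Suc_split[OF Suc.prems(2)] by blast
  let ?T = "\<lambda>p q. p \<cdot>\<^sub>v const_vec (mul_mat q *\<^sub>v x) - q \<cdot>\<^sub>v const_vec (mul_mat p *\<^sub>v x)"
  have "?T (p + p') (q + q') = (?T p q + ?T p q') + (?T p' q + ?T p' q')" for p p' q q'
  proof -
    have c: "const_vec (mul_mat a *\<^sub>v x) \<in> carrier_vec N" for a using Suc.prems(3) by simp
    have a: "const_vec (mul_mat (a + b) *\<^sub>v x) = const_vec (mul_mat a *\<^sub>v x) + const_vec (mul_mat b *\<^sub>v x)" for a b
      using Suc.prems(3) by (simp add: mul_mat_add_mult_vec const_vec_simps)
    show ?thesis unfolding a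
      by (rule eq_vecI) (use c[of p] c[of p'] c[of q] c[of q'] in \<open>auto simp: algebra_simps simp del: const_vec_carrier\<close>)
  qed
  then show ?case unfolding p(3) q(3)
    using t[OF p(1) q(1), of X0 X0] t[OF p(1) q(2), of X0 X1] t[OF p(2) q(1), of X1 X0] t[OF p(2) q(2), of X1 X1]
    by (simp add: pencil_span_add)
qed

text \<open>
  The map from \<open>\<O>\<^sup>N\<close> to functions on the subscheme that sends the \<open>i\<close>-th basis vector to the \<open>i\<close>-th basis
  element of the algebra.
\<close>

definition eval_vec :: "'a poly poly vec \<Rightarrow> 'a vec" where
  "eval_vec y = vec N (\<lambda>k. \<Sum>i<N. (mul_mat (y $ i) *\<^sub>v unit_vec N i) $ k)"

lemma eval_vec_carrier [simp]: "eval_vec y \<in> carrier_vec N"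
  by (simp add: eval_vec_def)

text \<open>
  The image of the multiplication pencil is the whole kernel of the evaluation, in degrees
  \<open>l \<ge> N - 1\<close>.  There is a form \<open>u\<close> of degree \<open>l\<close> that restricts to \<open>1\<close>, and
  \<open>y\<^sub>i e\<^sub>i = y\<^sub>i \<cdot> (u e\<^sub>i)\<close> is congruent to \<open>u \<cdot> (y\<^sub>i e\<^sub>i)\<close>.  Summing over \<open>i\<close> gives \<open>u\<close> times the value of
  \<open>y\<close>, which is zero.
\<close>

lemma pencil_spanI:
  assumes y: "homog_vec N (int l) y" and l: "N \<le> l + 1" and ev: "eval_vec y = 0\<^sub>v N"
  shows "y \<in> pencil_span (int l)"
proof -
  have yc: "y \<in> carrier_vec N" and yh: "\<And>i. i < N \<Longrightarrow> homog (int l) (y $ i)"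
    using y by (auto simp: homog_vec_def)
  obtain u where u: "homog (int l) u" "1\<^sub>m N = mul_mat u"
    by (rule mult_algebra_eq_mul_mat[OF mult_algebra_one l])
  define X where "X i = mul_mat (y $ i) *\<^sub>v unit_vec N i" for i
  have Xc: "X i \<in> carrier_vec N" for i by (simp add: X_def)
  define D where "D i = y $ i \<cdot>\<^sub>v const_vec (unit_vec N i) - u \<cdot>\<^sub>v const_vec (X i)" for i
  have Dc: "D i \<in> carrier_vec N" for i using Xc by (simp add: D_def)
  have D: "D i \<in> pencil_span (int l)" if "i < N" for i
    using swap_forms_vec[OF yh[OF that] u(1), of "unit_vec N i"]
    unfolding D_def X_def u(2)[symmetric] by simp
  define V where "V m = vec N (\<lambda>k. \<Sum>i<m. D i $ k)" for m
  have "V m \<in> pencil_span (int l)" if "m \<le> N" for m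
    using that
  proof (induction m)
    case 0
    have "V 0 = 0\<^sub>v N" by (auto simp: V_def)
    then show ?case using pencil_span_zero by simp
  next
    case (Suc m)
    have "V (Suc m) = V m + D m"
      using Dc[of m] by (intro eq_vecI) (auto simp: V_def)
    then show ?case using pencil_span_add[OF Suc.IH D[of m]] Suc.prems by simp
  qed
  then have "V N \<in> pencil_span (int l)" by simp
  moreover have "V N = y"
  proof (rule eq_vecI)
    fix k assume "k < dim_vec y"
    then have k: "k < N" using yc by simp
    have Dk: "D i $ k = y $ i * const (unit_vec N i $ k) - u * const (X i $ k)" for i
      using k Xc[of i] by (simp add: D_def const_vec_def)
    have "(\<Sum>i<N. const (X i $ k)) = const (eval_vec y $ k)"
      using k by (simp only: eval_vec_def index_vec X_def const_hom.hom_sum)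
    also have "\<dots> = 0" using k by (simp add: ev)
    finally have 0: "(\<Sum>i<N. u * const (X i $ k)) = 0"
      by (simp only: sum_distrib_left[symmetric]) simp
    have "V N $ k = (\<Sum>i<N. y $ i * const (unit_vec N i $ k)) - (\<Sum>i<N. u * const (X i $ k))"
      using k by (simp only: V_def index_vec Dk sum_subtractf)
    also have "\<dots> = (\<Sum>i<N. y $ i * const (unit_vec N i $ k))" by (simp only: 0 diff_zero)
    also have "\<dots> = (\<Sum>i<N. if i = k then y $ i else 0)"
      using k by (intro sum.cong refl) (auto simp: const_hom.hom_one)
    also have "\<dots> = y $ k" using k by (simp add: sum.delta)
    finally show "V N $ k = y $ k" .
  qed (use yc in \<open>simp add: V_def\<close>)
  ultimately show ?thesis by simp
qed

lemma eval_vec_const_mat_mult: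
  assumes B: "B \<in> carrier_mat N N" and y: "y \<in> carrier_vec N"
  shows "eval_vec (map_mat const B *\<^sub>v y) = vec N (\<lambda>k. \<Sum>j<N. (mul_mat (y $ j) *\<^sub>v col B j) $ k)"
proof -
  have lin: "(mul_mat (\<Sum>j<m. const (b j) * a j) *\<^sub>v x) $ k = (\<Sum>j<m. b j * (mul_mat (a j) *\<^sub>v x) $ k)"
    if "k < N" "x \<in> carrier_vec N" for m :: nat and b a x k
  proof (induction m)
    case 0
    show ?case using that by (simp add: mul_mat_0 zero_mat_mult_vec)
  next
    case (Suc m)
    have "mul_mat (\<Sum>j<Suc m. const (b j) * a j) *\<^sub>v x
      = mul_mat (\<Sum>j<m. const (b j) * a j) *\<^sub>v x + b m \<cdot>\<^sub>v (mul_mat (a m) *\<^sub>v x)"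
      using that by (simp add: mul_mat_add_mult_vec mul_mat_const_mult_vec)
    then show ?case using that Suc by (simp del: index_mult_mat_vec)
  qed
  have e: "(map_mat const B *\<^sub>v y) $ i = (\<Sum>j<N. const (B $$ (i, j)) * y $ j)" if "i < N" for i
    using that B y by (simp add: scalar_prod_def atLeast0LessThan)
  have col: "(mul_mat a *\<^sub>v col B j) $ k = (\<Sum>i<N. B $$ (i, j) * (mul_mat a *\<^sub>v unit_vec N i) $ k)"
    if "k < N" "j < N" for a j k
  proof -
    have "(mul_mat a *\<^sub>v unit_vec N i) $ k = mul_mat a $$ (k, i)" if "i < N" for i
      using that \<open>k < N\<close> by (simp add: mult_unit_vec_eq_col[of _ N N] del: index_mult_mat_vec)
    then have "(\<Sum>i<N. B $$ (i, j) * (mul_mat a *\<^sub>v unit_vec N i) $ k) = (\<Sum>i<N. B $$ (i, j) * mul_mat a $$ (k, i))"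
      by simp
    then show ?thesis using that B by (simp add: scalar_prod_def atLeast0LessThan mult.commute)
  qed
  show ?thesis
  proof (rule eq_vecI)
    fix k assume "k < dim_vec (vec N (\<lambda>k. \<Sum>j<N. (mul_mat (y $ j) *\<^sub>v col B j) $ k))"
    then have k: "k < N" by simp
    have "eval_vec (map_mat const B *\<^sub>v y) $ k
      = (\<Sum>i<N. \<Sum>j<N. B $$ (i, j) * (mul_mat (y $ j) *\<^sub>v unit_vec N i) $ k)"
      using k by (simp add: eval_vec_def e lin del: index_mult_mat_vec)
    also have "\<dots> = (\<Sum>j<N. (mul_mat (y $ j) *\<^sub>v col B j) $ k)"
      by (subst sum.swap) (simp add: col k del: index_mult_mat_vec)
    finally show "eval_vec (map_mat const B *\<^sub>v y) $ k
      = vec N (\<lambda>k. \<Sum>j<N. (mul_mat (y $ j) *\<^sub>v col B j) $ k) $ k" using k by simp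
  qed simp
qed

end

section \<open>Freeness of the associated sheaf\<close>

lemma twist_sum: "g \<in> forms \<Longrightarrow> (\<And>i. i \<in> A \<Longrightarrow> h i \<in> twist e g) \<Longrightarrow> sum h A \<in> twist e g"
  by (induction A rule: infinite_finite_induct) (auto intro: twist_add twist_zero)

lemma homog_vec_diff: "homog_vec n e v \<Longrightarrow> homog_vec n e w \<Longrightarrow> homog_vec n e (v - w)"
  by (auto simp: homog_vec_def intro!: homog_diff)

lemma (in binary_form) mul_mat_sum_mult_vec:
  assumes "v \<in> carrier_vec N" "k < N"
  shows "(mul_mat (\<Sum>j<m. b j) *\<^sub>v v) $ k = (\<Sum>j<(m::nat). (mul_mat (b j) *\<^sub>v v) $ k)"
proof (induction m)
  case 0
  show ?case using assms by (simp add: mul_mat_0 zero_mat_mult_vec)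
next
  case (Suc m)
  then show ?case using assms by (simp add: mul_mat_add_mult_vec del: index_mult_mat_vec)
qed

lemma (in binary_form) mul_mat_eq_0_if_one_vec:
  assumes "mul_mat a *\<^sub>v one_vec = 0\<^sub>v N"
  shows "mul_mat a = 0\<^sub>m N N"
  using assms mult_algebra_eqI[OF mul_mat_in_algebra mult_algebra_zero] by (simp add: zero_mat_mult_vec)

lemma (in binary_form_scheme) zero_in_S: "g \<in> forms \<Longrightarrow> 0 \<in> S g"
  using additive_subgroup.zero_closed[OF ideal.axioms(1)[OF S_ideal]] by (simp add: regular_simps)

lemma (in binary_form_scheme) S_add: "g \<in> forms \<Longrightarrow> x \<in> S g \<Longrightarrow> y \<in> S g \<Longrightarrow> x + y \<in> S g"
  using additive_subgroup.a_closed[OF ideal.axioms(1)[OF S_ideal]] by (simp add: regular_simps)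

lemma (in binary_form_scheme) S_uminus: "g \<in> forms \<Longrightarrow> x \<in> S g \<Longrightarrow> - x \<in> S g"
proof -
  assume gf: "g \<in> forms" and x: "x \<in> S g"
  have e: "(0\<^sub>m N N :: 'a mat) - 0\<^sub>m N N = 0\<^sub>m N N" by (intro eq_matI) auto
  have "represents g (0 - x) (0\<^sub>m N N - 0\<^sub>m N N)"
    using zero_in_S[OF gf] x unfolding mem_S_iff_represents_zero[OF gf]
    by (intro represents_diff[OF gf]) auto
  then show ?thesis unfolding e mem_S_iff_represents_zero[OF gf] by simp
qed

lemma (in binary_form_scheme) S_coset_eqI:
  assumes gf: "g \<in> forms" and d: "x - y \<in> S g"
  shows "S g +>\<^bsub>regular g\<^esub> x = S g +>\<^bsub>regular g\<^esub> y"
proof -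
  have sub: "{z + x | z. z \<in> S g} \<subseteq> {z + y | z. z \<in> S g}" if "x - y \<in> S g" for x y
  proof
    fix b assume "b \<in> {z + x | z. z \<in> S g}"
    then obtain z where z: "z \<in> S g" "b = z + x" by blast
    have "b = (z + (x - y)) + y" by (simp add: z)
    then show "b \<in> {z + y | z. z \<in> S g}" using S_add[OF gf z(1) that] by blast
  qed
  have "y - x \<in> S g" using S_uminus[OF gf d] by simp
  then show ?thesis unfolding S_coset_eq[OF gf] using sub[OF d] sub by blast
qed

lemma (in binary_form_scheme) represents_sum:
  assumes gf: "g \<in> forms" and r: "\<And>i. i < m \<Longrightarrow> represents g (x i) (mul_mat (a i))"
  shows "represents g (\<Sum>i<(m::nat). x i) (mul_mat (\<Sum>i<m. a i))"
  using r
proof (induction m)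
  case 0
  show ?case using zero_in_S[OF gf] by (simp add: mem_S_iff_represents_zero[OF gf] mul_mat_0)
next
  case (Suc m)
  then show ?case by (simp add: mul_mat_add represents_add[OF gf])
qed

lemma (in binary_form_scheme) represents_const_mult:
  assumes gf: "g \<in> forms" and r: "represents g x (mul_mat a)"
  shows "represents g (Fraction_Field.Fract (const c) 1 * x) (mul_mat (const c * a))"
  using represents_mult[OF gf represents_const[OF gf] r, of c]
  by (simp add: mul_mat_mult mul_mat_const mult_algebra_smult mult_algebra_one)

context pencil_on_scheme
begin

text \<open>
  A matrix relation as in the description of symmetric pairs says that the functions \<open>a\<^sub>i\<close> kill every
  column of the pencil.
\<close>

lemma col_relation:
  assumes j: "j < N"
  shows "col (mul_mat X0 * (basis_mat a * fst M) + mul_mat X1 * (basis_mat a * snd M)) j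
    = mul_mat (\<Sum>i<N. pencil M $$ (i, j) * a i) *\<^sub>v one_vec"
proof -
  have c: "col A j \<in> carrier_vec N" if "A \<in> carrier_mat N N" for A :: "'a mat" using that j by auto
  have m: "col (mul_mat x * (basis_mat a * A)) j
    = mul_mat (x * (\<Sum>i<N. const (A $$ (i, j)) * a i)) *\<^sub>v one_vec" if A: "A \<in> carrier_mat N N" for A x
  proof -
    have "col (mul_mat x * (basis_mat a * A)) j = mul_mat x *\<^sub>v (basis_mat a *\<^sub>v col A j)"
      using A j by (simp add: col_mult2[of _ N N _ N] mat_closed)
    also have "\<dots> = mul_mat (x * (\<Sum>i<N. const (col A j $ i) * a i)) *\<^sub>v one_vec"
      by (simp only: basis_mat_mult_vec[OF c[OF A]] mul_mat_mult_mult_vec[OF one_vec_carrier])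
    also have "(\<Sum>i<N. const (col A j $ i) * a i) = (\<Sum>i<N. const (A $$ (i, j)) * a i)"
      using A j by (intro sum.cong) auto
    finally show ?thesis .
  qed
  have col_add: "col (A + B) j = col A j + col B j" if "A \<in> carrier_mat N N" "B \<in> carrier_mat N N" for A B :: "'a mat"
    using that j by (intro eq_vecI) auto
  have "col (mul_mat X0 * (basis_mat a * fst M) + mul_mat X1 * (basis_mat a * snd M)) j
    = col (mul_mat X0 * (basis_mat a * fst M)) j + col (mul_mat X1 * (basis_mat a * snd M)) j"
    by (intro col_add mat_closed mul_mat_carrier basis_mat_carrier M_carrier)
  also have "\<dots> = mul_mat (X0 * (\<Sum>i<N. const (fst M $$ (i, j)) * a i)
      + X1 * (\<Sum>i<N. const (snd M $$ (i, j)) * a i)) *\<^sub>v one_vec"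
    by (simp only: m[OF M_carrier(1)] m[OF M_carrier(2)] mul_mat_add_mult_vec[OF one_vec_carrier])
  also have "X0 * (\<Sum>i<N. const (fst M $$ (i, j)) * a i) + X1 * (\<Sum>i<N. const (snd M $$ (i, j)) * a i)
    = (\<Sum>i<N. pencil M $$ (i, j) * a i)"
  proof -
    have "X0 * (\<Sum>i<N. const (fst M $$ (i, j)) * a i) + X1 * (\<Sum>i<N. const (snd M $$ (i, j)) * a i)
      = (\<Sum>i<N. X0 * (const (fst M $$ (i, j)) * a i) + X1 * (const (snd M $$ (i, j)) * a i))"
      by (simp only: sum_distrib_left sum.distrib)
    also have "\<dots> = (\<Sum>i<N. pencil M $$ (i, j) * a i)"
      using j by (intro sum.cong refl) (simp add: pencil_index distrib_right mult.assoc)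
    finally show ?thesis .
  qed
  finally show ?thesis .
qed

lemma relation_eq_0_iff:
  "mul_mat X0 * (basis_mat a * fst M) + mul_mat X1 * (basis_mat a * snd M) = 0\<^sub>m N N
    \<longleftrightarrow> (\<forall>j<N. mul_mat (\<Sum>i<N. pencil M $$ (i, j) * a i) = 0\<^sub>m N N)"
proof
  assume "mul_mat X0 * (basis_mat a * fst M) + mul_mat X1 * (basis_mat a * snd M) = 0\<^sub>m N N"
  then show "\<forall>j<N. mul_mat (\<Sum>i<N. pencil M $$ (i, j) * a i) = 0\<^sub>m N N"
    using col_relation[of _ a] by (auto intro!: mul_mat_eq_0_if_one_vec)
next
  assume z: "\<forall>j<N. mul_mat (\<Sum>i<N. pencil M $$ (i, j) * a i) = 0\<^sub>m N N"
  show "mul_mat X0 * (basis_mat a * fst M) + mul_mat X1 * (basis_mat a * snd M) = 0\<^sub>m N N"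
  proof (rule mat_col_eqI)
    fix j assume "j < dim_col (0\<^sub>m N N :: 'a mat)"
    then have j: "j < N" by simp
    then show "col (mul_mat X0 * (basis_mat a * fst M) + mul_mat X1 * (basis_mat a * snd M)) j = col (0\<^sub>m N N) j"
      using z by (simp only: col_relation) (simp add: zero_mat_mult_vec)
  qed (use M_carrier carrier_matD[OF basis_mat_carrier] in auto)
qed

text \<open>
  Over \<open>D\<^sub>+(unit_form)\<close>, which contains the subscheme, let \<open>\<omega>\<close> represent the image of \<open>1\<close> under the
  isomorphism.  Each basis vector is congruent to \<open>x\<^sub>i \<omega>\<close> for a section \<open>x\<^sub>i\<close>, which restricts to
  a function \<open>a\<^sub>i\<close>.  The \<open>a\<^sub>i\<close> kill the columns of the pencil, since these are zero in the cokernel and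
  \<open>\<omega>\<close> has no annihilator outside the ideal.  They are linearly independent, since a linear relation would
  put a constant vector into the image of the pencil.
\<close>

lemma free_imp_SL_act_base_pair:
  assumes free: "assoc_free_rank_one n S M"
  obtains P H where "P \<in> carrier_mat N N" "det P \<noteq> 0" "H \<in> mult_algebra" "M = SL_act P (base_pair H)"
proof -
  let ?u = unit_form
  have uf: "?u \<in> forms" by (rule unit_form)
  obtain d where d: "0 < d" and u: "homog (int d) ?u" "?u \<noteq> 0" using uf by (rule forms_degree)
  obtain \<phi> where hom: "\<phi> ?u \<in> LinearCombinations.module_hom (struct_sheaf S ?u) (self_module S ?u) (assoc_sheaf n M ?u)"
    and bij: "bij_betw (\<phi> ?u) (carrier (self_module S ?u)) (carrier (assoc_sheaf n M ?u))"
    using free uf unfolding assoc_free_rank_one_def by blast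
  let ?q = "\<lambda>x. S ?u +>\<^bsub>regular ?u\<^esub> x"
  have q: "?q x \<in> carrier (self_module S ?u)" "?q x \<in> carrier (struct_sheaf S ?u)" if "x \<in> twist 0 ?u" for x
    using that by (auto simp: self_module_simps struct_sheaf_simps A_RCOSETS_def' regular_simps)
  have "\<phi> ?u (?q 1) \<in> carrier (assoc_sheaf n M ?u)"
    using bij q(1)[OF twist_one[OF uf]] by (auto simp: bij_betw_def)
  then obtain \<omega> where \<omega>: "\<omega> \<in> vec_over N (twist 0 ?u)" "\<phi> ?u (?q 1) = cok_class ?u \<omega>"
    by (auto simp: assoc_sheaf_carrier)
  have \<omega>c: "\<omega> \<in> carrier_vec N" using \<omega> by (simp add: vec_over_def)
  have \<phi>: "\<phi> ?u (?q x) = cok_class ?u (x \<cdot>\<^sub>v \<omega>)" if x: "x \<in> twist 0 ?u" for x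
  proof -
    have "?q x = ?q x \<odot>\<^bsub>self_module S ?u\<^esub> ?q 1"
      using S_coset_mult[OF uf x twist_one[OF uf]] by (simp add: self_module_simps)
    then have "\<phi> ?u (?q x) = ?q x \<odot>\<^bsub>assoc_sheaf n M ?u\<^esub> \<phi> ?u (?q 1)"
      using LinearCombinations.module_hom_smult[OF hom q(2)[OF x] q(1)[OF twist_one[OF uf]]] by simp
    then show ?thesis by (simp add: \<omega> assoc_sheaf_smult[OF uf x \<omega>(1)])
  qed
  have inj: "x \<in> S ?u" if x: "x \<in> twist 0 ?u" and i: "x \<cdot>\<^sub>v \<omega> \<in> im ?u" for x
  proof -
    have "x \<cdot>\<^sub>v \<omega> - 0 \<cdot>\<^sub>v \<omega> = x \<cdot>\<^sub>v \<omega>" using \<omega>c by (intro eq_vecI) auto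
    then have "cok_class ?u (x \<cdot>\<^sub>v \<omega>) = cok_class ?u (0 \<cdot>\<^sub>v \<omega>)"
      using \<omega>c i by (subst cok_class_eq_iff[OF uf]) auto
    then have "\<phi> ?u (?q x) = \<phi> ?u (?q 0)" by (simp add: \<phi> x twist_zero[OF uf])
    then have "?q x = ?q 0"
      using bij q(1) x twist_zero[OF uf] by (auto simp: bij_betw_def inj_on_def)
    moreover have "x \<in> ?q x" using zero_in_S[OF uf] by (force simp: S_coset_eq[OF uf])
    ultimately show ?thesis by (auto simp: S_coset_eq[OF uf])
  qed
  let ?e = "\<lambda>i. unit_vec N i :: 'a poly poly fract vec"
  have "\<exists>x a. x \<in> twist 0 ?u \<and> ?e i - x \<cdot>\<^sub>v \<omega> \<in> im ?u \<and> represents ?u x (mul_mat a)" if i: "i < N" for i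
  proof -
    have "?e i \<in> vec_over N (twist 0 ?u)"
      using i twist_one[OF uf] twist_zero[OF uf] by (auto simp: vec_over_def unit_vec_def)
    then have "cok_class ?u (?e i) \<in> \<phi> ?u ` carrier (self_module S ?u)"
      using bij by (auto simp: bij_betw_def assoc_sheaf_carrier)
    then obtain x where x: "x \<in> twist 0 ?u" "cok_class ?u (?e i) = \<phi> ?u (?q x)"
      by (auto simp: self_module_simps A_RCOSETS_def' regular_simps)
    then have "?e i - x \<cdot>\<^sub>v \<omega> \<in> im ?u"
      using \<omega>c \<phi> by (subst cok_class_eq_iff[OF uf, symmetric]) auto
    moreover obtain Z where Z: "Z \<in> mult_algebra" "represents ?u x Z" using ex_represented_by[OF x(1)] .
    moreover obtain a where "Z = mul_mat a" using mult_algebra_eq_mul_mat[OF Z(1) le_add1] by blast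
    ultimately show ?thesis using x(1) by blast
  qed
  then obtain x a where xa: "\<And>i. i < N \<Longrightarrow> x i \<in> twist 0 ?u"
    "\<And>i. i < N \<Longrightarrow> ?e i - x i \<cdot>\<^sub>v \<omega> \<in> im ?u" "\<And>i. i < N \<Longrightarrow> represents ?u (x i) (mul_mat (a i))"
    by metis
  \<comment> \<open>every section of the free module is congruent to a multiple of the generator\<close>
  have reduce: "y - (\<Sum>i<N. y $ i * x i) \<cdot>\<^sub>v \<omega> \<in> im ?u" if y: "y \<in> vec_over N (twist 0 ?u)" for y
  proof -
    have yc: "y \<in> carrier_vec N" and yt: "\<And>i. i < N \<Longrightarrow> y $ i \<in> twist 0 ?u" using y by (auto simp: vec_over_def)
    define V where "V m = vec N (\<lambda>k. \<Sum>i<m. y $ i * (?e i - x i \<cdot>\<^sub>v \<omega>) $ k)" for m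
    have "V m \<in> im ?u" if "m \<le> N" for m
      using that
    proof (induction m)
      case 0
      have "V 0 = 0\<^sub>v N" by (auto simp: V_def)
      then show ?case using im_zero[OF uf] by simp
    next
      case (Suc m)
      have "V (Suc m) = V m + y $ m \<cdot>\<^sub>v (?e m - x m \<cdot>\<^sub>v \<omega>)"
        using \<omega>c by (intro eq_vecI) (auto simp: V_def)
      then show ?case using Suc im_add[OF uf _ im_smult[OF uf yt xa(2)]] by simp
    qed
    then have "V N \<in> im ?u" by simp
    moreover have "V N = y - (\<Sum>i<N. y $ i * x i) \<cdot>\<^sub>v \<omega>"
    proof (rule eq_vecI)
      fix k assume "k < dim_vec (y - (\<Sum>i<N. y $ i * x i) \<cdot>\<^sub>v \<omega>)"
      then have k: "k < N" using \<omega>c by simp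
      have "V N $ k = (\<Sum>i<N. (if i = k then y $ i else 0) - y $ i * x i * \<omega> $ k)"
        using k \<omega>c by (auto simp: V_def algebra_simps intro!: sum.cong)
      also have "\<dots> = y $ k - (\<Sum>i<N. y $ i * x i) * \<omega> $ k"
        using k by (simp add: sum_subtractf sum_distrib_right sum.delta)
      finally show "V N $ k = (y - (\<Sum>i<N. y $ i * x i) \<cdot>\<^sub>v \<omega>) $ k" using k \<omega>c yc by simp
    qed (use \<omega>c in \<open>simp add: V_def\<close>)
    ultimately show ?thesis by simp
  qed
  have im_imp: "(\<Sum>i<N. y $ i * x i) \<in> S ?u" if y: "y \<in> im ?u" for y
  proof (rule inj)
    have yv: "y \<in> vec_over N (twist 0 ?u)" using im_subset_vec_over[OF uf y] .
    then have yt: "\<And>i. i < N \<Longrightarrow> y $ i \<in> twist 0 ?u" by (auto simp: vec_over_def)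
    show "(\<Sum>i<N. y $ i * x i) \<in> twist 0 ?u"
      using twist_mult[OF uf yt xa(1)] by (intro twist_sum[OF uf]) auto
    have "y - (y - (\<Sum>i<N. y $ i * x i) \<cdot>\<^sub>v \<omega>) \<in> im ?u" by (rule im_diff[OF uf y reduce[OF yv]])
    moreover have "y - (y - (\<Sum>i<N. y $ i * x i) \<cdot>\<^sub>v \<omega>) = (\<Sum>i<N. y $ i * x i) \<cdot>\<^sub>v \<omega>"
      using vec_over_carrier[OF yv] \<omega>c by (intro eq_vecI) auto
    ultimately show "(\<Sum>i<N. y $ i * x i) \<cdot>\<^sub>v \<omega> \<in> im ?u" by simp
  qed
  have "det (basis_mat a) \<noteq> 0"
  proof
    assume "det (basis_mat a) = 0"
    then obtain v where v: "v \<in> carrier_vec N" "v \<noteq> 0\<^sub>v N" "basis_mat a *\<^sub>v v = 0\<^sub>v N"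
      using det_0_iff_vec_prod_zero_field[OF basis_mat_carrier] by blast
    then have z: "mul_mat (\<Sum>i<N. const (v $ i) * a i) = 0\<^sub>m N N"
      by (intro mul_mat_eq_0_if_one_vec) (simp add: basis_mat_mult_vec[symmetric])
    define y where "y = frac_vec ?u 0 (const_vec v)"
    have yi: "y $ i = Fraction_Field.Fract (const (v $ i)) 1" if "i < N" for i
      using that v by (simp add: y_def frac_vec_def const_vec_def)
    have yv: "y \<in> vec_over N (twist 0 ?u)"
      using yi Fract_const_in_twist[OF uf] v by (auto simp: vec_over_def y_def frac_vec_def const_vec_def)
    have "represents ?u (\<Sum>i<N. y $ i * x i) (mul_mat (\<Sum>i<N. const (v $ i) * a i))"
      by (rule represents_sum[OF uf]) (use yi represents_const_mult[OF uf xa(3)] in auto)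
    then have "(\<Sum>i<N. y $ i * x i) \<in> S ?u" by (simp add: z mem_S_iff_represents_zero[OF uf])
    then have "(\<Sum>i<N. y $ i * x i) \<cdot>\<^sub>v \<omega> \<in> im ?u" by (rule S_annihilates[OF uf _ \<omega>(1)])
    then have "(y - (\<Sum>i<N. y $ i * x i) \<cdot>\<^sub>v \<omega>) + (\<Sum>i<N. y $ i * x i) \<cdot>\<^sub>v \<omega> \<in> im ?u"
      by (rule im_add[OF uf reduce[OF yv]])
    moreover have "(y - (\<Sum>i<N. y $ i * x i) \<cdot>\<^sub>v \<omega>) + (\<Sum>i<N. y $ i * x i) \<cdot>\<^sub>v \<omega> = y"
      using vec_over_carrier[OF yv] \<omega>c by (intro eq_vecI) auto
    ultimately have "y \<in> im ?u" by simp
    then show False using const_vec_in_im[OF v(1)] v(2) by (simp add: y_def)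
  qed
  moreover have "mul_mat X0 * (basis_mat a * fst M) + mul_mat X1 * (basis_mat a * snd M) = 0\<^sub>m N N"
    unfolding relation_eq_0_iff
  proof (intro allI impI)
    fix j assume j: "j < N"
    \<comment> \<open>a large exponent makes room for a form restricting to 1\<close>
    define m where "m = N + 1"
    have "0 < m * d" using d by (simp add: m_def)
    moreover have "N \<le> m * d - 1 + 1" using d by (cases d) (auto simp: m_def)
    ultimately obtain c where c: "homog (int (m * d - 1)) c" "1\<^sub>m N = mul_mat c"
      using mult_algebra_eq_mul_mat[OF mult_algebra_one] by metis
    define w where "w = c \<cdot>\<^sub>v unit_vec N j"
    have "homog_vec N 0 (unit_vec N j :: 'a poly poly vec)" by (auto simp: homog_vec_def unit_vec_def)
    then have "homog_vec N (int (m * d - 1) + 0) w" unfolding w_def by (rule homog_vec_smult[OF c(1)])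
    then have w: "homog_vec N (int (m * d) - 1) w" using \<open>0 < m * d\<close> by (simp add: of_nat_diff)
    have pw: "pencil M *\<^sub>v w = c \<cdot>\<^sub>v col (pencil M) j"
      using j pencil_carrier by (simp add: w_def mult_mat_smult_vec[of _ N N] mult_unit_vec_eq_col[of _ N N])
    have pwc: "pencil M *\<^sub>v w \<in> carrier_vec N" using pencil_carrier j by (simp add: pw)
    define y where "y = frac_vec ?u m (pencil M *\<^sub>v w)"
    have "y \<in> im ?u"
      unfolding y_def im_iff[OF u pwc] using w by (intro exI[of _ 0] exI[of _ w]) simp
    have "represents ?u (y $ i * x i) (mul_mat (pencil M $$ (i, j) * a i))" if i: "i < N" for i
    proof -
      have yi: "y $ i = Fraction_Field.Fract (c * pencil M $$ (i, j)) (?u ^ m)"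
        using i j pencil_carrier by (simp add: y_def frac_vec_def pw)
      have "homog (int (m * d - 1) + 1) (c * pencil M $$ (i, j))"
        by (rule homog_mult[OF c(1) homog_pencil[OF i j]])
      then have "homog (int (m * d)) (c * pencil M $$ (i, j))" using \<open>0 < m * d\<close> by (simp add: of_nat_diff)
      moreover have "mul_mat (c * pencil M $$ (i, j)) = mul_mat (pencil M $$ (i, j)) * mul_mat (?u ^ m)"
        by (simp add: mul_mat_mult c(2)[symmetric] mul_mat_unit_form_power left_mult_one_mat[of _ N N] right_mult_one_mat[of _ N N])
      ultimately have "represents ?u (y $ i) (mul_mat (pencil M $$ (i, j)))"
        unfolding represents_iff[OF u] using yi by blast
      from represents_mult[OF uf this xa(3)[OF i]] show ?thesis by (simp add: mul_mat_mult)
    qed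
    then have "represents ?u (\<Sum>i<N. y $ i * x i) (mul_mat (\<Sum>i<N. pencil M $$ (i, j) * a i))"
      by (rule represents_sum[OF uf])
    moreover have "represents ?u (\<Sum>i<N. y $ i * x i) (0\<^sub>m N N)"
      using im_imp[OF \<open>y \<in> im ?u\<close>] by (simp add: mem_S_iff_represents_zero[OF uf])
    ultimately show "mul_mat (\<Sum>i<N. pencil M $$ (i, j) * a i) = 0\<^sub>m N N"
      by (rule represents_unit_form_unique) auto
  qed
  moreover have "(fst M)\<^sup>T = fst M" "(snd M)\<^sup>T = snd M" using M by (auto simp: sym_pairs_def)
  ultimately obtain P H where "P \<in> carrier_mat N N" "det P \<noteq> 0" "H \<in> mult_algebra"
    "(fst M, snd M) = SL_act P (base_pair H)"
    using symmetric_pair_is_SL_act_base_pair[OF M_carrier(1) _ M_carrier(2) _ basis_mat_carrier] by blast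
  with that show ?thesis by simp
qed

text \<open>
  The columns of \<open>Z = (P\<^sup>T gram)\<^sup>-\<^sup>1\<close> are functions \<open>a\<^sub>i\<close> that kill the columns of the pencil, so
  \<open>y \<mapsto> \<Sum> y\<^sub>i a\<^sub>i\<close> is a well-defined map from the cokernel to functions.  It sends the constant vector
  \<open>c1 = P\<^sup>T gram 1\<close> to \<open>1\<close>.  Therefore multiples of \<open>c1\<close> give an injective map from the structure sheaf of the
  subscheme to the cokernel, and it is surjective because the kernel of \<open>y \<mapsto> \<Sum> y\<^sub>i a\<^sub>i\<close> is no larger than
  the image of the pencil.
\<close>

lemma SL_act_base_pair_imp_free:
  assumes P: "P \<in> carrier_mat N N" "det P \<noteq> 0" and H: "H \<in> mult_algebra" "det H \<noteq> 0"
    and MPH: "M = SL_act P (base_pair H)"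
  shows "assoc_free_rank_one n S M"
proof -
  have Hc: "H \<in> carrier_mat N N" using H by (simp add: mult_algebra_carrier)
  define G where "G = P\<^sup>T * gram"
  have G: "G \<in> carrier_mat N N" "det G \<noteq> 0"
    using P det_gram_nonzero by (auto simp: G_def mat_closed det_mult[of _ N] det_transpose[of _ N])
  obtain Z where Z: "Z \<in> carrier_mat N N" "G * Z = 1\<^sub>m N" "Z * G = 1\<^sub>m N" using ex_inverse_mat[OF G] .
  obtain Hi where Hi: "Hi \<in> carrier_mat N N" "H * Hi = 1\<^sub>m N" "Hi * H = 1\<^sub>m N" using ex_inverse_mat[OF Hc H(2)] .
  obtain Pi where Pi: "Pi \<in> carrier_mat N N" "P * Pi = 1\<^sub>m N" "Pi * P = 1\<^sub>m N" using ex_inverse_mat[OF P] .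
  have "Hi \<in> mult_algebra" by (rule mult_algebra_inverse[OF H(1) Hi])
  then obtain hi where hi: "Hi = mul_mat hi" using mult_algebra_eq_mul_mat[OF _ le_add1] by blast
  have "\<exists>b. mul_mat b *\<^sub>v one_vec = col Z i" for i
  proof -
    have "col Z i \<in> carrier_vec N" using Z by auto
    from homog_of_one_vec[OF le_add1 this] show ?thesis by blast
  qed
  then obtain a where a: "\<And>i. mul_mat (a i) *\<^sub>v one_vec = col Z i" by metis
  have bZ: "basis_mat a = Z"
    using Z by (intro eq_matI) (auto simp: basis_mat_def a simp del: index_mult_mat_vec)
  have neg: "A * - B = - (A * B)" "- A * B = - (A * B)" if "A \<in> carrier_mat N N" "B \<in> carrier_mat N N" for A B :: "'a mat"
    using that by (auto intro!: eq_matI)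
  have fM: "fst M = G * (H * mul_mat X1 * P)" "snd M = - (G * (H * mul_mat X0 * P))"
    using P Hc by (simp_all add: MPH SL_act_def base_pair_def G_def neg mat_closed mat_assoc)
  have rel: "mul_mat (\<Sum>i<N. pencil M $$ (i, j) * a i) = 0\<^sub>m N N" if "j < N" for j
  proof -
    have plus_uminus: "B + - B = 0\<^sub>m N N" if "B \<in> carrier_mat N N" for B :: "'a mat"
      using that by (intro eq_matI) auto
    have ZG: "Z * (G * B) = B" if "B \<in> carrier_mat N N" for B
      using that Z G by (simp add: mat_assoc[symmetric])
    have "mul_mat X0 * (Z * fst M) + mul_mat X1 * (Z * snd M)
      = mul_mat X0 * (H * mul_mat X1 * P) + - (mul_mat X1 * (H * mul_mat X0 * P))"
      using Hc P Z G by (simp add: fM neg ZG mat_closed)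
    also have "mul_mat X1 * (H * mul_mat X0 * P) = mul_mat X0 * (H * mul_mat X1 * P)"
    proof -
      have "mul_mat X1 * (H * mul_mat X0 * P) = H * (mul_mat X1 * mul_mat X0) * P"
        using Hc P by (simp add: mat_assoc[symmetric] mat_closed mult_algebra_commute_mul_mat[OF H(1), symmetric])
      also have "\<dots> = H * (mul_mat X0 * mul_mat X1) * P" by (simp add: mul_mat_commute)
      also have "\<dots> = mul_mat X0 * (H * mul_mat X1 * P)"
        using Hc P by (simp add: mat_assoc[symmetric] mat_closed mult_algebra_commute_mul_mat[OF H(1), symmetric])
      finally show ?thesis .
    qed
    also have "mul_mat X0 * (H * mul_mat X1 * P) + - (mul_mat X0 * (H * mul_mat X1 * P)) = 0\<^sub>m N N"
      by (rule plus_uminus) (use Hc P in \<open>simp add: mat_closed\<close>)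
    finally show ?thesis using relation_eq_0_iff[of a] that by (simp add: bZ)
  qed
  define c1 where "c1 = G *\<^sub>v one_vec"
  have c1: "c1 \<in> carrier_vec N" unfolding c1_def by (rule mult_mat_vec_carrier[OF G(1) one_vec_carrier])
  have "mul_mat (\<Sum>i<N. const (c1 $ i) * a i) *\<^sub>v one_vec = Z *\<^sub>v c1"
    by (simp add: basis_mat_mult_vec[OF c1, symmetric] bZ)
  also have "\<dots> = one_vec" using Z G by (simp add: c1_def assoc_mult_mat_vec[of _ N N _ N, symmetric])
  finally have one: "mul_mat (\<Sum>i<N. const (c1 $ i) * a i) = 1\<^sub>m N"
    by (intro mult_algebra_eqI mul_mat_in_algebra mult_algebra_one) simp
  define \<omega> where "\<omega> = map_vec (\<lambda>p. Fraction_Field.Fract p 1) (const_vec c1)"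
  have \<omega>c: "\<omega> \<in> carrier_vec N" using c1 by (simp add: \<omega>_def const_vec_def)
  have \<omega>v: "\<omega> \<in> vec_over N (twist 0 g)" if "g \<in> forms" for g
    using c1 Fract_const_in_twist[OF that] by (auto simp: vec_over_def \<omega>_def const_vec_def)
  have frac: "frac_vec g m (c \<cdot>\<^sub>v const_vec c1) = Fraction_Field.Fract c (g ^ m) \<cdot>\<^sub>v \<omega>" for g m c
    by (intro eq_vecI) (auto simp: frac_vec_def \<omega>_def const_vec_def)
  \<comment> \<open>the image of the pencil is the kernel of the evaluation map\<close>
  have exact: "\<exists>w. homog_vec N (int l - 1) w \<and> y = pencil M *\<^sub>v w"
    if y: "homog_vec N (int l) y" and l: "N \<le> l + 1" and z: "mul_mat (\<Sum>i<N. y $ i * a i) = 0\<^sub>m N N" for y l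
  proof -
    let ?c = "map_mat const"
    have yc: "y \<in> carrier_vec N" using y by (simp add: homog_vec_def)
    define B where "B = Hi * Z"
    have B: "B \<in> carrier_mat N N" using Hi Z by (simp add: B_def mat_closed)
    have GHB: "(G * H) * B = 1\<^sub>m N"
    proof -
      have "(G * H) * B = G * ((H * Hi) * Z)" using G Hc Hi(1) Z(1) by (simp add: B_def mat_assoc mat_closed)
      then show ?thesis using Hi Z by simp
    qed
    have Bcol: "mul_mat (y $ j) *\<^sub>v col B j = mul_mat (hi * (y $ j * a j)) *\<^sub>v one_vec" if "j < N" for j
    proof -
      have "col B j = Hi *\<^sub>v col Z j" unfolding B_def by (rule col_mult2[OF Hi(1) Z(1) that])
      then have "mul_mat (y $ j) *\<^sub>v col B j = mul_mat (y $ j * (hi * a j)) *\<^sub>v one_vec"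
        by (simp add: hi a[symmetric] mul_mat_mult_mult_vec)
      then show ?thesis by (simp add: ac_simps)
    qed
    have "eval_vec (?c B *\<^sub>v y) = mul_mat (\<Sum>j<N. hi * (y $ j * a j)) *\<^sub>v one_vec"
      unfolding eval_vec_const_mat_mult[OF B yc]
      by (rule eq_vecI) (simp_all add: mul_mat_sum_mult_vec Bcol del: index_mult_mat_vec)
    also have "\<dots> = 0\<^sub>v N"
      using z by (simp add: sum_distrib_left[symmetric] mul_mat_mult right_mult_zero_mat[of _ N N] zero_mat_mult_vec)
    finally have ev: "eval_vec (?c B *\<^sub>v y) = 0\<^sub>v N" .
    have "homog_vec N (0 + int l) (?c B *\<^sub>v y)"
      using B by (intro homog_vec_mult y) auto
    then have "?c B *\<^sub>v y \<in> pencil_span (int l)"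
      using pencil_spanI[OF _ l ev] by simp
    then obtain w where w: "homog_vec N (int l - 1) w" "?c B *\<^sub>v y = mult_pencil *\<^sub>v w"
      by (auto simp: pencil_span_def)
    have wc: "w \<in> carrier_vec N" using w by (simp add: homog_vec_def)
    have cc: "?c A \<in> carrier_mat N N" if "A \<in> carrier_mat N N" for A using that by simp
    have GH: "G * H \<in> carrier_mat N N" using G Hc by (simp add: mat_closed)
    have c_mult: "?c A * ?c A' = ?c (A * A')" if "A \<in> carrier_mat N N" "A' \<in> carrier_mat N N" for A A'
      using that by (simp add: const_hom.mat_hom_mult[of _ N N _ N])
    have c_one: "?c (1\<^sub>m N) = 1\<^sub>m N" by (simp add: const_hom.mat_hom_one)
    have pen: "pencil M = ?c (G * H) * mult_pencil * ?c P"
    proof -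
      have "(?c P)\<^sup>T = ?c (P\<^sup>T)" by (auto intro!: eq_matI)
      then have "pencil M = ?c (P\<^sup>T) * (?c (gram * H) * mult_pencil) * ?c P"
        unfolding MPH pencil_SL_act[OF base_pair_carrier[OF Hc] P(1)] pencil_base_pair[OF Hc]
        by (simp add: base_pair_def)
      also have "?c (P\<^sup>T) * (?c (gram * H) * mult_pencil) = ?c (P\<^sup>T) * ?c (gram * H) * mult_pencil"
        using P Hc by (intro assoc_mult_mat[symmetric, of _ N N _ N _ N]) (auto simp: mat_closed)
      also have "?c (P\<^sup>T) * ?c (gram * H) = ?c (G * H)"
        using P Hc by (simp add: c_mult mat_closed G_def mat_assoc)
      finally show ?thesis .
    qed
    have "pencil M *\<^sub>v (?c Pi *\<^sub>v w) = ?c (G * H) *\<^sub>v (mult_pencil *\<^sub>v ((?c P * ?c Pi) *\<^sub>v w))"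
      unfolding pen using cc[OF GH] cc[OF P(1)] cc[OF Pi(1)] wc mult_pencil_carrier
      by (simp add: assoc_mult_mat_vec[of _ N N _ N] mult_carrier_mat[of _ N N])
    also have "\<dots> = ?c (G * H) *\<^sub>v (?c B *\<^sub>v y)" using P Pi wc w by (simp add: c_mult c_one)
    also have "\<dots> = (?c (G * H) * ?c B) *\<^sub>v y"
      using cc[OF GH] cc[OF B] yc by (simp add: assoc_mult_mat_vec[of _ N N _ N])
    also have "\<dots> = y" using GH B yc by (simp only: c_mult GHB c_one one_mult_mat_vec)
    finally have "y = pencil M *\<^sub>v (?c Pi *\<^sub>v w)" by simp
    moreover have "homog_vec N (0 + (int l - 1)) (?c Pi *\<^sub>v w)"
      using Pi by (intro homog_vec_mult w) auto
    ultimately show ?thesis by auto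
  qed
  have inj: "x \<in> S g" if gf: "g \<in> forms" and x: "x \<in> twist 0 g" and i: "x \<cdot>\<^sub>v \<omega> \<in> im g" for g x
  proof -
    obtain d where g: "homog (int d) g" "g \<noteq> 0" using gf by (rule forms_degree)
    obtain c m where c: "homog (int (m * d)) c" "x = Fraction_Field.Fract c (g ^ m)"
      using x unfolding twist_iff[OF g] by auto
    have cc: "c \<cdot>\<^sub>v const_vec c1 \<in> carrier_vec N" using c1 by simp
    obtain k w where w: "homog_vec N (int ((m + k) * d) - 1) w" "g ^ k \<cdot>\<^sub>v (c \<cdot>\<^sub>v const_vec c1) = pencil M *\<^sub>v w"
      using i unfolding c(2) frac[symmetric] im_iff[OF g cc] by blast
    have wc: "w \<in> carrier_vec N" using w by (simp add: homog_vec_def)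
    have e: "g ^ k * (c * const (c1 $ i)) = (\<Sum>j<N. pencil M $$ (i, j) * w $ j)" if "i < N" for i
      using arg_cong[OF w(2), of "\<lambda>v. v $ i"] that c1 wc pencil_carrier
      by (simp add: const_vec_def scalar_prod_def atLeast0LessThan)
    have "c * g ^ k * (\<Sum>i<N. const (c1 $ i) * a i) = (\<Sum>i<N. g ^ k * (c * const (c1 $ i)) * a i)"
      by (simp add: sum_distrib_left ac_simps)
    also have "\<dots> = (\<Sum>i<N. \<Sum>j<N. w $ j * (pencil M $$ (i, j) * a i))"
    proof (intro sum.cong refl)
      fix i assume "i \<in> {..<N}"
      then have "g ^ k * (c * const (c1 $ i)) * a i = (\<Sum>j<N. pencil M $$ (i, j) * w $ j) * a i"
        by (simp only: e lessThan_iff)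
      also have "\<dots> = (\<Sum>j<N. w $ j * (pencil M $$ (i, j) * a i))"
        unfolding sum_distrib_right by (intro sum.cong refl) (simp only: ac_simps)
      finally show "g ^ k * (c * const (c1 $ i)) * a i = (\<Sum>j<N. w $ j * (pencil M $$ (i, j) * a i))" .
    qed
    also have "\<dots> = (\<Sum>j<N. w $ j * (\<Sum>i<N. pencil M $$ (i, j) * a i))"
      by (subst sum.swap) (simp add: sum_distrib_left)
    finally have s: "c * g ^ k * (\<Sum>i<N. const (c1 $ i) * a i) = (\<Sum>j<N. w $ j * (\<Sum>i<N. pencil M $$ (i, j) * a i))" .
    have "mul_mat (\<Sum>j<m. w $ j * (\<Sum>i<N. pencil M $$ (i, j) * a i)) = 0\<^sub>m N N" if "m \<le> N" for m
      using that by (induction m) (simp_all add: mul_mat_0 mul_mat_add mul_mat_mult rel right_mult_zero_mat[of _ N N])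
    from this[of N] have "mul_mat (c * g ^ k * (\<Sum>i<N. const (c1 $ i) * a i)) = 0\<^sub>m N N" by (simp add: s)
    then have z: "mul_mat (c * g ^ k) = 0\<^sub>m N N"
      using one by (simp only: mul_mat_mult[of "c * g ^ k"] right_mult_one_mat[OF mul_mat_carrier])
    have "homog (0 + int (m * d)) c" using c by simp
    note t = twist_raise[OF g this, of k]
    have "represents g x (0\<^sub>m N N)"
      unfolding represents_iff[OF g]
    proof (intro exI conjI)
      show "homog (int ((m + k) * d)) (c * g ^ k)" using t(1) by simp
      show "x = Fraction_Field.Fract (c * g ^ k) (g ^ (m + k))" using t(2) c(2) by simp
      show "mul_mat (c * g ^ k) = 0\<^sub>m N N * mul_mat (g ^ (m + k))" using z by (simp add: left_mult_zero_mat[of _ N N])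
    qed
    then show ?thesis by (simp add: mem_S_iff_represents_zero[OF gf])
  qed
  have surj: "\<exists>x\<in>twist 0 g. v - x \<cdot>\<^sub>v \<omega> \<in> im g" if gf: "g \<in> forms" and v: "v \<in> vec_over N (twist 0 g)" for g v
  proof -
    obtain d where d: "0 < d" and g: "homog (int d) g" "g \<noteq> 0" using gf by (rule forms_degree)
    obtain m0 w0 where w0: "homog_vec N (0 + int (m0 * d)) w0" "v = frac_vec g m0 w0"
      using v unfolding vec_over_twist_iff[OF g] by blast
    define m where "m = m0 + N"
    define w where "w = g ^ N \<cdot>\<^sub>v w0"
    have vw: "v = frac_vec g m w" using frac_vec_raise[OF g(2), of m0 N w0] w0 by (simp add: m_def w_def)
    have "homog_vec N (int N * int d + (0 + int (m0 * d))) w"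
      unfolding w_def by (rule homog_vec_smult[OF homog_power[OF g(1)] w0(1)])
    then have w: "homog_vec N (int (m * d)) w" by (simp add: m_def algebra_simps)
    have wc: "w \<in> carrier_vec N" using w by (simp add: homog_vec_def)
    have "N * 1 \<le> N * d" using d by (intro mult_le_mono) auto
    moreover have "m * d = m0 * d + N * d" by (simp add: m_def add_mult_distrib)
    ultimately have l: "N \<le> m * d + 1" by linarith
    obtain c where c: "homog (int (m * d)) c" "mul_mat (\<Sum>i<N. w $ i * a i) = mul_mat c"
      by (rule mult_algebra_eq_mul_mat[OF mul_mat_in_algebra l])
    define x where "x = Fraction_Field.Fract c (g ^ m)"
    have x: "x \<in> twist 0 g" unfolding x_def twist_iff[OF g] using c(1) by (intro exI[of _ c] exI[of _ m]) simp
    define y where "y = w - c \<cdot>\<^sub>v const_vec c1"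
    have y: "homog_vec N (int (m * d)) y"
    proof -
      have "homog_vec N (int (m * d) + 0) (c \<cdot>\<^sub>v const_vec c1)"
        by (rule homog_vec_smult[OF c(1) homog_const_vec[OF c1]])
      with w show ?thesis unfolding y_def by (intro homog_vec_diff) simp_all
    qed
    have yc: "y \<in> carrier_vec N" using y by (simp add: homog_vec_def)
    have "(\<Sum>i<N. y $ i * a i) = (\<Sum>i<N. w $ i * a i - c * (const (c1 $ i) * a i))"
      using c1 wc by (intro sum.cong refl) (simp add: y_def const_vec_def left_diff_distrib mult.assoc)
    also have "\<dots> = (\<Sum>i<N. w $ i * a i) - c * (\<Sum>i<N. const (c1 $ i) * a i)"
      by (simp only: sum_subtractf sum_distrib_left)
    finally have "(\<Sum>i<N. y $ i * a i) + c * (\<Sum>i<N. const (c1 $ i) * a i) = (\<Sum>i<N. w $ i * a i)"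
      by (simp only: diff_add_cancel)
    from arg_cong[OF this, of mul_mat]
    have e: "mul_mat (\<Sum>i<N. y $ i * a i) + mul_mat c = mul_mat c"
      by (simp only: mul_mat_add mul_mat_mult[of c] one c(2) right_mult_one_mat[OF mul_mat_carrier])
    have "mul_mat (\<Sum>i<N. y $ i * a i) = 0\<^sub>m N N"
    proof (rule eq_matI)
      fix i j assume "i < dim_row (0\<^sub>m N N :: 'a mat)" "j < dim_col (0\<^sub>m N N :: 'a mat)"
      then show "mul_mat (\<Sum>i<N. y $ i * a i) $$ (i, j) = 0\<^sub>m N N $$ (i, j)"
        using arg_cong[OF e, of "\<lambda>A. A $$ (i, j)"] by simp
    qed simp_all
    from exact[OF y l this] obtain w' where "homog_vec N (int (m * d) - 1) w'" "y = pencil M *\<^sub>v w'" by blast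
    then have "frac_vec g m y \<in> im g"
      unfolding im_iff[OF g yc] by (intro exI[of _ 0] exI[of _ w']) simp
    moreover have "frac_vec g m y = v - x \<cdot>\<^sub>v \<omega>"
    proof -
      have sub: "Fraction_Field.Fract (p - q) (g ^ m) = Fraction_Field.Fract p (g ^ m) - Fraction_Field.Fract q (g ^ m)" for p q
        using g(2) Fract_cancel[of "g ^ m" "p - q" "g ^ m"] by (simp add: left_diff_distrib)
      have "frac_vec g m y = frac_vec g m w - frac_vec g m (c \<cdot>\<^sub>v const_vec c1)"
        using wc c1 by (intro eq_vecI) (auto simp: y_def frac_vec_def sub)
      then show ?thesis by (simp add: vw frac x_def)
    qed
    ultimately show ?thesis using x by auto
  qed
  let ?q = "\<lambda>g x. S g +>\<^bsub>regular g\<^esub> x"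
  define \<phi> where "\<phi> g A = (\<Union>x\<in>A. cok_class g (x \<cdot>\<^sub>v \<omega>))" for g A
  have \<phi>: "\<phi> g (?q g x) = cok_class g (x \<cdot>\<^sub>v \<omega>)" if gf: "g \<in> forms" for g x
  proof -
    have "cok_class g ((z + x) \<cdot>\<^sub>v \<omega>) = cok_class g (x \<cdot>\<^sub>v \<omega>)" if "z \<in> S g" for z
    proof -
      have "(z + x) \<cdot>\<^sub>v \<omega> - x \<cdot>\<^sub>v \<omega> = z \<cdot>\<^sub>v \<omega>" using \<omega>c by (intro eq_vecI) (auto simp: algebra_simps)
      then show ?thesis using S_annihilates[OF gf that \<omega>v[OF gf]] \<omega>c by (subst cok_class_eq_iff[OF gf]) auto
    qed
    then show ?thesis using zero_in_S[OF gf] unfolding \<phi>_def S_coset_eq[OF gf] by auto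
  qed
  have car: "carrier (self_module S g) = ?q g ` twist 0 g" for g
    by (auto simp: self_module_simps A_RCOSETS_def' regular_simps)
  have xv: "x \<cdot>\<^sub>v \<omega> \<in> vec_over N (twist 0 g)" if "g \<in> forms" "x \<in> twist 0 g" for g x
    using \<omega>v[OF that(1)] twist_mult[OF that] by (auto simp: vec_over_def)
  show ?thesis
    unfolding assoc_free_rank_one_def
  proof (intro exI[of _ \<phi>] conjI ballI)
    fix g :: "'a poly poly" assume gf: "g \<in> forms"
    show "\<phi> g \<in> LinearCombinations.module_hom (struct_sheaf S g) (self_module S g) (assoc_sheaf n M g)"
      unfolding LinearCombinations.module_hom_def
    proof (intro CollectI conjI allI impI)
      show "\<phi> g \<in> carrier (self_module S g) \<rightarrow> carrier (assoc_sheaf n M g)"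
        using xv[OF gf] by (auto simp: car \<phi>[OF gf] assoc_sheaf_carrier)
      fix A B assume "A \<in> carrier (self_module S g) \<and> B \<in> carrier (self_module S g)"
      then obtain x y where xy: "x \<in> twist 0 g" "A = ?q g x" "y \<in> twist 0 g" "B = ?q g y" by (auto simp: car)
      have "(x + y) \<cdot>\<^sub>v \<omega> = x \<cdot>\<^sub>v \<omega> + y \<cdot>\<^sub>v \<omega>" by (rule add_smult_distrib_vec)
      then show "\<phi> g (A \<oplus>\<^bsub>self_module S g\<^esub> B) = \<phi> g A \<oplus>\<^bsub>assoc_sheaf n M g\<^esub> \<phi> g B"
        using xy \<omega>c by (simp add: self_module_simps S_coset_add[OF gf] \<phi>[OF gf] assoc_sheaf_add[OF gf])
    next
      fix A B assume "A \<in> carrier (struct_sheaf S g) \<and> B \<in> carrier (self_module S g)"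
      then obtain x y where xy: "x \<in> twist 0 g" "A = ?q g x" "y \<in> twist 0 g" "B = ?q g y"
        by (auto simp: car struct_sheaf_simps A_RCOSETS_def' regular_simps)
      then show "\<phi> g (A \<odot>\<^bsub>self_module S g\<^esub> B) = A \<odot>\<^bsub>assoc_sheaf n M g\<^esub> \<phi> g B"
        by (simp add: self_module_simps S_coset_mult[OF gf] \<phi>[OF gf] assoc_sheaf_smult[OF gf] xv[OF gf] smult_smult_assoc)
    qed
    show "bij_betw (\<phi> g) (carrier (self_module S g)) (carrier (assoc_sheaf n M g))"
      unfolding bij_betw_def
    proof
      show "inj_on (\<phi> g) (carrier (self_module S g))"
      proof (rule inj_onI)
        fix A B assume "A \<in> carrier (self_module S g)" "B \<in> carrier (self_module S g)" and e: "\<phi> g A = \<phi> g B"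
        then obtain x y where xy: "x \<in> twist 0 g" "A = ?q g x" "y \<in> twist 0 g" "B = ?q g y" by (auto simp: car)
        have "x \<cdot>\<^sub>v \<omega> - y \<cdot>\<^sub>v \<omega> \<in> im g"
          using e \<omega>c by (simp add: xy \<phi>[OF gf] cok_class_eq_iff[OF gf])
        moreover have "x \<cdot>\<^sub>v \<omega> - y \<cdot>\<^sub>v \<omega> = (x - y) \<cdot>\<^sub>v \<omega>" by (intro eq_vecI) (auto simp: algebra_simps)
        moreover have "x - y \<in> twist 0 g"
          using twist_add[OF gf xy(1) twist_uminus[OF gf xy(3)]] by simp
        ultimately have "x - y \<in> S g" using inj[OF gf] by simp
        then show "A = B" unfolding xy by (rule S_coset_eqI[OF gf])
      qed
      show "\<phi> g ` carrier (self_module S g) = carrier (assoc_sheaf n M g)"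
      proof (intro equalityI subsetI)
        fix B assume "B \<in> carrier (assoc_sheaf n M g)"
        then obtain v where v: "v \<in> vec_over N (twist 0 g)" "B = cok_class g v" by (auto simp: assoc_sheaf_carrier)
        obtain x where x: "x \<in> twist 0 g" "v - x \<cdot>\<^sub>v \<omega> \<in> im g" using surj[OF gf v(1)] by blast
        have "B = \<phi> g (?q g x)"
          unfolding v(2) \<phi>[OF gf] using x vec_over_carrier[OF v(1)] \<omega>c by (subst cok_class_eq_iff[OF gf]) auto
        then show "B \<in> \<phi> g ` carrier (self_module S g)" using x by (auto simp: car)
      qed (use xv[OF gf] in \<open>auto simp: car \<phi>[OF gf] assoc_sheaf_carrier\<close>)
    qed
  next
    fix g h :: "'a poly poly" and A
    assume gf: "g \<in> forms" and hf: "h \<in> forms" and "A \<in> carrier (self_module S g)"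
    then obtain x where x: "x \<in> twist 0 g" "A = ?q g x" by (auto simp: car)
    have gh: "g * h \<in> forms" using gf hf by (rule forms_mult)
    have "struct_res S g h A = ?q (g * h) x"
    proof -
      have "struct_res S g h A = {y + (z + x) | y z. y \<in> S (g * h) \<and> z \<in> S g}"
        by (auto simp: struct_res_def set_add_def' regular_simps x S_coset_eq[OF gf])
      also have "\<dots> = {y + x | y. y \<in> S (g * h)}"
      proof (intro equalityI subsetI)
        fix b assume "b \<in> {y + (z + x) | y z. y \<in> S (g * h) \<and> z \<in> S g}"
        then obtain y z where yz: "y \<in> S (g * h)" "z \<in> S g" "b = y + (z + x)" by auto
        have "y + z \<in> S (g * h)"
          using yz S_mono[OF gf hf] additive_subgroup.a_closed[OF ideal.axioms(1)[OF S_ideal[OF gh]]]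
          by (auto simp: regular_simps)
        then show "b \<in> {y + x | y. y \<in> S (g * h)}" using yz(3) by (auto simp: add.assoc[symmetric])
      next
        fix b assume "b \<in> {y + x | y. y \<in> S (g * h)}"
        then show "b \<in> {y + (z + x) | y z. y \<in> S (g * h) \<and> z \<in> S g}"
          using zero_in_S[OF gf] by force
      qed
      finally show ?thesis by (simp add: S_coset_eq[OF gh])
    qed
    moreover have "assoc_res n M g h (cok_class g (x \<cdot>\<^sub>v \<omega>)) = cok_class (g * h) (x \<cdot>\<^sub>v \<omega>)"
    proof -
      have xc: "x \<cdot>\<^sub>v \<omega> \<in> carrier_vec N" using \<omega>c by simp
      have "assoc_res n M g h (cok_class g (x \<cdot>\<^sub>v \<omega>)) = {i + (j + x \<cdot>\<^sub>v \<omega>) | i j. i \<in> im (g * h) \<and> j \<in> im g}"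
        unfolding assoc_res_def set_add_def' free_sections_simps cok_class_def by auto
      also have "\<dots> = cok_class (g * h) (x \<cdot>\<^sub>v \<omega>)"
      proof (intro equalityI subsetI)
        fix b assume "b \<in> {i + (j + x \<cdot>\<^sub>v \<omega>) | i j. i \<in> im (g * h) \<and> j \<in> im g}"
        then obtain i j where ij: "i \<in> im (g * h)" "j \<in> im g" "b = i + (j + x \<cdot>\<^sub>v \<omega>)" by blast
        have "b = (i + j) + x \<cdot>\<^sub>v \<omega>"
          unfolding ij(3) by (rule assoc_add_vec[symmetric, OF im_carrier[OF ij(1)] im_carrier[OF ij(2)] xc])
        then show "b \<in> cok_class (g * h) (x \<cdot>\<^sub>v \<omega>)"
          using im_add[OF gh ij(1) im_restrict[OF gf hf ij(2)]] by (auto simp: cok_class_def)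
      next
        fix b assume "b \<in> cok_class (g * h) (x \<cdot>\<^sub>v \<omega>)"
        then obtain i where i: "i \<in> im (g * h)" "b = i + x \<cdot>\<^sub>v \<omega>" by (auto simp: cok_class_def)
        then have "b = i + (0\<^sub>v N + x \<cdot>\<^sub>v \<omega>)" using xc by simp
        then show "b \<in> {i + (j + x \<cdot>\<^sub>v \<omega>) | i j. i \<in> im (g * h) \<and> j \<in> im g}"
          using i(1) im_zero[OF gf] by blast
      qed
      finally show ?thesis .
    qed
    ultimately show "\<phi> (g * h) (struct_res S g h A) = assoc_res n M g h (\<phi> g A)"
      by (simp add: x \<phi>[OF gf] \<phi>[OF gh])
  qed
qed

end

section \<open>Actions of a quotient group\<close>

text \<open>
  If the fibres of a map from an abelian group are the cosets of a subgroup, translation makes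
  the image a torsor under the quotient group.
\<close>

lemma simply_transitive_quotient_action:
  fixes K (structure)
  assumes K: "comm_group K" and Nn: "subgroup Nn K"
    and E: "E = \<pi> ` carrier K"
    and fib: "\<And>x y. x \<in> carrier K \<Longrightarrow> y \<in> carrier K \<Longrightarrow> \<pi> x = \<pi> y \<longleftrightarrow> y \<in> Nn #> x"
  obtains act where "simply_transitive_action (K Mod Nn) E act"
    "\<And>x y. x \<in> carrier K \<Longrightarrow> y \<in> carrier K \<Longrightarrow> act (Nn #> x) (\<pi> y) = \<pi> (x \<otimes> y)"
proof -
  interpret comm_group K by (rule K)
  interpret nor: normal Nn K using Nn by (rule subgroup_imp_normal)
  have fib': "\<pi> x = \<pi> y \<longleftrightarrow> Nn #> x = Nn #> y" if "x \<in> carrier K" "y \<in> carrier K" for x y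
  proof
    assume "\<pi> x = \<pi> y"
    then have "y \<in> Nn #> x" using fib that by simp
    then show "Nn #> x = Nn #> y" using repr_independence[OF _ that(1) Nn] by blast
  next
    assume "Nn #> x = Nn #> y"
    then have "y \<in> Nn #> x" using rcos_self[OF that(2) Nn] by simp
    then show "\<pi> x = \<pi> y" using fib that by simp
  qed
  define rep where "rep e = (SOME y. y \<in> carrier K \<and> \<pi> y = e)" for e
  define crep where "crep \<gamma> = (SOME x. x \<in> carrier K \<and> Nn #> x = \<gamma>)" for \<gamma>
  have rep: "rep (\<pi> y) \<in> carrier K" "\<pi> (rep (\<pi> y)) = \<pi> y" if "y \<in> carrier K" for y
    using someI[of "\<lambda>z. z \<in> carrier K \<and> \<pi> z = \<pi> y" y] that by (auto simp: rep_def)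
  have crep: "crep (Nn #> x) \<in> carrier K" "Nn #> crep (Nn #> x) = Nn #> x" if "x \<in> carrier K" for x
    using someI[of "\<lambda>z. z \<in> carrier K \<and> Nn #> z = Nn #> x" x] that by (auto simp: crep_def)
  have cm: "(Nn #> x) <#> (Nn #> y) = Nn #> (x \<otimes> y)" if "x \<in> carrier K" "y \<in> carrier K" for x y
    using nor.rcos_sum that by simp
  define act where "act \<gamma> = (\<lambda>e\<in>E. \<pi> (crep \<gamma> \<otimes> rep e))" for \<gamma>
  have act: "act (Nn #> x) (\<pi> y) = \<pi> (x \<otimes> y)" if x: "x \<in> carrier K" and y: "y \<in> carrier K" for x y
  proof -
    have "Nn #> (crep (Nn #> x) \<otimes> rep (\<pi> y)) = Nn #> (x \<otimes> y)"
      using cm[OF crep(1)[OF x] rep(1)[OF y]] cm[OF x y] crep[OF x] fib'[OF rep(1)[OF y] y] rep(2)[OF y] by simp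
    then have "\<pi> (crep (Nn #> x) \<otimes> rep (\<pi> y)) = \<pi> (x \<otimes> y)"
      using fib'[of "crep (Nn #> x) \<otimes> rep (\<pi> y)" "x \<otimes> y"] crep(1)[OF x] rep(1)[OF y] x y by simp
    then show ?thesis using y by (simp add: act_def E)
  qed
  have carr: "carrier (K Mod Nn) = (\<lambda>x. Nn #> x) ` carrier K"
    by (auto simp: FactGroup_def RCOSETS_def)
  have bij: "act (Nn #> x) \<in> Bij E" if x: "x \<in> carrier K" for x
  proof -
    have "bij_betw (act (Nn #> x)) E E"
    proof (rule bij_betw_byWitness[where f' = "act (Nn #> inv x)"])
      show "\<forall>e\<in>E. act (Nn #> inv x) (act (Nn #> x) e) = e"
        using x by (auto simp: E act m_assoc[symmetric])
      show "\<forall>e\<in>E. act (Nn #> x) (act (Nn #> inv x) e) = e"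
        using x by (auto simp: E act m_assoc[symmetric])
    qed (use x in \<open>auto simp: E act\<close>)
    then show ?thesis by (simp add: Bij_def act_def)
  qed
  have hom: "act \<in> hom (K Mod Nn) (BijGroup E)"
  proof (rule homI)
    fix \<gamma> assume "\<gamma> \<in> carrier (K Mod Nn)"
    then show "act \<gamma> \<in> carrier (BijGroup E)" using bij by (auto simp: carr BijGroup_def)
  next
    fix \<gamma> \<delta> assume "\<gamma> \<in> carrier (K Mod Nn)" "\<delta> \<in> carrier (K Mod Nn)"
    then obtain x y where xy: "x \<in> carrier K" "\<gamma> = Nn #> x" "y \<in> carrier K" "\<delta> = Nn #> y"
      by (auto simp: carr)
    have "act (Nn #> (x \<otimes> y)) = compose E (act (Nn #> x)) (act (Nn #> y))"
    proof (rule extensionalityI[of _ E])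
      fix e assume "e \<in> E"
      then obtain z where z: "z \<in> carrier K" "e = \<pi> z" by (auto simp: E)
      show "act (Nn #> (x \<otimes> y)) e = compose E (act (Nn #> x)) (act (Nn #> y)) e"
        using xy z \<open>e \<in> E\<close> by (simp add: compose_def act m_assoc)
    qed (auto simp: act_def)
    then show "act (\<gamma> \<otimes>\<^bsub>K Mod Nn\<^esub> \<delta>) = act \<gamma> \<otimes>\<^bsub>BijGroup E\<^esub> act \<delta>"
      using xy bij by (simp add: FactGroup_def cm BijGroup_def)
  qed
  have "group_action (K Mod Nn) E act"
    by (intro group_action.intro group_hom.intro group_hom_axioms.intro hom nor.factorgroup_is_group group_BijGroup)
  moreover have "E \<noteq> {}" using E one_closed by blast
  moreover have "\<exists>!\<gamma>. \<gamma> \<in> carrier (K Mod Nn) \<and> act \<gamma> e = e'" if "e \<in> E" "e' \<in> E" for e e'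
  proof -
    obtain y y' where y: "y \<in> carrier K" "e = \<pi> y" "y' \<in> carrier K" "e' = \<pi> y'" using \<open>e \<in> E\<close> \<open>e' \<in> E\<close> by (auto simp: E)
    show ?thesis
    proof (rule ex1I[of _ "Nn #> (y' \<otimes> inv y)"])
      show "Nn #> (y' \<otimes> inv y) \<in> carrier (K Mod Nn) \<and> act (Nn #> (y' \<otimes> inv y)) e = e'"
        using y by (simp add: carr act m_assoc)
    next
      fix \<gamma> assume "\<gamma> \<in> carrier (K Mod Nn) \<and> act \<gamma> e = e'"
      then obtain x where x: "x \<in> carrier K" "\<gamma> = Nn #> x" "act (Nn #> x) e = e'" by (auto simp: carr)
      then have "\<pi> (x \<otimes> y) = \<pi> y'" using y by (simp add: act)
      then have "Nn #> (x \<otimes> y) = Nn #> y'" using fib' x y by simp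
      then have "(Nn #> (x \<otimes> y)) <#> (Nn #> inv y) = (Nn #> y') <#> (Nn #> inv y)" by simp
      then show "\<gamma> = Nn #> (y' \<otimes> inv y)" using x y by (simp add: cm m_assoc)
    qed
  qed
  ultimately have "simply_transitive_action (K Mod Nn) E act" by (simp add: simply_transitive_action_def)
  with act that show ?thesis by blast
qed

lemma zero_scheme_const_mult:
  assumes "(c :: 'a::field) \<noteq> 0"
  shows "zero_scheme (const c * f) = zero_scheme f"
proof (rule ext)
  fix g
  have c: "const c * const (1 / c) = 1" using assms by (simp flip: const_hom.hom_mult add: const_hom.hom_one)
  have "x \<in> zero_scheme f g" if "x \<in> zero_scheme (const c * f) g" for x
  proof -
    from that obtain b m where "x \<in> twist 0 g" "x = Fraction_Field.Fract (const c * f * b) (g ^ m)"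
      by (auto simp: zero_scheme_def)
    moreover have "const c * f * b = f * (const c * b)" by (simp only: ac_simps)
    ultimately show ?thesis unfolding zero_scheme_def mem_Collect_eq by metis
  qed
  moreover have "x \<in> zero_scheme (const c * f) g" if "x \<in> zero_scheme f g" for x
  proof -
    from that obtain b m where "x \<in> twist 0 g" "x = Fraction_Field.Fract (f * b) (g ^ m)"
      by (auto simp: zero_scheme_def)
    moreover have "f * b = const c * f * (const (1 / c) * b)"
    proof -
      have "const c * f * (const (1 / c) * b) = (const c * const (1 / c)) * (f * b)" by (simp only: ac_simps)
      then show ?thesis by (simp only: c mult_1)
    qed
    ultimately show ?thesis unfolding zero_scheme_def mem_Collect_eq by metis
  qed
  ultimately show "zero_scheme (const c * f) g = zero_scheme f g" by blast
qed

section \<open>Orbits of pairs\<close>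

context binary_form
begin

definition disc_sign :: 'a where "disc_sign = (- 1) ^ (N * (N - 1) div 2)"

lemma disc_SL_act_base_pair:
  assumes "P \<in> carrier_mat N N" "H \<in> carrier_mat N N"
  shows "disc (SL_act P (base_pair H)) = const (disc_sign * (det P)\<^sup>2 * det H / lead_coeff F) * f"
proof -
  have l: "lead_coeff F \<noteq> 0" using F_nonzero by simp
  define b where "b = 1 / lead_coeff F"
  have "b * lead_coeff F = 1" using l by (simp add: b_def)
  then have c: "const b * const (lead_coeff F) = 1" by (metis const_hom.hom_mult const_hom.hom_one)
  have "disc (base_pair H) = const b * const (lead_coeff F) * disc (base_pair H)" by (simp only: c mult_1)
  also have "\<dots> = const b * (const (disc_sign * det H) * f)"
    by (simp only: mult.assoc disc_base_pair[OF assms(2)] disc_sign_def)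
  finally have e: "disc (base_pair H) = const b * (const (disc_sign * det H) * f)" .
  have "disc (SL_act P (base_pair H)) = const ((det P)\<^sup>2) * (const b * (const (disc_sign * det H) * f))"
    by (simp only: disc_SL_act[OF base_pair_carrier[OF assms(2)] assms(1)] e)
  also have "\<dots> = const ((det P)\<^sup>2 * (b * (disc_sign * det H))) * f"
    by (simp only: const_hom.hom_mult mult.assoc)
  also have "(det P)\<^sup>2 * (b * (disc_sign * det H)) = disc_sign * (det P)\<^sup>2 * det H / lead_coeff F"
    by (simp add: b_def)
  finally show ?thesis .
qed

lemma gram_mult_algebra_transpose:
  assumes "Z \<in> mult_algebra"
  shows "(gram * Z)\<^sup>T = gram * Z"
  using gram_mult_algebra_symmetric[OF assms] mult_algebra_carrier[OF assms]
  by (simp add: transpose_mult[of _ N N _ N] gram_symmetric)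

lemma SL_act_base_pair_symmetric:
  assumes P: "P \<in> carrier_mat N N" and H: "H \<in> mult_algebra" and N: "N = n + 1"
  shows "SL_act P (base_pair H) \<in> sym_pairs n"
proof -
  have Hc: "H \<in> carrier_mat N N" using H by (rule mult_algebra_carrier)
  have t: "(P\<^sup>T * B * P)\<^sup>T = P\<^sup>T * B * P" if "B \<in> carrier_mat N N" "B\<^sup>T = B" for B
    using P that by (simp add: transpose_mult[of _ N N _ N] mat_closed mat_assoc)
  have s: "(gram * (H * mul_mat a))\<^sup>T = gram * (H * mul_mat a)" for a
    by (intro gram_mult_algebra_transpose mult_algebra_mult H mul_mat_in_algebra)
  have "(P\<^sup>T * (gram * (H * mul_mat X1)) * P)\<^sup>T = P\<^sup>T * (gram * (H * mul_mat X1)) * P"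
    using Hc by (intro t s) (simp add: mat_closed)
  moreover have "(P\<^sup>T * (- (gram * (H * mul_mat X0))) * P)\<^sup>T = P\<^sup>T * (- (gram * (H * mul_mat X0))) * P"
    using Hc by (intro t) (simp_all add: mat_closed transpose_uminus s)
  moreover have "fst (SL_act P (base_pair H)) \<in> carrier_mat N N" "snd (SL_act P (base_pair H)) \<in> carrier_mat N N"
    by (rule SL_act_carrier[OF base_pair_carrier[OF Hc] P])+
  moreover have "carrier_mat (n + 1) (n + 1) = (carrier_mat N N :: 'a mat set)" by (simp only: N)
  ultimately show ?thesis
    unfolding sym_pairs_def SL_act_def base_pair_def by simp
qed

lemma cancel_X0_X1_mul_mat:
  assumes "mul_mat (p * X0) = 0\<^sub>m N N" "mul_mat (p * X1) = 0\<^sub>m N N"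
  shows "mul_mat p = 0\<^sub>m N N"
  by (rule cancel_X0_X1) (use assms in \<open>auto simp: mul_mat_mult left_mult_zero_mat[of _ N N]\<close>)

lemma cancel_X1_power_mul_mat:
  "mul_mat (p * X0) = 0\<^sub>m N N \<Longrightarrow> mul_mat (p * X1 ^ b) = 0\<^sub>m N N \<Longrightarrow> mul_mat p = 0\<^sub>m N N"
proof (induction b arbitrary: p)
  case (Suc b)
  have "p * X1 * X0 = p * X0 * X1" by (simp only: ac_simps)
  then have "mul_mat (p * X1 * X0) = mul_mat (p * X0) * mul_mat X1" by (simp only: mul_mat_mult[of "p * X0"])
  also have "\<dots> = 0\<^sub>m N N" by (simp only: Suc.prems(1) left_mult_zero_mat[OF mul_mat_carrier])
  finally have "mul_mat (p * X1 * X0) = 0\<^sub>m N N" .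
  moreover have "mul_mat (p * X1 * X1 ^ b) = 0\<^sub>m N N" using Suc.prems(2) by (simp only: power_Suc mult.assoc)
  ultimately have "mul_mat (p * X1) = 0\<^sub>m N N" by (rule Suc.IH)
  with Suc.prems(1) show ?case by (rule cancel_X0_X1_mul_mat)
qed simp

text \<open>
  Vanishing on both standard charts of the projective line implies vanishing on the subscheme.
\<close>

lemma cancel_powers_mul_mat:
  "mul_mat (p * X0 ^ a) = 0\<^sub>m N N \<Longrightarrow> mul_mat (p * X1 ^ b) = 0\<^sub>m N N \<Longrightarrow> mul_mat p = 0\<^sub>m N N"
proof (induction a arbitrary: p)
  case (Suc a)
  have "p * X0 * X1 ^ b = p * X1 ^ b * X0" by (simp only: ac_simps)
  then have "mul_mat (p * X0 * X1 ^ b) = mul_mat (p * X1 ^ b) * mul_mat X0" by (simp only: mul_mat_mult[of "p * X1 ^ b"])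
  also have "\<dots> = 0\<^sub>m N N" by (simp only: Suc.prems(2) left_mult_zero_mat[OF mul_mat_carrier])
  finally have "mul_mat (p * X0 * X1 ^ b) = 0\<^sub>m N N" .
  moreover have "mul_mat (p * X0 * X0 ^ a) = 0\<^sub>m N N" using Suc.prems(1) by (simp only: power_Suc mult.assoc)
  ultimately have "mul_mat (p * X0) = 0\<^sub>m N N" by (rule Suc.IH[rotated])
  then show ?case using Suc.prems(2) by (rule cancel_X1_power_mul_mat)
qed simp

text \<open>
  A matrix of given determinant; any choice represents the same orbit.
\<close>

definition det_mat :: "'a \<Rightarrow> 'a mat" where
  "det_mat u = mat N N (\<lambda>(i, j). if i = j then if i = 0 then u else 1 else 0)"

lemma det_mat_carrier [simp]: "det_mat u \<in> carrier_mat N N"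
  by (simp add: det_mat_def)

lemma det_det_mat:
  assumes "0 < N"
  shows "det (det_mat u) = u"
proof -
  have "det (det_mat u) = prod_list (diag_mat (det_mat u))"
    by (rule det_lower_triangular[OF _ det_mat_carrier]) (auto simp: det_mat_def)
  also have "\<dots> = (\<Prod>i = 0..<N. if i = 0 then u else 1)"
    by (subst prod_list_diag_prod) (auto simp: det_mat_def intro!: prod.cong)
  finally show ?thesis using assms by (simp add: prod.delta)
qed

end

lemma SL_simps:
  "carrier (SL n) = {P \<in> carrier_mat (n + 1) (n + 1). det P = 1}" "monoid.mult (SL n) = (*)"
  "one (SL n) = 1\<^sub>m (n + 1)"
  by (auto simp: SL_def)

lemma SL_orbit_eq: "SL_orbit n M = {SL_act R M | R. R \<in> carrier_mat (n + 1) (n + 1) \<and> det R = 1}"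
  by (auto simp: SL_orbit_def orbit_def SL_simps)

lemma mem_SL_orbit:
  fixes M :: "'a::field mat \<times> 'a mat"
  assumes "fst M \<in> carrier_mat (n + 1) (n + 1)" "snd M \<in> carrier_mat (n + 1) (n + 1)"
  shows "M \<in> SL_orbit n M"
proof -
  have "M = SL_act (1\<^sub>m (n + 1)) M" by (rule SL_act_one[OF assms, symmetric])
  moreover have "1\<^sub>m (n + 1) \<in> carrier_mat (n + 1) (n + 1)" "det (1\<^sub>m (n + 1) :: 'a mat) = 1" by simp_all
  ultimately show ?thesis unfolding SL_orbit_eq mem_Collect_eq by (intro exI[of _ "1\<^sub>m (n + 1)"] conjI)
qed

lemma SL_orbit_SL_act:
  assumes M: "fst M \<in> carrier_mat (n + 1) (n + 1)" "snd M \<in> carrier_mat (n + 1) (n + 1)"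
    and R: "R \<in> carrier_mat (n + 1) (n + 1)" "det R = 1"
  shows "SL_orbit n (SL_act R M) = SL_orbit n M"
proof -
  have "det R \<noteq> 0" using R(2) by simp
  obtain R' where R': "R' \<in> carrier_mat (n + 1) (n + 1)" "R * R' = 1\<^sub>m (n + 1)" "R' * R = 1\<^sub>m (n + 1)"
      "det R' = inverse (det R)"
    using ex_inverse_mat[OF R(1) \<open>det R \<noteq> 0\<close>] .
  show ?thesis
  proof (intro equalityI subsetI)
    fix x assume "x \<in> SL_orbit n (SL_act R M)"
    then obtain Q where Q: "Q \<in> carrier_mat (n + 1) (n + 1)" "det Q = 1" "x = SL_act Q (SL_act R M)"
      by (auto simp: SL_orbit_eq)
    then have "x = SL_act (R * Q) M" using SL_act_SL_act[OF M R(1) Q(1)] by simp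
    moreover have "R * Q \<in> carrier_mat (n + 1) (n + 1)" "det (R * Q) = 1"
      using R Q by (auto simp: det_mult[of _ "n + 1"] intro: mult_carrier_mat)
    ultimately show "x \<in> SL_orbit n M" unfolding SL_orbit_eq by blast
  next
    fix x assume "x \<in> SL_orbit n M"
    then obtain Q where Q: "Q \<in> carrier_mat (n + 1) (n + 1)" "det Q = 1" "x = SL_act Q M"
      by (auto simp: SL_orbit_eq)
    have QR: "R' * Q \<in> carrier_mat (n + 1) (n + 1)" "det (R' * Q) = 1"
      using R R' Q by (auto simp: det_mult[of _ "n + 1"] intro: mult_carrier_mat)
    have "R * (R' * Q) = Q"
      using R(1) R'(1) Q(1) by (simp add: assoc_mult_mat[of R "n + 1" "n + 1" R' "n + 1" Q "n + 1", symmetric] R'(2))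
    then have "x = SL_act (R' * Q) (SL_act R M)" using SL_act_SL_act[OF M R(1) QR(1)] Q by simp
    with QR show "x \<in> SL_orbit n (SL_act R M)" unfolding SL_orbit_eq by blast
  qed
qed

lemma orbit_disc_SL_orbit:
  assumes "fst M \<in> carrier_mat (n + 1) (n + 1)" "snd M \<in> carrier_mat (n + 1) (n + 1)"
  shows "orbit_disc (SL_orbit n M) = disc M"
proof -
  have "disc x = disc M" if "x \<in> SL_orbit n M" for x
    using that disc_SL_act[OF assms] by (auto simp: SL_orbit_eq const_hom.hom_one)
  with mem_SL_orbit[OF assms] have "disc ` SL_orbit n M = {disc M}" by blast
  then show ?thesis by (simp add: orbit_disc_def)
qed

locale classification = binary_form_scheme f N S
  for f :: "'a::field poly poly" and N and S :: "'a subscheme" +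
  fixes n :: nat
  assumes N_eq: "N = n + 1"
begin

lemma base_carrier:
  assumes "P \<in> carrier_mat N N" "H \<in> mult_algebra"
  shows "fst (SL_act P (base_pair H)) \<in> carrier_mat (n + 1) (n + 1)"
    "snd (SL_act P (base_pair H)) \<in> carrier_mat (n + 1) (n + 1)"
  using SL_act_carrier[OF base_pair_carrier assms(1)] mult_algebra_carrier[OF assms(2)] N_eq by auto

text \<open>
  Two forms that define the same subscheme are proportional: the discriminant has degree \<open>N\<close> and vanishes on
  the subscheme of \<open>f\<close>, so it is \<open>f\<close> times a form of degree zero.
\<close>

lemma disc_is_multiple_of_f:
  assumes M: "M \<in> sym_pairs_S n S"
  obtains c where "c \<noteq> 0" "disc M = const c * f"
proof -
  have Mc: "fst M \<in> carrier_mat N N" "snd M \<in> carrier_mat N N"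
    using M N_eq by (auto simp: sym_pairs_S_def sym_pairs_def)
  have D0: "disc M \<noteq> 0" and same': "same_subscheme (zero_scheme (disc M)) S"
    using M by (auto simp: sym_pairs_S_def)
  have hp: "homog 1 (pencil M $$ (i, j))" if "i < N" "j < N" for i j
    using that Mc homog_mult[OF homog_X0 homog_const, of "fst M $$ (i, j)"]
      homog_mult[OF homog_X1 homog_const, of "snd M $$ (i, j)"]
    by (simp add: pencil_def homog_add)
  have Dh: "homog (int N) (disc M)"
    unfolding disc_def using Mc by (intro homog_det hp) (auto simp: pencil_def)
  have k: "\<exists>m. mul_mat (disc M * x ^ m) = 0\<^sub>m N N" if x: "x \<in> {X0, X1}" for x
  proof -
    have hx: "homog (int 1) x" "x \<noteq> 0" using x by auto
    then have xf: "x \<in> forms" by (auto simp: forms_def intro!: exI[of _ 1])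
    have "Fraction_Field.Fract (disc M) (x ^ N) \<in> twist 0 x"
      unfolding twist_iff[OF hx] using Dh by (intro exI[of _ "disc M"] exI[of _ N]) simp
    then have "Fraction_Field.Fract (disc M) (x ^ N) \<in> zero_scheme (disc M) x"
      unfolding zero_scheme_def by (auto intro!: exI[of _ 1] exI[of _ N])
    then have "Fraction_Field.Fract (disc M) (x ^ N) \<in> S x"
      using same' xf by (simp add: same_subscheme_def)
    then have "represents x (Fraction_Field.Fract (disc M) (x ^ N)) (0\<^sub>m N N)"
      by (simp add: mem_S_iff_represents_zero[OF xf])
    then obtain c m where c: "Fraction_Field.Fract (disc M) (x ^ N) = Fraction_Field.Fract c (x ^ m)"
      "mul_mat c = 0\<^sub>m N N * mul_mat (x ^ m)" unfolding represents_iff[OF hx] by blast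
    then have "disc M * x ^ m = c * x ^ N" using hx by (simp add: eq_fract)
    then have "mul_mat (disc M * x ^ m) = 0\<^sub>m N N"
      using c(2) by (simp add: mul_mat_mult left_mult_zero_mat[of _ N N])
    then show ?thesis by blast
  qed
  obtain a b where "mul_mat (disc M * X0 ^ a) = 0\<^sub>m N N" "mul_mat (disc M * X1 ^ b) = 0\<^sub>m N N"
    using k by blast
  then have "mul_mat (disc M) = 0\<^sub>m N N" by (rule cancel_powers_mul_mat)
  then obtain b where b: "homog (int N - int N) b" "disc M = f * b" by (rule mul_mat_homog_eq_0D[OF Dh])
  then obtain c where c: "b = const c" by (metis diff_self homog_0_const)
  with b D0 have "c \<noteq> 0" by auto
  with that b c show ?thesis by (simp add: mult.commute)
qed

lemma sym_pairs_fr_eq: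
  "sym_pairs_fr n S = {SL_act P (base_pair H) | P H.
     P \<in> carrier_mat N N \<and> det P \<noteq> 0 \<and> H \<in> mult_algebra \<and> det H \<noteq> 0}"
proof (intro equalityI subsetI)
  fix M assume M: "M \<in> sym_pairs_fr n S"
  then have MS: "M \<in> sym_pairs_S n S" and free: "assoc_free_rank_one n S M" by (auto simp: sym_pairs_fr_def)
  obtain c where c: "c \<noteq> 0" "disc M = const c * f" using disc_is_multiple_of_f[OF MS] .
  interpret pencil_on_scheme f N S n M c
    using MS c N_eq by unfold_locales (auto simp: sym_pairs_S_def)
  obtain P H where PH: "P \<in> carrier_mat N N" "det P \<noteq> 0" "H \<in> mult_algebra" "M = SL_act P (base_pair H)"
    using free_imp_SL_act_base_pair[OF free] .
  have "det H \<noteq> 0"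
  proof
    assume "det H = 0"
    then have "disc M = 0" using disc_SL_act_base_pair[OF PH(1) mult_algebra_carrier[OF PH(3)]] PH by simp
    then show False using c f_nonzero by simp
  qed
  with PH show "M \<in> {SL_act P (base_pair H) | P H.
     P \<in> carrier_mat N N \<and> det P \<noteq> 0 \<and> H \<in> mult_algebra \<and> det H \<noteq> 0}" by blast
next
  fix M assume "M \<in> {SL_act P (base_pair H) | P H.
     P \<in> carrier_mat N N \<and> det P \<noteq> 0 \<and> H \<in> mult_algebra \<and> det H \<noteq> 0}"
  then obtain P H where PH: "P \<in> carrier_mat N N" "det P \<noteq> 0" "H \<in> mult_algebra" "det H \<noteq> 0"
    "M = SL_act P (base_pair H)" by blast
  define c where "c = disc_sign * (det P)\<^sup>2 * det H / lead_coeff F"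
  have d: "disc M = const c * f"
    using disc_SL_act_base_pair[OF PH(1) mult_algebra_carrier[OF PH(3)]] PH by (simp add: c_def)
  have c: "c \<noteq> 0" using PH F_nonzero by (simp add: c_def disc_sign_def)
  have sy: "M \<in> sym_pairs n" using SL_act_base_pair_symmetric[OF PH(1,3) N_eq] PH by simp
  interpret pencil_on_scheme f N S n M c using sy c d N_eq by unfold_locales auto
  have "assoc_free_rank_one n S M" by (rule SL_act_base_pair_imp_free[OF PH])
  moreover have "same_subscheme (zero_scheme (disc M)) S"
    using same by (simp add: d zero_scheme_const_mult[OF c])
  moreover have "disc M \<noteq> 0" using d c f_nonzero by simp
  ultimately show "M \<in> sym_pairs_fr n S" using sy by (simp add: sym_pairs_fr_def sym_pairs_S_def)
qed

text \<open>
  The ambiguity in writing a pair by \<open>P\<close> and \<open>H\<close> is an element \<open>g\<close> of the algebra.  Within an orbit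
  \<open>P\<close> can be changed by any matrix of determinant one on the right, so only its determinant remains.
\<close>

lemma SL_orbit_eq_iff:
  assumes P: "P \<in> carrier_mat N N" "det P \<noteq> 0" and Q: "Q \<in> carrier_mat N N" "det Q \<noteq> 0"
    and H: "H \<in> mult_algebra" "det H \<noteq> 0" and K: "K \<in> mult_algebra"
  shows "SL_orbit n (SL_act P (base_pair H)) = SL_orbit n (SL_act Q (base_pair K)) \<longleftrightarrow>
    (\<exists>g\<in>mult_algebra. det P = det g * det Q \<and> K = H * (g * g))"
proof
  have Hc: "H \<in> carrier_mat N N" and Kc: "K \<in> carrier_mat N N" using H K by (auto simp: mult_algebra_carrier)
  note bH = base_pair_carrier[OF Hc] and bK = base_pair_carrier[OF Kc]
  {
    assume e: "SL_orbit n (SL_act P (base_pair H)) = SL_orbit n (SL_act Q (base_pair K))"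
    have "SL_act Q (base_pair K) \<in> SL_orbit n (SL_act P (base_pair H))"
      unfolding e by (rule mem_SL_orbit) (rule base_carrier[OF Q(1) K])+
    then obtain R where R: "R \<in> carrier_mat N N" "det R = 1" "SL_act Q (base_pair K) = SL_act R (SL_act P (base_pair H))"
      unfolding SL_orbit_eq N_eq[symmetric] by blast
    have PR: "P * R \<in> carrier_mat N N" "det (P * R) = det P"
      using P R by (auto simp: mat_closed det_mult[of _ N])
    have e': "SL_act (P * R) (base_pair H) = SL_act Q (base_pair K)"
      by (simp only: R(3) SL_act_SL_act[OF bH P(1) R(1)])
    have "det (P * R) \<noteq> 0" using PR(2) P(2) by simp
    obtain g where g: "g \<in> mult_algebra" "P * R = g * Q" "K = H * (g * g)"
      using SL_act_base_pair_eqD[OF PR(1) \<open>det (P * R) \<noteq> 0\<close> Q H K e'] .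
    have "det P = det (g * Q)" using PR(2) by (simp only: g(2))
    also have "\<dots> = det g * det Q" by (rule det_mult[OF mult_algebra_carrier[OF g(1)] Q(1)])
    finally have "det P = det g * det Q" .
    with g show "\<exists>g\<in>mult_algebra. det P = det g * det Q \<and> K = H * (g * g)" by blast
  }
  assume "\<exists>g\<in>mult_algebra. det P = det g * det Q \<and> K = H * (g * g)"
  then obtain g where g: "g \<in> mult_algebra" "det P = det g * det Q" "K = H * (g * g)" by blast
  have gc: "g \<in> carrier_mat N N" using g by (simp add: mult_algebra_carrier)
  obtain Pi where Pi: "Pi \<in> carrier_mat N N" "P * Pi = 1\<^sub>m N" "Pi * P = 1\<^sub>m N" "det Pi = inverse (det P)"
    using ex_inverse_mat[OF P] .
  define R where "R = Pi * (g * Q)"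
  have R: "R \<in> carrier_mat N N" using Pi gc Q by (simp add: R_def mat_closed)
  have "det R = det Pi * (det g * det Q)"
    using Pi(1) gc Q(1) by (simp add: R_def det_mult[of _ N] mat_closed)
  also have "\<dots> = 1" using P(2) by (simp only: Pi(4) g(2)[symmetric]) simp
  finally have dR: "det R = 1" .
  have PR: "P * R = g * Q"
  proof -
    have "P * R = (P * Pi) * (g * Q)"
      unfolding R_def by (rule mat_assoc[OF P(1) Pi(1) mat_closed[OF gc Q(1)], symmetric])
    then show ?thesis by (simp only: Pi(2) left_mult_one_mat[OF mat_closed[OF gc Q(1)]])
  qed
  have "SL_act Q (base_pair K) = SL_act Q (SL_act g (base_pair H))"
    by (simp only: SL_act_mult_algebra_base_pair[OF g(1) H(1)] g(3))
  also have "\<dots> = SL_act R (SL_act P (base_pair H))"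
    by (simp only: SL_act_SL_act[OF bH gc Q(1)] SL_act_SL_act[OF bH P(1) R] PR)
  finally have e: "SL_act Q (base_pair K) = SL_act R (SL_act P (base_pair H))" .
  have "R \<in> carrier_mat (n + 1) (n + 1)" using R by (simp only: N_eq)
  then show "SL_orbit n (SL_act P (base_pair H)) = SL_orbit n (SL_act Q (base_pair K))"
    unfolding e by (rule SL_orbit_SL_act[OF base_carrier[OF P(1) H(1)] _ dR, symmetric])
qed

definition algebra_elem :: "('a poly poly \<Rightarrow> 'a poly poly fract set) \<Rightarrow> 'a mat" where
  "algebra_elem \<alpha> = inv_into mult_algebra global_section \<alpha>"

lemma algebra_elem_global_section: "Z \<in> mult_algebra \<Longrightarrow> algebra_elem (global_section Z) = Z"
  using global_section_bij by (simp add: algebra_elem_def bij_betw_def)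

lemma Units_H0_cases:
  assumes "\<alpha> \<in> Units (H0 S)"
  shows "algebra_elem \<alpha> \<in> mult_algebra" "det (algebra_elem \<alpha>) \<noteq> 0" "global_section (algebra_elem \<alpha>) = \<alpha>"
    "alg_norm (H0 S) \<alpha> = det (algebra_elem \<alpha>)"
  using assms unfolding Units_H0 by (auto simp: algebra_elem_global_section alg_norm_global_section)

definition orbit_of :: "'a \<times> ('a poly poly \<Rightarrow> 'a poly poly fract set) \<Rightarrow> ('a mat \<times> 'a mat) set" where
  "orbit_of k = SL_orbit n (SL_act (det_mat (fst k)) (base_pair (algebra_elem (snd k))))"

lemma carrier_kL_units: "carrier (kL_units S) = {(u, \<alpha>). u \<noteq> 0 \<and> \<alpha> \<in> Units (H0 S)}"
proof -
  have "Units (class_ring :: 'a ring) = {u. u \<noteq> 0}"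
  proof -
    have "\<exists>v. v * u = 1 \<and> u * v = 1" if "u \<noteq> 0" for u :: 'a
      using that by (intro exI[of _ "inverse u"]) simp
    then show ?thesis unfolding Units_def by auto
  qed
  then show ?thesis by (auto simp: kL_units_def DirProd_def units_of_def)
qed

lemma mult_kL_units: "(u, \<alpha>) \<otimes>\<^bsub>kL_units S\<^esub> (v, \<beta>) = (u * v, \<alpha> \<otimes>\<^bsub>H0 S\<^esub> \<beta>)"
  by (simp add: kL_units_def DirProd_def units_of_def)

lemma comm_group_kL_units: "comm_group (kL_units S)"
proof -
  interpret A: comm_monoid "H0 S" by (rule comm_monoid_H0)
  have g: "group (kL_units S)"
    unfolding kL_units_def
    by (intro DirProd_group comm_group.axioms(2) A.units_comm_group
        comm_monoid.units_comm_group[OF cring.axioms(2)[OF class_cring.cring_axioms]])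
  show ?thesis
  proof (rule group.group_comm_groupI[OF g])
    fix x y assume "x \<in> carrier (kL_units S)" "y \<in> carrier (kL_units S)"
    then show "x \<otimes>\<^bsub>kL_units S\<^esub> y = y \<otimes>\<^bsub>kL_units S\<^esub> x"
      by (cases x; cases y) (auto simp: carrier_kL_units mult_kL_units mult.commute intro!: A.m_comm)
  qed
qed

lemma norm_square_eq:
  "norm_square S = {(inverse (det g), global_section (g * g)) | g. g \<in> mult_algebra \<and> det g \<noteq> 0}"
proof -
  have "norm_square S = (\<lambda>g. (inverse (alg_norm (H0 S) (global_section g)), global_section g \<otimes>\<^bsub>H0 S\<^esub> global_section g))
      ` {Z \<in> mult_algebra. det Z \<noteq> 0}"
    unfolding norm_square_def Units_H0 by auto
  also have "\<dots> = (\<lambda>g. (inverse (det g), global_section (g * g))) ` {Z \<in> mult_algebra. det Z \<noteq> 0}"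
    by (intro image_cong refl) (simp add: alg_norm_global_section global_section_hom)
  finally show ?thesis by auto
qed

lemma det_algebra_mult: "g \<in> mult_algebra \<Longrightarrow> h \<in> mult_algebra \<Longrightarrow> det (g * h) = det g * det h"
  by (intro det_mult[of _ N] mult_algebra_carrier)

lemma global_section_in_Units: "Z \<in> mult_algebra \<Longrightarrow> det Z \<noteq> 0 \<Longrightarrow> global_section Z \<in> Units (H0 S)"
  by (auto simp: Units_H0)

lemma one_kL_units: "\<one>\<^bsub>kL_units S\<^esub> = (1, \<one>\<^bsub>H0 S\<^esub>)"
  by (simp add: kL_units_def DirProd_def units_of_def)

lemma mult_algebra_square_mult:
  assumes "g \<in> mult_algebra" "h \<in> mult_algebra"
  shows "(g * g) * (h * h) = (g * h) * (g * h)"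
proof -
  have c: "g \<in> carrier_mat N N" "h \<in> carrier_mat N N" using assms by (auto simp: mult_algebra_carrier)
  have "(g * g) * (h * h) = g * (g * h) * h" using c by (simp add: mat_assoc mat_closed)
  also have "g * h = h * g" by (rule mult_algebra_commute[OF assms])
  also have "g * (h * g) * h = (g * h) * (g * h)" using c by (simp add: mat_assoc mat_closed)
  finally show ?thesis .
qed

lemma subgroup_norm_square: "subgroup (norm_square S) (kL_units S)"
proof -
  interpret comm_group "kL_units S" by (rule comm_group_kL_units)
  define q where "q g = (inverse (det g), global_section (g * g))" for g
  have ns: "norm_square S = q ` {g \<in> mult_algebra. det g \<noteq> 0}"
    unfolding norm_square_eq q_def by blast
  have carr: "q g \<in> carrier (kL_units S)" if "g \<in> mult_algebra" "det g \<noteq> 0" for g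
  proof -
    have "g * g \<in> mult_algebra" by (rule mult_algebra_mult[OF that(1) that(1)])
    moreover have "det (g * g) \<noteq> 0" unfolding det_algebra_mult[OF that(1) that(1)] using that(2) by simp
    ultimately show ?thesis unfolding carrier_kL_units q_def using global_section_in_Units that(2) by simp
  qed
  have mult: "q g \<otimes>\<^bsub>kL_units S\<^esub> q h = q (g * h)" if "g \<in> mult_algebra" "h \<in> mult_algebra" for g h
    unfolding q_def mult_kL_units global_section_hom(1)[OF mult_algebra_mult[OF that(1) that(1)] mult_algebra_mult[OF that(2) that(2)]]
      mult_algebra_square_mult[OF that] det_algebra_mult[OF that] by simp
  have one: "q (1\<^sub>m N) = \<one>\<^bsub>kL_units S\<^esub>"
    unfolding q_def one_kL_units global_section_hom(4) by simp
  show ?thesis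
  proof (rule subgroupI)
    show "norm_square S \<subseteq> carrier (kL_units S)" unfolding ns using carr by blast
    have "det (1\<^sub>m N :: 'a mat) \<noteq> 0" by simp
    then show "norm_square S \<noteq> {}" unfolding ns using mult_algebra_one by blast
  next
    fix x assume "x \<in> norm_square S"
    then obtain g where g: "g \<in> mult_algebra" "det g \<noteq> 0" "x = q g" unfolding ns by blast
    obtain h where h: "h \<in> carrier_mat N N" "g * h = 1\<^sub>m N" "h * g = 1\<^sub>m N" "det h = inverse (det g)"
      using ex_inverse_mat[OF mult_algebra_carrier[OF g(1)] g(2)] .
    have ha: "h \<in> mult_algebra" by (rule mult_algebra_inverse[OF g(1) h(1-3)])
    have dh: "det h \<noteq> 0" using g(2) by (simp add: h(4))
    have "q h \<otimes>\<^bsub>kL_units S\<^esub> q g = \<one>\<^bsub>kL_units S\<^esub>" unfolding mult[OF ha g(1)] h(3) by (rule one)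
    then have "inv\<^bsub>kL_units S\<^esub> (q g) = q h" by (rule inv_equality[OF _ carr[OF g(1,2)] carr[OF ha dh]])
    then show "inv\<^bsub>kL_units S\<^esub> x \<in> norm_square S" unfolding g(3) ns using ha dh by blast
  next
    fix x y assume "x \<in> norm_square S" "y \<in> norm_square S"
    then obtain g h where g: "g \<in> mult_algebra" "det g \<noteq> 0" "x = q g"
      and h: "h \<in> mult_algebra" "det h \<noteq> 0" "y = q h" unfolding ns by blast
    have "det (g * h) \<noteq> 0" unfolding det_algebra_mult[OF g(1) h(1)] using g(2) h(2) by simp
    then show "x \<otimes>\<^bsub>kL_units S\<^esub> y \<in> norm_square S"
      unfolding g(3) h(3) mult[OF g(1) h(1)] ns using mult_algebra_mult[OF g(1) h(1)] by blast
  qed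
qed

lemma N_pos: "0 < N" by (simp add: N_eq)

lemma orbit_of_eq_iff:
  assumes "u \<noteq> 0" "\<alpha> \<in> Units (H0 S)" "v \<noteq> 0" "\<beta> \<in> Units (H0 S)"
  shows "orbit_of (u, \<alpha>) = orbit_of (v, \<beta>) \<longleftrightarrow>
    (\<exists>\<gamma>\<in>Units (H0 S). v = inverse (alg_norm (H0 S) \<gamma>) * u \<and> \<beta> = (\<gamma> \<otimes>\<^bsub>H0 S\<^esub> \<gamma>) \<otimes>\<^bsub>H0 S\<^esub> \<alpha>)"
proof -
  note A = Units_H0_cases[OF assms(2)] and B = Units_H0_cases[OF assms(4)]
  have "orbit_of (u, \<alpha>) = orbit_of (v, \<beta>) \<longleftrightarrow>
    (\<exists>g\<in>mult_algebra. u = det g * v \<and> algebra_elem \<beta> = algebra_elem \<alpha> * (g * g))"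
    unfolding orbit_of_def fst_conv snd_conv
    using SL_orbit_eq_iff[OF det_mat_carrier _ det_mat_carrier _ A(1,2) B(1), of u v] assms N_pos
    by (simp add: det_det_mat)
  also have "\<dots> \<longleftrightarrow> (\<exists>\<gamma>\<in>Units (H0 S). v = inverse (alg_norm (H0 S) \<gamma>) * u \<and> \<beta> = (\<gamma> \<otimes>\<^bsub>H0 S\<^esub> \<gamma>) \<otimes>\<^bsub>H0 S\<^esub> \<alpha>)"
  proof
    assume "\<exists>g\<in>mult_algebra. u = det g * v \<and> algebra_elem \<beta> = algebra_elem \<alpha> * (g * g)"
    then obtain g where g: "g \<in> mult_algebra" "u = det g * v" "algebra_elem \<beta> = algebra_elem \<alpha> * (g * g)" by blast
    have "det g \<noteq> 0" using g assms by auto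
    then have "global_section g \<in> Units (H0 S)" "v = inverse (alg_norm (H0 S) (global_section g)) * u"
      using g by (auto simp: global_section_in_Units alg_norm_global_section)
    moreover have "\<beta> = (global_section g \<otimes>\<^bsub>H0 S\<^esub> global_section g) \<otimes>\<^bsub>H0 S\<^esub> \<alpha>"
    proof -
      have "\<beta> = global_section ((g * g) * algebra_elem \<alpha>)"
        using B(3) g(3) mult_algebra_commute[OF A(1) mult_algebra_mult[OF g(1) g(1)]] by simp
      also have "\<dots> = (global_section g \<otimes>\<^bsub>H0 S\<^esub> global_section g) \<otimes>\<^bsub>H0 S\<^esub> global_section (algebra_elem \<alpha>)"
        using g A(1) by (simp add: global_section_hom mult_algebra_mult)
      finally show ?thesis by (simp add: A(3))
    qed
    ultimately show "\<exists>\<gamma>\<in>Units (H0 S). v = inverse (alg_norm (H0 S) \<gamma>) * u \<and> \<beta> = (\<gamma> \<otimes>\<^bsub>H0 S\<^esub> \<gamma>) \<otimes>\<^bsub>H0 S\<^esub> \<alpha>" by blast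
  next
    assume "\<exists>\<gamma>\<in>Units (H0 S). v = inverse (alg_norm (H0 S) \<gamma>) * u \<and> \<beta> = (\<gamma> \<otimes>\<^bsub>H0 S\<^esub> \<gamma>) \<otimes>\<^bsub>H0 S\<^esub> \<alpha>"
    then obtain \<gamma> where \<gamma>: "\<gamma> \<in> Units (H0 S)" "v = inverse (alg_norm (H0 S) \<gamma>) * u"
      "\<beta> = (\<gamma> \<otimes>\<^bsub>H0 S\<^esub> \<gamma>) \<otimes>\<^bsub>H0 S\<^esub> \<alpha>" by blast
    note G = Units_H0_cases[OF \<gamma>(1)]
    let ?g = "algebra_elem \<gamma>"
    have gg: "?g * ?g \<in> mult_algebra" by (intro mult_algebra_mult G)
    have "\<beta> = (global_section ?g \<otimes>\<^bsub>H0 S\<^esub> global_section ?g) \<otimes>\<^bsub>H0 S\<^esub> global_section (algebra_elem \<alpha>)"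
      by (simp add: G(3) A(3) \<gamma>(3))
    also have "\<dots> = global_section (algebra_elem \<alpha> * (?g * ?g))"
      using G(1) A(1) gg mult_algebra_commute[OF A(1) gg] by (simp add: global_section_hom)
    finally have "algebra_elem \<beta> = algebra_elem \<alpha> * (?g * ?g)"
      using mult_algebra_mult[OF A(1) gg] by (simp add: algebra_elem_global_section)
    moreover have "u = det ?g * v" using \<gamma>(2) G by simp
    ultimately show "\<exists>g\<in>mult_algebra. u = det g * v \<and> algebra_elem \<beta> = algebra_elem \<alpha> * (g * g)"
      using G(1) by blast
  qed
  finally show ?thesis .
qed

lemma orbit_of_eq_iff_coset:
  assumes "x \<in> carrier (kL_units S)" "y \<in> carrier (kL_units S)"
  shows "orbit_of x = orbit_of y \<longleftrightarrow> y \<in> norm_square S #>\<^bsub>kL_units S\<^esub> x"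
proof -
  obtain u \<alpha> v \<beta> where xy: "x = (u, \<alpha>)" "y = (v, \<beta>)" "u \<noteq> 0" "\<alpha> \<in> Units (H0 S)" "v \<noteq> 0" "\<beta> \<in> Units (H0 S)"
    using assms by (cases x; cases y) (auto simp: carrier_kL_units)
  show ?thesis
    unfolding xy(1,2) orbit_of_eq_iff[OF xy(3-6)]
    by (auto simp: r_coset_def norm_square_def mult_kL_units)
qed

lemma disc_orbit_of:
  assumes "u \<noteq> 0" "\<alpha> \<in> Units (H0 S)"
  shows "orbit_disc (orbit_of (u, \<alpha>)) = const (disc_sign * u\<^sup>2 * alg_norm (H0 S) \<alpha> / lead_coeff F) * f"
proof -
  note A = Units_H0_cases[OF assms(2)]
  show ?thesis
    unfolding orbit_of_def fst_conv snd_conv orbit_disc_SL_orbit[OF base_carrier[OF det_mat_carrier A(1)]]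
      disc_SL_act_base_pair[OF det_mat_carrier mult_algebra_carrier[OF A(1)]]
    by (simp add: det_det_mat[OF N_pos] A(4))
qed

lemma orbit_of_SL_act:
  assumes PH: "P \<in> carrier_mat N N" "det P \<noteq> 0" "H \<in> mult_algebra" "det H \<noteq> 0"
  shows "SL_orbit n (SL_act P (base_pair H)) = orbit_of (det P, global_section H)"
proof -
  have "\<exists>g\<in>mult_algebra. det P = det g * det P \<and> H = H * (g * g)"
    using mult_algebra_carrier[OF PH(3)] by (intro bexI[of _ "1\<^sub>m N"] mult_algebra_one) simp
  then show ?thesis
    unfolding orbit_of_def fst_conv snd_conv algebra_elem_global_section[OF PH(3)]
    using SL_orbit_eq_iff[OF PH(1,2) det_mat_carrier _ PH(3,4) PH(3), of "det P"] PH N_pos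
    by (simp add: det_det_mat)
qed

lemma fr_orbits_eq: "fr_orbits n S = orbit_of ` carrier (kL_units S)"
proof (intro equalityI subsetI)
  fix Q assume "Q \<in> fr_orbits n S"
  then obtain M where M: "M \<in> sym_pairs_fr n S" "Q = SL_orbit n M"
    by (auto simp: fr_orbits_def orbits_def SL_orbit_def)
  then obtain P H where "P \<in> carrier_mat N N" "det P \<noteq> 0" "H \<in> mult_algebra" "det H \<noteq> 0"
    "M = SL_act P (base_pair H)" unfolding sym_pairs_fr_eq by blast
  then show "Q \<in> orbit_of ` carrier (kL_units S)"
    using M orbit_of_SL_act global_section_in_Units by (auto simp: carrier_kL_units)
next
  fix Q assume "Q \<in> orbit_of ` carrier (kL_units S)"
  then obtain u \<alpha> where k: "u \<noteq> 0" "\<alpha> \<in> Units (H0 S)" "Q = orbit_of (u, \<alpha>)" by (auto simp: carrier_kL_units)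
  note A = Units_H0_cases[OF k(2)]
  have d: "det (det_mat u) \<noteq> 0" by (simp add: det_det_mat[OF N_pos] k(1))
  have "SL_act (det_mat u) (base_pair (algebra_elem \<alpha>)) \<in> sym_pairs_fr n S"
    unfolding sym_pairs_fr_eq mem_Collect_eq
    by (rule exI[of _ "det_mat u"], rule exI[of _ "algebra_elem \<alpha>"])
      (rule conjI[OF refl conjI[OF det_mat_carrier conjI[OF d conjI[OF A(1,2)]]]])
  then show "Q \<in> fr_orbits n S" 
    unfolding k(3) orbit_of_def fr_orbits_def orbits_def SL_orbit_def fst_conv snd_conv by blast
qed

text \<open>
  If \<open>R\<close> fixes the pair given by \<open>P\<close> and \<open>H\<close>, then \<open>P R = g P\<close> with \<open>g\<close> in the algebra and
  \<open>H = H g\<^sup>2\<close>.  So conjugation by \<open>P\<close> carries the stabilizer to the elements with \<open>g\<^sup>2 = 1\<close> and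
  \<open>det g = 1\<close>, and \<open>det g\<close> is the norm.
\<close>

lemma stabilizer_iso:
  assumes M: "M \<in> sym_pairs_fr n S"
  shows "SL_stabilizer n M \<cong> mu2_norm_one S"
proof -
  obtain P H where P: "P \<in> carrier_mat N N" "det P \<noteq> 0" and H: "H \<in> mult_algebra" "det H \<noteq> 0"
    and MPH: "M = SL_act P (base_pair H)" using M unfolding sym_pairs_fr_eq by blast
  have Hc: "H \<in> carrier_mat N N" using H by (simp add: mult_algebra_carrier)
  note bH = base_pair_carrier[OF Hc]
  obtain Pi where Pi: "Pi \<in> carrier_mat N N" "P * Pi = 1\<^sub>m N" "Pi * P = 1\<^sub>m N" "det Pi = inverse (det P)"
    using ex_inverse_mat[OF P] .
  define \<kappa> where "\<kappa> R = P * R * Pi" for R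
  have st: "carrier (SL_stabilizer n M) = {R \<in> carrier_mat N N. det R = 1 \<and> SL_act R M = M}"
    by (auto simp: SL_stabilizer_def stabilizer_def SL_simps N_eq)
  have \<kappa>: "\<kappa> R \<in> mult_algebra \<and> \<kappa> R * \<kappa> R = 1\<^sub>m N \<and> det (\<kappa> R) = 1"
    if R: "R \<in> carrier_mat N N" "det R = 1" "SL_act R M = M" for R
  proof -
    have e: "SL_act (P * R) (base_pair H) = SL_act P (base_pair H)"
      using R(3) SL_act_SL_act[OF bH P(1) R(1)] by (simp add: MPH)
    have PR: "P * R \<in> carrier_mat N N" "det (P * R) \<noteq> 0" using P R by (auto simp: mat_closed det_mult[of _ N])
    obtain g where g: "g \<in> mult_algebra" "P * R = g * P" "H = H * (g * g)"
      using SL_act_base_pair_eqD[OF PR P H H(1) e] .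
    have gc: "g \<in> carrier_mat N N" using g by (simp add: mult_algebra_carrier)
    have "\<kappa> R = g * (P * Pi)" unfolding \<kappa>_def g(2) by (rule mat_assoc[OF gc P(1) Pi(1)])
    then have kg: "\<kappa> R = g" by (simp only: Pi(2) right_mult_one_mat[OF gc])
    obtain Hi where Hi: "Hi \<in> carrier_mat N N" "H * Hi = 1\<^sub>m N" "Hi * H = 1\<^sub>m N"
      using ex_inverse_mat[OF Hc H(2)] .
    have "g * g = Hi * H * (g * g)"
      by (simp only: Hi(3) left_mult_one_mat[OF mat_closed[OF gc gc]])
    also have "\<dots> = Hi * (H * (g * g))" by (rule mat_assoc[OF Hi(1) Hc mat_closed[OF gc gc]])
    also have "\<dots> = 1\<^sub>m N" by (simp only: g(3)[symmetric] Hi(3))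
    finally have "g * g = 1\<^sub>m N" .
    moreover have "det g = 1"
    proof -
      have "det P * det R = det (P * R)" by (rule det_mult[OF P(1) R(1), symmetric])
      also have "\<dots> = det g * det P" unfolding g(2) by (rule det_mult[OF gc P(1)])
      finally show ?thesis using P R by simp
    qed
    ultimately show ?thesis unfolding kg using g(1) by blast
  qed
  have mu: "carrier (mu2_norm_one S) = {\<beta> \<in> Units (H0 S). \<beta> \<otimes>\<^bsub>H0 S\<^esub> \<beta> = \<one>\<^bsub>H0 S\<^esub> \<and> alg_norm (H0 S) \<beta> = 1}"
    by (simp add: mu2_norm_one_def)
  have inj: "inj_on global_section mult_algebra" using global_section_bij by (simp add: bij_betw_def)
  let ?h = "\<lambda>R. global_section (\<kappa> R)"
  have h_in: "?h R \<in> carrier (mu2_norm_one S)" if "R \<in> carrier (SL_stabilizer n M)" for R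
    using that \<kappa>[of R] by (simp add: st mu global_section_in_Units global_section_hom alg_norm_global_section)
  have "?h \<in> iso (SL_stabilizer n M) (mu2_norm_one S)"
  proof (rule isoI)
    show "?h \<in> hom (SL_stabilizer n M) (mu2_norm_one S)"
    proof (rule homI)
      fix R assume "R \<in> carrier (SL_stabilizer n M)"
      then show "?h R \<in> carrier (mu2_norm_one S)" by (rule h_in)
    next
      fix R Q assume RQ: "R \<in> carrier (SL_stabilizer n M)" "Q \<in> carrier (SL_stabilizer n M)"
      then have c: "R \<in> carrier_mat N N" "Q \<in> carrier_mat N N" by (auto simp: st)
      have "\<kappa> R * \<kappa> Q = P * R * (Pi * P) * (Q * Pi)"
        using P(1) Pi(1) c by (simp add: \<kappa>_def mat_assoc mat_closed)
      also have "\<dots> = \<kappa> (R * Q)" using P(1) Pi(1) c by (simp add: Pi(3) \<kappa>_def mat_assoc mat_closed)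
      finally have "\<kappa> (R * Q) = \<kappa> R * \<kappa> Q" ..
      have kR: "\<kappa> R \<in> mult_algebra" and kQ: "\<kappa> Q \<in> mult_algebra" using \<kappa> RQ by (auto simp: st)
      have "R \<otimes>\<^bsub>SL_stabilizer n M\<^esub> Q = R * Q" by (simp add: SL_stabilizer_def SL_simps)
      moreover have "?h R \<otimes>\<^bsub>mu2_norm_one S\<^esub> ?h Q = ?h R \<otimes>\<^bsub>H0 S\<^esub> ?h Q"
        by (simp add: mu2_norm_one_def units_of_def)
      ultimately show "?h (R \<otimes>\<^bsub>SL_stabilizer n M\<^esub> Q) = ?h R \<otimes>\<^bsub>mu2_norm_one S\<^esub> ?h Q"
        by (simp only: \<open>\<kappa> (R * Q) = \<kappa> R * \<kappa> Q\<close> global_section_hom(1)[OF kR kQ])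
    qed
    show "bij_betw ?h (carrier (SL_stabilizer n M)) (carrier (mu2_norm_one S))"
      unfolding bij_betw_def
    proof (intro conjI equalityI subsetI inj_onI)
      fix R Q assume RQ: "R \<in> carrier (SL_stabilizer n M)" "Q \<in> carrier (SL_stabilizer n M)" "?h R = ?h Q"
      then have c: "R \<in> carrier_mat N N" "Q \<in> carrier_mat N N" by (auto simp: st)
      have kR: "\<kappa> R \<in> mult_algebra" and kQ: "\<kappa> Q \<in> mult_algebra" using \<kappa> RQ(1,2) by (auto simp: st)
      have e: "\<kappa> R = \<kappa> Q" by (rule inj_onD[OF inj RQ(3) kR kQ])
      have restore: "Pi * \<kappa> B * P = B" if "B \<in> carrier_mat N N" for B
      proof -
        have "Pi * \<kappa> B * P = (Pi * P) * (B * (Pi * P))"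
          using P(1) Pi(1) that by (simp add: \<kappa>_def mat_assoc mat_closed)
        then show ?thesis by (simp only: Pi(3) right_mult_one_mat[OF that] left_mult_one_mat[OF that])
      qed
      have "R = Pi * \<kappa> R * P" by (rule restore[OF c(1), symmetric])
      also have "\<dots> = Q" unfolding e by (rule restore[OF c(2)])
      finally show "R = Q" .
    next
      fix \<beta> assume "\<beta> \<in> ?h ` carrier (SL_stabilizer n M)"
      then obtain R where "R \<in> carrier (SL_stabilizer n M)" "\<beta> = ?h R" by (rule imageE)
      then show "\<beta> \<in> carrier (mu2_norm_one S)" using h_in by simp
    next
      fix \<beta> assume b: "\<beta> \<in> carrier (mu2_norm_one S)"
      then have bU: "\<beta> \<in> Units (H0 S)" by (simp add: mu)
      note B = Units_H0_cases[OF bU]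
      let ?g = "algebra_elem \<beta>"
      have gc: "?g \<in> carrier_mat N N" using B by (simp add: mult_algebra_carrier)
      have "global_section (?g * ?g) = \<beta> \<otimes>\<^bsub>H0 S\<^esub> \<beta>"
        unfolding global_section_hom(1)[OF B(1) B(1), symmetric] B(3) by (rule refl)
      also have "\<dots> = global_section (1\<^sub>m N)" using b by (simp add: mu global_section_hom(4))
      finally have "global_section (?g * ?g) = global_section (1\<^sub>m N)" .
      then have gg: "?g * ?g = 1\<^sub>m N"
        using inj_onD[OF inj _ mult_algebra_mult[OF B(1) B(1)] mult_algebra_one] by blast
      have dg: "det ?g = 1" using b B(4) by (simp add: mu)
      define R where "R = Pi * ?g * P"
      have R: "R \<in> carrier_mat N N" "det R = 1"
        using P Pi(1,4) gc dg by (simp_all add: R_def mat_closed det_mult[of _ N])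
      have PR: "P * R = ?g * P"
      proof -
        have "P * R = (P * Pi) * (?g * P)" using P(1) Pi(1) gc by (simp add: R_def mat_assoc mat_closed)
        then show ?thesis by (simp only: Pi(2) left_mult_one_mat[OF mat_closed[OF gc P(1)]])
      qed
      have "SL_act R M = SL_act P (SL_act ?g (base_pair H))"
        by (simp only: MPH SL_act_SL_act[OF bH P(1) R(1)] SL_act_SL_act[OF bH gc P(1)] PR)
      also have "\<dots> = M"
        by (simp only: SL_act_mult_algebra_base_pair[OF B(1) H(1)] gg right_mult_one_mat[OF Hc] MPH)
      finally have "SL_act R M = M" .
      then have RC: "R \<in> carrier (SL_stabilizer n M)" unfolding st using R by blast
      have "\<kappa> R = ?g"
      proof -
        have "\<kappa> R = ?g * (P * Pi)" unfolding \<kappa>_def PR by (rule mat_assoc[OF gc P(1) Pi(1)])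
        then show ?thesis by (simp only: Pi(2) right_mult_one_mat[OF gc])
      qed
      then have "\<beta> = ?h R" by (simp only: B(3))
      then show "\<beta> \<in> ?h ` carrier (SL_stabilizer n M)" using RC by (rule image_eqI)
    qed
  qed
  then show ?thesis by (auto simp: is_iso_def)
qed

end

section \<open>The classification\<close>

context classification
begin

lemma mem_fr_orbit:
  assumes Q: "Q \<in> fr_orbits n S" and M: "M \<in> Q"
  shows "M \<in> sym_pairs_fr n S"
proof -
  obtain M' where M': "M' \<in> sym_pairs_fr n S" "Q = SL_orbit n M'"
    using Q unfolding fr_orbits_def orbits_def SL_orbit_def by blast
  obtain P H where PH: "P \<in> carrier_mat N N" "det P \<noteq> 0" "H \<in> mult_algebra" "det H \<noteq> 0"
    "M' = SL_act P (base_pair H)" using M'(1) unfolding sym_pairs_fr_eq by blast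
  obtain R where R: "R \<in> carrier_mat N N" "det R = 1" "M = SL_act R M'"
    using M unfolding M'(2) SL_orbit_eq N_eq[symmetric] by blast
  have e: "M = SL_act (P * R) (base_pair H)"
    unfolding R(3) PH(5)
    by (rule SL_act_SL_act[OF base_pair_carrier[OF mult_algebra_carrier[OF PH(3)]] PH(1) R(1)])
  have c: "P * R \<in> carrier_mat N N" by (rule mat_closed[OF PH(1) R(1)])
  have d: "det (P * R) \<noteq> 0" unfolding det_mult[OF PH(1) R(1)] using PH(2) R(2) by simp
  show ?thesis unfolding sym_pairs_fr_eq mem_Collect_eq
    by (rule exI[of _ "P * R"], rule exI[of _ H]) (rule conjI[OF e conjI[OF c conjI[OF d conjI[OF PH(3,4)]]]])
qed

lemma orbit_disc_fr:
  assumes "M \<in> sym_pairs_fr n S"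
  shows "orbit_disc (SL_orbit n M) = disc M" "M \<in> SL_orbit n M" "SL_orbit n M \<in> fr_orbits n S"
proof -
  have c: "fst M \<in> carrier_mat (n + 1) (n + 1)" "snd M \<in> carrier_mat (n + 1) (n + 1)"
    using assms by (auto simp: sym_pairs_fr_def sym_pairs_S_def sym_pairs_def)
  show "orbit_disc (SL_orbit n M) = disc M" by (rule orbit_disc_SL_orbit[OF c])
  show "M \<in> SL_orbit n M" by (rule mem_SL_orbit[OF c])
  show "SL_orbit n M \<in> fr_orbits n S"
    unfolding fr_orbits_def orbits_def SL_orbit_def using assms by blast
qed

lemma alg_norm_Units_mult:
  assumes "\<alpha> \<in> Units (H0 S)" "\<beta> \<in> Units (H0 S)"
  shows "alg_norm (H0 S) (\<alpha> \<otimes>\<^bsub>H0 S\<^esub> \<beta>) = alg_norm (H0 S) \<alpha> * alg_norm (H0 S) \<beta>"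
proof -
  note A = Units_H0_cases[OF assms(1)] and B = Units_H0_cases[OF assms(2)]
  have "\<alpha> \<otimes>\<^bsub>H0 S\<^esub> \<beta> = global_section (algebra_elem \<alpha> * algebra_elem \<beta>)"
    unfolding global_section_hom(1)[OF A(1) B(1), symmetric] A(3) B(3) by (rule refl)
  then show ?thesis
    using alg_norm_global_section[OF mult_algebra_mult[OF A(1) B(1)]]
    by (simp only: det_algebra_mult[OF A(1) B(1)] A(4) B(4))
qed

lemma ex_simply_transitive_action:
  obtains act where "simply_transitive_action (G_grp S) (fr_orbits n S) act"
    "\<And>M u \<alpha>. M \<in> sym_pairs_fr n S \<Longrightarrow> u \<noteq> 0 \<Longrightarrow> \<alpha> \<in> Units (H0 S) \<Longrightarrow>
      orbit_disc (act (G_class S u \<alpha>) (SL_orbit n M))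
        = const (u\<^sup>2 * alg_norm (H0 S) \<alpha>) * orbit_disc (SL_orbit n M)"
proof (rule simply_transitive_quotient_action[OF comm_group_kL_units subgroup_norm_square fr_orbits_eq orbit_of_eq_iff_coset])
  fix act assume act: "simply_transitive_action (kL_units S Mod norm_square S) (fr_orbits n S) act"
    "\<And>x y. x \<in> carrier (kL_units S) \<Longrightarrow> y \<in> carrier (kL_units S) \<Longrightarrow>
      act (norm_square S #>\<^bsub>kL_units S\<^esub> x) (orbit_of y) = orbit_of (x \<otimes>\<^bsub>kL_units S\<^esub> y)"
  have disc: "orbit_disc (act (G_class S u \<alpha>) (SL_orbit n M))
      = const (u\<^sup>2 * alg_norm (H0 S) \<alpha>) * orbit_disc (SL_orbit n M)"
    if M: "M \<in> sym_pairs_fr n S" and u: "u \<noteq> 0" and \<alpha>: "\<alpha> \<in> Units (H0 S)" for M u \<alpha>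
  proof -
    have "SL_orbit n M \<in> orbit_of ` carrier (kL_units S)"
      using orbit_disc_fr(3)[OF M] unfolding fr_orbits_eq .
    then obtain y where y: "SL_orbit n M = orbit_of y" "y \<in> carrier (kL_units S)" by (rule imageE)
    obtain v \<beta> where v: "y = (v, \<beta>)" "v \<noteq> 0" "\<beta> \<in> Units (H0 S)"
      using y(2) unfolding carrier_kL_units by blast
    have x: "(u, \<alpha>) \<in> carrier (kL_units S)" using u \<alpha> unfolding carrier_kL_units by blast
    have ab: "\<alpha> \<otimes>\<^bsub>H0 S\<^esub> \<beta> \<in> Units (H0 S)"
      using \<alpha> v(3) comm_monoid.axioms(1)[OF comm_monoid_H0] by (rule monoid.Units_m_closed[rotated])
    have uv: "u * v \<noteq> 0" using u v(2) by simp
    have e: "act (G_class S u \<alpha>) (SL_orbit n M) = orbit_of (u * v, \<alpha> \<otimes>\<^bsub>H0 S\<^esub> \<beta>)"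
      unfolding G_class_def y(1) act(2)[OF x y(2)] unfolding v(1) mult_kL_units by (rule refl)
    have "orbit_disc (act (G_class S u \<alpha>) (SL_orbit n M))
        = const (disc_sign * (u * v)\<^sup>2 * (alg_norm (H0 S) \<alpha> * alg_norm (H0 S) \<beta>) / lead_coeff F) * f"
      unfolding e disc_orbit_of[OF uv ab] alg_norm_Units_mult[OF \<alpha> v(3)] by (rule refl)
    also have "disc_sign * (u * v)\<^sup>2 * (alg_norm (H0 S) \<alpha> * alg_norm (H0 S) \<beta>) / lead_coeff F
        = (u\<^sup>2 * alg_norm (H0 S) \<alpha>) * (disc_sign * v\<^sup>2 * alg_norm (H0 S) \<beta> / lead_coeff F)"
      by (simp add: power_mult_distrib ac_simps)
    also have "const \<dots> * f = const (u\<^sup>2 * alg_norm (H0 S) \<alpha>) * orbit_disc (SL_orbit n M)"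
      unfolding y(1) v(1) disc_orbit_of[OF v(2,3)] const_hom.hom_mult mult.assoc by (rule refl)
    finally show ?thesis .
  qed
  show thesis by (rule that[OF act(1)[folded G_grp_def]]) (rule disc)
qed

definition solution_class ::
  "('a mat \<times> 'a mat) set \<Rightarrow> ('a \<times> ('a poly poly \<Rightarrow> 'a poly poly fract set)) set" where
  "solution_class Q = {k \<in> norm_solutions n S (lead_coeff F). orbit_of k = Q}"

lemma norm_solutions_eq:
  "norm_solutions n S (lead_coeff F) = {k \<in> carrier (kL_units S). orbit_disc (orbit_of k) = f}"
proof -
  have l: "lead_coeff F \<noteq> 0" using F_nonzero by simp
  have c1: "const c * f = f \<longleftrightarrow> c = 1" for c
  proof -
    have "const c * f = f \<longleftrightarrow> (const c - 1) * f = 0" by (simp add: left_diff_distrib)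
    also have "\<dots> \<longleftrightarrow> const c = 1" using f_nonzero by simp
    also have "\<dots> \<longleftrightarrow> c = 1" by (simp add: const_def one_pCons)
    finally show ?thesis .
  qed
  have ds: "disc_sign = (- 1) ^ (n * (n + 1) div 2)"
    unfolding disc_sign_def by (simp add: N_eq mult.commute)
  have "lead_coeff F = disc_sign * u\<^sup>2 * alg_norm (H0 S) \<alpha> \<longleftrightarrow> orbit_disc (orbit_of (u, \<alpha>)) = f"
    if "u \<noteq> 0" "\<alpha> \<in> Units (H0 S)" for u \<alpha>
    unfolding disc_orbit_of[OF that] c1 using l by (auto simp: divide_simps)
  then show ?thesis unfolding norm_solutions_def carrier_kL_units ds by blast
qed

lemma norm_solutions_rel_eq:
  "norm_solutions_rel n S C = {(k, k'). k \<in> norm_solutions n S C \<and> k' \<in> norm_solutions n S C \<and> orbit_of k = orbit_of k'}"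
proof -
  have "(\<exists>\<beta>\<in>Units (H0 S). u = inverse (alg_norm (H0 S) \<beta>) * u' \<and> \<alpha> = (\<beta> \<otimes>\<^bsub>H0 S\<^esub> \<beta>) \<otimes>\<^bsub>H0 S\<^esub> \<alpha>')
      \<longleftrightarrow> orbit_of (u, \<alpha>) = orbit_of (u', \<alpha>')"
    if "(u, \<alpha>) \<in> norm_solutions n S C" "(u', \<alpha>') \<in> norm_solutions n S C" for u \<alpha> u' \<alpha>'
  proof -
    have U: "u \<noteq> 0" "\<alpha> \<in> Units (H0 S)" "u' \<noteq> 0" "\<alpha>' \<in> Units (H0 S)" using that unfolding norm_solutions_def by blast+
    show ?thesis using orbit_of_eq_iff[OF U(3,4,1,2)] by (simp only: eq_commute[of "orbit_of (u', \<alpha>')"])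
  qed
  then show ?thesis unfolding norm_solutions_rel_def by blast
qed

text \<open>
  The relation on solutions is the kernel of \<open>orbit_of\<close>, so its classes are the fibres of \<open>orbit_of\<close>
  over the orbits with discriminant \<open>f\<close>.
\<close>

lemma solution_class_bij:
  "bij_betw solution_class {Q \<in> fr_orbits n S. orbit_disc Q = f}
     (norm_solutions n S (lead_coeff F) // norm_solutions_rel n S (lead_coeff F))"
proof -
  have im: "norm_solutions_rel n S (lead_coeff F) `` {k} = solution_class (orbit_of k)"
    if "k \<in> norm_solutions n S (lead_coeff F)" for k
    using that unfolding norm_solutions_rel_eq solution_class_def by auto
  have orb: "\<exists>k \<in> norm_solutions n S (lead_coeff F). Q = orbit_of k"
    if Q: "Q \<in> fr_orbits n S" "orbit_disc Q = f" for Q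
    using Q unfolding fr_orbits_eq norm_solutions_eq by blast
  have fr: "orbit_of k \<in> fr_orbits n S" "orbit_disc (orbit_of k) = f"
    if "k \<in> norm_solutions n S (lead_coeff F)" for k
    using that unfolding fr_orbits_eq norm_solutions_eq by blast+
  show ?thesis
    unfolding bij_betw_def
  proof (intro conjI inj_onI)
    fix Q Q' assume "Q \<in> {Q \<in> fr_orbits n S. orbit_disc Q = f}" "Q' \<in> {Q \<in> fr_orbits n S. orbit_disc Q = f}"
      and e: "solution_class Q = solution_class Q'"
    then obtain k where k: "k \<in> norm_solutions n S (lead_coeff F)" "Q = orbit_of k" using orb by blast
    then have "k \<in> solution_class Q" unfolding solution_class_def by blast
    then have "k \<in> solution_class Q'" unfolding e .
    then show "Q = Q'" using k(2) unfolding solution_class_def by blast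
  next
    show "solution_class ` {Q \<in> fr_orbits n S. orbit_disc Q = f}
        = norm_solutions n S (lead_coeff F) // norm_solutions_rel n S (lead_coeff F)"
    proof (intro equalityI subsetI)
    fix X assume "X \<in> solution_class ` {Q \<in> fr_orbits n S. orbit_disc Q = f}"
    then obtain Q where Q: "Q \<in> fr_orbits n S" "orbit_disc Q = f" "X = solution_class Q" by blast
    obtain k where k': "k \<in> norm_solutions n S (lead_coeff F)" "Q = orbit_of k" using orb[OF Q(1,2)] by (rule bexE)
    note k = k'(1) Q(3)[unfolded k'(2)]
    show "X \<in> norm_solutions n S (lead_coeff F) // norm_solutions_rel n S (lead_coeff F)"
      unfolding k(2) im[OF k(1), symmetric] using k(1) by (rule quotientI)
  next
    fix X assume "X \<in> norm_solutions n S (lead_coeff F) // norm_solutions_rel n S (lead_coeff F)"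
    then obtain k where k: "k \<in> norm_solutions n S (lead_coeff F)"
      "X = norm_solutions_rel n S (lead_coeff F) `` {k}" by (rule quotientE)
    then show "X \<in> solution_class ` {Q \<in> fr_orbits n S. orbit_disc Q = f}"
      unfolding k(2) im[OF k(1)] using fr[OF k(1)] by blast
    qed
  qed
qed

lemma ex_disc_eq_iff:
  "(\<exists>M\<in>sym_pairs_fr n S. disc M = f) \<longleftrightarrow> norm_solutions n S (lead_coeff F) \<noteq> {}"
proof
  assume "\<exists>M\<in>sym_pairs_fr n S. disc M = f"
  then obtain M where M: "M \<in> sym_pairs_fr n S" "disc M = f" by blast
  have "SL_orbit n M \<in> orbit_of ` carrier (kL_units S)"
    using orbit_disc_fr(3)[OF M(1)] unfolding fr_orbits_eq .
  then obtain k where k: "SL_orbit n M = orbit_of k" "k \<in> carrier (kL_units S)" by (rule imageE)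
  have "orbit_disc (orbit_of k) = f" using orbit_disc_fr(1)[OF M(1)] unfolding k(1) M(2) .
  then show "norm_solutions n S (lead_coeff F) \<noteq> {}" unfolding norm_solutions_eq using k(2) by blast
next
  assume "norm_solutions n S (lead_coeff F) \<noteq> {}"
  then obtain k where k: "k \<in> carrier (kL_units S)" "orbit_disc (orbit_of k) = f"
    unfolding norm_solutions_eq by blast
  have "orbit_of k \<in> fr_orbits n S" unfolding fr_orbits_eq using k(1) by (rule imageI)
  then obtain M where M: "M \<in> sym_pairs_fr n S" "orbit_of k = SL_orbit n M"
    unfolding fr_orbits_def orbits_def SL_orbit_def by blast
  have "disc M = f" using k(2) unfolding M(2) orbit_disc_fr(1)[OF M(1)] .
  then show "\<exists>M\<in>sym_pairs_fr n S. disc M = f" using M(1) by blast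
qed

end

lemma coeff_X1_power_mult: "coeff (X1 ^ s * g) i = (if i < s then 0 else coeff g (i - s))"
proof -
  have e: "X1 ^ s = monom 1 s" by (simp add: X1_def monom_altdef)
  show ?thesis unfolding e by (simp add: coeff_monom_mult)
qed

text \<open>
  The constant that normalizes the discriminant of the base pair is read off from \<open>f\<close>: dividing by
  the highest power of \<open>X\<^sub>1\<close> exposes the term with the highest power of \<open>X\<^sub>0\<close>.
\<close>

lemma lead_coeff_dehom_X1:
  assumes h: "homog (int m) f" and f: "f = X1 ^ s * g" and g: "\<not> X1 dvd g"
  shows "lead_coeff (dehom_X1 f) = coeff (coeff f s) (m - s)"
proof -
  have g0: "coeff g 0 \<noteq> 0"
  proof
    assume "coeff g 0 = 0"
    then have "[:0, 1:] dvd g" by (simp add: dvd_iff_poly_eq_0 poly_0_coeff_0)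
    with g show False by (simp add: X1_def)
  qed
  have cf: "coeff f i = (if i < s then 0 else coeff g (i - s))" for i
    unfolding f by (rule coeff_X1_power_mult)
  have "coeff f s \<noteq> 0" using g0 by (simp add: cf)
  then have i: "coeff (coeff f s) (degree (coeff f s)) \<noteq> 0" by simp
  then have "int (degree (coeff f s)) + int s = int m" using h unfolding homog_def by blast
  then have ms: "m = degree (coeff f s) + s" by linarith
  have c: "coeff (dehom_X1 f) (m - s) = coeff (coeff f s) (m - s)"
    by (simp add: coeff_dehom_X1[OF h] ms)
  have nz: "coeff (coeff f s) (m - s) \<noteq> 0" using i by (simp add: ms)
  have z: "coeff (dehom_X1 f) j = 0" if "m - s < j" for j
    using that by (auto simp: coeff_dehom_X1[OF h] cf)
  have "degree (dehom_X1 f) \<le> m - s" by (rule degree_le) (use z in blast)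
  moreover have "m - s \<le> degree (dehom_X1 f)" by (rule le_degree) (simp only: c nz not_False_eq_True)
  ultimately have d: "degree (dehom_X1 f) = m - s" by (rule antisym)
  show ?thesis unfolding d by (rule c)
qed

theorem theorem4p5:
  fixes S :: "'a::field subscheme" and n s :: nat and f g :: "'a poly poly" and C :: 'a
  assumes "n \<ge> 1"
    and "closed_subscheme S"
    and "finite_over_field S"
    and "vectorspace.fin_dim class_ring (H0 S)"
    and "vectorspace.dim class_ring (H0 S) = n + 1"
    and "homogeneous f"
    and "same_subscheme (zero_scheme f) S"
    and "f = X1 ^ s * g"
    and "\<not> X1 dvd g"
    and "C = coeff (coeff f s) (n + 1 - s)"
  shows "\<exists>act \<Phi>.
    simply_transitive_action (G_grp S) (fr_orbits n S) act \<and>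
    (\<forall>M\<in>sym_pairs_fr n S. \<forall>u \<alpha>. u \<noteq> 0 \<longrightarrow> \<alpha> \<in> Units (H0 S) \<longrightarrow>
        orbit_disc (act (G_class S u \<alpha>) (SL_orbit n M))
          = const (u\<^sup>2 * alg_norm (H0 S) \<alpha>) * orbit_disc (SL_orbit n M)) \<and>
    bij_betw \<Phi> {Q \<in> fr_orbits n S. orbit_disc Q = f}
      (norm_solutions n S C // norm_solutions_rel n S C) \<and>
    ((\<exists>M\<in>sym_pairs_fr n S. disc M = f) \<longleftrightarrow>
      (\<exists>u \<alpha>. u \<noteq> 0 \<and> \<alpha> \<in> Units (H0 S) \<and>
        C = (- 1) ^ (n * (n + 1) div 2) * u\<^sup>2 * alg_norm (H0 S) \<alpha>)) \<and>
    (\<forall>u \<alpha> Q M. u \<noteq> 0 \<longrightarrow> \<alpha> \<in> Units (H0 S) \<longrightarrow>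
        C = (- 1) ^ (n * (n + 1) div 2) * u\<^sup>2 * alg_norm (H0 S) \<alpha> \<longrightarrow>
        Q \<in> fr_orbits n S \<longrightarrow> orbit_disc Q = f \<longrightarrow>
        \<Phi> Q = norm_solutions_rel n S C `` {(u, \<alpha>)} \<longrightarrow> M \<in> Q \<longrightarrow>
        SL_stabilizer n M \<cong> mu2_norm_one S)"
proof -
  have "g \<noteq> 0" using assms(9) by auto
  then have f0: "f \<noteq> 0" unfolding assms(8) by (simp add: X1_def)
  obtain e where e: "homog e f" using assms(6) unfolding homogeneous_def by blast
  have "0 \<le> e" by (rule homog_nonneg[OF f0 e])
  then have h: "homog (int (nat e)) f" using e by simp
  interpret B: binary_form_scheme f "nat e" S
    by (unfold_locales) (rule h f0 assms(2,7))+
  have N: "nat e = n + 1" by (rule trans[OF B.H0.dim_eq[symmetric] assms(5)])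
  interpret classification f "nat e" S n
    by (unfold_locales) (rule N)
  have C: "C = lead_coeff B.F"
    unfolding assms(10) B.F_def lead_coeff_dehom_X1[OF h assms(8,9)] N by (rule refl)
  have sol: "norm_solutions n S C \<noteq> {} \<longleftrightarrow>
      (\<exists>u \<alpha>. u \<noteq> 0 \<and> \<alpha> \<in> Units (H0 S) \<and> C = (- 1) ^ (n * (n + 1) div 2) * u\<^sup>2 * alg_norm (H0 S) \<alpha>)"
    unfolding norm_solutions_def by blast
  have iff: "(\<exists>M\<in>sym_pairs_fr n S. disc M = f) \<longleftrightarrow> norm_solutions n S C \<noteq> {}"
    unfolding C by (rule ex_disc_eq_iff)
  show ?thesis
  proof (rule ex_simply_transitive_action)
    fix act assume act: "simply_transitive_action (G_grp S) (fr_orbits n S) act"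
      and disc_act: "\<And>M u \<alpha>. M \<in> sym_pairs_fr n S \<Longrightarrow> u \<noteq> 0 \<Longrightarrow> \<alpha> \<in> Units (H0 S) \<Longrightarrow>
        orbit_disc (act (G_class S u \<alpha>) (SL_orbit n M))
          = const (u\<^sup>2 * alg_norm (H0 S) \<alpha>) * orbit_disc (SL_orbit n M)"
    show ?thesis
    proof (rule exI[of _ act], rule exI[of _ solution_class], intro conjI)
      show "simply_transitive_action (G_grp S) (fr_orbits n S) act" by (rule act)
      show "bij_betw solution_class {Q \<in> fr_orbits n S. orbit_disc Q = f}
          (norm_solutions n S C // norm_solutions_rel n S C)"
        unfolding C by (rule solution_class_bij)
      show "(\<exists>M\<in>sym_pairs_fr n S. disc M = f) \<longleftrightarrow>
        (\<exists>u \<alpha>. u \<noteq> 0 \<and> \<alpha> \<in> Units (H0 S) \<and>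
          C = (- 1) ^ (n * (n + 1) div 2) * u\<^sup>2 * alg_norm (H0 S) \<alpha>)"
        by (rule trans[OF iff sol])
      show "\<forall>M\<in>sym_pairs_fr n S. \<forall>u \<alpha>. u \<noteq> 0 \<longrightarrow> \<alpha> \<in> Units (H0 S) \<longrightarrow>
        orbit_disc (act (G_class S u \<alpha>) (SL_orbit n M))
          = const (u\<^sup>2 * alg_norm (H0 S) \<alpha>) * orbit_disc (SL_orbit n M)"
        by (intro ballI allI impI) (rule disc_act)
    next
      show "\<forall>u \<alpha> Q M. u \<noteq> 0 \<longrightarrow> \<alpha> \<in> Units (H0 S) \<longrightarrow>
        C = (- 1) ^ (n * (n + 1) div 2) * u\<^sup>2 * alg_norm (H0 S) \<alpha> \<longrightarrow>
        Q \<in> fr_orbits n S \<longrightarrow> orbit_disc Q = f \<longrightarrow>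
        solution_class Q = norm_solutions_rel n S C `` {(u, \<alpha>)} \<longrightarrow> M \<in> Q \<longrightarrow>
        SL_stabilizer n M \<cong> mu2_norm_one S"
        by (intro allI impI) (rule stabilizer_iso[OF mem_fr_orbit])
    qed
  qed
qed

end
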